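(* Fix $T>0$. Let $u_0\in C[0,1]$, $f\in C^3[0,T]$, and let $(f_n)_{n\ge1}$ be a sequence in $C^3[0,T]$ with $\lim_{n\to\infty}\|f_n-f\|_{C^1[0,T]}=0$. Let $u$ be the solution on $[0,T]$ of the PIDE with initial state $u_0$ and input $f$, and for each $n$ let $v_n:[0,T]\to\mathbb R^n$ solve $\dot v_n(t)=P_nv_n(t)+B_nf_n(t)$, $t\in[0,T]$, $v_n(0)=R_nu_0$. Then $$\lim_{n\to\infty}\sup_{t\in[0,T]}\|u(\cdot,t)-S_nv_n(t)\|_{L^2(0,1)}=0.$$
   Context: Standing assumptions: $\theta,\sigma,\lambda\in PC^1[0,1]$ (piecewise $C^1$: on each interval of some finite partition of $[0,1]$ the function is the restriction of a $C^1[0,1]$ function) with $\inf_{x\in[0,1]}\theta(x)>0$; $\varphi\in C^1([0,1];C^1[0,1])$ is a kernel $\varphi(x,\tilde x)$; $\alpha_0,\beta_0,\alpha_1,\beta_1$ are real constants. The PIDE is $u_t=\theta u_{xx}+\sigma u_x+\lambda u+\int_0^x\varphi(x,\tilde x)u(\tilde x,t)d\tilde x$ on $[0,1]$ with $\alpha_0u_x(0,t)+\beta_0u(0,t)=0$, $\alpha_1u_x(1,t)+\beta_1u(1,t)=f(t)$. The operator $\mathscr P$ has domain $\mathscr D(\mathscr P)=\{w\in H^2(0,1):\alpha_0w_x(0)+\beta_0w(0)=\alpha_1w_x(1)+\beta_1w(1)=0\}$ and $\mathscr Pw(x)=\theta w_{xx}+\sigma w_x+\lambda w+\int_0^x\varphi(x,\tilde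 x)w(\tilde x)d\tilde x$ (the same expression is used for any $w\in H^2(0,1)$); it generates an analytic semigroup $\mathbb S$ on $L^2(0,1)$. With $\nu(x)=\mu_1x^{\mu_2}$, $\mu_2\ge3$, $\mu_1(\mu_2\alpha_1+\beta_1)=1$, the solution of the PIDE with initial state $u_0$ and input $f$ is $u(t)=\mathbb S_t[u_0-\nu f(0)]+\int_0^t\mathbb S_{t-\tau}[\mathscr P\nu f(\tau)-\nu\dot f(\tau)]d\tau+\nu f(t)$. Discretization: for $n\ge1$ let $h=1/(n+1)$, $r_0=\alpha_0/(3\alpha_0-2h\beta_0)$, $r_1=\alpha_1/(3\alpha_1+2h\beta_1)$, $q_0=-\beta_0/(\alpha_0-h\beta_0)$, $b_n=2h\theta(nh)/(3\alpha_1+2h\beta_1)$ (assumed well defined for all $n$). Define $n\times n$ matrices $\Theta_n=\mathrm{diag}(\theta(h),\dots,\theta(nh))$, $\Sigma_n=\mathrm{diag}(\sigma(h),\dots,\sigma(nh))$, $\Lambda_n=\mathrm{diag}(\lambda(h),\dots,\lambda(nh))$; $L_n=h^{-2}M$ where $M$ is tridiagonal with diagonal entries $-2$ except $M_{11}=4r_0-2$, $M_{nn}=4r_1-2$, superdiagonal entries $1$ except $M_{12}=1-r_0$, subdiagonal entries $1$ except $M_{n,n-1}=1-r_1$; $D_n=h^{-1}N$ where $N_{11}=hq_0$, $N_{1j}=0$ for $j\ge2$, and for $i\ge2$: $N_{ii}=1$, $N_{i,i-1}=-1$, other entries $0$; $\Phi_n$ is lower triangular with $(\Phi_n)_{jm}=h\varphi(jh,mh)$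 for $m\le j$. Set $P_n=\Theta_nL_n+\Sigma_nD_n+\Lambda_n+\Phi_n$ and $B_n=h^{-2}(0,\dots,0,b_n)^\top$. For $z\in PC[0,1]$, $R_nz=(z(h),\dots,z(nh))^\top$. The extension operator $S_n:\mathbb R^n\to L^\infty(0,1)$ is $[S_nv](0)=v_1$, $[S_nv](x)=v_j$ for $(j-1)h<x\le jh$, $j=1,\dots,n$, and $[S_nv](x)=0$ for $nh<x\le1$. *)

theory Defs
  imports "HOL-Analysis.Analysis"
begin

definition C1_01 :: "(real \<Rightarrow> real) \<Rightarrow> bool" where
  "C1_01 g \<longleftrightarrow> (\<exists>g'. (\<forall>x\<in>{0..1}. (g has_real_derivative g' x) (at x within {0..1}))
                     \<and> continuous_on {0..1} g')"

definition C1norm_01 :: "(real \<Rightarrow> real) \<Rightarrow> real" where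
  "C1norm_01 g = (SUP x\<in>{0..1}. \<bar>g x\<bar>) + (SUP x\<in>{0..1}. \<bar>vector_derivative g (at x within {0..1})\<bar>)"

definition PC1_01 :: "(real \<Rightarrow> real) \<Rightarrow> bool" where
  "PC1_01 f \<longleftrightarrow> (\<exists>\<I>. finite \<I> \<and> \<Union>\<I> = {0..1} \<and>
      (\<forall>I\<in>\<I>. \<forall>J\<in>\<I>. I \<noteq> J \<longrightarrow> I \<inter> J = {}) \<and>
      (\<forall>I\<in>\<I>. is_interval I \<and> interior I \<noteq> {} \<and> (\<exists>g. C1_01 g \<and> (\<forall>x\<in>I. f x = g x))))"

definition C1_C1_kernel :: "(real \<Rightarrow> real \<Rightarrow> real) \<Rightarrow> bool" where
  "C1_C1_kernel \<phi> \<longleftrightarrow> (\<forall>x\<in>{0..1}. C1_01 (\<phi> x)) \<and>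
     (\<exists>\<phi>'. (\<forall>x\<in>{0..1}. C1_01 (\<phi>' x)) \<and>
        (\<forall>x\<in>{0..1}. ((\<lambda>y. C1norm_01 (\<lambda>s. \<phi> y s - \<phi> x s - (y - x) * \<phi>' x s) / \<bar>y - x\<bar>)
                        \<longlongrightarrow> 0) (at x within {0..1})) \<and>
        (\<forall>x\<in>{0..1}. ((\<lambda>y. C1norm_01 (\<lambda>s. \<phi>' y s - \<phi>' x s)) \<longlongrightarrow> 0) (at x within {0..1})))"

definition C3_on :: "real \<Rightarrow> (real \<Rightarrow> real) \<Rightarrow> (real \<Rightarrow> real) \<Rightarrow> (real \<Rightarrow> real) \<Rightarrow> (real \<Rightarrow> real) \<Rightarrow> bool" where
  "C3_on T f f1 f2 f3 \<longleftrightarrow>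
     (\<forall>t\<in>{0..T}. (f has_real_derivative f1 t) (at t within {0..T})) \<and>
     (\<forall>t\<in>{0..T}. (f1 has_real_derivative f2 t) (at t within {0..T})) \<and>
     (\<forall>t\<in>{0..T}. (f2 has_real_derivative f3 t) (at t within {0..T})) \<and>
     continuous_on {0..T} f3"

definition C1dist_on :: "real \<Rightarrow> (real \<Rightarrow> real) \<Rightarrow> (real \<Rightarrow> real) \<Rightarrow> (real \<Rightarrow> real) \<Rightarrow> (real \<Rightarrow> real) \<Rightarrow> real" where
  "C1dist_on T g g1 f f1 = (SUP t\<in>{0..T}. \<bar>g t - f t\<bar>) + (SUP t\<in>{0..T}. \<bar>g1 t - f1 t\<bar>)"

definition L2 :: "(real \<Rightarrow> real) set" where
  "L2 = {w. w \<in> borel_measurable (lebesgue_on {0..1}) \<and>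
            integrable (lebesgue_on {0..1}) (\<lambda>x. (w x)^2)}"

definition L2norm :: "(real \<Rightarrow> real) \<Rightarrow> real" where
  "L2norm w = sqrt (integral\<^sup>L (lebesgue_on {0..1}) (\<lambda>x. (w x)^2))"

definition L2inner :: "(real \<Rightarrow> real) \<Rightarrow> (real \<Rightarrow> real) \<Rightarrow> real" where
  "L2inner v w = integral\<^sup>L (lebesgue_on {0..1}) (\<lambda>x. v x * w x)"

definition L2eq :: "(real \<Rightarrow> real) \<Rightarrow> (real \<Rightarrow> real) \<Rightarrow> bool" where
  "L2eq v w \<longleftrightarrow> L2norm (\<lambda>x. v x - w x) = 0"

text \<open>w is (a representative of) an H^2(0,1) function with first derivative w1 and weak second
  derivative g \<in> L^2: w is C^1 on [0,1] with derivative w1, and w1 is absolutely continuous with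
  derivative g.\<close>
definition H2_rep :: "(real \<Rightarrow> real) \<Rightarrow> (real \<Rightarrow> real) \<Rightarrow> (real \<Rightarrow> real) \<Rightarrow> bool" where
  "H2_rep w w1 g \<longleftrightarrow> g \<in> L2 \<and>
     (\<forall>x\<in>{0..1}. (w has_real_derivative w1 x) (at x within {0..1})) \<and>
     (\<forall>x\<in>{0..1}. w1 x = w1 0 + integral {0..x} g)"

definition P_rel :: "(real \<Rightarrow> real) \<Rightarrow> (real \<Rightarrow> real) \<Rightarrow> (real \<Rightarrow> real) \<Rightarrow> (real \<Rightarrow> real \<Rightarrow> real)
                     \<Rightarrow> (real \<Rightarrow> real) \<Rightarrow> (real \<Rightarrow> real) \<Rightarrow> bool" where
  "P_rel \<theta> \<sigma> lam \<phi> w z \<longleftrightarrow> (\<exists>w1 g. H2_rep w w1 g \<and>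
      L2eq z (\<lambda>x. \<theta> x * g x + \<sigma> x * w1 x + lam x * w x + integral {0..x} (\<lambda>s. \<phi> x s * w s)))"

definition DomP :: "real \<Rightarrow> real \<Rightarrow> real \<Rightarrow> real \<Rightarrow> (real \<Rightarrow> real) set" where
  "DomP \<alpha>0 \<beta>0 \<alpha>1 \<beta>1 = {w. \<exists>w1 g. H2_rep w w1 g \<and>
      \<alpha>0 * w1 0 + \<beta>0 * w 0 = 0 \<and> \<alpha>1 * w1 1 + \<beta>1 * w 1 = 0}"

definition gen_lim :: "(real \<Rightarrow> (real \<Rightarrow> real) \<Rightarrow> (real \<Rightarrow> real)) \<Rightarrow> (real \<Rightarrow> real) \<Rightarrow> (real \<Rightarrow> real) \<Rightarrow> bool" where
  "gen_lim S w z \<longleftrightarrow> ((\<lambda>h. L2norm (\<lambda>x. (S h w x - w x) / h - z x)) \<longlongrightarrow> 0) (at_right 0)"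

text \<open>S is the C0-semigroup on L^2(0,1) whose generator is the operator with domain Dom (given by
  representatives) and action A (a relation: A w z means z = Aw in L^2).\<close>
definition generates_semigroup :: "(real \<Rightarrow> real) set \<Rightarrow> ((real \<Rightarrow> real) \<Rightarrow> (real \<Rightarrow> real) \<Rightarrow> bool)
     \<Rightarrow> (real \<Rightarrow> (real \<Rightarrow> real) \<Rightarrow> (real \<Rightarrow> real)) \<Rightarrow> bool" where
  "generates_semigroup Dom A S \<longleftrightarrow>
     (\<forall>t\<ge>0. \<forall>w\<in>L2. S t w \<in> L2) \<and>
     (\<forall>t\<ge>0. \<forall>v\<in>L2. \<forall>w\<in>L2. \<forall>a b. L2eq (S t (\<lambda>x. a * v x + b * w x)) (\<lambda>x. a * S t v x + b * S t w x)) \<and>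
     (\<forall>t\<ge>0. \<exists>C. \<forall>w\<in>L2. L2norm (S t w) \<le> C * L2norm w) \<and>
     (\<forall>w\<in>L2. L2eq (S 0 w) w) \<and>
     (\<forall>s\<ge>0. \<forall>t\<ge>0. \<forall>w\<in>L2. L2eq (S (s + t) w) (S s (S t w))) \<and>
     (\<forall>w\<in>L2. ((\<lambda>t. L2norm (\<lambda>x. S t w x - w x)) \<longlongrightarrow> 0) (at_right 0)) \<and>
     (\<forall>w\<in>L2. (\<exists>z\<in>L2. gen_lim S w z) \<longleftrightarrow> (\<exists>w'\<in>Dom. L2eq w w')) \<and>
     (\<forall>w\<in>L2. \<forall>z\<in>L2. \<forall>w'\<in>Dom. L2eq w w' \<longrightarrow> gen_lim S w z \<longrightarrow> A w' z)"

definition nu :: "real \<Rightarrow> real \<Rightarrow> real \<Rightarrow> real" where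
  "nu \<mu>1 \<mu>2 x = \<mu>1 * x powr \<mu>2"

text \<open>P\<nu>, computed with \<nu>' = \<mu>1 \<mu>2 x^(\<mu>2-1), \<nu>'' = \<mu>1 \<mu>2 (\<mu>2-1) x^(\<mu>2-2).\<close>
definition Pnu :: "(real \<Rightarrow> real) \<Rightarrow> (real \<Rightarrow> real) \<Rightarrow> (real \<Rightarrow> real) \<Rightarrow> (real \<Rightarrow> real \<Rightarrow> real)
                  \<Rightarrow> real \<Rightarrow> real \<Rightarrow> real \<Rightarrow> real" where
  "Pnu \<theta> \<sigma> lam \<phi> \<mu>1 \<mu>2 x =
     \<theta> x * (\<mu>1 * \<mu>2 * (\<mu>2 - 1) * x powr (\<mu>2 - 2)) + \<sigma> x * (\<mu>1 * \<mu>2 * x powr (\<mu>2 - 1))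
     + lam x * nu \<mu>1 \<mu>2 x + integral {0..x} (\<lambda>s. \<phi> x s * nu \<mu>1 \<mu>2 s)"

text \<open>u(t) = S_t[u0 - \<nu> f(0)] + \<integral>_0^t S_{t-\<tau>}[P\<nu> f(\<tau>) - \<nu> f'(\<tau>)] d\<tau> + \<nu> f(t) in L^2(0,1),
  for t \<in> [0,T]; the L^2-valued (Bochner) integral is characterised weakly, by testing against
  every \<psi> \<in> L^2 (the integrand is continuous in \<tau>, so this is equivalent).
  u t x is the value u(x,t).\<close>
definition PIDE_solution where
  "PIDE_solution \<theta> \<sigma> lam \<phi> \<mu>1 \<mu>2 S T u0 f f1 u \<longleftrightarrow>
     (\<forall>t\<in>{0..T}. u t \<in> L2 \<and>
       (\<forall>\<psi>\<in>L2. L2inner (\<lambda>x. u t x - nu \<mu>1 \<mu>2 x * f t) \<psi> =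
          L2inner (S t (\<lambda>x. u0 x - nu \<mu>1 \<mu>2 x * f 0)) \<psi>
          + integral {0..t} (\<lambda>\<tau>. L2inner (S (t - \<tau>)
                (\<lambda>x. Pnu \<theta> \<sigma> lam \<phi> \<mu>1 \<mu>2 x * f \<tau> - nu \<mu>1 \<mu>2 x * f1 \<tau>)) \<psi>)))"

section \<open>Discretization (vectors and matrices indexed from 1 to n)\<close>

definition hh :: "nat \<Rightarrow> real" where "hh n = 1 / (real n + 1)"

definition r0 :: "real \<Rightarrow> real \<Rightarrow> nat \<Rightarrow> real" where
  "r0 \<alpha>0 \<beta>0 n = \<alpha>0 / (3 * \<alpha>0 - 2 * hh n * \<beta>0)"
definition r1 :: "real \<Rightarrow> real \<Rightarrow> nat \<Rightarrow> real" where
  "r1 \<alpha>1 \<beta>1 n = \<alpha>1 / (3 * \<alpha>1 + 2 * hh n * \<beta>1)"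
definition q0 :: "real \<Rightarrow> real \<Rightarrow> nat \<Rightarrow> real" where
  "q0 \<alpha>0 \<beta>0 n = - \<beta>0 / (\<alpha>0 - hh n * \<beta>0)"
definition bn :: "(real \<Rightarrow> real) \<Rightarrow> real \<Rightarrow> real \<Rightarrow> nat \<Rightarrow> real" where
  "bn \<theta> \<alpha>1 \<beta>1 n = 2 * hh n * \<theta> (real n * hh n) / (3 * \<alpha>1 + 2 * hh n * \<beta>1)"

definition Mmat :: "real \<Rightarrow> real \<Rightarrow> real \<Rightarrow> real \<Rightarrow> nat \<Rightarrow> nat \<Rightarrow> nat \<Rightarrow> real" where
  "Mmat \<alpha>0 \<beta>0 \<alpha>1 \<beta>1 n i j =
     (if j = i then (if i = 1 then 4 * r0 \<alpha>0 \<beta>0 n - 2 else if i = n then 4 * r1 \<alpha>1 \<beta>1 n - 2 else -2)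
      else if j = i + 1 then (if i = 1 then 1 - r0 \<alpha>0 \<beta>0 n else 1)
      else if i = j + 1 then (if i = n then 1 - r1 \<alpha>1 \<beta>1 n else 1)
      else 0)"

definition Nmat :: "real \<Rightarrow> real \<Rightarrow> nat \<Rightarrow> nat \<Rightarrow> nat \<Rightarrow> real" where
  "Nmat \<alpha>0 \<beta>0 n i j =
     (if i = 1 then (if j = 1 then hh n * q0 \<alpha>0 \<beta>0 n else 0)
      else if j = i then 1 else if j + 1 = i then -1 else 0)"

definition Pmat :: "(real \<Rightarrow> real) \<Rightarrow> (real \<Rightarrow> real) \<Rightarrow> (real \<Rightarrow> real) \<Rightarrow> (real \<Rightarrow> real \<Rightarrow> real)
                   \<Rightarrow> real \<Rightarrow> real \<Rightarrow> real \<Rightarrow> real \<Rightarrow> nat \<Rightarrow> nat \<Rightarrow> nat \<Rightarrow> real" where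
  "Pmat \<theta> \<sigma> lam \<phi> \<alpha>0 \<beta>0 \<alpha>1 \<beta>1 n i j =
     \<theta> (real i * hh n) * (Mmat \<alpha>0 \<beta>0 \<alpha>1 \<beta>1 n i j / (hh n)^2)
     + \<sigma> (real i * hh n) * (Nmat \<alpha>0 \<beta>0 n i j / hh n)
     + (if i = j then lam (real i * hh n) else 0)
     + (if j \<le> i then hh n * \<phi> (real i * hh n) (real j * hh n) else 0)"

definition Bvec :: "(real \<Rightarrow> real) \<Rightarrow> real \<Rightarrow> real \<Rightarrow> nat \<Rightarrow> nat \<Rightarrow> real" where
  "Bvec \<theta> \<alpha>1 \<beta>1 n j = (if j = n then bn \<theta> \<alpha>1 \<beta>1 n / (hh n)^2 else 0)"

definition Rn :: "nat \<Rightarrow> (real \<Rightarrow> real) \<Rightarrow> nat \<Rightarrow> real" where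
  "Rn n z j = z (real j * hh n)"

definition Sn :: "nat \<Rightarrow> (nat \<Rightarrow> real) \<Rightarrow> real \<Rightarrow> real" where
  "Sn n v x = (if x \<le> 0 then v 1 else if x \<le> real n * hh n then v (nat \<lceil>x / hh n\<rceil>) else 0)"

end

theory Submission imports Defs begin

text \<open>In the inner product with weight \<open>1/\<theta>\<close> the matrices \<open>P\<^sub>n\<close> satisfy a one-sided bound \<open>\<langle>v, P\<^sub>n v\<rangle> \<le> K \<parallel>v\<parallel>\<^sup>2\<close>
  uniformly in \<open>n\<close>, so the scheme is stable, with an error controlled by the initial and the mean-square residual.
  \<open>P\<^sub>n\<close> is consistent on functions with piecewise continuous second derivative, and passing to the limit
  shows that \<open>\<P> - K\<close> is dissipative, whence (solving a Volterra equation) resolvents \<open>(\<kappa> - \<P>)\<^sup>-\<^sup>1\<close> for \<open>\<kappa> > K\<close>, which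
  commute with the semigroup.  Approximating \<open>f\<close> and \<open>f'\<close> uniformly by sums of \<open>exp (\<kappa>\<^sub>i t)\<close> turns the mild solution
  into \<open>\<nu> f\<close>, plus resolvent modes \<open>exp (\<kappa>\<^sub>i t) m\<^sub>i\<close>, plus an orbit \<open>S\<^sub>t y\<^sub>0\<close>.  Replacing \<open>y\<^sub>0\<close> by
  \<open>\<kappa>\<^sup>2 (\<kappa> - \<P>)\<^sup>-\<^sup>2 y\<^sub>0\<close> makes the orbit classical with coefficients controlled uniformly in time, so its restriction
  to the grid solves the scheme up to a small residual.\<close>

text \<open>Coefficients may jump and the residuals of the two end rows are merely bounded, so
  consistency cannot be uniform over the grid. But the number of bad rows is bounded independently
  of \<open>n\<close>; in the mean square they cost \<open>O(h)\<close>, which is why every residual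
  is measured there. The semigroup is given abstractly: a bound for each single time, strong right
  continuity at zero, and its generator. Continuity of orbits and a growth bound uniform on
  \<open>[0,T]\<close> must be derived, at first from right difference quotients alone. Two
  resolvents are applied to the orbit because one makes it Lipschitz in space, and the second
  derivative of the twice smoothed orbit then contains this Lipschitz function instead of the bare
  \<open>L2\<close> orbit. The rates of the exponentials exceed \<open>Kd\<close> because each
  serves both as the rate of an input and as a resolvent parameter. On the grid the lifting carries
  \<open>fn n\<close> rather than \<open>f\<close>: the input vector grows at least like
  \<open>1/h\<close>, and this choice lets it cancel up to a consistency residual, so that
  differences of inputs are multiplied by bounded functions only.\<close>

abbreviation M01 :: "real measure" where "M01 \<equiv> lebesgue_on {0..1}"

section \<open>Representatives of square integrable functions: inner product, norm, equality almost
  everywhere\<close>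

lemma finite_measure_M01: "finite_measure M01"
  by (rule finite_measure_lebesgue_on) simp

lemma emeasure_M01_UNIV: "measure M01 (space M01) = 1"
  by (simp add: measure_restrict_space)

lemma integrable_M01_bounded:
  fixes f :: "real => real"
  assumes "f \<in> borel_measurable M01" "\<And>x. x \<in> {0..1} ==> \<bar>f x\<bar> <= B"
  shows "integrable M01 f"
  by (rule finite_measure.integrable_const_bound[OF finite_measure_M01, where B=B])
     (use assms in \<open>auto simp: AE_restrict_space_iff\<close>)

lemma borel_measurable_M01_cont: "continuous_on {0..1} f ==> f \<in> borel_measurable M01"
  for f :: "real => real"
  by (rule continuous_imp_measurable_on_sets_lebesgue) auto

lemma L2_measurable: "w \<in> L2 ==> w \<in> borel_measurable M01"
  by (simp add: L2_def)

lemma L2_prod_integrable: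
  assumes "v \<in> L2" "w \<in> L2"
  shows "integrable M01 (%x. v x * w x)"
proof (rule Bochner_Integration.integrable_bound)
  show "integrable M01 (%x. (v x)^2 + (w x)^2)" using assms by (auto simp: L2_def)
  show "(%x. v x * w x) \<in> borel_measurable M01"
    using assms[THEN L2_measurable] by measurable
  have "\<bar>v x * w x\<bar> <= (v x)^2 + (w x)^2" for x
  proof -
    have "0 <= (\<bar>v x\<bar> - \<bar>w x\<bar>)^2" by simp
    then have "2 * (\<bar>v x\<bar> * \<bar>w x\<bar>) <= (v x)^2 + (w x)^2" by (simp add: power2_diff)
    moreover have "0 <= \<bar>v x\<bar> * \<bar>w x\<bar>" by simp
    ultimately show ?thesis unfolding abs_mult by linarith
  qed
  then show "AE x in M01. norm (v x * w x) <= norm ((v x)^2 + (w x)^2)"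
    by auto
qed

lemma L2_bounded:
  assumes "f \<in> borel_measurable M01" "\<And>x. x \<in> {0..1} ==> \<bar>f x\<bar> <= B"
  shows "f \<in> L2"
proof -
  have "integrable M01 (%x. (f x)^2)"
  proof (rule integrable_M01_bounded[where B="B^2"])
    show "(%x. (f x)^2) \<in> borel_measurable M01" using assms(1) by measurable
    show "\<bar>(f x)^2\<bar> <= B^2" if "x \<in> {0..1}" for x
      using power_mono[OF assms(2)[OF that], of 2] by simp
  qed
  then show ?thesis using assms by (simp add: L2_def)
qed

lemma L2_cont: "continuous_on {0..1} f ==> f \<in> L2"
proof -
  assume c: "continuous_on {0..1} f"
  then have "bounded (f ` {0..1})" by (intro compact_imp_bounded compact_continuous_image) auto
  then obtain B where "\<And>x. x \<in> {0..1} ==> \<bar>f x\<bar> <= B" unfolding bounded_iff by (metis imageI real_norm_def)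
  then show ?thesis using L2_bounded borel_measurable_M01_cont[OF c] by blast
qed

lemma L2_scale: "w \<in> L2 ==> (%x. c * w x) \<in> L2"
  by (auto simp: L2_def power_mult_distrib)

lemma L2_add: assumes "v \<in> L2" "w \<in> L2" shows "(%x. v x + w x) \<in> L2"
proof -
  have "integrable M01 (%x. (v x)^2 + (w x)^2 + 2 * (v x * w x))"
    using assms L2_prod_integrable[OF assms] by (auto simp: L2_def)
  then have "integrable M01 (%x. (v x + w x)^2)" by (simp add: power2_sum algebra_simps)
  then show ?thesis using assms by (auto simp: L2_def)
qed

lemma L2_uminus: "w \<in> L2 ==> (%x. - w x) \<in> L2"
  using L2_scale[of w "-1"] by simp

lemma L2_diff: assumes "v \<in> L2" "w \<in> L2" shows "(%x. v x - w x) \<in> L2"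
  using L2_add[OF assms(1) L2_uminus[OF assms(2)]] by simp

lemma L2_divide: "w \<in> L2 ==> (%x. w x / c) \<in> L2"
  using L2_scale[of w "1/c"] by simp

lemma L2_zero: "(%x. 0) \<in> L2" by (auto simp: L2_def)

lemma L2_sum: "(\<And>i. i \<in> A ==> f i \<in> L2) ==> (%x. \<Sum>i\<in>A. f i x) \<in> L2"
  by (induction A rule: infinite_finite_induct) (auto intro: L2_zero L2_add)

lemma L2_mult_bounded:
  assumes w: "w \<in> L2" and c: "c \<in> borel_measurable M01" and B: "\<And>x. x \<in> {0..1} ==> \<bar>c x\<bar> <= (B::real)"
  shows "(%x. c x * w x) \<in> L2"
proof -
  have m: "(%x. c x * w x) \<in> borel_measurable M01" using L2_measurable[OF w] c by measurable
  have "integrable M01 (%x. (c x * w x)^2)"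
  proof (rule Bochner_Integration.integrable_bound)
    show "integrable M01 (%x. B^2 * (w x)^2)" using w by (auto simp: L2_def)
    show "(%x. (c x * w x)^2) \<in> borel_measurable M01" using m by measurable
    have "(c x * w x)^2 <= B^2 * (w x)^2" if "x \<in> {0..1}" for x
      unfolding power_mult_distrib
      using power_mono[OF B[OF that], of 2] by (intro mult_right_mono) auto
    then show "AE x in M01. norm ((c x * w x)^2) <= norm (B^2 * (w x)^2)"
      by (auto simp: AE_restrict_space_iff)
  qed
  then show ?thesis using m by (simp add: L2_def)
qed

lemma L2_integrable: "w \<in> L2 ==> integrable M01 w"
  using L2_prod_integrable[of w "%x. 1"] L2_cont[of "%x. 1"] by simp

lemma L2norm_nonneg: "0 <= L2norm w" by (simp add: L2norm_def)

lemma L2norm_power2: "(L2norm w)^2 = L2inner w w"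
  by (simp add: L2norm_def L2inner_def power2_eq_square[symmetric])

lemma L2inner_commute: "L2inner v w = L2inner w v"
  by (simp add: L2inner_def mult.commute)

lemma L2inner_add: "v \<in> L2 ==> w \<in> L2 ==> p \<in> L2 ==> L2inner (%x. v x + w x) p = L2inner v p + L2inner w p"
  by (simp add: L2inner_def ring_distribs Bochner_Integration.integral_add L2_prod_integrable)

lemma L2inner_diff: "v \<in> L2 ==> w \<in> L2 ==> p \<in> L2 ==> L2inner (%x. v x - w x) p = L2inner v p - L2inner w p"
  by (simp add: L2inner_def left_diff_distrib Bochner_Integration.integral_diff L2_prod_integrable)

lemma L2inner_add_right: "v \<in> L2 ==> w \<in> L2 ==> p \<in> L2 ==> L2inner p (%x. v x + w x) = L2inner p v + L2inner p w"
  by (simp add: L2inner_def ring_distribs Bochner_Integration.integral_add L2_prod_integrable)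

lemma L2inner_diff_right: "v \<in> L2 ==> w \<in> L2 ==> p \<in> L2 ==> L2inner p (%x. v x - w x) = L2inner p v - L2inner p w"
  by (simp add: L2inner_def right_diff_distrib Bochner_Integration.integral_diff L2_prod_integrable)

lemma L2inner_scale: "L2inner (%x. c * w x) p = c * L2inner w p"
  by (simp add: L2inner_def mult.assoc)

lemma L2inner_scale_right: "L2inner p (%x. c * w x) = c * L2inner p w"
  by (simp add: L2inner_def mult.left_commute)

lemma L2norm_scale: "L2norm (%x. c * w x) = \<bar>c\<bar> * L2norm w"
  by (simp add: L2norm_def power_mult_distrib real_sqrt_mult)

lemma L2norm_minus_commute: "L2norm (%x. v x - w x) = L2norm (%x. w x - v x)"
  by (simp add: L2norm_def power2_commute)

lemma L2norm_zero_AE: "w \<in> L2 ==> L2norm w = 0 \<longleftrightarrow> (AE x in M01. w x = 0)"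
  using integral_nonneg_eq_0_iff_AE[of M01 "%x. (w x)^2"] by (auto simp: L2norm_def L2_def)

lemma L2eq_AE: "v \<in> L2 ==> w \<in> L2 ==> L2eq v w \<longleftrightarrow> (AE x in M01. v x = w x)"
  unfolding L2eq_def by (subst L2norm_zero_AE) (auto intro: L2_diff)

lemma L2inner_cong_AE:
  assumes "AE x in M01. v x = v' x" "AE x in M01. w x = w' x"
    "v \<in> L2" "v' \<in> L2" "w \<in> L2" "w' \<in> L2"
  shows "L2inner v w = L2inner v' w'"
  unfolding L2inner_def
proof (rule integral_cong_AE)
  show "AE x in M01. v x * w x = v' x * w' x" using assms(1,2) by eventually_elim simp
  show "(%x. v x * w x) \<in> borel_measurable M01"
    by (rule borel_measurable_integrable) (rule L2_prod_integrable[OF assms(3,5)])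
  show "(%x. v' x * w' x) \<in> borel_measurable M01"
    by (rule borel_measurable_integrable) (rule L2_prod_integrable[OF assms(4,6)])
qed

lemma L2norm_cong_AE:
  assumes "AE x in M01. v x = v' x" "v \<in> L2" "v' \<in> L2"
  shows "L2norm v = L2norm v'"
proof (rule power2_eq_imp_eq)
  show "(L2norm v)^2 = (L2norm v')^2"
    unfolding L2norm_power2 by (rule L2inner_cong_AE[OF assms(1) assms(1) assms(2,3,2,3)])
qed (simp_all add: L2norm_nonneg)

lemma L2norm_cong: "(\<And>x. x \<in> {0..1} ==> v x = v' x) ==> L2norm v = L2norm v'"
  unfolding L2norm_def by (intro arg_cong[where f=sqrt] Bochner_Integration.integral_cong) auto

lemma L2inner_cong: "(\<And>x. x \<in> {0..1} ==> v x = v' x) ==> (\<And>x. x \<in> {0..1} ==> w x = w' x) ==> L2inner v w = L2inner v' w'"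
  unfolding L2inner_def by (intro Bochner_Integration.integral_cong) auto

lemma L2_Cauchy_Schwarz_le:
  assumes "v \<in> L2" "w \<in> L2"
  shows "L2inner v w <= L2norm v * L2norm w"
proof (cases "L2norm v = 0 \<or> L2norm w = 0")
  case True
  then have "AE x in M01. v x * w x = 0"
    using L2norm_zero_AE assms by fastforce
  then have "L2inner v w = 0" unfolding L2inner_def by (rule integral_eq_zero_AE)
  with True show ?thesis by auto
next
  case False
  \<comment> \<open>With these scalings the squared norm of \<open>a v - b w\<close> collapses to
    \<open>2 a b (a b - <v,w>)\<close>, and the positive factor \<open>a b\<close> can be
    cancelled.\<close>
  define a b where "a = L2norm w" and "b = L2norm v"
  have pos: "0 < a * b"
    using False L2norm_nonneg[of v] L2norm_nonneg[of w] by (simp add: a_def b_def)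
  have "0 <= L2inner (%x. a * v x - b * w x) (%x. a * v x - b * w x)"
    using L2norm_power2 by (metis zero_le_power2)
  also have "\<dots> = a * L2inner v (%x. a * v x - b * w x) - b * L2inner w (%x. a * v x - b * w x)"
    using assms by (subst L2inner_diff) (auto intro: L2_scale L2_diff simp: L2inner_scale)
  also have "\<dots> = a * (a * L2inner v v - b * L2inner v w) - b * (a * L2inner w v - b * L2inner w w)"
    using assms by (simp add: L2inner_diff_right L2_scale L2inner_scale_right)
  also have "\<dots> = 2 * (a * b) * (a * b - L2inner v w)"
    by (simp add: L2norm_power2[symmetric] a_def b_def L2inner_commute[of w v] algebra_simps power2_eq_square)
  finally show ?thesis using pos by (simp add: a_def b_def zero_le_mult_iff mult.commute)
qed

lemma L2_Cauchy_Schwarz: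
  assumes "v \<in> L2" "w \<in> L2"
  shows "\<bar>L2inner v w\<bar> <= L2norm v * L2norm w"
  using L2_Cauchy_Schwarz_le[OF assms] L2_Cauchy_Schwarz_le[OF L2_scale[OF assms(1), of "-1"] assms(2)]
    L2inner_scale[of "-1" v w] L2norm_scale[of "-1" v] by simp

lemma L2norm_add_sq:
  assumes "v \<in> L2" "w \<in> L2"
  shows "(L2norm (%x. v x + w x))^2 = (L2norm v)^2 + 2 * L2inner v w + (L2norm w)^2"
  using assms L2inner_commute[of w v] by (simp add: L2norm_power2 L2inner_add L2_add L2inner_add_right)

lemma L2norm_triangle:
  assumes "v \<in> L2" "w \<in> L2"
  shows "L2norm (%x. v x + w x) <= L2norm v + L2norm w"
proof (rule power2_le_imp_le)
  show "(L2norm (%x. v x + w x))\<^sup>2 <= (L2norm v + L2norm w)\<^sup>2"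
    unfolding L2norm_add_sq[OF assms] using L2_Cauchy_Schwarz_le[OF assms] by (simp add: power2_sum)
qed (simp add: L2norm_nonneg)

lemma L2norm_triangle_diff:
  assumes "v \<in> L2" "w \<in> L2"
  shows "L2norm (%x. v x - w x) <= L2norm v + L2norm w"
  using L2norm_triangle[OF assms(1) L2_uminus[OF assms(2)]] L2norm_scale[of "-1" w] by simp

lemma L2norm_triangle3:
  assumes "u \<in> L2" "v \<in> L2" "w \<in> L2"
  shows "L2norm (%x. u x - w x) <= L2norm (%x. u x - v x) + L2norm (%x. v x - w x)"
  using L2norm_triangle[OF L2_diff[OF assms(1,2)] L2_diff[OF assms(2,3)]] by simp

lemma L2norm_le_bound:
  assumes "w \<in> L2" "\<And>x. x \<in> {0..1} ==> \<bar>w x\<bar> <= B"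
  shows "L2norm w <= B"
proof -
  have B: "0 <= B" using assms(2)[of 0] by auto
  have "(LINT x|M01. (w x)^2) <= (LINT x|M01. B^2)"
  proof (rule integral_mono)
    show "(w x)^2 <= B^2" if "x \<in> space M01" for x
      using power_mono[OF assms(2), of x 2] that by simp
  qed (use assms in \<open>auto simp: L2_def\<close>)
  also have "\<dots> = B^2" using emeasure_M01_UNIV by simp
  finally show ?thesis unfolding L2norm_def using B by (simp add: real_le_lsqrt)
qed

lemma L2_L1_bound:
  assumes "w \<in> L2"
  shows "(LINT x|M01. \<bar>w x\<bar>) <= L2norm w"
proof -
  have "(%x. \<bar>w x\<bar>) \<in> L2" using assms by (auto simp: L2_def)
  then have "L2inner (%x. \<bar>w x\<bar>) (%x. 1) <= L2norm (%x. \<bar>w x\<bar>) * L2norm (%x. 1)"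
    by (rule L2_Cauchy_Schwarz_le) (rule L2_cont, simp)
  moreover have "L2norm (%x. 1) = 1" using emeasure_M01_UNIV by (simp add: L2norm_def)
  ultimately show ?thesis by (simp add: L2inner_def L2norm_def)
qed

lemma L2eq_refl: "L2eq w w" by (simp add: L2eq_def L2norm_def)
lemma L2eq_sym: "L2eq v w ==> L2eq w v" by (simp add: L2eq_def L2norm_minus_commute[of w v])
lemma L2eq_trans:
  assumes "u \<in> L2" "v \<in> L2" "w \<in> L2" "L2eq u v" "L2eq v w"
  shows "L2eq u w"
proof -
  have "L2norm (%x. u x - w x) <= 0"
    using L2norm_triangle3[OF assms(1-3)] assms(4,5) by (simp add: L2eq_def)
  then show ?thesis using L2norm_nonneg by (simp add: L2eq_def order.antisym)
qed

lemma L2_integrable_on: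
  assumes "g \<in> L2" "0 <= a" "b <= 1"
  shows "g absolutely_integrable_on {a..b}" "g integrable_on {a..b}"
proof -
  have "integrable M01 (%x. \<bar>g x\<bar>)" using L2_integrable[OF assms(1)] by simp
  then have "g absolutely_integrable_on {0..1}"
    using L2_measurable[OF assms(1)] by (subst absolutely_integrable_measurable) (auto simp: o_def)
  then show "g absolutely_integrable_on {a..b}"
    by (rule set_integrable_subset) (use assms in auto)
  then show "g integrable_on {a..b}" using set_lebesgue_integral_eq_integral(1) by blast
qed

lemma L2_integral_bound:
  assumes "g \<in> L2" "0 <= a" "a <= b" "b <= 1"
  shows "\<bar>integral {a..b} g\<bar> <= L2norm g"
proof -
  have "(%x. \<bar>g x\<bar>) \<in> L2" using assms by (auto simp: L2_def)
  note i = L2_integrable_on(2)[OF this]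
  have "\<bar>integral {a..b} g\<bar> <= integral {a..b} (%x. \<bar>g x\<bar>)"
    using integral_norm_bound_integral[OF L2_integrable_on(2)[OF assms(1,2,4)] i[OF assms(2,4)]] by simp
  also have "\<dots> <= integral {0..1} (%x. \<bar>g x\<bar>)"
    by (rule integral_subset_le) (use assms i in auto)
  also have "\<dots> = (LINT x|M01. \<bar>g x\<bar>)"
    using L2_integrable[OF \<open>(%x. \<bar>g x\<bar>) \<in> L2\<close>] by (simp add: lebesgue_integral_eq_integral)
  also have "\<dots> <= L2norm g" by (rule L2_L1_bound[OF assms(1)])
  finally show ?thesis .
qed

lemma L2inner_eq_integral: "v \<in> L2 ==> w \<in> L2 ==> L2inner v w = integral {0..1} (%x. v x * w x)"
  unfolding L2inner_def by (rule lebesgue_integral_eq_integral) (auto intro: L2_prod_integrable)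

text \<open>The signed measure with density \<open>g\<close> vanishes on all half lines, an
  intersection-stable generator of the Borel sets, hence on all Borel sets, and up to null sets on
  all Lebesgue sets; a density of the zero measure is zero a.e. This is what makes the resolvent
  injective.\<close>

lemma L2_AE_zero_of_integrals:
  assumes g: "g \<in> L2" and z: "\<And>x. x \<in> {0..1} ==> integral {0..x} g = 0"
  shows "AE x in M01. g x = 0"
proof -
  let ?f = "%x. if x \<in> {0..1} then g x else 0"
  have f: "integrable lebesgue ?f"
    using L2_integrable[OF g] by (subst Lebesgue_Measure.integrable_restrict_UNIV) auto
  have Int_stable_atMost: "Int_stable (range (%a::real. {..a}))"
    by (auto simp: Int_stable_def)
  have Pow_atMost: "range (%a::real. {..a}) \<subseteq> Pow UNIV" by simp
  have si: "set_integrable lebesgue B ?f" if "B \<in> sets lebesgue" for B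
    unfolding set_integrable_def using integrable_mult_indicator[OF that f] .
  have sig: "sigma_sets UNIV (range (%a::real. {..a})) = sets borel"
    by (simp add: borel_eq_atMost)
  \<comment> \<open>Dynkin's argument; the complement step needs the total integral, which is the
    hypothesis at \<open>x = 1\<close>.\<close>
  have borel0: "set_lebesgue_integral lebesgue A ?f = 0" if "A \<in> sets borel" for A
  proof -
    have "A \<in> sigma_sets UNIV (range (%a::real. {..a}))"
      using that sig by simp
    with Int_stable_atMost Pow_atMost show ?thesis
    proof (induction rule: sigma_sets_induct_disjoint)
      case (basic A)
      then obtain a where A: "A = {..a}" by auto
      have "set_lebesgue_integral lebesgue {..a} ?f = integral {..a} ?f"
        by (rule set_lebesgue_integral_eq_integral(2))
           (unfold set_integrable_def, rule integrable_mult_indicator[OF _ f], simp)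
      also have "\<dots> = integral ({0..1} \<inter> {..a}) g"
        by (rule integral_restrict_Int)
      also have "\<dots> = 0"
      proof (cases "a < 0")
        case True then have "{0..1} \<inter> {..a} = {}" by force
        then show ?thesis by simp
      next
        case False
        then have "{0..1} \<inter> {..a} = {0..min a 1}" by force
        then show ?thesis using z[of "min a 1"] False by simp
      qed
      finally show ?case using A by simp
    next
      case empty then show ?case by (simp add: set_lebesgue_integral_def)
    next
      case (compl A)
      then have Ab: "A \<in> sets lebesgue" using sig by auto
      have "set_lebesgue_integral lebesgue (A \<union> (UNIV - A)) ?f
          = set_lebesgue_integral lebesgue A ?f + set_lebesgue_integral lebesgue (UNIV - A) ?f"
        using Ab by (intro set_integral_Un si) auto
      moreover have "set_lebesgue_integral lebesgue UNIV ?f = 0"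
      proof -
        have "set_lebesgue_integral lebesgue UNIV ?f = integral UNIV ?f"
          by (rule set_lebesgue_integral_eq_integral(2), rule si, simp)
        also have "\<dots> = integral {0..1} g" by (simp only: integral_restrict_UNIV)
        finally show ?thesis using z[of 1] by simp
      qed
      moreover have "A \<union> (UNIV - A) = UNIV" by auto
      ultimately show ?case using compl by simp
    next
      case (union A)
      have "range A \<subseteq> sets lebesgue"
      proof
        fix B assume "B \<in> range A"
        then have "B \<in> sigma_sets UNIV (range (%a::real. {..a}))" using union by auto
        then show "B \<in> sets lebesgue" using sig by auto
      qed
      then have "set_lebesgue_integral lebesgue (\<Union>i. A i) ?f = (\<Sum>i. set_lebesgue_integral lebesgue (A i) ?f)"
        using union(1)
        by (intro lebesgue_integral_countable_add si sets.countable_UN)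
           (auto simp: disjoint_family_on_def)
      then show ?case using union by simp
    qed
  qed
  interpret M: finite_measure M01 by (rule finite_measure_M01)
  show ?thesis
  proof (rule M.density_zero[OF L2_integrable[OF g]])
    fix A assume "A \<in> sets M01"
    then have "A \<in> sets lebesgue" by (simp add: sets_restrict_space_iff)
    \<comment> \<open>A Lebesgue set differs from a Borel set by a subset of a null set, so
      \<open>borel0\<close> suffices.\<close>
    then obtain S N N' where A: "A = S \<union> N" "N \<subseteq> N'" "N' \<in> null_sets lborel" "S \<in> sets lborel"
      by (rule sets_completionE[where M=lborel]) auto
    have N: "N \<in> null_sets lebesgue"
      using A by (meson null_sets_completion_iff2 null_sets_completionI)
    have "set_lebesgue_integral M01 A g = set_lebesgue_integral lebesgue A ?f"
      unfolding set_lebesgue_integral_def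
      by (subst Lebesgue_Measure.integral_restrict_UNIV[symmetric])
         (auto intro!: Bochner_Integration.integral_cong)
    also have "\<dots> = set_lebesgue_integral lebesgue S ?f"
      unfolding set_lebesgue_integral_def
    proof (rule integral_cong_AE)
      show "AE x in lebesgue. indicat_real A x *\<^sub>R ?f x = indicat_real S x *\<^sub>R ?f x"
        using AE_not_in[OF N] by eventually_elim (use A in \<open>auto simp: indicator_def\<close>)
      show "(%x. indicat_real A x *\<^sub>R ?f x) \<in> borel_measurable lebesgue"
        by (rule borel_measurable_integrable[OF integrable_mult_indicator[OF \<open>A \<in> sets lebesgue\<close> f]])
      have "S \<in> sets lebesgue" using A(4) by (rule sets_completionI_sets)
      from borel_measurable_integrable[OF integrable_mult_indicator[OF this f]]
      show "(%x. indicat_real S x *\<^sub>R ?f x) \<in> borel_measurable lebesgue" .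
    qed
    finally show "set_lebesgue_integral M01 A g = 0" using borel0 A by simp
  qed
qed

subsection \<open>Piecewise equicontinuous families\<close>

abbreviation modulus :: "'i set => real set => ('i => real => real) => real => real => bool" where
  "modulus I D a d e \<equiv> \<forall>i\<in>I. \<forall>x\<in>{0..1}. \<forall>y\<in>{0..1}.
     x <= y --> y - x < d --> {x..y} \<inter> D = {} --> \<bar>a i x - a i y\<bar> < e"

text \<open>The exceptional set \<open>D\<close> is chosen before \<open>e\<close> and is common to
  the whole family. Hence the number of grid cells that meet it is bounded independently of the mesh
  and of the index; with time as index this gives consistency uniform in time.\<close>

definition pequi :: "'i set => ('i => real => real) => bool" where
  "pequi I a \<longleftrightarrow> (\<exists>B. \<forall>i\<in>I. \<forall>x\<in>{0..1}. \<bar>a i x\<bar> <= B) \<and>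
     (\<exists>D. finite D \<and> (\<forall>e>0. \<exists>d>0. modulus I D a d e))"

abbreviation pcont :: "(real => real) => bool" where
  "pcont a \<equiv> pequi {()} (%_. a)"

lemma pequiI:
  assumes B: "\<And>i x. i \<in> I ==> x \<in> {0..1} ==> \<bar>a i x\<bar> <= B" and D: "finite D"
    and m: "\<And>e. e > 0 ==> \<exists>d>0. modulus I D a d e"
  shows "pequi I a"
proof -
  have "\<forall>i\<in>I. \<forall>x\<in>{0..1}. \<bar>a i x\<bar> <= B" by (intro ballI B)
  then have 1: "\<exists>B. \<forall>i\<in>I. \<forall>x\<in>{0..1}. \<bar>a i x\<bar> <= B" by (rule exI)
  have "\<forall>e>0. \<exists>d>0. modulus I D a d e"
    by (rule allI, rule impI, rule m)
  with D have 2: "finite D \<and> (\<forall>e>0. \<exists>d>0. modulus I D a d e)" by (rule conjI)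
  have 3: "\<exists>D. finite D \<and> (\<forall>e>0. \<exists>d>0. modulus I D a d e)"
    by (rule exI[of _ D]) (rule 2)
  show ?thesis unfolding pequi_def by (rule conjI[OF 1 3])
qed

lemma pequi_bounded:
  assumes "pequi I a" obtains B where "0 <= B" "\<And>i x. i \<in> I ==> x \<in> {0..1} ==> \<bar>a i x\<bar> <= B"
proof -
  obtain B where "\<forall>i\<in>I. \<forall>x\<in>{0..1}. \<bar>a i x\<bar> <= B" using assms by (auto simp: pequi_def)
  then show thesis by (intro that[of "max 0 B"]) (auto simp: le_max_iff_disj)
qed

lemma pequi_modulus:
  assumes "pequi I a"
  obtains D where "finite D" "\<forall>e>0. \<exists>d>0. modulus I D a d e"
  using assms unfolding pequi_def by (elim conjE exE) (rule that)

lemma pequi_reindex: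
  assumes "pequi J a" "\<And>i. i \<in> I ==> f i \<in> J"
  shows "pequi I (%i. a (f i))"
proof -
  obtain B where B: "\<And>i x. i \<in> J ==> x \<in> {0..1} ==> \<bar>a i x\<bar> <= B" using pequi_bounded[OF assms(1)] by metis
  obtain D where D: "finite D"
    and *: "\<forall>e>0. \<exists>d>0. modulus J D a d e"
    using assms(1) by (rule pequi_modulus)
  show ?thesis
  proof (rule pequiI[OF _ D])
    fix e :: real assume "e > 0"
    from *[rule_format, OF this] obtain d where d: "d > 0" "modulus J D a d e"
      by (elim exE conjE) (rule that)
    show "\<exists>d>0. \<forall>i\<in>I. \<forall>x\<in>{0..1}. \<forall>y\<in>{0..1}. x <= y --> y - x < d --> {x..y} \<inter> D = {} --> \<bar>a (f i) x - a (f i) y\<bar> < e"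
      by (intro exI[of _ d] conjI ballI d(1)) (rule d(2)[THEN bspec, THEN bspec, THEN bspec, OF assms(2)])
  qed (use B assms(2) in auto)
qed

lemma pequi_const_family: "pcont a ==> pequi I (%_. a)"
  by (erule pequi_reindex[where f="%_. ()"]) simp

lemma pequi_member: "pequi I a ==> i \<in> I ==> pcont (a i)"
  by (erule pequi_reindex[where f="%_. i"]) simp

text \<open>The common source of the closure properties below: sums, products, reciprocals and
  Lipschitz families all have increments dominated in this way.\<close>

lemma pequi_dom:
  assumes a: "pequi I a" and b: "pequi I b" and L: "0 <= L"
    and C: "\<And>i x. i \<in> I ==> x \<in> {0..1} ==> \<bar>c i x\<bar> <= C"
    and dom: "\<And>i x y. i \<in> I ==> x \<in> {0..1} ==> y \<in> {0..1} ==>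
      \<bar>c i x - c i y\<bar> <= L * (\<bar>a i x - a i y\<bar> + \<bar>b i x - b i y\<bar> + \<bar>x - y\<bar>)"
  shows "pequi I c"
proof -
  obtain D where D: "finite D" and Da: "\<forall>e>0. \<exists>d>0. modulus I D a d e"
    using a by (rule pequi_modulus)
  obtain E where E: "finite E" and Eb: "\<forall>e>0. \<exists>d>0. modulus I E b d e"
    using b by (rule pequi_modulus)
  show ?thesis
  proof (rule pequiI[where D="D \<union> E", OF C])
    fix e :: real assume that: "e > 0"
    define e' where "e' = e / (3 * (L + 1))"
    have e': "e' > 0" using that L by (simp add: e'_def)
    from Da[rule_format, OF e'] obtain d1 where d1: "d1 > 0" "modulus I D a d1 e'" by (elim exE conjE) (rule that)
    from Eb[rule_format, OF e'] obtain d2 where d2: "d2 > 0" "modulus I E b d2 e'" by (elim exE conjE) (rule that)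
    have "\<bar>c i x - c i y\<bar> < e" if "i \<in> I" "x \<in> {0..1}" "y \<in> {0..1}" "x <= y"
      "y - x < min e' (min d1 d2)" "{x..y} \<inter> (D \<union> E) = {}" for i x y
    proof -
      have "{x..y} \<inter> D = {}" "{x..y} \<inter> E = {}" using that(6) by auto
      then have "\<bar>a i x - a i y\<bar> < e'" "\<bar>b i x - b i y\<bar> < e'"
        using d1(2)[rule_format, OF that(1-4)] d2(2)[rule_format, OF that(1-4)] that(5) by auto
      then have "\<bar>a i x - a i y\<bar> + \<bar>b i x - b i y\<bar> + \<bar>x - y\<bar> <= 3 * e'" using that by simp
      then have "\<bar>c i x - c i y\<bar> <= L * (3 * e')"
        using dom[OF that(1-3)] L by (meson mult_left_mono order_trans)
      also have "\<dots> < e" using \<open>e > 0\<close> L by (simp add: e'_def field_simps)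
      finally show ?thesis .
    qed
    then show "\<exists>d>0. \<forall>i\<in>I. \<forall>x\<in>{0..1}. \<forall>y\<in>{0..1}. x <= y --> y - x < d --> {x..y} \<inter> (D \<union> E) = {} --> \<bar>c i x - c i y\<bar> < e"
      using e' d1(1) d2(1) by (intro exI[of _ "min e' (min d1 d2)"] conjI ballI impI) simp_all
  qed (use D E in simp_all)
qed

lemma pequi_zero: "pequi I (%i x. 0)"
proof (rule pequiI[where B=0 and D="{}"])
  fix e :: real assume "e > 0"
  then show "\<exists>d>0. \<forall>i\<in>I. \<forall>x\<in>{0..1::real}. \<forall>y\<in>{0..1}.
    x <= y --> y - x < d --> {x..y} \<inter> {} = {} --> \<bar>0 - 0\<bar> < e" by (intro exI[of _ 1]) simp
qed simp_all

lemma pequi_lipschitz: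
  assumes "\<And>i x. i \<in> I ==> x \<in> {0..1} ==> \<bar>c i x\<bar> <= C"
    "\<And>i x y. i \<in> I ==> x \<in> {0..1} ==> y \<in> {0..1} ==> \<bar>c i x - c i y\<bar> <= L * \<bar>x - y\<bar>"
  shows "pequi I c"
proof (rule pequi_dom[OF pequi_zero pequi_zero, of "\<bar>L\<bar>" I c C])
  show "\<bar>c i x - c i y\<bar> <= \<bar>L\<bar> * (\<bar>0 - 0\<bar> + \<bar>0 - 0\<bar> + \<bar>x - y\<bar>)"
    if "i \<in> I" "x \<in> {0..1}" "y \<in> {0..1}" for i x y
    using order_trans[OF assms(2)[OF that] mult_right_mono[OF abs_ge_self abs_ge_zero]] by simp
qed (use assms in auto)

lemma pequi_equicont:
  assumes "\<And>i x. i \<in> I ==> x \<in> {0..1} ==> \<bar>c i x\<bar> <= C"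
    "\<And>e. e > 0 ==> \<exists>d>0. \<forall>i\<in>I. \<forall>x\<in>{0..1}. \<forall>y\<in>{0..1}. \<bar>x - y\<bar> < d --> \<bar>c i x - c i y\<bar> < e"
  shows "pequi I c"
proof (rule pequiI[where D="{}", OF assms(1)])
  fix e :: real assume "e > 0"
  from assms(2)[OF this] obtain d where d: "d > 0" "\<forall>i\<in>I. \<forall>x\<in>{0..1}. \<forall>y\<in>{0..1}. \<bar>x - y\<bar> < d --> \<bar>c i x - c i y\<bar> < e"
    by (elim exE conjE) (rule that)
  have "\<bar>c i x - c i y\<bar> < e" if "i \<in> I" "x \<in> {0..1}" "y \<in> {0..1}" "x <= y" "y - x < d" for i x y
    using d(2)[rule_format, OF that(1-3)] that(4,5) by simp
  then show "\<exists>d>0. \<forall>i\<in>I. \<forall>x\<in>{0..1}. \<forall>y\<in>{0..1}. x <= y --> y - x < d --> {x..y} \<inter> {} = {} --> \<bar>c i x - c i y\<bar> < e"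
    using d(1) by (intro exI[of _ d] conjI ballI impI) simp_all
qed simp_all

lemma pcont_continuous: assumes "continuous_on {0..1} f" shows "pcont f"
proof -
  have "bounded (f ` {0..1})" using assms by (intro compact_imp_bounded compact_continuous_image) auto
  then obtain C where C: "\<And>x. x \<in> {0..1} ==> \<bar>f x\<bar> <= C" unfolding bounded_iff by (metis imageI real_norm_def)
  have u: "uniformly_continuous_on {0..1} f" using assms by (intro compact_uniformly_continuous) auto
  show ?thesis
  proof (rule pequi_equicont[where C=C])
    fix e :: real assume "e > 0"
    then obtain d where "d > 0" "\<forall>x\<in>{0..1}. \<forall>x'\<in>{0..1}. dist x' x < d --> dist (f x') (f x) < e"
      using u unfolding uniformly_continuous_on_def by blast
    then show "\<exists>d>0. \<forall>i\<in>{()}. \<forall>x\<in>{0..1}. \<forall>y\<in>{0..1}. \<bar>x - y\<bar> < d --> \<bar>f x - f y\<bar> < e"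
      by (intro exI[of _ d]) (auto simp: dist_real_def)
  qed (use C in auto)
qed

lemma pequi_add: assumes a: "pequi I a" and b: "pequi I b" shows "pequi I (%i x. a i x + b i x)"
proof -
  obtain A where A: "\<And>i x. i \<in> I ==> x \<in> {0..1} ==> \<bar>a i x\<bar> <= A" using pequi_bounded[OF a] by metis
  obtain B where B: "\<And>i x. i \<in> I ==> x \<in> {0..1} ==> \<bar>b i x\<bar> <= B" using pequi_bounded[OF b] by metis
  show ?thesis
  proof (rule pequi_dom[OF a b, of 1 _ "A + B"])
    show "\<bar>a i x + b i x\<bar> <= A + B" if "i \<in> I" "x \<in> {0..1}" for i x using A[OF that] B[OF that] by linarith
  qed auto
qed

lemma pequi_uminus: assumes a: "pequi I a" shows "pequi I (%i x. - a i x)"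
proof -
  obtain A where A: "\<And>i x. i \<in> I ==> x \<in> {0..1} ==> \<bar>a i x\<bar> <= A" using pequi_bounded[OF a] by metis
  show ?thesis
  proof (rule pequi_dom[OF a a, of 1 _ "A"])
    show "\<bar>- a i x - - a i y\<bar> <= 1 * (\<bar>a i x - a i y\<bar> + \<bar>a i x - a i y\<bar> + \<bar>x - y\<bar>)" for i x y
      by (simp add: abs_minus_commute[of "a i y"])
  qed (use A in auto)
qed

lemma pequi_diff: assumes "pequi I a" "pequi I b" shows "pequi I (%i x. a i x - b i x)"
  using pequi_add[OF assms(1) pequi_uminus[OF assms(2)]] by simp

lemma pequi_mult: assumes a: "pequi I a" and b: "pequi I b" shows "pequi I (%i x. a i x * b i x)"
proof -
  obtain A where A0: "0 <= A" and A: "\<And>i x. i \<in> I ==> x \<in> {0..1} ==> \<bar>a i x\<bar> <= A" using pequi_bounded[OF a] by metis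
  obtain B where B0: "0 <= B" and B: "\<And>i x. i \<in> I ==> x \<in> {0..1} ==> \<bar>b i x\<bar> <= B" using pequi_bounded[OF b] by metis
  show ?thesis
  proof (rule pequi_dom[OF a b, of "A + B" _ "A * B"])
    show "\<bar>a i x * b i x\<bar> <= A * B" if "i \<in> I" "x \<in> {0..1}" for i x
      unfolding abs_mult using A[OF that] B[OF that] A0 by (intro mult_mono) auto
    show "\<bar>a i x * b i x - a i y * b i y\<bar> <= (A + B) * (\<bar>a i x - a i y\<bar> + \<bar>b i x - b i y\<bar> + \<bar>x - y\<bar>)"
      if "i \<in> I" "x \<in> {0..1}" "y \<in> {0..1}" for i x y
    proof -
      have "a i x * b i x - a i y * b i y = a i x * (b i x - b i y) + b i y * (a i x - a i y)"
        by (simp add: algebra_simps)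
      then have "\<bar>a i x * b i x - a i y * b i y\<bar> <= \<bar>a i x\<bar> * \<bar>b i x - b i y\<bar> + \<bar>b i y\<bar> * \<bar>a i x - a i y\<bar>"
        by (metis abs_mult abs_triangle_ineq)
      also have "\<dots> <= A * \<bar>b i x - b i y\<bar> + B * \<bar>a i x - a i y\<bar>"
        using A[OF that(1,2)] B[OF that(1,3)] by (intro add_mono mult_right_mono) auto
      also have "\<dots> <= (A + B) * (\<bar>a i x - a i y\<bar> + \<bar>b i x - b i y\<bar> + \<bar>x - y\<bar>)"
        using A0 B0 by (simp add: algebra_simps)
      finally show ?thesis .
    qed
  qed (use A0 B0 in auto)
qed

lemma pequi_inverse:
  assumes a: "pequi I a" and c: "c > 0" "\<And>i x. i \<in> I ==> x \<in> {0..1} ==> c <= a i x"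
  shows "pequi I (%i x. 1 / a i x)"
proof (rule pequi_dom[OF a a, of "1 / c^2" _ "1 / c"])
  show "\<bar>1 / a i x\<bar> <= 1 / c" if "i \<in> I" "x \<in> {0..1}" for i x
    using c(1) c(2)[OF that] by (simp add: frac_le)
  show "\<bar>1 / a i x - 1 / a i y\<bar> <= 1 / c^2 * (\<bar>a i x - a i y\<bar> + \<bar>a i x - a i y\<bar> + \<bar>x - y\<bar>)"
    if "i \<in> I" "x \<in> {0..1}" "y \<in> {0..1}" for i x y
  proof -
    have p: "c <= a i x" "c <= a i y" using c(2) that by auto
    have "1 / a i x - 1 / a i y = (a i y - a i x) / (a i x * a i y)"
      using p c(1) by (simp add: field_simps)
    then have "\<bar>1 / a i x - 1 / a i y\<bar> = \<bar>a i x - a i y\<bar> / (a i x * a i y)"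
      using p c(1) by (simp add: abs_mult abs_minus_commute)
    also have "\<dots> <= \<bar>a i x - a i y\<bar> / c^2"
      using p c(1) by (intro divide_left_mono) (auto simp: power2_eq_square intro: mult_mono)
    also have "\<dots> <= 1 / c^2 * (\<bar>a i x - a i y\<bar> + \<bar>a i x - a i y\<bar> + \<bar>x - y\<bar>)"
      by (simp add: divide_right_mono)
    finally show ?thesis .
  qed
qed (use c in auto)

lemma pequi_const: assumes "\<And>i. i \<in> I ==> \<bar>c i\<bar> <= C" shows "pequi I (%i x. c i)"
  by (rule pequi_lipschitz[where C=C and L=0]) (use assms in auto)

lemma pcont_scale: "pcont a ==> pcont (%x. c * a x)"
  using pequi_mult[OF pequi_const[of "{()}" "%_. c" "\<bar>c\<bar>"]] by simp

lemma pcont_sum: "(\<And>i. i \<in> A ==> pcont (f i)) ==> pcont (%x. \<Sum>i\<in>A. f i x)"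
  by (induction A rule: infinite_finite_induct) (auto intro: pequi_zero pequi_add)

text \<open>Extended by zero, \<open>a\<close> is continuous off the finite set \<open>D\<close>
  together with the two end points, and countably many exceptional points do not affect Borel
  measurability.\<close>

lemma pcont_measurable: assumes "pcont a" shows "a \<in> borel_measurable M01"
proof -
  obtain D where D: "finite D" and *: "\<forall>e>0. \<exists>d>0. \<forall>i\<in>{()}. \<forall>x\<in>{0..1}. \<forall>y\<in>{0..1}.
      x <= y --> y - x < d --> {x..y} \<inter> D = {} --> \<bar>a x - a y\<bar> < e"
    using assms by (rule pequi_modulus)
  let ?b = "%x. if x \<in> {0..1} then a x else 0"
  have "?b \<in> borel_measurable borel"
  proof (rule borel_measurable_continuous_countable_exceptions[where X="D \<union> {0,1}"])
    have "finite (D \<union> {0,1})" using D by simp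
    then show "countable (D \<union> {0,1})" by (rule countable_finite)
    have "isCont ?b x" if x: "x \<notin> D \<union> {0,1}" for x
    proof (cases "x \<in> {0..1}")
      case False
      have "\<forall>\<^sub>F y in nhds x. y \<in> - {0..1}" using False by (intro eventually_nhds_in_open) auto
      then have "\<forall>\<^sub>F y in nhds x. ?b y = 0" by eventually_elim auto
      then show ?thesis by (subst isCont_cong[where g="%_. 0"]) auto
    next
      case True
      have "open (- (D \<union> {0,1}))" using D by (simp add: finite_imp_closed open_Compl)
      then obtain r where r: "r > 0" "ball x r \<subseteq> - (D \<union> {0,1})" using x open_contains_ball by blast
      have x01: "0 < x" "x < 1" using x True by auto
      show ?thesis unfolding continuous_at_eps_delta
      proof (intro allI impI)
        fix e :: real assume "e > 0"
        from *[rule_format, OF this] obtain d where d: "d > 0" "\<forall>i\<in>{()}. \<forall>x\<in>{0..1}. \<forall>y\<in>{0..1}.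
            x <= y --> y - x < d --> {x..y} \<inter> D = {} --> \<bar>a x - a y\<bar> < e"
          by (elim exE conjE) (rule that)
        \<comment> \<open>The radius combines the modulus \<open>d\<close>, the distance
          \<open>r\<close> to the exceptional points, and the distances to 0 and 1, which keep
          \<open>y\<close> inside the interval.\<close>
        have "dist (?b y) (?b x) < e" if y: "dist y x < min (min d r) (min x (1 - x))" for y
        proof -
          have y01: "y \<in> {0..1}" using y x01 by (auto simp: dist_real_def)
          have "{min x y..max x y} \<subseteq> ball x r" using y by (auto simp: dist_real_def)
          then have "{min x y..max x y} \<inter> D = {}" using r(2) by blast
          then have "\<bar>a (min x y) - a (max x y)\<bar> < e"
            using y01 True y by (intro d(2)[rule_format, of "()"]) (auto simp: dist_real_def)
          then show ?thesis using y01 True by (auto simp: dist_real_def min_def max_def abs_minus_commute split: if_splits)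
        qed
        then show "\<exists>d>0. \<forall>y. dist y x < d --> dist (?b y) (?b x) < e"
          using d(1) r(1) x01 by (intro exI[of _ "min (min d r) (min x (1 - x))"]) auto
      qed
    qed
    then show "continuous_on (- (D \<union> {0,1})) ?b"
      by (intro continuous_at_imp_continuous_on) blast
  qed
  then have "?b \<in> borel_measurable lebesgue" by (simp add: measurable_completion)
  then have "?b \<in> borel_measurable M01" by (rule measurable_restrict_space1)
  then show ?thesis by (subst measurable_cong[where g="?b"]) auto
qed

lemma pcont_L2: assumes "pcont a" shows "a \<in> L2"
proof -
  obtain B where "\<And>x. x \<in> {0..1} ==> \<bar>a x\<bar> <= B" using pequi_bounded[OF assms] by auto
  then show ?thesis using L2_bounded pcont_measurable[OF assms] by blast
qed

lemma C1_01_bounds: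
  assumes "C1_01 g"
  shows "\<exists>B. (\<forall>x\<in>{0..1}. \<bar>g x\<bar> <= B) \<and> (\<forall>x\<in>{0..1}. \<forall>y\<in>{0..1}. \<bar>g x - g y\<bar> <= B * \<bar>x - y\<bar>)"
proof -
  obtain g' where g': "\<And>x. x \<in> {0..1} ==> (g has_real_derivative g' x) (at x within {0..1})"
    and c: "continuous_on {0..1} g'" using assms unfolding C1_01_def by blast
  have "continuous_on {0..1} g" using g' by (meson DERIV_continuous_on)
  then have "bounded (g ` {0..1})" by (intro compact_imp_bounded compact_continuous_image) auto
  then obtain B1 where B1: "\<And>x. x \<in> {0..1} ==> \<bar>g x\<bar> <= B1" unfolding bounded_iff by (metis imageI real_norm_def)
  have "bounded (g' ` {0..1})" using c by (intro compact_imp_bounded compact_continuous_image) auto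
  then obtain B2 where B2: "\<And>x. x \<in> {0..1} ==> \<bar>g' x\<bar> <= B2" unfolding bounded_iff by (metis imageI real_norm_def)
  have "\<bar>g x - g y\<bar> <= max B1 B2 * \<bar>x - y\<bar>" if "x \<in> {0..1}" "y \<in> {0..1}" for x y
  proof -
    have "norm (g x - g y) <= B2 * norm (x - y)"
      by (rule field_differentiable_bound[where S="{0..1}" and f'=g']) (use g' B2 that in auto)
    also have "\<dots> <= max B1 B2 * norm (x - y)" by (intro mult_right_mono) auto
    finally show ?thesis by simp
  qed
  then show ?thesis using B1 by (intro exI[of _ "max B1 B2"]) (auto simp: le_max_iff_disj)
qed

text \<open>Two points whose connecting segment contains no end point of a piece lie in the same
  piece, where the function is Lipschitz; finitely many pieces give one constant.\<close>

lemma PC1_pcont: assumes "PC1_01 f" shows "pcont f"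
proof -
  obtain \<I> where fin: "finite \<I>" and U: "\<Union>\<I> = {0..1}"
    and I': "\<forall>I\<in>\<I>. is_interval I \<and> interior I \<noteq> {} \<and> (\<exists>g. C1_01 g \<and> (\<forall>x\<in>I. f x = g x))"
    using assms unfolding PC1_01_def by (elim exE conjE) (rule that)
  note I = I'[rule_format]
  have "\<exists>B. (\<forall>x\<in>I. \<bar>f x\<bar> <= B) \<and> (\<forall>x\<in>I. \<forall>y\<in>I. \<bar>f x - f y\<bar> <= B * \<bar>x - y\<bar>)" if IX: "I \<in> \<I>" for I
  proof -
    have sub: "I \<subseteq> {0..1}" using U IX by blast
    obtain g where "C1_01 g" and g: "\<forall>x\<in>I. f x = g x" using I[OF IX] by (elim exE conjE) (rule that)
    then obtain B where B: "\<forall>x\<in>{0..1}. \<bar>g x\<bar> <= B" "\<forall>x\<in>{0..1}. \<forall>y\<in>{0..1}. \<bar>g x - g y\<bar> <= B * \<bar>x - y\<bar>"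
      using C1_01_bounds[OF \<open>C1_01 g\<close>] by (elim exE conjE) (rule that)
    have "\<bar>f x\<bar> <= B" if "x \<in> I" for x using B(1) g sub that by auto
    moreover have "\<bar>f x - f y\<bar> <= B * \<bar>x - y\<bar>" if "x \<in> I" "y \<in> I" for x y
      using bspec[OF bspec[OF B(2) subsetD[OF sub that(1)]] subsetD[OF sub that(2)]] g that by simp
    ultimately show ?thesis by (intro exI[of _ B]) simp
  qed
  then obtain B where B: "\<And>I x. I \<in> \<I> ==> x \<in> I ==> \<bar>f x\<bar> <= B I"
    "\<And>I x y. I \<in> \<I> ==> x \<in> I ==> y \<in> I ==> \<bar>f x - f y\<bar> <= B I * \<bar>x - y\<bar>" by metis
  define C where "C = (\<Sum>I\<in>\<I>. \<bar>B I\<bar>)"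
  have C: "B I <= C" if "I \<in> \<I>" for I
  proof -
    have "B I <= \<bar>B I\<bar>" by simp
    also have "\<dots> <= C" unfolding C_def by (rule member_le_sum) (use fin that in auto)
    finally show ?thesis .
  qed
  have C0: "0 <= C" unfolding C_def by (simp add: sum_nonneg)
  define D where "D = (\<Union>I\<in>\<I>. {Inf I, Sup I})"
  have bnd: "\<bar>f x\<bar> <= C" if "x \<in> {0..1}" for x
  proof -
    obtain I where "I \<in> \<I>" "x \<in> I" using \<open>x \<in> {0..1}\<close> U by blast
    then show ?thesis using order_trans[OF B(1) C] by simp
  qed
  have lip: "\<bar>f x - f y\<bar> <= C * \<bar>x - y\<bar>" if "x \<in> {0..1}" "y \<in> {0..1}" "x <= y" "{x..y} \<inter> D = {}" for x y
  proof -
    have "x \<in> \<Union>\<I>" using that(1) U by simp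
    then obtain I where IU: "x \<in> I" "I \<in> \<I>" by (rule UnionE)
    have sub: "I \<subseteq> {0..1}" using Union_upper[OF IU(2)] U by simp
    then have bdd: "bdd_above I" by (rule bdd_above_mono[OF bdd_above_Icc])
    \<comment> \<open>Since \<open>Sup I\<close> is at least \<open>x\<close> but avoids the
      segment, it lies beyond \<open>y\<close>; convexity of \<open>I\<close> then puts
      \<open>y\<close> in the piece of \<open>x\<close>.\<close>
    have "x <= Sup I" using IU bdd by (simp add: cSup_upper)
    moreover have "Sup I \<notin> {x..y}" using that(4) IU by (auto simp: D_def)
    ultimately have "y < Sup I" by auto
    then obtain z where "z \<in> I" "y < z" using less_cSup_iff[of I y] bdd IU by auto
    then have "y \<in> I" using I[OF IU(2)] IU(1) that(3)
      by (intro mem_is_interval_1_I[of I x z y]) auto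
    then have "\<bar>f x - f y\<bar> <= B I * \<bar>x - y\<bar>" using B(2)[OF IU(2,1)] by simp
    also have "\<dots> <= C * \<bar>x - y\<bar>" using C[OF IU(2)] by (intro mult_right_mono) auto
    finally show ?thesis .
  qed
  show ?thesis
  proof (rule pequiI[where B=C and D=D])
    show "finite D" using fin by (auto simp: D_def)
    fix e :: real assume e: "e > 0"
    have "\<bar>f x - f y\<bar> < e" if "x \<in> {0..1}" "y \<in> {0..1}" "x <= y" "y - x < e / (C + 1)" "{x..y} \<inter> D = {}" for x y
    proof -
      have "\<bar>f x - f y\<bar> <= C * (y - x)" using lip[OF that(1-3,5)] that(3) by simp
      also have "\<dots> <= C * (e / (C + 1))" using that(4) C0 by (intro mult_left_mono) auto
      also have "\<dots> < e" using C0 e by (simp add: field_simps)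
      finally show ?thesis .
    qed
    moreover have "e / (C + 1) > 0" using C0 e by simp
    ultimately show "\<exists>d>0. \<forall>i\<in>{()}. \<forall>x\<in>{0..1}. \<forall>y\<in>{0..1}. x <= y --> y - x < d --> {x..y} \<inter> D = {} --> \<bar>f x - f y\<bar> < e"
      by (intro exI[of _ "e / (C + 1)"] conjI ballI impI) simp_all
  qed (use bnd in simp_all)
qed

subsection \<open>Grid functions and Riemann sums\<close>

abbreviation gp :: "nat => nat => real" where "gp n j \<equiv> real j * hh n"

abbreviation mean_sq :: "nat => (nat => real) => real" where
  "mean_sq n a \<equiv> hh n * (\<Sum>j=1..n. (a j)^2)"

lemma hh_pos: "0 < hh n" by (simp add: hh_def)
lemma hh_le: "hh n <= 1" by (simp add: hh_def field_simps)
lemma hh_mult: "hh n * (real n + 1) = 1" by (simp add: hh_def)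
lemma n_hh_le: "gp n n <= 1" by (simp add: hh_def field_simps)
lemma hh_tendsto: "hh \<longlonglongrightarrow> 0"
  unfolding hh_def[abs_def] using LIMSEQ_inverse_real_of_nat by (simp add: inverse_eq_divide add.commute)

lemma hh_eventually_less: "e > 0 ==> \<forall>\<^sub>F n in sequentially. hh n < e"
  using order_tendstoD(2)[OF hh_tendsto] by blast

lemma grid_in: assumes "j <= n + 1" shows "gp n j \<in> {0..1}"
proof -
  have "gp n j <= (real n + 1) * hh n" using assms hh_pos[of n] by (intro mult_right_mono) auto
  then show ?thesis using hh_mult[of n] hh_pos[of n] by (simp add: mult.commute)
qed

text \<open>Measured from the value at the centre, because both the second difference and the
  Riemann sum compare a function with its value at a grid point.\<close>

definition osc :: "(real => real) => real => real => real" where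
  "osc a x d = (SUP y\<in>{max 0 (x-d)..min 1 (x+d)}. \<bar>a y - a x\<bar>)"

lemma osc_ge:
  assumes "\<And>y. y \<in> {0..1} ==> \<bar>a y\<bar> <= B" "x \<in> {0..1}" "y \<in> {0..1}" "\<bar>y - x\<bar> <= d"
  shows "\<bar>a y - a x\<bar> <= osc a x d"
  unfolding osc_def
proof (rule cSUP_upper)
  show "bdd_above ((%y. \<bar>a y - a x\<bar>) ` {max 0 (x - d)..min 1 (x + d)})"
  proof (rule bdd_aboveI2)
    fix y assume "y \<in> {max 0 (x - d)..min 1 (x + d)}"
    then have "y \<in> {0..1}" by auto
    then show "\<bar>a y - a x\<bar> <= 2 * B" using assms(1)[of y] assms(1)[of x] assms(2) by linarith
  qed
qed (use assms in auto)

lemma osc_le: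
  assumes "x \<in> {0..1}" "0 <= d" "\<And>y. y \<in> {0..1} ==> \<bar>y - x\<bar> <= d ==> \<bar>a y - a x\<bar> <= c"
  shows "osc a x d <= c"
  unfolding osc_def by (rule cSUP_least) (use assms in auto)

lemma osc_nonneg:
  assumes "\<And>y. y \<in> {0..1} ==> \<bar>a y\<bar> <= B" "x \<in> {0..1}" "0 <= d"
  shows "0 <= osc a x d"
  using osc_ge[of a B x x d] assms by auto

text \<open>Mean square instead of maximum, uniformly over the index set: rows at the boundary and
  at jumps may keep residuals of order one.\<close>

definition vanish :: "'i set => (nat => 'i => nat => real) => bool" where
  "vanish I r \<longleftrightarrow> (\<forall>e>0. \<forall>\<^sub>F n in sequentially. \<forall>i\<in>I. mean_sq n (r n i) <= e)"

lemma vanishD: "vanish I r ==> e > 0 ==> \<forall>\<^sub>F n in sequentially. \<forall>i\<in>I. mean_sq n (r n i) <= e"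
  by (simp add: vanish_def)

text \<open>Two rows of size \<open>C\<close> contribute at most \<open>2 C^2\<close> to the sum and
  therefore \<open>O(h)\<close> to the mean square.\<close>

lemma vanish_ends:
  assumes s: "vanish I s" and C: "0 <= C"
    and dom: "\<forall>\<^sub>F n in sequentially. \<forall>i\<in>I. \<forall>j\<in>{1..n}. \<bar>r n i j\<bar> <= C \<and> (j \<noteq> 1 --> j \<noteq> n --> \<bar>r n i j\<bar> <= \<bar>s n i j\<bar>)"
  shows "vanish I r"
  unfolding vanish_def
proof (intro allI impI)
  fix e :: real assume e: "e > 0"
  have e2: "e / 2 > 0" "e / (4 * C^2 + 1) > 0" using e by (auto simp: add_nonneg_pos)
  from vanishD[OF s e2(1)] dom hh_eventually_less[OF e2(2)]
  show "\<forall>\<^sub>F n in sequentially. \<forall>i\<in>I. mean_sq n (r n i) <= e"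
  proof eventually_elim
    case (elim n)
    show ?case
    proof
      fix i assume i: "i \<in> I"
      have "(r n i j)^2 <= (s n i j)^2 + C^2 * (if j = 1 then 1 else 0) + C^2 * (if j = n then 1 else 0)" if "j \<in> {1..n}" for j
      proof (cases "j = 1 \<or> j = n")
        case True
        have "\<bar>r n i j\<bar> <= C" using elim(2) i that by blast
        then have "(r n i j)^2 <= C^2" by (rule power2_le_iff_abs_le[THEN iffD2, OF C])
        moreover have "0 <= (s n i j)^2" by simp
        moreover have "C^2 <= C^2 * (if j = 1 then 1 else 0) + C^2 * (if j = n then 1 else 0)"
          using True by auto
        ultimately show ?thesis by linarith
      next
        case False
        then have "\<bar>r n i j\<bar> <= \<bar>s n i j\<bar>" using elim(2) i that by blast
        then show ?thesis using False by (simp add: abs_le_square_iff)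
      qed
      then have "(\<Sum>j=1..n. (r n i j)^2) <= (\<Sum>j=1..n. (s n i j)^2 + C^2 * (if j = 1 then 1 else 0) + C^2 * (if j = n then 1 else 0))"
        by (rule sum_mono)
      also have "\<dots> <= (\<Sum>j=1..n. (s n i j)^2) + C^2 + C^2"
        by (simp add: sum.distrib sum_distrib_left[symmetric])
      finally have "mean_sq n (r n i) <= mean_sq n (s n i) + hh n * (2 * C^2)"
        using hh_pos[of n] by (simp add: distrib_left[symmetric] mult_left_mono)
      also have "\<dots> <= e / 2 + e / (4 * C^2 + 1) * (2 * C^2)"
        using elim i by (intro add_mono mult_right_mono) auto
      also have "e / (4 * C^2 + 1) * (2 * C^2) <= e / 2"
      proof -
        have "e / (4 * C^2 + 1) * (2 * C^2) = e / 2 * (4 * C^2 / (4 * C^2 + 1))" by simp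
        also have "\<dots> <= e / 2 * 1" using e
          by (intro mult_left_mono) (simp_all add: divide_le_eq_1 add_nonneg_pos)
        finally show ?thesis by simp
      qed
      finally show "mean_sq n (r n i) <= e" by simp
    qed
  qed
qed

lemma vanish_dom:
  assumes s: "vanish I s"
    and dom: "\<forall>\<^sub>F n in sequentially. \<forall>i\<in>I. \<forall>j\<in>{1..n}. \<bar>r n i j\<bar> <= C * \<bar>s n i j\<bar>"
  shows "vanish I r"
  unfolding vanish_def
proof (intro allI impI)
  fix e :: real assume e: "e > 0"
  have e2: "e / (C^2 + 1) > 0" using e by (auto simp: add_nonneg_pos)
  from vanishD[OF s e2] dom
  show "\<forall>\<^sub>F n in sequentially. \<forall>i\<in>I. mean_sq n (r n i) <= e"
  proof eventually_elim
    case (elim n)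
    show ?case
    proof
      fix i assume i: "i \<in> I"
      have "(r n i j)^2 <= C^2 * (s n i j)^2" if "j \<in> {1..n}" for j
      proof -
        have "\<bar>r n i j\<bar> <= \<bar>C * s n i j\<bar>"
          using elim(2) i that unfolding abs_mult
          by (meson abs_ge_self abs_ge_zero mult_right_mono order_trans)
        then have "(r n i j)^2 <= (C * s n i j)^2" by (simp only: abs_le_square_iff)
        then show ?thesis by (simp add: power_mult_distrib)
      qed
      then have "(\<Sum>j=1..n. (r n i j)^2) <= C^2 * (\<Sum>j=1..n. (s n i j)^2)"
        unfolding sum_distrib_left by (rule sum_mono)
      then have "mean_sq n (r n i) <= C^2 * (mean_sq n (s n i))"
        using hh_pos[of n] by (metis mult.left_commute mult_left_mono less_imp_le)
      also have "\<dots> <= C^2 * (e / (C^2 + 1))" using elim i by (intro mult_left_mono) auto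
      also have "\<dots> = e * (C^2 / (C^2 + 1))" by simp
      also have "\<dots> <= e * 1" using e
        by (intro mult_left_mono) (simp_all add: divide_le_eq_1 add_nonneg_pos)
      finally show "mean_sq n (r n i) <= e" by simp
    qed
  qed
qed

lemma vanish_add: assumes r: "vanish I r" and s: "vanish I s" shows "vanish I (%n i j. r n i j + s n i j)"
  unfolding vanish_def
proof (intro allI impI)
  fix e :: real assume "e > 0"
  then have e: "e / 4 > 0" by simp
  from vanishD[OF r e] vanishD[OF s e]
  show "\<forall>\<^sub>F n in sequentially. \<forall>i\<in>I. hh n * (\<Sum>j=1..n. (r n i j + s n i j)^2) <= e"
  proof eventually_elim
    case (elim n)
    show ?case
    proof
      fix i assume i: "i \<in> I"
      have "(r n i j + s n i j)^2 <= 2 * (r n i j)^2 + 2 * (s n i j)^2" for j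
        using sum_squares_ge_zero[of "r n i j - s n i j" 0] by (simp add: power2_eq_square algebra_simps)
      then have "(\<Sum>j=1..n. (r n i j + s n i j)^2) <= (\<Sum>j=1..n. 2 * (r n i j)^2 + 2 * (s n i j)^2)"
        by (intro sum_mono)
      also have "\<dots> = 2 * (\<Sum>j=1..n. (r n i j)^2) + 2 * (\<Sum>j=1..n. (s n i j)^2)"
        by (simp add: sum.distrib sum_distrib_left)
      finally have "hh n * (\<Sum>j=1..n. (r n i j + s n i j)^2) <= hh n * (2 * (\<Sum>j=1..n. (r n i j)^2) + 2 * (\<Sum>j=1..n. (s n i j)^2))"
        using hh_pos[of n] by simp
      also have "\<dots> = 2 * (mean_sq n (r n i)) + 2 * (mean_sq n (s n i))"
        by (simp add: algebra_simps)
      also have "\<dots> <= e" using elim[rule_format, OF i] by linarith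
      finally show "hh n * (\<Sum>j=1..n. (r n i j + s n i j)^2) <= e" .
    qed
  qed
qed

lemma vanish_uniform:
  assumes c: "c \<longlonglongrightarrow> 0" and dom: "\<forall>\<^sub>F n in sequentially. \<forall>i\<in>I. \<forall>j\<in>{1..n}. \<bar>r n i j\<bar> <= c n"
  shows "vanish I r"
  unfolding vanish_def
proof (intro allI impI)
  fix e :: real assume e: "e > 0"
  have "(%n. (c n)^2) \<longlonglongrightarrow> 0" using tendsto_power[OF c, of 2] by simp
  then have "\<forall>\<^sub>F n in sequentially. (c n)^2 < e" using e order_tendstoD(2) by blast
  with dom show "\<forall>\<^sub>F n in sequentially. \<forall>i\<in>I. mean_sq n (r n i) <= e"
  proof eventually_elim
    case (elim n)
    show ?case
    proof
      fix i assume i: "i \<in> I"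
      have "(\<Sum>j=1..n. (r n i j)^2) <= (\<Sum>j=1..n. e)"
      proof (rule sum_mono)
        fix j assume j: "j \<in> {1..n}"
        have "\<bar>r n i j\<bar> <= \<bar>c n\<bar>" using elim(1) i j by (meson abs_ge_self order_trans)
        then have "(r n i j)^2 <= (c n)^2" by (simp only: abs_le_square_iff)
        then show "(r n i j)^2 <= e" using elim(2) by simp
      qed
      then have "mean_sq n (r n i) <= hh n * (real n * e)" using hh_pos[of n] by (simp add: mult_left_mono)
      also have "\<dots> = (gp n n) * e" by simp
      also have "\<dots> <= 1 * e" using n_hh_le e by (intro mult_right_mono) auto
      finally show "mean_sq n (r n i) <= e" by simp
    qed
  qed
qed

lemma vanish_reindex: "vanish J r ==> (\<And>i. i \<in> I ==> f i \<in> J) ==> vanish I (%n i. r n (f i))"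
  unfolding vanish_def by (auto elim!: eventually_mono)

text \<open>The index is within distance 1 of \<open>d / h\<close>, hence one of four integers
  around its floor; what matters is a count independent of \<open>h\<close>.\<close>

lemma card_near: fixes d h :: real assumes h: "0 < h"
  shows "finite {j::nat. \<bar>real j * h - d\<bar> <= h}" "card {j::nat. \<bar>real j * h - d\<bar> <= h} <= 4"
proof -
  let ?A = "{j::nat. \<bar>real j * h - d\<bar> <= h}" and ?z = "\<lfloor>d / h\<rfloor>"
  have sub: "int ` ?A \<subseteq> {?z - 1..?z + 2}"
  proof
    fix k assume "k \<in> int ` ?A"
    then obtain j where j: "k = int j" "\<bar>real j * h - d\<bar> <= h" by auto
    have "real j - d / h = (real j * h - d) / h" using h by (simp add: diff_divide_distrib)
    then have "\<bar>real j - d / h\<bar> = \<bar>real j * h - d\<bar> / h" using h by (simp add: abs_divide)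
    also have "\<dots> <= 1" using j(2) h by (simp add: pos_divide_le_eq)
    finally have "\<bar>real j - d / h\<bar> <= 1" .
    then show "k \<in> {?z - 1..?z + 2}" unfolding j(1) atLeastAtMost_iff by linarith
  qed
  then have "finite (int ` ?A)" using finite_subset by blast
  then show fin: "finite ?A" by (simp add: finite_image_iff)
  have "card ?A = card (int ` ?A)" by (simp add: card_image)
  also have "\<dots> <= card {?z - 1..?z + 2}" using sub by (intro card_mono) auto
  finally show "card ?A <= 4" by simp
qed

text \<open>Away from \<open>D\<close> the oscillation is below the modulus; the at most
  \<open>4 * card D\<close> remaining nodes have oscillation at most \<open>2 B\<close> and together
  contribute \<open>O(h)\<close>.\<close>

lemma vanish_osc: assumes a: "pequi I a" shows "vanish I (%n i j. osc (a i) (gp n j) (hh n))"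
  unfolding vanish_def
proof (intro allI impI)
  fix e :: real assume e: "e > 0"
  obtain B where B0: "0 <= B" and B: "\<And>i x. i \<in> I ==> x \<in> {0..1} ==> \<bar>a i x\<bar> <= B" using pequi_bounded[OF a] by metis
  obtain D where D: "finite D" and Da: "\<forall>e>0. \<exists>d>0. modulus I D a d e"
    using a by (rule pequi_modulus)
  define e' where "e' = sqrt (e / 2)"
  have e': "e' > 0" "e'^2 = e / 2" using e by (auto simp: e'_def)
  from Da[rule_format, OF e'(1)] obtain d where d: "d > 0" and dd': "modulus I D a d e'"
    by (elim exE conjE) (rule that)
  note dd = dd'[rule_format]
  define c where "c = 4 * B^2 * (4 * real (card D))"
  have c: "0 <= c" by (simp add: c_def)
  have "e / (2 * c + 1) > 0" using e c by simp
  from hh_eventually_less[OF d] hh_eventually_less[OF this]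
  show "\<forall>\<^sub>F n in sequentially. \<forall>i\<in>I. hh n * (\<Sum>j=1..n. (osc (a i) (gp n j) (hh n))^2) <= e"
  proof eventually_elim
    case (elim n)
    show ?case
    proof
      fix i assume i: "i \<in> I"
      define bad where "bad = {j\<in>{1..n}. {gp n j - hh n..gp n j + hh n} \<inter> D \<noteq> {}}"
      have o: "(osc (a i) (gp n j) (hh n))^2 <= e / 2 + (if j \<in> bad then 4 * B^2 else 0)" if j: "j \<in> {1..n}" for j
      proof -
        have x: "gp n j \<in> {0..1}" using j by (intro grid_in) auto
        have o0: "0 <= osc (a i) (gp n j) (hh n)"
          using osc_nonneg[of "a i" B, OF B[OF i] x] hh_pos[of n] by simp
        show ?thesis
        proof (cases "j \<in> bad")
          case True
          have "osc (a i) (gp n j) (hh n) <= 2 * B"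
          proof (rule osc_le[OF x])
            show "\<bar>a i y - a i (gp n j)\<bar> <= 2 * B" if "y \<in> {0..1}" for y
              using B[OF i that] B[OF i x] by linarith
          qed (use hh_pos[of n] in auto)
          then have "(osc (a i) (gp n j) (hh n))^2 <= (2 * B)^2" using o0 by (intro power_mono) auto
          then show ?thesis using True e by simp
        next
          case False
          have "osc (a i) (gp n j) (hh n) <= e'"
          proof (rule osc_le[OF x])
            fix y assume y: "y \<in> {0..1}" "\<bar>y - gp n j\<bar> <= hh n"
            let ?x = "gp n j"
            have "{min y ?x..max y ?x} \<subseteq> {?x - hh n..?x + hh n}" using y hh_pos[of n] by auto
            moreover have "{?x - hh n..?x + hh n} \<inter> D = {}" using False j by (auto simp: bad_def)
            ultimately have "{min y ?x..max y ?x} \<inter> D = {}" by blast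
            then have "\<bar>a i (min y ?x) - a i (max y ?x)\<bar> < e'"
              using y x elim(1) by (intro dd[OF i]) (auto simp: min_def max_def)
            then show "\<bar>a i y - a i ?x\<bar> <= e'" by (auto simp: min_def max_def abs_minus_commute split: if_splits)
          qed (use hh_pos[of n] in auto)
          then have "(osc (a i) (gp n j) (hh n))^2 <= e'^2" using o0 by (intro power_mono) auto
          then show ?thesis using False e'(2) by simp
        qed
      qed
      have "bad \<subseteq> (\<Union>x\<in>D. {j::nat. \<bar>gp n j - x\<bar> <= hh n})"
        unfolding bad_def by (auto simp: abs_le_iff)
      then have "card bad <= card (\<Union>x\<in>D. {j::nat. \<bar>gp n j - x\<bar> <= hh n})"
        using D card_near(1)[OF hh_pos] by (intro card_mono) auto
      also have "\<dots> <= (\<Sum>x\<in>D. card {j::nat. \<bar>gp n j - x\<bar> <= hh n})" by (rule card_UN_le[OF D])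
      also have "\<dots> <= (\<Sum>x\<in>D. 4)" by (intro sum_mono card_near(2)[OF hh_pos])
      finally have cb: "card bad <= 4 * card D" by simp
      have "(\<Sum>j=1..n. (osc (a i) (gp n j) (hh n))^2) <= (\<Sum>j=1..n. e / 2 + (if j \<in> bad then 4 * B^2 else 0))"
        using o by (rule sum_mono)
      also have "\<dots> = real n * (e / 2) + 4 * B^2 * real (card bad)"
      proof -
        have "(\<Sum>j=1..n. (if j \<in> bad then 4 * B^2 else 0)) = (\<Sum>j\<in>{1..n} \<inter> bad. 4 * B^2)"
          by (simp add: sum.If_cases Int_def)
        also have "{1..n} \<inter> bad = bad" by (auto simp: bad_def)
        finally show ?thesis by (simp add: sum.distrib)
      qed
      also have "\<dots> <= real n * (e / 2) + c"
        using cb unfolding c_def by (intro add_left_mono mult_left_mono) auto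
      finally have "hh n * (\<Sum>j=1..n. (osc (a i) (gp n j) (hh n))^2) <= hh n * (real n * (e / 2) + c)"
        using hh_pos[of n] by (simp add: mult_left_mono)
      also have "\<dots> = (gp n n) * (e / 2) + hh n * c" by (simp add: algebra_simps)
      also have "\<dots> <= 1 * (e / 2) + e / (2 * c + 1) * c"
        using n_hh_le[of n] e c elim(2) by (intro add_mono mult_right_mono) auto
      also have "\<dots> <= e" using e c by (simp add: field_simps)
      finally show "hh n * (\<Sum>j=1..n. (osc (a i) (gp n j) (hh n))^2) <= e" .
    qed
  qed
qed

text \<open>Induction over the cells with the right-end-point rule; the cellwise deviation
  \<open>c j\<close> is arbitrary, so cells containing a jump are allowed.\<close>

lemma riemann_err:
  fixes a :: "real => real"
  assumes int: "a integrable_on {0..1}" and h: "0 < h" and k: "real k * h <= 1"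
    and c: "\<And>j y. j \<in> {1..k} ==> y \<in> {real j * h - h..real j * h} ==> \<bar>a y - a (real j * h)\<bar> <= c j"
  shows "\<bar>integral {0..real k * h} a - h * (\<Sum>j=1..k. a (real j * h))\<bar> <= h * (\<Sum>j=1..k. c j)"
  using k c
proof (induction k)
  case 0 then show ?case by simp
next
  case (Suc k)
  let ?x = "real k * h" and ?y = "real (Suc k) * h"
  have y: "?y = ?x + h" by (simp add: algebra_simps)
  have k1: "real k * h <= 1" using Suc.prems(1) h y by linarith
  have k0: "0 <= ?x" using h by simp
  have IH: "\<bar>integral {0..?x} a - h * (\<Sum>j=1..k. a (real j * h))\<bar> <= h * (\<Sum>j=1..k. c j)"
    using Suc.IH[OF k1] Suc.prems(2) by auto
  have "{0..?y} \<subseteq> {0..1}" using Suc.prems(1) by simp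
  moreover have "{?x..?y} \<subseteq> {0..1}"
    using k0 Suc.prems(1) by (simp only: atLeastatMost_subset_iff simp_thms)
  ultimately have i: "a integrable_on {0..?y}" "a integrable_on {?x..?y}"
    by (auto intro: integrable_on_subinterval[OF int])
  have "integral {0..?y} a = integral {0..?x} a + integral {?x..?y} a"
    using i(1) h k0 y by (subst Henstock_Kurzweil_Integration.integral_combine) auto
  moreover have "\<bar>integral {?x..?y} a - h * a ?y\<bar> <= h * c (Suc k)"
  proof -
    have cc: "integral {?x..?y} (%_. a ?y) = h * a ?y" using h y by simp
    have "integral {?x..?y} a - h * a ?y = integral {?x..?y} (%t. a t - a ?y)"
      unfolding cc[symmetric] by (rule Henstock_Kurzweil_Integration.integral_diff[symmetric]) (use i in auto)
    moreover have "norm (integral {?x..?y} (%t. a t - a ?y)) <= integral {?x..?y} (%t. c (Suc k))"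
    proof (rule integral_norm_bound_integral)
      show "(%t. a t - a ?y) integrable_on {?x..?y}" using i(2) by (intro integrable_diff) auto
      show "norm (a t - a ?y) <= c (Suc k)" if "t \<in> {?x..?y}" for t
        using Suc.prems(2)[of "Suc k" t] that y by auto
    qed auto
    ultimately show ?thesis using h y by simp
  qed
  ultimately show ?case using IH by (simp add: algebra_simps abs_le_iff)
qed

lemma riemann_sum_tendsto:
  assumes a: "pcont a"
  shows "(%n. hh n * (\<Sum>j=1..n. a (gp n j))) \<longlonglongrightarrow> integral {0..1} a"
proof (rule LIMSEQ_I)
  fix r :: real assume r: "0 < r"
  define \<delta> where "\<delta> = r / 4"
  have \<delta>: "\<delta> > 0" using r by (simp add: \<delta>_def)
  obtain B where B0: "0 <= B" and B: "\<And>x. x \<in> {0..1} ==> \<bar>a x\<bar> <= B" using pequi_bounded[OF a] by auto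
  have int: "a integrable_on {0..1}" using L2_integrable_on(2)[OF pcont_L2[OF a]] by auto
  have d2: "\<delta>^2 > 0" and dB: "\<delta> / (B + 1) > 0" using \<delta> B0 by auto
  from vanishD[OF vanish_osc[OF a] d2] hh_eventually_less[OF dB]
  have "\<forall>\<^sub>F n in sequentially. norm (hh n * (\<Sum>j=1..n. a (gp n j)) - integral {0..1} a) < r"
  proof eventually_elim
    case (elim n)
    let ?o = "%j. osc a (gp n j) (hh n)"
    have grid: "gp n j \<in> {0..1}" if "j \<in> {1..n}" for j using that by (intro grid_in) auto
    have "\<bar>integral {0..gp n n} a - hh n * (\<Sum>j=1..n. a (gp n j))\<bar> <= hh n * (\<Sum>j=1..n. ?o j)"
    proof (rule riemann_err[OF int hh_pos n_hh_le])
      fix j y assume j: "j \<in> {1..n}" and y: "y \<in> {gp n j - hh n..gp n j}"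
      have "hh n <= gp n j" using j hh_pos[of n] by simp
      then have "y \<in> {0..1}" using y grid[OF j] by auto
      then show "\<bar>a y - a (gp n j)\<bar> <= ?o j"
        using osc_ge[of a B "gp n j" y "hh n"] B grid[OF j] y by auto
    qed
    also have "hh n * (\<Sum>j=1..n. ?o j) <= hh n * (\<Sum>j=1..n. \<delta> + (?o j)^2 / \<delta>)"
    proof (intro mult_left_mono sum_mono)
      fix j
      \<comment> \<open>Young's inequality turns smallness in the mean square, which
        \<open>vanish_osc\<close> provides, into smallness in the mean.\<close>
      show "?o j <= \<delta> + (?o j)^2 / \<delta>"
      proof -
        have "0 <= (?o j - \<delta>)^2" by simp
        then have "2 * (?o j * \<delta>) <= (?o j)^2 + \<delta>^2" by (simp add: power2_diff algebra_simps)
        moreover have "0 <= (?o j)^2 + \<delta>^2" by simp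
        ultimately have "?o j * \<delta> <= \<delta>^2 + (?o j)^2" by linarith
        then show ?thesis using \<delta> by (simp add: field_simps power2_eq_square)
      qed
    qed (use hh_pos[of n] in auto)
    also have "\<dots> = (gp n n) * \<delta> + (hh n * (\<Sum>j=1..n. (?o j)^2)) / \<delta>"
      by (simp add: sum.distrib sum_divide_distrib[symmetric] algebra_simps)
    also have "\<dots> <= 1 * \<delta> + \<delta>^2 / \<delta>"
      using elim(1) \<delta> n_hh_le by (intro add_mono divide_right_mono mult_right_mono) auto
    also have "\<dots> = 2 * \<delta>" using \<delta> by (simp add: power2_eq_square)
    finally have 1: "\<bar>integral {0..gp n n} a - hh n * (\<Sum>j=1..n. a (gp n j))\<bar> <= 2 * \<delta>" .
    \<comment> \<open>The nodes stop at \<open>n h = 1 - h\<close>; the last interval of length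
      \<open>h\<close> is estimated separately.\<close>
    have "integral {0..1} a = integral {0..gp n n} a + integral {gp n n..1} a"
      using n_hh_le[of n] hh_pos[of n] int by (subst Henstock_Kurzweil_Integration.integral_combine) auto
    moreover have "\<bar>integral {gp n n..1} a\<bar> <= B * hh n"
    proof -
      have "0 <= gp n n" using hh_pos[of n] by simp
      then have sub: "{gp n n..1} \<subseteq> {0..1}"
        by (simp only: atLeastatMost_subset_iff simp_thms order_refl)
      have "norm (integral {gp n n..1} a) <= integral {gp n n..1} (%_. B)"
        by (intro integral_norm_bound_integral integrable_on_subinterval[OF int sub])
           (use B sub in \<open>auto simp del: atLeastatMost_subset_iff\<close>)
      also have "\<dots> = B * (1 - gp n n)" using n_hh_le[of n] by simp
      also have "1 - gp n n = hh n" using hh_mult[of n] by (simp add: algebra_simps)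
      finally show ?thesis by simp
    qed
    moreover have "B * hh n < \<delta>"
    proof -
      have "B * hh n <= (B + 1) * hh n" using hh_pos[of n] by simp
      also have "\<dots> < \<delta>" using elim(2) B0 by (simp add: field_simps)
      finally show ?thesis .
    qed
    ultimately show ?case using 1 unfolding real_norm_def \<delta>_def by linarith
  qed
  then show "\<exists>no. \<forall>n\<ge>no. norm (hh n * (\<Sum>j=1..n. a (gp n j)) - integral {0..1} a) < r"
    by (simp add: eventually_sequentially)
qed

section \<open>Scalar inequalities for the discrete energy method\<close>

lemma deriv_within_nonincreasing:
  fixes f f' :: "real => real"
  assumes d: "\<And>t. t \<in> {0..T} ==> (f has_real_derivative f' t) (at t within {0..T})"
    and neg: "\<And>t. t \<in> {0..T} ==> f' t <= 0" and t: "t \<in> {0..T}"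
  shows "f t <= f 0"
proof (cases "t = 0")
  case False
  then have t0: "0 < t" using t by simp
  have "continuous_on {0..T} f" using d by (rule DERIV_continuous_on)
  then have c: "continuous_on {0..t} f" by (rule continuous_on_subset) (use t in auto)
  show ?thesis
  proof (rule DERIV_nonpos_imp_decreasing_open[OF less_imp_le[OF t0] _ c])
    fix s assume s: "0 < s" "s < t"
    then have "s \<in> {0..T}" "at s within {0..T} = at s" using t by (auto intro: at_within_Icc_at)
    then show "\<exists>y. DERIV f s :> y \<and> y <= 0" using d[of s] neg[of s] by auto
  qed
qed simp

lemma tridiagonal_row_sum:
  fixes v :: "nat => real"
  assumes "i \<in> {1..n}"
  shows "(\<Sum>m=1..n. (if m = i then A else if m = i + 1 then B else if i = m + 1 then C else 0) * v m)
    = A * v i + (if i < n then B * v (i + 1) else 0) + (if 1 < i then C * v (i - 1) else 0)"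
proof -
  have "(\<Sum>m=1..n. (if m = i then A else if m = i + 1 then B else if i = m + 1 then C else 0) * v m)
    = (\<Sum>m=1..n. (if m = i then A * v i else 0) + (if m = i + 1 then B * v (i + 1) else 0)
        + (if m = i - 1 then C * v (i - 1) else 0))"
    by (rule sum.cong) auto
  also have "\<dots> = (\<Sum>m=1..n. if m = i then A * v i else 0) + (\<Sum>m=1..n. if m = i + 1 then B * v (i + 1) else 0)
        + (\<Sum>m=1..n. if m = i - 1 then C * v (i - 1) else 0)"
    by (simp add: sum.distrib)
  also have "\<dots> = A * v i + (if i < n then B * v (i + 1) else 0) + (if 1 < i then C * v (i - 1) else 0)"
    using assms by (simp only: sum.delta finite_atLeastAtMost) auto
  finally show ?thesis .
qed

lemma sum_by_parts_aux:
  fixes v :: "nat => real"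
  shows "v 1 * (v 2 - v 1) + (\<Sum>j=2..Suc k. v j * (v (j+1) - 2 * v j + v (j-1)))
    = - (\<Sum>j=2..Suc k. (v j - v (j-1))^2) + v (Suc k) * (v (Suc (Suc k)) - v (Suc k))"
proof (induction k)
  case 0 then show ?case by (simp add: numeral_2_eq_2)
next
  case (Suc k)
  have 1: "{2..Suc (Suc k)} = insert (Suc (Suc k)) {2..Suc k}" by auto
  show ?case unfolding 1 using Suc by (simp add: algebra_simps power2_eq_square)
qed

text \<open>Discrete Green identity. With Neumann end rows no boundary term remains, so the Robin
  conditions will enter the energy only as separate diagonal excesses.\<close>

lemma sum_by_parts:
  fixes v :: "nat => real"
  assumes "2 <= n"
  shows "v 1 * (v 2 - v 1) + (\<Sum>j=2..n-1. v j * (v (j+1) - 2 * v j + v (j-1))) + v n * (v (n-1) - v n)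
    = - (\<Sum>j=2..n. (v j - v (j-1))^2)"
proof -
  obtain k where k: "n = Suc (Suc k)" using assms by (metis add_2_eq_Suc le_Suc_ex)
  have 1: "{2..Suc (Suc k)} = insert (Suc (Suc k)) {2..Suc k}" by auto
  have "v 1 * (v 2 - v 1) + (\<Sum>j=2..Suc k. v j * (v (j+1) - 2 * v j + v (j-1)))
    = - (\<Sum>j=2..Suc k. (v j - v (j-1))^2) + v (Suc k) * (v (Suc (Suc k)) - v (Suc k))"
    by (rule sum_by_parts_aux)
  moreover have "(\<Sum>j=2..Suc (Suc k). (v j - v (j-1))^2) = (v (Suc (Suc k)) - v (Suc k))^2 + (\<Sum>j=2..Suc k. (v j - v (j-1))^2)"
    unfolding 1 by simp
  ultimately show ?thesis unfolding k by (simp add: algebra_simps power2_eq_square)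
qed

lemma telescope_abs:
  fixes q :: "nat => real"
  assumes "k <= l"
  shows "\<bar>q l - q k\<bar> <= (\<Sum>j=Suc k..l. \<bar>q j - q (j-1)\<bar>)"
  using assms
proof (induction l rule: dec_induct)
  case (step l)
  have "{Suc k..Suc l} = insert (Suc l) {Suc k..l}" using step by auto
  then show ?case using step by simp
qed simp

text \<open>Discrete trace inequality: an end value squared costs an arbitrarily small multiple of
  the gradient plus a multiple of the mass. It comes from averaging \<open>(v k)^2 - (v l)^2\<close>
  over \<open>l\<close> and bounding the total variation \<open>W\<close> of the squares by Young's
  inequality. It is needed to absorb boundary terms of size \<open>K / h\<close>.\<close>

lemma boundary_interpolation:
  fixes v :: "nat => real"
  assumes n: "1 <= n" and k: "k \<in> {1..n}" and d: "0 < d"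
  shows "(v k)^2 / hh n <= d * ((\<Sum>j=2..n. (v j - v (j-1))^2) / (hh n)^2) + (2 + 1 / d) * (\<Sum>j=1..n. (v j)^2)"
proof -
  let ?G = "\<Sum>j=2..n. (v j - v (j-1))^2" and ?V = "\<Sum>j=1..n. (v j)^2"
  \<comment> \<open>The Young weight is scaled by \<open>1 / h\<close> so that after division by
    \<open>h\<close> the gradient carries \<open>d / h^2\<close> and the mass
    \<open>1 / d\<close>.\<close>
  define s where "s = d / hh n"
  have h: "hh n > 0" by (rule hh_pos)
  have s: "s > 0" using d h by (simp add: s_def)
  define W where "W = (\<Sum>j=2..n. \<bar>(v j)^2 - (v (j-1))^2\<bar>)"
  have sub: "(\<Sum>j=Suc a..b. \<bar>(v j)^2 - (v (j-1))^2\<bar>) <= W" if "1 <= a" "b <= n" for a b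
    unfolding W_def by (rule sum_mono2) (use that in auto)
  have kl: "(v k)^2 <= (v l)^2 + W" if l: "l \<in> {1..n}" for l
  proof (cases "k <= l")
    case True
    have "\<bar>(v l)^2 - (v k)^2\<bar> <= W"
      by (rule order_trans[OF telescope_abs[OF True, of "%j. (v j)^2"] sub]) (use k l in auto)
    then show ?thesis by linarith
  next
    case False
    then have "l <= k" by simp
    have "\<bar>(v k)^2 - (v l)^2\<bar> <= W"
      by (rule order_trans[OF telescope_abs[OF \<open>l <= k\<close>, of "%j. (v j)^2"] sub]) (use k l in auto)
    then show ?thesis by linarith
  qed
  have "(\<Sum>l=1..n. (v k)^2) <= (\<Sum>l=1..n. (v l)^2 + W)" by (rule sum_mono) (rule kl)
  then have avg: "real n * (v k)^2 <= ?V + real n * W" by (simp add: sum.distrib)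
  have "W <= (\<Sum>j=2..n. s * (v j - v (j-1))^2 + ((v j)^2 + (v (j-1))^2) / (2 * s))"
    unfolding W_def
  proof (rule sum_mono)
    fix j
    let ?x = "v j" and ?y = "v (j-1)"
    have e: "\<bar>?x^2 - ?y^2\<bar> = \<bar>?x - ?y\<bar> * \<bar>?x + ?y\<bar>"
      by (simp add: abs_mult[symmetric] power2_eq_square algebra_simps)
    have "4 * s * (\<bar>?x - ?y\<bar> * \<bar>?x + ?y\<bar>) <= 4 * s^2 * (?x - ?y)^2 + (?x + ?y)^2"
    proof -
      have "0 <= (2 * s * \<bar>?x - ?y\<bar> - \<bar>?x + ?y\<bar>)^2" by simp
      then show ?thesis by (simp add: power2_diff power_mult_distrib algebra_simps)
    qed
    moreover have "(?x + ?y)^2 <= 2 * (?x^2 + ?y^2)"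
      using sum_squares_ge_zero[of "?x - ?y" 0] by (simp add: power2_eq_square algebra_simps)
    ultimately have "4 * s * \<bar>?x^2 - ?y^2\<bar> <= 4 * s^2 * (?x - ?y)^2 + 2 * (?x^2 + ?y^2)" unfolding e by linarith
    also have "\<dots> = 4 * s * (s * (?x - ?y)^2 + (?x^2 + ?y^2) / (2 * s))"
    proof -
      have "4 * s^2 * a + 2 * b = 4 * s * (s * a + b / (2 * s))" for a b
        using s by (simp add: power2_eq_square distrib_left)
      then show ?thesis .
    qed
    finally have "4 * s * \<bar>?x^2 - ?y^2\<bar> <= 4 * s * (s * (?x - ?y)^2 + (?x^2 + ?y^2) / (2 * s))" .
    then show "\<bar>?x^2 - ?y^2\<bar> <= s * (?x - ?y)^2 + (?x^2 + ?y^2) / (2 * s)"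
      using s by simp
  qed
  also have "\<dots> = s * ?G + ((\<Sum>j=2..n. (v j)^2) + (\<Sum>j=2..n. (v (j-1))^2)) / (2 * s)"
    by (simp only: sum.distrib sum_distrib_left[symmetric] sum_divide_distrib[symmetric])
  also have "\<dots> <= s * ?G + (?V + ?V) / (2 * s)"
  proof -
    have "(\<Sum>j=2..n. (v j)^2) <= ?V" by (rule sum_mono2) auto
    moreover have "(\<Sum>j=2..n. (v (j-1))^2) <= ?V"
    proof -
      have "(\<Sum>j=2..n. (v (j-1))^2) = (\<Sum>j=1..n-1. (v j)^2)"
        by (rule sum.reindex_bij_witness[of _ Suc "%j. j - 1"]) auto
      also have "\<dots> <= ?V" by (rule sum_mono2) auto
      finally show ?thesis .
    qed
    ultimately show ?thesis using s by (intro add_left_mono divide_right_mono) auto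
  qed
  finally have W: "W <= s * ?G + ?V / s" by simp
  have V0: "0 <= ?V" by (simp add: sum_nonneg)
  \<comment> \<open>This is the origin of the 2 in the constant \<open>2 + 1 / d\<close>: the
    average over \<open>l\<close> divides by \<open>n\<close>, and \<open>n h\<close> is at least
    one half.\<close>
  have "gp n n \<ge> 1 / 2" using n by (simp add: hh_def field_simps)
  then have nh: "1 / (gp n n) <= 2" using n h by (simp add: field_simps)
  have "(v k)^2 <= ?V / real n + W" using avg n by (simp add: field_simps)
  then have "(v k)^2 / hh n <= (?V / real n + (s * ?G + ?V / s)) / hh n"
    using W h by (intro divide_right_mono) auto
  also have "\<dots> = ?V * (1 / (gp n n)) + d * (?G / (hh n)^2) + ?V * (1 / d)"
    using h d n by (simp add: s_def field_simps power2_eq_square)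
  also have "\<dots> <= ?V * 2 + d * (?G / (hh n)^2) + ?V * (1 / d)"
    using nh V0 by (intro add_right_mono mult_left_mono) auto
  finally show ?thesis by (simp add: algebra_simps)
qed

subsection \<open>The semi-discrete operator\<close>

text \<open>The lower bound \<open>c0\<close> is a parameter, so that constants in norm equivalences
  and resolvent bounds can name it; \<open>PC1_pcont\<close> and \<open>kernel_continuous\<close>
  provide the regularity assumptions.\<close>

locale pide =
  fixes \<theta> \<sigma> lam :: "real => real" and \<phi> :: "real => real => real" and \<alpha>0 \<beta>0 \<alpha>1 \<beta>1 c0 :: real
  assumes pc_theta: "pcont \<theta>" and pc_sigma: "pcont \<sigma>" and pc_lam: "pcont lam"
    and c0: "0 < c0" and theta_ge: "\<And>x. x \<in> {0..1} ==> c0 <= \<theta> x"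
    and phi_cont: "continuous_on ({0..1} \<times> {0..1}) (%p. \<phi> (fst p) (snd p))"
    and wd0: "\<And>n. 1 <= n ==> 3 * \<alpha>0 - 2 * hh n * \<beta>0 \<noteq> 0"
    and wd1: "\<And>n. 1 <= n ==> 3 * \<alpha>1 + 2 * hh n * \<beta>1 \<noteq> 0"
    and wdq: "\<And>n. 1 <= n ==> \<alpha>0 - hh n * \<beta>0 \<noteq> 0"
begin

abbreviation "R0 n \<equiv> r0 \<alpha>0 \<beta>0 n"
abbreviation "R1 n \<equiv> r1 \<alpha>1 \<beta>1 n"
abbreviation "Q0 n \<equiv> q0 \<alpha>0 \<beta>0 n"

lemma left_BC_nontrivial: "\<alpha>0 = 0 ==> \<beta>0 \<noteq> 0" using wdq[of 1] by auto
lemma theta_pos: "x \<in> {0..1} ==> 0 < \<theta> x" using theta_ge c0 by fastforce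

definition Pv :: "nat => (nat => real) => nat => real" where
  "Pv n v j = (\<Sum>m=1..n. Pmat \<theta> \<sigma> lam \<phi> \<alpha>0 \<beta>0 \<alpha>1 \<beta>1 n j m * v m)"

definition Lv :: "nat => (nat => real) => nat => real" where
  "Lv n v i = (if i = 1 then (4 * R0 n - 2) * v 1 + (1 - R0 n) * v 2
     else if i = n then (4 * R1 n - 2) * v n + (1 - R1 n) * v (n - 1)
     else v (i+1) - 2 * v i + v (i-1)) / (hh n)^2"

definition Dv :: "nat => (nat => real) => nat => real" where
  "Dv n v i = (if i = 1 then Q0 n * v 1 else (v i - v (i-1)) / hh n)"

lemma Pv_eq:
  assumes n: "2 <= n" and i: "i \<in> {1..n}"
  shows "Pv n v i = \<theta> (gp n i) * Lv n v i + \<sigma> (gp n i) * Dv n v i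
    + lam (gp n i) * v i + hh n * (\<Sum>m=1..i. \<phi> (gp n i) (gp n m) * v m)"
proof -
  let ?x = "gp n i"
  have M: "(\<Sum>m=1..n. Mmat \<alpha>0 \<beta>0 \<alpha>1 \<beta>1 n i m * v m) / (hh n)^2 = Lv n v i"
  proof -
    have "(\<Sum>m=1..n. Mmat \<alpha>0 \<beta>0 \<alpha>1 \<beta>1 n i m * v m) =
       (\<Sum>m=1..n. (if m = i then (if i = 1 then 4 * R0 n - 2 else if i = n then 4 * R1 n - 2 else -2)
          else if m = i + 1 then (if i = 1 then 1 - R0 n else 1)
          else if i = m + 1 then (if i = n then 1 - R1 n else 1) else 0) * v m)"
      by (rule sum.cong) (auto simp: Mmat_def)
    then show ?thesis unfolding tridiagonal_row_sum[OF i] Lv_def using n i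
      by (auto simp: numeral_2_eq_2)
  qed
  have N: "(\<Sum>m=1..n. Nmat \<alpha>0 \<beta>0 n i m * v m) / hh n = Dv n v i"
  proof -
    have "(\<Sum>m=1..n. Nmat \<alpha>0 \<beta>0 n i m * v m) =
       (\<Sum>m=1..n. (if m = i then (if i = 1 then hh n * Q0 n else 1)
          else if m = i + 1 then 0 else if i = m + 1 then (if i = 1 then 0 else - 1) else 0) * v m)"
      by (rule sum.cong) (auto simp: Nmat_def)
    then show ?thesis unfolding tridiagonal_row_sum[OF i] Dv_def using n i hh_pos[of n]
      by auto
  qed
  have L: "(\<Sum>m=1..n. (if i = m then lam ?x else 0) * v m) = lam ?x * v i"
    using i by (simp add: if_distrib[where f="%c. c * _"] cong: if_cong)
  have F: "(\<Sum>m=1..n. (if m <= i then hh n * \<phi> ?x (gp n m) else 0) * v m)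
      = hh n * (\<Sum>m=1..i. \<phi> ?x (gp n m) * v m)"
  proof -
    have "(\<Sum>m=1..n. (if m <= i then hh n * \<phi> ?x (gp n m) else 0) * v m)
      = (\<Sum>m\<in>{1..i}. (if m <= i then hh n * \<phi> ?x (gp n m) else 0) * v m)"
      by (rule sum.mono_neutral_right) (use i in auto)
    also have "\<dots> = hh n * (\<Sum>m=1..i. \<phi> ?x (gp n m) * v m)"
      unfolding sum_distrib_left by (rule sum.cong) auto
    finally show ?thesis .
  qed
  have "Pv n v i = \<theta> ?x * ((\<Sum>m=1..n. Mmat \<alpha>0 \<beta>0 \<alpha>1 \<beta>1 n i m * v m) / (hh n)^2)
     + \<sigma> ?x * ((\<Sum>m=1..n. Nmat \<alpha>0 \<beta>0 n i m * v m) / hh n)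
     + (\<Sum>m=1..n. (if i = m then lam ?x else 0) * v m)
     + (\<Sum>m=1..n. (if m <= i then hh n * \<phi> ?x (gp n m) else 0) * v m)"
    unfolding Pv_def Pmat_def
    by (simp only: distrib_right sum.distrib sum_distrib_left sum_divide_distrib mult.assoc times_divide_eq_left times_divide_eq_right)
  then show ?thesis unfolding M N L F .
qed

text \<open>The end weights make the off-diagonal entries \<open>1 - r0\<close>, \<open>1 - r1\<close> of the end rows symmetric with their transposes \<open>1\<close>.\<close>

definition gw :: "nat => nat => real" where
  "gw n i = (if i = 1 then 1 / (1 - R0 n) else if i = n then 1 / (1 - R1 n) else 1)"

text \<open>The factor \<open>1 / \<theta>\<close> cancels the diffusion coefficient in front of the
  second difference, so summation by parts never differences \<open>\<theta>\<close>.\<close>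

definition om :: "nat => nat => real" where
  "om n i = gw n i / \<theta> (gp n i)"

lemma R0_bounds: "\<forall>\<^sub>F n in sequentially. 1/2 <= 1 - R0 n \<and> 1 - R0 n <= 2"
proof (cases "\<alpha>0 = 0")
  case True then show ?thesis by (simp add: r0_def)
next
  case False
  have "(%n. 1 - \<alpha>0 / (3 * \<alpha>0 - 2 * hh n * \<beta>0)) \<longlonglongrightarrow> 1 - \<alpha>0 / (3 * \<alpha>0 - 2 * 0 * \<beta>0)"
    by (intro tendsto_intros hh_tendsto) (use False in auto)
  then have l: "(%n. 1 - R0 n) \<longlonglongrightarrow> 2/3" using False by (simp add: r0_def)
  have "\<forall>\<^sub>F n in sequentially. 1/2 < 1 - R0 n" "\<forall>\<^sub>F n in sequentially. 1 - R0 n < 2"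
    by (rule order_tendstoD[OF l]; simp)+
  then show ?thesis by eventually_elim simp
qed

lemma R1_bounds: "\<forall>\<^sub>F n in sequentially. 1/2 <= 1 - R1 n \<and> 1 - R1 n <= 2"
proof (cases "\<alpha>1 = 0")
  case True then show ?thesis by (simp add: r1_def)
next
  case False
  have "(%n. 1 - \<alpha>1 / (3 * \<alpha>1 + 2 * hh n * \<beta>1)) \<longlonglongrightarrow> 1 - \<alpha>1 / (3 * \<alpha>1 + 2 * 0 * \<beta>1)"
    by (intro tendsto_intros hh_tendsto) (use False in auto)
  then have l: "(%n. 1 - R1 n) \<longlonglongrightarrow> 2/3" using False by (simp add: r1_def)
  have "\<forall>\<^sub>F n in sequentially. 1/2 < 1 - R1 n" "\<forall>\<^sub>F n in sequentially. 1 - R1 n < 2"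
    by (rule order_tendstoD[OF l]; simp)+
  then show ?thesis by eventually_elim simp
qed

lemma gw_bounds: "\<forall>\<^sub>F n in sequentially. \<forall>i. 1/2 <= gw n i \<and> gw n i <= 2"
  using R0_bounds R1_bounds
proof eventually_elim
  case (elim n)
  have "1/2 <= 1 / (1 - R0 n)" "1 / (1 - R0 n) <= 2" "1/2 <= 1 / (1 - R1 n)" "1 / (1 - R1 n) <= 2"
    using elim by (auto simp: field_simps)
  then show ?case by (auto simp: gw_def)
qed

lemma Q0_bounded: assumes "\<alpha>0 \<noteq> 0" shows "\<forall>\<^sub>F n in sequentially. \<bar>Q0 n\<bar> <= \<bar>\<beta>0 / \<alpha>0\<bar> + 1"
proof -
  have "(%n. \<bar>- \<beta>0 / (\<alpha>0 - hh n * \<beta>0)\<bar>) \<longlonglongrightarrow> \<bar>- \<beta>0 / (\<alpha>0 - 0 * \<beta>0)\<bar>"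
    by (intro tendsto_intros hh_tendsto) (use assms in auto)
  then have l: "(%n. \<bar>Q0 n\<bar>) \<longlonglongrightarrow> \<bar>\<beta>0 / \<alpha>0\<bar>" by (simp add: q0_def)
  have "\<forall>\<^sub>F n in sequentially. \<bar>Q0 n\<bar> < \<bar>\<beta>0 / \<alpha>0\<bar> + 1" by (rule order_tendstoD[OF l]) simp
  then show ?thesis by eventually_elim simp
qed

text \<open>The excess of row 1 over a Neumann row is exactly the boundary term of the difference
  operator: \<open>(3 r0 - 1)/(1 - r0) = - h q0\<close>.\<close>

lemma left_excess:
  assumes n: "1 <= n" "1/2 <= 1 - R0 n"
  shows "(4 * R0 n - 2) / (1 - R0 n) = - 1 - hh n * Q0 n"
proof -
  define A where "A = 3 * \<alpha>0 - 2 * hh n * \<beta>0"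
  define B where "B = \<alpha>0 - hh n * \<beta>0"
  have AB: "A \<noteq> 0" "B \<noteq> 0" using wd0[OF n(1)] wdq[OF n(1)] by (auto simp: A_def B_def)
  have r: "R0 n = \<alpha>0 / A" and q: "Q0 n = - \<beta>0 / B" by (simp_all add: r0_def q0_def A_def B_def)
  have 1: "1 - R0 n = 2 * B / A" unfolding r using AB by (simp add: field_simps A_def B_def)
  have 2: "4 * R0 n - 2 = (4 * \<alpha>0 - 2 * A) / A" unfolding r using AB by (simp add: field_simps)
  have "(4 * R0 n - 2) / (1 - R0 n) = (4 * \<alpha>0 - 2 * A) / (2 * B)" unfolding 1 2 using AB by simp
  also have "\<dots> = - 1 - hh n * Q0 n" unfolding q using AB by (simp add: field_simps A_def) (simp add: B_def algebra_simps)
  finally show ?thesis .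
qed

text \<open>For a Dirichlet condition \<open>Q0 n = 1 / h\<close>: the excess is nonpositive and the
  drift term is of order \<open>1 / h\<close>. Otherwise \<open>Q0 n\<close> is bounded and the
  excess itself is of order \<open>1 / h\<close>. Both cases end in the order that
  \<open>boundary_interpolation\<close> can absorb.\<close>

lemma left_boundary_term:
  assumes C: "0 <= C"
  shows "\<exists>K\<ge>0. \<forall>\<^sub>F n in sequentially. \<forall>s. \<bar>s\<bar> <= C -->
     (- hh n * Q0 n) / (hh n)^2 + s * Q0 n <= K / hh n"
proof (cases "\<alpha>0 = 0")
  case True
  have "- hh n * Q0 n / (hh n)^2 + s * Q0 n <= C / hh n" if "\<bar>s\<bar> <= C" for n s
  proof -
    have Q: "Q0 n = 1 / hh n" using True left_BC_nontrivial[OF True] by (simp add: q0_def)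
    have "- hh n * Q0 n / (hh n)^2 <= 0" unfolding Q using hh_pos[of n] by simp
    moreover have "s * Q0 n <= C / hh n" unfolding Q using that hh_pos[of n] by (simp add: divide_right_mono)
    ultimately show ?thesis by linarith
  qed
  then show ?thesis using C by (intro exI[of _ C]) simp
next
  case False
  define Q where "Q = \<bar>\<beta>0 / \<alpha>0\<bar> + 1"
  have Q: "0 <= Q" by (simp add: Q_def)
  have "\<forall>\<^sub>F n in sequentially. \<forall>s. \<bar>s\<bar> <= C --> - hh n * Q0 n / (hh n)^2 + s * Q0 n <= (Q + C * Q) / hh n"
    using Q0_bounded[OF False]
  proof eventually_elim
    case (elim n)
    show ?case
    proof (intro allI impI)
      fix s assume s: "\<bar>s\<bar> <= C"
      have h: "hh n > 0" by (rule hh_pos)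
      have q: "\<bar>Q0 n\<bar> <= Q" using elim by (simp add: Q_def)
      have "- hh n * Q0 n / (hh n)^2 = - Q0 n / hh n" using h by (simp add: power2_eq_square)
      also have "\<dots> <= Q / hh n" using q h by (intro divide_right_mono) auto
      finally have 1: "- hh n * Q0 n / (hh n)^2 <= Q / hh n" .
      have "s * Q0 n <= \<bar>s\<bar> * \<bar>Q0 n\<bar>" by (metis abs_ge_self abs_mult)
      also have "\<dots> <= C * Q" using s q C by (intro mult_mono) auto
      also have "\<dots> <= C * Q / hh n" using h hh_le[of n] C Q mult_left_le[of "hh n" "C * Q"] by (simp add: pos_le_divide_eq)
      finally show "- hh n * Q0 n / (hh n)^2 + s * Q0 n <= (Q + C * Q) / hh n"
        using 1 by (simp add: add_divide_distrib)
    qed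
  qed
  then show ?thesis using C Q by (intro exI[of _ "Q + C * Q"]) simp
qed

text \<open>For \<open>\<alpha>1 = 0\<close> the excess is negative; otherwise it equals
  \<open>- h\<close> times a convergent quotient, so division by \<open>h^2\<close> leaves order
  \<open>1 / h\<close>.\<close>

lemma right_boundary_term:
  "\<exists>K\<ge>0. \<forall>\<^sub>F n in sequentially. ((4 * R1 n - 2) / (1 - R1 n) + 1) / (hh n)^2 <= K / hh n"
proof (cases "\<alpha>1 = 0")
  case True
  then show ?thesis by (intro exI[of _ 0]) (simp add: r1_def)
next
  case False
  have "(%n. \<bar>2 * \<beta>1 / (2 * \<alpha>1 + 2 * hh n * \<beta>1)\<bar>) \<longlonglongrightarrow> \<bar>2 * \<beta>1 / (2 * \<alpha>1 + 2 * 0 * \<beta>1)\<bar>"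
    by (intro tendsto_intros hh_tendsto) (use False in auto)
  then have l: "(%n. \<bar>2 * \<beta>1 / (2 * \<alpha>1 + 2 * hh n * \<beta>1)\<bar>) \<longlonglongrightarrow> \<bar>\<beta>1 / \<alpha>1\<bar>" by simp
  have e1: "\<forall>\<^sub>F n in sequentially. \<bar>2 * \<beta>1 / (2 * \<alpha>1 + 2 * hh n * \<beta>1)\<bar> < \<bar>\<beta>1 / \<alpha>1\<bar> + 1"
    by (rule order_tendstoD[OF l]) simp
  have "\<forall>\<^sub>F n in sequentially. ((4 * R1 n - 2) / (1 - R1 n) + 1) / (hh n)^2 <= (\<bar>\<beta>1 / \<alpha>1\<bar> + 1) / hh n"
    using e1 R1_bounds eventually_ge_at_top[of 1]
  proof eventually_elim
    case (elim n)
    define A where "A = 3 * \<alpha>1 + 2 * hh n * \<beta>1"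
    have h: "hh n > 0" by (rule hh_pos)
    have A: "A \<noteq> 0" using wd1[OF elim(3)] by (simp add: A_def)
    have r: "R1 n = \<alpha>1 / A" by (simp add: r1_def A_def)
    have 1: "1 - R1 n = (2 * \<alpha>1 + 2 * hh n * \<beta>1) / A" unfolding r using A by (simp add: field_simps A_def)
    \<comment> \<open>This denominator is not covered by \<open>wd1\<close>; it is nonzero because
      \<open>1 - R1 n\<close> is eventually at least 1/2.\<close>
    have B: "2 * \<alpha>1 + 2 * hh n * \<beta>1 \<noteq> 0"
    proof
      assume "2 * \<alpha>1 + 2 * hh n * \<beta>1 = 0"
      with 1 have "1 - R1 n = 0" by simp
      with elim(2) show False by simp
    qed
    have 2: "4 * R1 n - 2 + (1 - R1 n) = - 2 * hh n * \<beta>1 / A"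
    proof -
      have "4 * R1 n - 2 + (1 - R1 n) = (3 * \<alpha>1 - A) / A" unfolding r using A by (simp add: diff_divide_distrib)
      then show ?thesis by (simp add: A_def)
    qed
    have "(4 * R1 n - 2) / (1 - R1 n) + 1 = (4 * R1 n - 2 + (1 - R1 n)) / (1 - R1 n)"
    proof -
      have "a / b + 1 = (a + b) / b" if "b \<noteq> 0" for a b :: real using that by (simp add: add_divide_distrib)
      moreover have "1 - R1 n \<noteq> 0" using elim(2) by linarith
      ultimately show ?thesis .
    qed
    also have "\<dots> = - hh n * (2 * \<beta>1 / (2 * \<alpha>1 + 2 * hh n * \<beta>1))" unfolding 2 unfolding 1 using A by simp
    finally have 3: "((4 * R1 n - 2) / (1 - R1 n) + 1) / (hh n)^2 = - (2 * \<beta>1 / (2 * \<alpha>1 + 2 * hh n * \<beta>1)) / hh n"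
      using h by (simp add: power2_eq_square)
    show ?case unfolding 3 using elim(1) h by (intro divide_right_mono; linarith)
  qed
  then show ?thesis by (intro exI[of _ "\<bar>\<beta>1 / \<alpha>1\<bar> + 1"]) simp
qed

end

text \<open>Replacing \<open>\<bar>v i * v m\<bar>\<close> by the mean of the squares gives
  \<open>n\<close> copies of the sum of squares, and the quadrature weight compensates through
  \<open>n h <= 1\<close>.\<close>

lemma kernel_form_bound:
  fixes v :: "nat => real"
  assumes k: "\<And>i m. i \<in> {1..n} ==> m \<in> {1..i} ==> \<bar>k i m\<bar> <= F" and F: "0 <= F"
  shows "(\<Sum>i=1..n. v i * (hh n * (\<Sum>m=1..i. k i m * v m))) <= F * (\<Sum>i=1..n. (v i)^2)"
proof -
  let ?V = "\<Sum>i=1..n. (v i)^2"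
  have h: "0 < hh n" by (rule hh_pos)
  have "(\<Sum>i=1..n. v i * (hh n * (\<Sum>m=1..i. k i m * v m))) = hh n * (\<Sum>i=1..n. \<Sum>m=1..i. v i * (k i m * v m))"
    by (simp add: sum_distrib_left mult.left_commute)
  also have "\<dots> <= hh n * (\<Sum>i=1..n. \<Sum>m=1..n. F * ((v i)^2 + (v m)^2) / 2)"
  proof (intro mult_left_mono sum_mono)
    fix i assume i: "i \<in> {1..n}"
    have "(\<Sum>m=1..i. v i * (k i m * v m)) <= (\<Sum>m=1..i. F * ((v i)^2 + (v m)^2) / 2)"
    proof (rule sum_mono)
      fix m assume m: "m \<in> {1..i}"
      have "v i * (k i m * v m) <= \<bar>k i m\<bar> * \<bar>v i * v m\<bar>"
        by (metis abs_ge_self abs_mult mult.left_commute)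
      also have "\<dots> <= F * \<bar>v i * v m\<bar>" using k[OF i m] by (intro mult_right_mono) auto
      also have "\<bar>v i * v m\<bar> <= ((v i)^2 + (v m)^2) / 2"
      proof -
        have "0 <= (\<bar>v i\<bar> - \<bar>v m\<bar>)^2" by simp
        then show ?thesis by (simp add: power2_diff abs_mult)
      qed
      finally show "v i * (k i m * v m) <= F * ((v i)^2 + (v m)^2) / 2" using F by (simp add: mult_left_mono)
    qed
    also have "\<dots> <= (\<Sum>m=1..n. F * ((v i)^2 + (v m)^2) / 2)"
      by (rule sum_mono2) (use i F in auto)
    finally show "(\<Sum>m=1..i. v i * (k i m * v m)) <= (\<Sum>m=1..n. F * ((v i)^2 + (v m)^2) / 2)" .
  qed (use h in auto)
  also have "(\<Sum>i=1..n. \<Sum>m=1..n. F * ((v i)^2 + (v m)^2) / 2) = F / 2 * (real n * ?V + real n * ?V)"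
    by (simp add: sum.distrib sum_distrib_left[symmetric] sum_divide_distrib[symmetric] distrib_left[symmetric])
  also have "hh n * (F / 2 * (real n * ?V + real n * ?V)) = (gp n n) * (F * ?V)"
    by (simp add: algebra_simps)
  also have "\<dots> <= 1 * (F * ?V)" using n_hh_le F by (intro mult_right_mono) (auto simp: sum_nonneg)
  finally show ?thesis by simp
qed

context pide begin

lemma phi_bounded: obtains F where "0 <= F" "\<And>x y. x \<in> {0..1} ==> y \<in> {0..1} ==> \<bar>\<phi> x y\<bar> <= F"
proof -
  have "compact ((%p. \<phi> (fst p) (snd p)) ` ({0..1} \<times> {0..1}))"
    by (intro compact_continuous_image phi_cont compact_Times) auto
  then have "bounded ((%p. \<phi> (fst p) (snd p)) ` ({0..1} \<times> {0..1}))" by (rule compact_imp_bounded)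
  then obtain F where F: "\<forall>z\<in>(%p. \<phi> (fst p) (snd p)) ` ({0..1} \<times> {0..1}). norm z <= F"
    unfolding bounded_iff by (elim exE)
  have "\<bar>\<phi> x y\<bar> <= max 0 F" if "x \<in> {0..1}" "y \<in> {0..1}" for x y
    using bspec[OF F, of "\<phi> x y"] that by force
  then show thesis by (intro that[of "max 0 F"]) auto
qed

text \<open>After weighting with \<open>gw\<close> the end rows are Neumann rows plus a diagonal
  excess, \<open>- h * Q0 n\<close> on the left by \<open>left_excess\<close>;
  \<open>sum_by_parts\<close> does the rest.\<close>

lemma Lv_energy:
  assumes n: "2 <= n" and r: "1/2 <= 1 - R0 n" "1/2 <= 1 - R1 n"
  shows "(\<Sum>i=1..n. gw n i * v i * Lv n v i) = (- (\<Sum>j=2..n. (v j - v (j-1))^2)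
     - hh n * Q0 n * (v 1)^2 + ((4 * R1 n - 2) / (1 - R1 n) + 1) * (v n)^2) / (hh n)^2"
proof -
  have h: "hh n > 0" by (rule hh_pos)
  have ins: "{1..n} = insert 1 (insert n {2..n-1})" using n by auto
  have t1: "gw n 1 * v 1 * Lv n v 1 = (v 1 * (v 2 - v 1) - hh n * Q0 n * (v 1)^2) / (hh n)^2"
  proof -
    have "gw n 1 * v 1 * Lv n v 1 = v 1 * ((4 * R0 n - 2) / (1 - R0 n) * v 1 + v 2) / (hh n)^2"
      using r(1) by (simp add: gw_def Lv_def field_simps)
    also have "\<dots> = v 1 * ((- 1 - hh n * Q0 n) * v 1 + v 2) / (hh n)^2"
      using left_excess[of n] n r(1) by simp
    finally show ?thesis by (simp add: algebra_simps power2_eq_square)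
  qed
  have tn: "gw n n * v n * Lv n v n = (v n * (v (n-1) - v n) + ((4 * R1 n - 2) / (1 - R1 n) + 1) * (v n)^2) / (hh n)^2"
  proof -
    have "gw n n * v n * Lv n v n = v n * ((4 * R1 n - 2) / (1 - R1 n) * v n + v (n-1)) / (hh n)^2"
      using r(2) n by (simp add: gw_def Lv_def field_simps)
    then show ?thesis by (simp add: algebra_simps power2_eq_square)
  qed
  have tm: "(\<Sum>i=2..n-1. gw n i * v i * Lv n v i) = (\<Sum>i=2..n-1. v i * (v (i+1) - 2 * v i + v (i-1))) / (hh n)^2"
    unfolding sum_divide_distrib by (rule sum.cong) (auto simp: gw_def Lv_def)
  have "(\<Sum>i=1..n. gw n i * v i * Lv n v i) = gw n 1 * v 1 * Lv n v 1 + gw n n * v n * Lv n v n + (\<Sum>i=2..n-1. gw n i * v i * Lv n v i)"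
    unfolding ins using n by (subst sum.insert; simp)+
  also have "\<dots> = ((v 1 * (v 2 - v 1) + (\<Sum>i=2..n-1. v i * (v (i+1) - 2 * v i + v (i-1))) + v n * (v (n-1) - v n))
      - hh n * Q0 n * (v 1)^2 + ((4 * R1 n - 2) / (1 - R1 n) + 1) * (v n)^2) / (hh n)^2"
    unfolding t1 tn tm by (simp only: add_divide_distrib diff_divide_distrib)
  finally show ?thesis unfolding sum_by_parts[OF n] .
qed

text \<open>Young's inequality spends a quarter of the gradient. Row 1 is kept aside:
  \<open>Q0 n\<close> can be of order \<open>1 / h\<close>, and it must be combined with the
  Laplacian excess of the same row.\<close>

lemma drift_energy:
  assumes n: "2 <= n" and s: "\<And>i. i \<in> {1..n} ==> \<bar>s i\<bar> <= C"
  shows "(\<Sum>i=1..n. s i * v i * Dv n v i) <= s 1 * Q0 n * (v 1)^2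
     + (\<Sum>j=2..n. (v j - v (j-1))^2) / (hh n)^2 / 4 + C^2 * (\<Sum>i=1..n. (v i)^2)"
proof -
  have h: "hh n > 0" by (rule hh_pos)
  have ins: "{1..n} = insert 1 {2..n}" using n by auto
  have "(\<Sum>i=2..n. s i * v i * Dv n v i) <= (\<Sum>i=2..n. (v i - v (i-1))^2 / (hh n)^2 / 4 + C^2 * (v i)^2)"
  proof (rule sum_mono)
    fix i assume i: "i \<in> {2..n}"
    define D where "D = (v i - v (i-1)) / hh n"
    have "Dv n v i = D" using i by (simp add: Dv_def D_def)
    moreover have "s i * v i * D <= D^2 / 4 + (s i * v i)^2"
    proof -
      have "0 <= (D / 2 - s i * v i)^2" by simp
      then show ?thesis by (simp add: power2_diff power_divide algebra_simps)
    qed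
    moreover have "(s i * v i)^2 <= C^2 * (v i)^2"
    proof -
      have "\<bar>s i\<bar> <= C" using s[of i] i by simp
      then have "(s i)^2 <= C^2" by (metis abs_ge_zero power2_abs power_mono)
      then show ?thesis unfolding power_mult_distrib by (intro mult_right_mono) auto
    qed
    ultimately show "s i * v i * Dv n v i <= (v i - v (i-1))^2 / (hh n)^2 / 4 + C^2 * (v i)^2"
      by (simp add: D_def power_divide)
  qed
  also have "\<dots> = (\<Sum>j=2..n. (v j - v (j-1))^2) / (hh n)^2 / 4 + C^2 * (\<Sum>i=2..n. (v i)^2)"
    by (simp add: sum.distrib sum_distrib_left sum_divide_distrib)
  also have "\<dots> <= (\<Sum>j=2..n. (v j - v (j-1))^2) / (hh n)^2 / 4 + C^2 * (\<Sum>i=1..n. (v i)^2)"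
    by (intro add_left_mono mult_left_mono sum_mono2) auto
  finally have 2: "(\<Sum>i=2..n. s i * v i * Dv n v i) <= (\<Sum>j=2..n. (v j - v (j-1))^2) / (hh n)^2 / 4 + C^2 * (\<Sum>i=1..n. (v i)^2)" .
  have "(\<Sum>i=1..n. s i * v i * Dv n v i) = s 1 * v 1 * Dv n v 1 + (\<Sum>i=2..n. s i * v i * Dv n v i)"
    unfolding ins by (subst sum.insert) auto
  also have "s 1 * v 1 * Dv n v 1 = s 1 * Q0 n * (v 1)^2" by (simp add: Dv_def power2_eq_square)
  finally show ?thesis using 2 by linarith
qed

lemma om_bounds:
  obtains cl cu where "0 < cl" "0 < cu"
    "\<forall>\<^sub>F n in sequentially. \<forall>i\<in>{1..n}. cl <= om n i \<and> om n i <= cu"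
proof -
  obtain B where B: "0 <= B" "\<And>x. x \<in> {0..1} ==> \<bar>\<theta> x\<bar> <= B" using pequi_bounded[OF pc_theta] by auto
  have "\<forall>\<^sub>F n in sequentially. \<forall>i\<in>{1..n}. 1 / (2 * (B + 1)) <= om n i \<and> om n i <= 2 / c0"
    using gw_bounds
  proof eventually_elim
    case (elim n)
    show ?case
    proof
      fix i assume i: "i \<in> {1..n}"
      let ?x = "gp n i"
      have x: "?x \<in> {0..1}" using i by (intro grid_in) auto
      have t: "c0 <= \<theta> ?x" "\<theta> ?x <= B + 1" using theta_ge[OF x] B(2)[OF x] by auto
      have g: "1/2 <= gw n i" "gw n i <= 2" using elim by auto
      have "1/2 / (B + 1) <= gw n i / \<theta> ?x" using t g c0 B(1) by (intro frac_le) auto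
      moreover have "gw n i / \<theta> ?x <= 2 / c0" using t g c0 by (intro frac_le) auto
      ultimately show "1 / (2 * (B + 1)) <= om n i \<and> om n i <= 2 / c0" by (simp add: om_def)
    qed
  qed
  moreover have "0 < 1 / (2 * (B + 1))" "0 < 2 / c0" using B c0 by auto
  ultimately show thesis using that by blast
qed

text \<open>A discrete Garding inequality. The Laplacian yields minus the full gradient; the drift
  and the two boundary terms take a quarter each, and everything else is bounded by the
  mass.\<close>

lemma discrete_energy:
  "\<exists>K\<ge>0. \<forall>\<^sub>F n in sequentially. \<forall>v. (\<Sum>i=1..n. om n i * v i * Pv n v i) <= K * (\<Sum>i=1..n. om n i * (v i)^2)"
proof -
  obtain S where S: "0 <= S" "\<And>x. x \<in> {0..1} ==> \<bar>\<sigma> x\<bar> <= S" using pequi_bounded[OF pc_sigma] by auto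
  obtain L where L: "0 <= L" "\<And>x. x \<in> {0..1} ==> \<bar>lam x\<bar> <= L" using pequi_bounded[OF pc_lam] by auto
  obtain F where F: "0 <= F" "\<And>x y. x \<in> {0..1} ==> y \<in> {0..1} ==> \<bar>\<phi> x y\<bar> <= F" using phi_bounded by metis
  obtain cl cu where c: "0 < cl" "0 < cu" and ev_om: "\<forall>\<^sub>F n in sequentially. \<forall>i\<in>{1..n}. cl <= om n i \<and> om n i <= cu"
    using om_bounds by blast
  define Cs where "Cs = cu * S"
  have Cs: "0 <= Cs" using c S by (simp add: Cs_def)
  obtain K0 where K0: "0 <= K0" and ev0: "\<forall>\<^sub>F n in sequentially. \<forall>s. \<bar>s\<bar> <= Cs -->
     (- hh n * Q0 n) / (hh n)^2 + s * Q0 n <= K0 / hh n" using left_boundary_term[OF Cs] by (elim exE conjE) (rule that)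
  obtain K1 where K1: "0 <= K1" and ev1: "\<forall>\<^sub>F n in sequentially. ((4 * R1 n - 2) / (1 - R1 n) + 1) / (hh n)^2 <= K1 / hh n"
    using right_boundary_term by (elim exE conjE) (rule that)
  \<comment> \<open>Chosen so that each boundary term, of strength \<open>K0\<close> or
    \<open>K1\<close>, consumes at most a quarter of the gradient.\<close>
  define d0 d1 where "d0 = 1 / (4 * (K0 + 1))" and "d1 = 1 / (4 * (K1 + 1))"
  have d: "0 < d0" "0 < d1" "K0 * d0 <= 1/4" "K1 * d1 <= 1/4"
    using K0 K1 by (auto simp: d0_def d1_def field_simps)
  define K where "K = Cs^2 + cu * L + cu * F + K0 * (2 + 1 / d0) + K1 * (2 + 1 / d1)"
  have K: "0 <= K" unfolding K_def using c L F K0 K1 d by simp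
  have "\<forall>\<^sub>F n in sequentially. \<forall>v. (\<Sum>i=1..n. om n i * v i * Pv n v i) <= K / cl * (\<Sum>i=1..n. om n i * (v i)^2)"
    using ev_om ev0 ev1 R0_bounds R1_bounds eventually_ge_at_top[of 2]
  proof eventually_elim
    case (elim n)
    show ?case
    proof
      fix v :: "nat => real"
      let ?G = "\<Sum>j=2..n. (v j - v (j-1))^2" and ?V = "\<Sum>i=1..n. (v i)^2"
      let ?x = "%i. gp n i"
      have n: "2 <= n" by (rule elim)
      have h: "hh n > 0" by (rule hh_pos)
      have x: "?x i \<in> {0..1}" if "i \<in> {1..n}" for i using that by (intro grid_in) auto
      define s where "s i = om n i * \<sigma> (?x i)" for i
      have s: "\<bar>s i\<bar> <= Cs" if "i \<in> {1..n}" for i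
        unfolding s_def Cs_def abs_mult using elim(1) that c S(1) S(2)[OF x[OF that]]
        by (intro mult_mono) force+
      have gw_om: "gw n i = om n i * \<theta> (?x i)" if "i \<in> {1..n}" for i
        using theta_pos[OF x[OF that]] by (simp add: om_def)
      have eq: "(\<Sum>i=1..n. om n i * v i * Pv n v i) = (\<Sum>i=1..n. gw n i * v i * Lv n v i)
          + (\<Sum>i=1..n. s i * v i * Dv n v i) + (\<Sum>i=1..n. om n i * lam (?x i) * (v i)^2)
          + (\<Sum>i=1..n. v i * (hh n * (\<Sum>m=1..i. om n i * \<phi> (?x i) (?x m) * v m)))"
      proof -
        have "om n i * v i * Pv n v i = gw n i * v i * Lv n v i + s i * v i * Dv n v i + om n i * lam (?x i) * (v i)^2
           + v i * (hh n * (\<Sum>m=1..i. om n i * \<phi> (?x i) (?x m) * v m))" if i: "i \<in> {1..n}" for i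
        proof -
          have e: "(\<Sum>m=1..i. om n i * \<phi> (?x i) (?x m) * v m) = om n i * (\<Sum>m=1..i. \<phi> (?x i) (?x m) * v m)"
            by (simp add: sum_distrib_left mult.assoc)
          show ?thesis unfolding Pv_eq[OF n i] gw_om[OF i] s_def e by (simp add: algebra_simps power2_eq_square)
        qed
        then have "(\<Sum>i=1..n. om n i * v i * Pv n v i) = (\<Sum>i=1..n. gw n i * v i * Lv n v i + s i * v i * Dv n v i + om n i * lam (?x i) * (v i)^2
           + v i * (hh n * (\<Sum>m=1..i. om n i * \<phi> (?x i) (?x m) * v m)))" by (rule sum.cong[OF refl])
        then show ?thesis by (simp only: sum.distrib)
      qed
      have A: "(\<Sum>i=1..n. gw n i * v i * Lv n v i) = - (?G / (hh n)^2) + (- hh n * Q0 n) / (hh n)^2 * (v 1)^2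
         + ((4 * R1 n - 2) / (1 - R1 n) + 1) / (hh n)^2 * (v n)^2"
      proof -
        have id: "(- g - p * x + a * y) / q = - (g / q) + (- p) / q * x + a / q * y" for g p x a y q :: real
          by (simp add: add_divide_distrib diff_divide_distrib)
        have m: "- hh n * Q0 n = - (hh n * Q0 n)" by simp
        show ?thesis unfolding m by (subst Lv_energy) (use elim n id in auto)
      qed
      have B: "(\<Sum>i=1..n. s i * v i * Dv n v i) <= s 1 * Q0 n * (v 1)^2 + ?G / (hh n)^2 / 4 + Cs^2 * ?V"
        by (rule drift_energy[OF n s])
      have Cc: "(\<Sum>i=1..n. om n i * lam (?x i) * (v i)^2) <= cu * L * ?V"
        unfolding sum_distrib_left
      proof (rule sum_mono)
        fix i assume i: "i \<in> {1..n}"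
        have "om n i * lam (?x i) <= \<bar>om n i\<bar> * \<bar>lam (?x i)\<bar>" by (metis abs_ge_self abs_mult)
        also have "\<dots> <= cu * L" using elim(1) i c L(2)[OF x[OF i]] by (intro mult_mono) force+
        finally show "om n i * lam (?x i) * (v i)^2 <= cu * L * (v i)^2" by (rule mult_right_mono) simp
      qed
      have D: "(\<Sum>i=1..n. v i * (hh n * (\<Sum>m=1..i. om n i * \<phi> (?x i) (?x m) * v m))) <= cu * F * ?V"
      proof (rule kernel_form_bound)
        fix i m assume i: "i \<in> {1..n}" and m: "m \<in> {1..i}"
        have "?x m \<in> {0..1}" using i m by (intro x) auto
        then have "\<bar>\<phi> (?x i) (?x m)\<bar> <= F" by (rule F(2)[OF x[OF i]])
        then show "\<bar>om n i * \<phi> (?x i) (?x m)\<bar> <= cu * F"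
          unfolding abs_mult using elim(1) i c by (intro mult_mono) force+
      qed (use c F in simp)
      have id2: "k * (d * a + c * b) = (k * d) * a + k * c * b" for k d a c b :: real
        by (simp add: algebra_simps)
      have "(- hh n * Q0 n) / (hh n)^2 + s 1 * Q0 n <= K0 / hh n"
        using elim(2) s[of 1] n by simp
      then have "((- hh n * Q0 n) / (hh n)^2 + s 1 * Q0 n) * (v 1)^2 <= K0 / hh n * (v 1)^2"
        by (rule mult_right_mono) simp
      also have "\<dots> = K0 * ((v 1)^2 / hh n)" by simp
      also have "\<dots> <= K0 * (d0 * (?G / (hh n)^2) + (2 + 1 / d0) * ?V)"
        using n by (intro mult_left_mono[OF boundary_interpolation K0] d) auto
      also have "\<dots> = (K0 * d0) * (?G / (hh n)^2) + K0 * (2 + 1 / d0) * ?V" by (rule id2)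
      also have "\<dots> <= 1/4 * (?G / (hh n)^2) + K0 * (2 + 1 / d0) * ?V"
        using d by (intro add_right_mono mult_right_mono) (auto simp: sum_nonneg)
      finally have E: "((- hh n * Q0 n) / (hh n)^2 + s 1 * Q0 n) * (v 1)^2 <= 1/4 * (?G / (hh n)^2) + K0 * (2 + 1 / d0) * ?V" .
      have "((4 * R1 n - 2) / (1 - R1 n) + 1) / (hh n)^2 * (v n)^2 <= K1 / hh n * (v n)^2"
        using elim(3) by (rule mult_right_mono) simp
      also have "\<dots> = K1 * ((v n)^2 / hh n)" by simp
      also have "\<dots> <= K1 * (d1 * (?G / (hh n)^2) + (2 + 1 / d1) * ?V)"
        using n by (intro mult_left_mono[OF boundary_interpolation K1] d) auto
      also have "\<dots> = (K1 * d1) * (?G / (hh n)^2) + K1 * (2 + 1 / d1) * ?V" by (rule id2)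
      also have "\<dots> <= 1/4 * (?G / (hh n)^2) + K1 * (2 + 1 / d1) * ?V"
        using d by (intro add_right_mono mult_right_mono) (auto simp: sum_nonneg)
      finally have H: "((4 * R1 n - 2) / (1 - R1 n) + 1) / (hh n)^2 * (v n)^2 <= 1/4 * (?G / (hh n)^2) + K1 * (2 + 1 / d1) * ?V" .
      have G0: "0 <= ?G / (hh n)^2" by (simp add: sum_nonneg)
      have "((- hh n * Q0 n) / (hh n)^2 + s 1 * Q0 n) * (v 1)^2 = (- hh n * Q0 n) / (hh n)^2 * (v 1)^2 + s 1 * Q0 n * (v 1)^2"
        by (rule distrib_right)
      moreover have "K * ?V = Cs^2 * ?V + cu * L * ?V + cu * F * ?V + K0 * (2 + 1 / d0) * ?V + K1 * (2 + 1 / d1) * ?V"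
        unfolding K_def by (simp only: distrib_right)
      moreover have "?G / (hh n)^2 / 4 = 1/4 * (?G / (hh n)^2)" by simp
      \<comment> \<open>The balance of gradients in abstract form: \<open>- g\<close> from the
        Laplacian against three quarters of \<open>g\<close>; the surplus is nonpositive.\<close>
      moreover have "t <= y" if "t = a + b + c + d" "a = - g + p + q" "b <= r + g' + y1" "c <= y2" "d <= y3"
        "w <= 1/4 * g + y4" "q <= 1/4 * g + y5" "0 <= g" "w = p + r" "y = y1 + y2 + y3 + y4 + y5" "g' = 1/4 * g"
        for t a b c d g g' p q r y1 y2 y3 y4 y5 w y :: real using that by linarith
      ultimately have "(\<Sum>i=1..n. om n i * v i * Pv n v i) <= K * ?V"
        using eq A B Cc D E H G0 by blast
      also have "K * ?V <= K * ((\<Sum>i=1..n. om n i * (v i)^2) / cl)"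
      proof (intro mult_left_mono K)
        have "cl * ?V <= (\<Sum>i=1..n. om n i * (v i)^2)"
          unfolding sum_distrib_left by (intro sum_mono mult_right_mono) (use elim(1) in auto)
        then show "?V <= (\<Sum>i=1..n. om n i * (v i)^2) / cl" using c by (simp add: pos_le_divide_eq mult.commute)
      qed
      finally show "(\<Sum>i=1..n. om n i * v i * Pv n v i) <= K / cl * (\<Sum>i=1..n. om n i * (v i)^2)" by simp
    qed
  qed
  then show ?thesis using K c by (intro exI[of _ "K / cl"]) simp
qed

text \<open>The quantifiers over \<open>e\<close>, \<open>r\<close> and \<open>\<rho>\<close> stand
  inside \<open>eventually\<close>: one threshold for \<open>n\<close> serves all perturbed
  solutions.\<close>

definition stable :: "real => real => bool" where
  "stable T C \<longleftrightarrow> (\<forall>\<^sub>F n in sequentially. \<forall>e r \<rho>.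
     (\<forall>t\<in>{0..T}. \<forall>j\<in>{1..n}. ((%s. e s j) has_real_derivative (Pv n (e t) j + r t j)) (at t within {0..T})) -->
     (\<forall>t\<in>{0..T}. mean_sq n (r t) <= \<rho>) -->
     (\<forall>t\<in>{0..T}. mean_sq n (e t) <= C * (mean_sq n (e 0) + \<rho>)))"

text \<open>Gronwall's argument for the \<open>om\<close>-weighted energy, whose equivalence with
  the unweighted mean square has constants independent of \<open>n\<close>.\<close>

lemma discrete_stability:
  assumes T: "0 <= T"
  shows "\<exists>C\<ge>0. stable T C"
proof -
  obtain cl cu where c: "0 < cl" "0 < cu" and ev_om: "\<forall>\<^sub>F n in sequentially. \<forall>i\<in>{1..n}. cl <= om n i \<and> om n i <= cu"
    using om_bounds by blast
  obtain K where K: "0 <= K" and ev: "\<forall>\<^sub>F n in sequentially. \<forall>v. (\<Sum>i=1..n. om n i * v i * Pv n v i) <= K * (\<Sum>i=1..n. om n i * (v i)^2)"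
    using discrete_energy by (elim exE conjE) (rule that)
  \<comment> \<open>Twice the energy constant, plus one for the term
    \<open>2 e r <= e^2 + r^2\<close>.\<close>
  define k where "k = 2 * K + 1"
  define C where "C = exp (k * T) * cu / cl"
  have C: "0 <= C" using c by (simp add: C_def)
  show ?thesis unfolding stable_def
  proof (intro exI[of _ C] conjI C)
    show "\<forall>\<^sub>F n in sequentially. \<forall>e r \<rho>.
     (\<forall>t\<in>{0..T}. \<forall>j\<in>{1..n}. ((%s. e s j) has_real_derivative (Pv n (e t) j + r t j)) (at t within {0..T})) -->
     (\<forall>t\<in>{0..T}. mean_sq n (r t) <= \<rho>) -->
     (\<forall>t\<in>{0..T}. mean_sq n (e t) <= C * (mean_sq n (e 0) + \<rho>))"
      using ev_om ev
    proof eventually_elim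
      case (elim n)
      show ?case
      proof (intro allI impI ballI)
        fix e r \<rho> t
        assume de: "\<forall>t\<in>{0..T}. \<forall>j\<in>{1..n}. ((%s. e s j) has_real_derivative (Pv n (e t) j + r t j)) (at t within {0..T})"
          and r: "\<forall>t\<in>{0..T}. mean_sq n (r t) <= \<rho>" and t: "t \<in> {0..T}"
        have h: "hh n > 0" by (rule hh_pos)
        define E where "E t = hh n * (\<Sum>j=1..n. om n j * (e t j)^2)" for t
        define E' where "E' t = hh n * (\<Sum>j=1..n. om n j * (2 * e t j * (Pv n (e t) j + r t j)))" for t
        define \<rho>' where "\<rho>' = cu * \<rho>"
        have dE: "(E has_real_derivative E' t) (at t within {0..T})" if t: "t \<in> {0..T}" for t
          unfolding E_def[abs_def] E'_def
        proof (intro DERIV_cmult DERIV_sum)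
          fix j assume j: "j \<in> {1..n}"
          show "((%s. (e s j)^2) has_real_derivative 2 * e t j * (Pv n (e t) j + r t j)) (at t within {0..T})"
            using DERIV_power[OF de[rule_format, OF t j], of 2] by (simp add: mult_ac)
        qed
        have r0: "0 <= \<rho>" using r[rule_format, OF t] h by (meson order_trans mult_nonneg_nonneg sum_nonneg less_imp_le zero_le_power2)
        have E'le: "E' t <= k * E t + \<rho>'" if t: "t \<in> {0..T}" for t
        proof -
          have "(\<Sum>j=1..n. om n j * (2 * e t j * (Pv n (e t) j + r t j)))
              <= (\<Sum>j=1..n. 2 * (om n j * e t j * Pv n (e t) j) + om n j * (e t j)^2 + cu * (r t j)^2)"
          proof (rule sum_mono)
            fix j assume j: "j \<in> {1..n}"
            have "cl <= om n j \<and> om n j <= cu" using elim(1) j by (rule bspec)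
            then have o: "0 <= om n j" "om n j <= cu" using c by auto
            have "2 * (e t j * r t j) <= (e t j)^2 + (r t j)^2"
              using sum_squares_bound[of "e t j" "r t j"] by simp
            then have "om n j * (2 * (e t j * r t j)) <= om n j * ((e t j)^2 + (r t j)^2)" using o by (intro mult_left_mono)
            moreover have "om n j * (r t j)^2 <= cu * (r t j)^2" using o by (intro mult_right_mono) auto
            ultimately show "om n j * (2 * e t j * (Pv n (e t) j + r t j))
              <= 2 * (om n j * e t j * Pv n (e t) j) + om n j * (e t j)^2 + cu * (r t j)^2"
              by (simp add: algebra_simps)
          qed
          also have "\<dots> = 2 * (\<Sum>j=1..n. om n j * e t j * Pv n (e t) j) + (\<Sum>j=1..n. om n j * (e t j)^2) + cu * (\<Sum>j=1..n. (r t j)^2)"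
            by (simp only: sum.distrib sum_distrib_left)
          also have "\<dots> <= 2 * (K * (\<Sum>j=1..n. om n j * (e t j)^2)) + (\<Sum>j=1..n. om n j * (e t j)^2) + cu * (\<Sum>j=1..n. (r t j)^2)"
            using elim(2)[rule_format, of "e t"] by simp
          also have "\<dots> = k * (\<Sum>j=1..n. om n j * (e t j)^2) + cu * (\<Sum>j=1..n. (r t j)^2)"
            by (simp add: k_def distrib_right)
          finally have "E' t <= hh n * (k * (\<Sum>j=1..n. om n j * (e t j)^2) + cu * (\<Sum>j=1..n. (r t j)^2))"
            unfolding E'_def using h by (intro mult_left_mono) auto
          also have "\<dots> = k * E t + cu * (mean_sq n (r t))"
            by (simp add: E_def algebra_simps)
          also have "\<dots> <= k * E t + \<rho>'" unfolding \<rho>'_def using r t c by (intro add_left_mono mult_left_mono) auto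
          finally show ?thesis .
        qed
        have k1: "1 <= k" using K by (simp add: k_def)
        have \<rho>': "0 <= \<rho>'" using r0 c by (simp add: \<rho>'_def)
        \<comment> \<open>Adding \<open>\<rho>'\<close> to the energy absorbs the forcing because
          \<open>k >= 1\<close>, so no convolution with the forcing appears.\<close>
        have "exp (- k * t) * (E t + \<rho>') <= exp (- k * 0) * (E 0 + \<rho>')"
        proof (rule deriv_within_nonincreasing[OF _ _ t])
          fix s assume s: "s \<in> {0..T}"
          show "((%t. exp (- k * t) * (E t + \<rho>')) has_real_derivative exp (- k * s) * (E' s - k * (E s + \<rho>'))) (at s within {0..T})"
            by (rule derivative_eq_intros dE[OF s] refl | simp add: algebra_simps)+
          have "E' s - k * (E s + \<rho>') <= \<rho>' - k * \<rho>'" using E'le[OF s] by (simp add: algebra_simps)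
          also have "\<dots> <= 0" using k1 \<rho>' mult_right_mono[of 1 k \<rho>'] by simp
          finally show "exp (- k * s) * (E' s - k * (E s + \<rho>')) <= 0" by (simp add: mult_le_0_iff)
        qed
        then have "exp (- k * t) * (E t + \<rho>') <= E 0 + \<rho>'" by simp
        then have "E t + \<rho>' <= exp (k * t) * (E 0 + \<rho>')"
          by (simp add: exp_minus field_simps)
        also have "\<dots> <= exp (k * T) * (E 0 + \<rho>')"
        proof (rule mult_right_mono)
          show "exp (k * t) <= exp (k * T)" using t k1 by simp
          have om0: "0 <= om n j" if "j \<in> {1..n}" for j using bspec[OF elim(1) that] c by linarith
          have "0 <= E 0" unfolding E_def using h om0 by (intro mult_nonneg_nonneg sum_nonneg) auto
          then show "0 <= E 0 + \<rho>'" using \<rho>' by simp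
        qed
        finally have 1: "E t <= exp (k * T) * (E 0 + \<rho>')" using \<rho>' by linarith
        have "cl * (\<Sum>j=1..n. (e t j)^2) <= (\<Sum>j=1..n. om n j * (e t j)^2)"
          unfolding sum_distrib_left by (intro sum_mono mult_right_mono) (use elim(1) in auto)
        then have "hh n * (cl * (\<Sum>j=1..n. (e t j)^2)) <= E t"
          unfolding E_def using h by (intro mult_left_mono) auto
        then have 2: "cl * (mean_sq n (e t)) <= E t" by (simp only: mult.left_commute)
        have "(\<Sum>j=1..n. om n j * (e 0 j)^2) <= cu * (\<Sum>j=1..n. (e 0 j)^2)"
          unfolding sum_distrib_left by (intro sum_mono mult_right_mono) (use elim(1) in auto)
        then have "E 0 <= hh n * (cu * (\<Sum>j=1..n. (e 0 j)^2))"
          unfolding E_def using h by (intro mult_left_mono) auto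
        then have 3: "E 0 <= cu * (mean_sq n (e 0))" by (simp only: mult.left_commute)
        have "exp (k * T) * (E 0 + \<rho>') <= exp (k * T) * (cu * (mean_sq n (e 0)) + \<rho>')"
          using 3 by (intro mult_left_mono) auto
        also have "\<dots> = cl * (C * (mean_sq n (e 0) + \<rho>))"
          using c by (simp add: C_def \<rho>'_def algebra_simps)
        finally have "cl * (mean_sq n (e t)) <= cl * (C * (mean_sq n (e 0) + \<rho>))"
          using 1 2 by linarith
        then show "mean_sq n (e t) <= C * (mean_sq n (e 0) + \<rho>)"
          using c by simp
      qed
    qed
  qed
qed

end

subsection \<open>Consistency\<close>

text \<open>The mean value inequality for \<open>w\<close> minus a quadratic polynomial. The second
  derivative need not exist at \<open>x\<close>; \<open>c\<close> takes the value there of a density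
  of \<open>w1\<close>.\<close>

lemma taylor_remainder:
  fixes w w1 :: "real => real"
  assumes d: "\<And>z. z \<in> {0..1} ==> (w has_real_derivative w1 z) (at z within {0..1})"
    and xy: "x \<in> {0..1}" "y \<in> {0..1}"
    and M: "\<And>z. z \<in> {min x y..max x y} ==> \<bar>w1 z - w1 x - (z - x) * c\<bar> <= M"
  shows "\<bar>w y - w x - (y - x) * w1 x - (y - x)^2 * c / 2\<bar> <= M * \<bar>y - x\<bar>"
proof -
  let ?p = "%z. w z - w x - (z - x) * w1 x - (z - x)^2 * c / 2"
  let ?S = "{min x y..max x y}"
  have S: "?S \<subseteq> {0..1}" using xy by auto
  have "norm (?p y - ?p x) <= M * norm (y - x)"
  proof (rule field_differentiable_bound[where S="?S" and f'="%z. w1 z - w1 x - (z - x) * c"])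
    fix z assume z: "z \<in> ?S"
    have "(w has_real_derivative w1 z) (at z within ?S)" using d S z by (meson DERIV_subset subsetD)
    then show "(?p has_real_derivative w1 z - w1 x - (z - x) * c) (at z within ?S)"
      by (auto intro!: derivative_eq_intros)
    show "norm (w1 z - w1 x - (z - x) * c) <= M" using M[OF z] by simp
  qed auto
  then show ?thesis by simp
qed

lemma vanish_eps:
  assumes "\<And>e. e > 0 ==> \<forall>\<^sub>F n in sequentially. \<forall>i\<in>I. \<forall>j\<in>{1..n}. \<bar>r n i j\<bar> <= e"
  shows "vanish I r"
  unfolding vanish_def
proof (intro allI impI)
  fix e :: real assume e: "e > 0"
  then have "0 < min 1 e" by simp
  from assms[OF this] show "\<forall>\<^sub>F n in sequentially. \<forall>i\<in>I. mean_sq n (r n i) <= e"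
  proof eventually_elim
    case (elim n)
    show ?case
    proof
      fix i assume i: "i \<in> I"
      have "(\<Sum>j=1..n. (r n i j)^2) <= (\<Sum>j=1..n. e)"
      proof (rule sum_mono)
        fix j assume j: "j \<in> {1..n}"
        have a: "\<bar>r n i j\<bar> <= 1" "\<bar>r n i j\<bar> <= e" using elim i j by auto
        have "(r n i j)^2 = \<bar>r n i j\<bar> * \<bar>r n i j\<bar>" by (simp add: power2_eq_square)
        also have "\<dots> <= 1 * e" using a by (intro mult_mono) auto
        finally show "(r n i j)^2 <= e" by simp
      qed
      then have "mean_sq n (r n i) <= hh n * (real n * e)" using hh_pos[of n] by (simp add: mult_left_mono)
      also have "\<dots> = (gp n n) * e" by simp
      also have "\<dots> <= 1 * e" using n_hh_le e by (intro mult_right_mono) auto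
      finally show "mean_sq n (r n i) <= e" by simp
    qed
  qed
qed

lemma increment_integral:
  fixes w1 g :: "real => real"
  assumes int: "g integrable_on {0..1}" and w1: "\<And>x. x \<in> {0..1} ==> w1 x = w1 0 + integral {0..x} g"
    and ab: "0 <= a" "a <= b" "b <= 1"
  shows "w1 b - w1 a = integral {a..b} g"
proof -
  have "integral {0..b} g = integral {0..a} g + integral {a..b} g"
    by (rule Henstock_Kurzweil_Integration.integral_combine[symmetric])
       (use ab int in \<open>auto intro: integrable_on_subinterval\<close>)
  then show ?thesis using w1[of a] w1[of b] ab by simp
qed

lemma increment_bound:
  fixes w1 g :: "real => real"
  assumes int: "g integrable_on {0..1}" and w1: "\<And>x. x \<in> {0..1} ==> w1 x = w1 0 + integral {0..x} g"
    and xy: "x \<in> {0..1}" "y \<in> {0..1}" and M: "\<And>z. z \<in> {min x y..max x y} ==> \<bar>g z - c\<bar> <= M"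
  shows "\<bar>w1 y - w1 x - (y - x) * c\<bar> <= M * \<bar>y - x\<bar>"
proof -
  have main: "\<bar>w1 b - w1 a - (b - a) * c\<bar> <= M * (b - a)"
    if ab: "0 <= a" "a <= b" "b <= 1" and M: "\<And>z. z \<in> {a..b} ==> \<bar>g z - c\<bar> <= M" for a b
  proof -
    have i: "g integrable_on {a..b}" by (rule integrable_on_subinterval[OF int]) (use ab in auto)
    have "w1 b - w1 a - (b - a) * c = integral {a..b} g - integral {a..b} (%z. c)"
      using increment_integral[OF int w1 ab] ab by simp
    also have "\<dots> = integral {a..b} (%z. g z - c)"
      by (rule Henstock_Kurzweil_Integration.integral_diff[symmetric]) (use i in auto)
    finally have "w1 b - w1 a - (b - a) * c = integral {a..b} (%z. g z - c)" .
    moreover have "norm (integral {a..b} (%z. g z - c)) <= integral {a..b} (%z. M)"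
      by (rule integral_norm_bound_integral) (use i M in \<open>auto intro: integrable_diff\<close>)
    ultimately show ?thesis using ab by (simp add: mult.commute)
  qed
  show ?thesis
  proof (cases "x <= y")
    case True then show ?thesis using main[of x y] M xy by (simp add: min_def max_def)
  next
    case False
    then have "\<bar>w1 x - w1 y - (x - y) * c\<bar> <= M * (x - y)" using main[of y x] M xy by (simp add: min_def max_def)
    moreover have "w1 x - w1 y - (x - y) * c = - (w1 y - w1 x - (y - x) * c)" by (simp add: algebra_simps)
    ultimately show ?thesis using False by (simp add: abs_minus_commute)
  qed
qed

context pide begin

text \<open>The derivatives are arguments because the second one is only a density of the first and
  may jump.\<close>

definition Pex :: "(real => real) => (real => real) => (real => real) => real => real" where
  "Pex w w1 g x = \<theta> x * g x + \<sigma> x * w1 x + lam x * w x + integral {0..x} (%s. \<phi> x s * w s)"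

lemma phi_uniform:
  assumes "e > 0"
  obtains d where "d > 0" "\<And>x y s t. x \<in> {0..1} ==> y \<in> {0..1} ==> s \<in> {0..1} ==> t \<in> {0..1} ==>
    \<bar>x - y\<bar> < d ==> \<bar>s - t\<bar> < d ==> \<bar>\<phi> x s - \<phi> y t\<bar> < e"
proof -
  have "uniformly_continuous_on ({0..1} \<times> {0..1}) (%p. \<phi> (fst p) (snd p))"
    by (intro compact_uniformly_continuous phi_cont compact_Times) auto
  from this[unfolded uniformly_continuous_on_def, rule_format, OF assms]
  obtain d where d: "d > 0" "\<forall>x\<in>{0..1} \<times> {0..1}. \<forall>x'\<in>{0..1} \<times> {0..1}. dist x' x < d -->
      dist (\<phi> (fst x') (snd x')) (\<phi> (fst x) (snd x)) < e" by (elim exE conjE) (rule that)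
  show thesis
  proof (rule that[of "d / 2"])
    fix x y s t :: real
    assume a: "x \<in> {0..1}" "y \<in> {0..1}" "s \<in> {0..1}" "t \<in> {0..1}" "\<bar>x - y\<bar> < d / 2" "\<bar>s - t\<bar> < d / 2"
    have "dist (x, s) (y, t) <= \<bar>x - y\<bar> + \<bar>s - t\<bar>"
      unfolding dist_Pair_Pair dist_real_def by (rule sqrt_sum_squares_le_sum) auto
    then have "dist (x, s) (y, t) < d" using a by linarith
    then have "dist (\<phi> (fst (x, s)) (snd (x, s))) (\<phi> (fst (y, t)) (snd (y, t))) < e"
      using a by (intro d(2)[rule_format]) auto
    then show "\<bar>\<phi> x s - \<phi> y t\<bar> < e" by (simp add: dist_real_def)
  qed (use d in simp)
qed

lemma phi_cont_section: "x \<in> {0..1} ==> continuous_on {0..1} (\<phi> x)"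
proof -
  assume x: "x \<in> {0..1}"
  have "continuous_on {0..1} (%s. (x, s))" by (intro continuous_on_Pair continuous_on_const continuous_on_id)
  moreover have "(%s. (x, s)) ` {0..1} \<subseteq> {0..1} \<times> {0..1}" by (rule image_subsetI) (use x in simp)
  ultimately have "continuous_on {0..1} (%s. \<phi> (fst (x, s)) (snd (x, s)))" by (rule continuous_on_compose2[OF phi_cont])
  then show ?thesis by simp
qed

lemma volterra_integrable:
  assumes "x \<in> {0..1}" "continuous_on {0..1} w" "0 <= a" "b <= 1"
  shows "(%s. \<phi> x s * w s) integrable_on {a..b}"
  by (rule integrable_continuous_interval)
     (intro continuous_intros continuous_on_subset[OF phi_cont_section[OF assms(1)]] continuous_on_subset[OF assms(2)]; use assms in auto)

lemma volterra_bound: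
  assumes F: "0 <= F" "\<And>x y. x \<in> {0..1} ==> y \<in> {0..1} ==> \<bar>\<phi> x y\<bar> <= F"
    and x: "x \<in> {0..1}" and w: "continuous_on {0..1} w" and B: "\<And>s. s \<in> {0..x} ==> \<bar>w s\<bar> <= B"
  shows "\<bar>integral {0..x} (%s. \<phi> x s * w s)\<bar> <= F * B"
proof -
  have B0: "0 <= B" using B[of 0] x by fastforce
  have "norm (integral {0..x} (%s. \<phi> x s * w s)) <= integral {0..x} (%s. F * B)"
  proof (rule integral_norm_bound_integral)
    show "(%s. \<phi> x s * w s) integrable_on {0..x}" by (rule volterra_integrable) (use x w in auto)
    show "norm (\<phi> x s * w s) <= F * B" if "s \<in> {0..x}" for s
      using F B[OF that] x that by (auto simp: abs_mult intro!: mult_mono)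
  qed auto
  also have "\<dots> = x * (F * B)" using x by simp
  also have "\<dots> <= 1 * (F * B)" using x F B0 by (intro mult_right_mono) auto
  finally show ?thesis by simp
qed

text \<open>The modulus depends on the family only through its sup bound: the kernel varies
  uniformly, and the additional piece of the integration interval is short.\<close>

lemma volterra_pequi:
  assumes w: "\<And>i. i \<in> I ==> continuous_on {0..1} (w i)" and B: "\<And>i x. i \<in> I ==> x \<in> {0..1} ==> \<bar>w i x\<bar> <= B"
  shows "pequi I (%i x. integral {0..x} (%s. \<phi> x s * w i s))"
    and "i \<in> I ==> continuous_on {0..1} (%x. integral {0..x} (%s. \<phi> x s * w i s))"
proof -
  obtain F where F: "0 <= F" "\<And>x y. x \<in> {0..1} ==> y \<in> {0..1} ==> \<bar>\<phi> x y\<bar> <= F" using phi_bounded by metis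
  define B' where "B' = max B 0"
  have B': "0 <= B'" "\<And>i x. i \<in> I ==> x \<in> {0..1} ==> \<bar>w i x\<bar> <= B'" using B by (fastforce simp: B'_def)+
  have main: "\<exists>d>0. \<forall>i\<in>I. \<forall>x\<in>{0..1}. \<forall>y\<in>{0..1}. \<bar>x - y\<bar> < d -->
      \<bar>integral {0..x} (%s. \<phi> x s * w i s) - integral {0..y} (%s. \<phi> y s * w i s)\<bar> < e" if e: "e > 0" for e
  proof -
    define e1 where "e1 = e / (2 * (B' + 1))"
    have e1: "e1 > 0" using e B' by (simp add: e1_def)
    obtain d1 where d1: "d1 > 0" "\<And>x y s t. x \<in> {0..1} ==> y \<in> {0..1} ==> s \<in> {0..1} ==> t \<in> {0..1} ==>
      \<bar>x - y\<bar> < d1 ==> \<bar>s - t\<bar> < d1 ==> \<bar>\<phi> x s - \<phi> y t\<bar> < e1" using phi_uniform[OF e1] by metis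
    define d where "d = min d1 (e / (2 * (F * B' + 1)))"
    have d: "d > 0" using d1 e F B' by (simp add: d_def add_nonneg_pos)
    have one: "\<bar>integral {0..x} (%s. \<phi> x s * w i s) - integral {0..y} (%s. \<phi> y s * w i s)\<bar> < e"
      if i: "i \<in> I" and x: "x \<in> {0..1}" and y: "y \<in> {0..1}" and xy: "x <= y" "y - x < d" for i x y
    proof -
      have ix: "(%s. \<phi> x s * w i s) integrable_on {0..x}" "(%s. \<phi> y s * w i s) integrable_on {0..x}"
        "(%s. \<phi> y s * w i s) integrable_on {x..y}" "(%s. \<phi> y s * w i s) integrable_on {0..y}"
        using x y w[OF i] by (auto intro: volterra_integrable)
      have "integral {0..y} (%s. \<phi> y s * w i s) = integral {0..x} (%s. \<phi> y s * w i s) + integral {x..y} (%s. \<phi> y s * w i s)"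
        by (rule Henstock_Kurzweil_Integration.integral_combine[symmetric]) (use x xy ix in auto)
      moreover have "integral {0..x} (%s. \<phi> x s * w i s) - integral {0..x} (%s. \<phi> y s * w i s)
          = integral {0..x} (%s. \<phi> x s * w i s - \<phi> y s * w i s)"
        by (rule Henstock_Kurzweil_Integration.integral_diff[symmetric]) (use ix in auto)
      moreover have "norm (integral {0..x} (%s. \<phi> x s * w i s - \<phi> y s * w i s)) <= integral {0..x} (%s. e1 * B')"
      proof (rule integral_norm_bound_integral)
        show "(%s. \<phi> x s * w i s - \<phi> y s * w i s) integrable_on {0..x}" using ix by (intro integrable_diff)
        fix s assume s: "s \<in> {0..x}"
        have "s \<in> {0..1}" using s x by auto
        then have "\<bar>\<phi> x s - \<phi> y s\<bar> <= e1" "\<bar>w i s\<bar> <= B'"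
          using d1(2)[OF x y, of s s] xy d1(1) B'(2)[OF i] by (auto simp: d_def)
        then have "\<bar>\<phi> x s - \<phi> y s\<bar> * \<bar>w i s\<bar> <= e1 * B'" using e1 by (intro mult_mono) auto
        then show "norm (\<phi> x s * w i s - \<phi> y s * w i s) <= e1 * B'"
          by (simp add: abs_mult left_diff_distrib[symmetric])
      qed auto
      moreover have "norm (integral {x..y} (%s. \<phi> y s * w i s)) <= integral {x..y} (%s. F * B')"
      proof (rule integral_norm_bound_integral)
        fix s assume s: "s \<in> {x..y}"
        then have "s \<in> {0..1}" using x y by auto
        then show "norm (\<phi> y s * w i s) <= F * B'" using F y B'(2)[OF i] by (auto simp: abs_mult intro!: mult_mono)
      qed (use ix in auto)
      moreover have "integral {0..x} (%s. e1 * B') <= e1 * B'"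
        using x e1 B' mult_right_mono[of x 1 "e1 * B'"] by simp
      moreover have "integral {x..y} (%s. F * B') = (y - x) * (F * B')" using xy by simp
      moreover have "e1 * B' < e / 2" using e B' by (simp add: e1_def field_simps)
      moreover have "(y - x) * (F * B') < e / 2"
      proof -
        have p: "0 < F * B' + 1" using F B' by (simp add: add_nonneg_pos)
        have "(y - x) * (F * B') <= (y - x) * (F * B' + 1)" using xy by (simp add: distrib_left)
        also have "\<dots> < e / (2 * (F * B' + 1)) * (F * B' + 1)"
          using xy p by (intro mult_strict_right_mono) (auto simp: d_def)
        also have "\<dots> = e / 2" using p by (simp add: field_simps)
        finally show ?thesis .
      qed
      ultimately show ?thesis unfolding real_norm_def by linarith
    qed
    have "\<bar>integral {0..x} (%s. \<phi> x s * w i s) - integral {0..y} (%s. \<phi> y s * w i s)\<bar> < e"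
      if "i \<in> I" "x \<in> {0..1}" "y \<in> {0..1}" "\<bar>x - y\<bar> < d" for i x y
    proof (cases "x <= y")
      case True then show ?thesis using one[of i x y] that by simp
    next
      case False
      then show ?thesis using one[of i y x] that by (simp add: abs_minus_commute)
    qed
    then show ?thesis using d by (intro exI[of _ d] conjI ballI impI) simp_all
  qed
  show "pequi I (%i x. integral {0..x} (%s. \<phi> x s * w i s))"
  proof (rule pequi_equicont[where C="F * B'", OF _ main])
    fix i x assume i: "i \<in> I" and x: "x \<in> {0..1::real}"
    show "\<bar>integral {0..x} (%s. \<phi> x s * w i s)\<bar> <= F * B'"
      by (rule volterra_bound[OF F x w[OF i] B'(2)[OF i]]) (use x in auto)
  qed
  show "continuous_on {0..1} (%x. integral {0..x} (%s. \<phi> x s * w i s))" if i: "i \<in> I"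
    unfolding continuous_on_iff
  proof (intro ballI allI impI)
    fix x e :: real assume x: "x \<in> {0..1}" and e: "0 < e"
    from main[OF e] obtain d where d: "d > 0" "\<forall>i\<in>I. \<forall>x\<in>{0..1}. \<forall>y\<in>{0..1}. \<bar>x - y\<bar> < d -->
      \<bar>integral {0..x} (%s. \<phi> x s * w i s) - integral {0..y} (%s. \<phi> y s * w i s)\<bar> < e"
      by (elim exE conjE) (rule that)
    show "\<exists>d>0. \<forall>x'\<in>{0..1}. dist x' x < d --> dist (integral {0..x'} (%s. \<phi> x' s * w i s)) (integral {0..x} (%s. \<phi> x s * w i s)) < e"
      using d(2)[rule_format, OF i _ x] d(1) by (intro exI[of _ d]) (simp add: dist_real_def)
  qed
qed

text \<open>The denominators of \<open>r0\<close> and \<open>r1\<close> tend to three times the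
  coefficients \<open>\<alpha>0\<close> and \<open>\<alpha>1\<close>. This keeps the error of the
  eliminated boundary values at order \<open>h^2\<close>.\<close>

lemma BC_coefficients: "\<forall>\<^sub>F n in sequentially. \<bar>\<alpha>0\<bar> <= \<bar>3 * \<alpha>0 - 2 * hh n * \<beta>0\<bar> \<and> \<bar>\<alpha>1\<bar> <= \<bar>3 * \<alpha>1 + 2 * hh n * \<beta>1\<bar>"
proof -
  have 0: "\<forall>\<^sub>F n in sequentially. \<bar>\<alpha>0\<bar> <= \<bar>3 * \<alpha>0 - 2 * hh n * \<beta>0\<bar>"
  proof (cases "\<alpha>0 = 0")
    case False
    have "(%n. \<bar>3 * \<alpha>0 - 2 * hh n * \<beta>0\<bar>) \<longlonglongrightarrow> \<bar>3 * \<alpha>0 - 2 * 0 * \<beta>0\<bar>" by (intro tendsto_intros hh_tendsto)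
    then have "\<forall>\<^sub>F n in sequentially. \<bar>\<alpha>0\<bar> < \<bar>3 * \<alpha>0 - 2 * hh n * \<beta>0\<bar>"
      by (rule order_tendstoD) (use False in \<open>simp add: abs_mult\<close>)
    then show ?thesis by eventually_elim simp
  qed simp
  have 1: "\<forall>\<^sub>F n in sequentially. \<bar>\<alpha>1\<bar> <= \<bar>3 * \<alpha>1 + 2 * hh n * \<beta>1\<bar>"
  proof (cases "\<alpha>1 = 0")
    case False
    have "(%n. \<bar>3 * \<alpha>1 + 2 * hh n * \<beta>1\<bar>) \<longlonglongrightarrow> \<bar>3 * \<alpha>1 + 2 * 0 * \<beta>1\<bar>" by (intro tendsto_intros hh_tendsto)
    then have "\<forall>\<^sub>F n in sequentially. \<bar>\<alpha>1\<bar> < \<bar>3 * \<alpha>1 + 2 * hh n * \<beta>1\<bar>"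
      by (rule order_tendstoD) (use False in \<open>simp add: abs_mult\<close>)
    then show ?thesis by eventually_elim simp
  qed simp
  from 0 1 show ?thesis by eventually_elim simp
qed

end

text \<open>Only the left condition is homogeneous; the right boundary value is left free because it
  plays the part of the input. All bounds are common to the family.\<close>

locale H2_family = pide +
  fixes I :: "'i set" and w w1 g :: "'i => real => real" and B G :: real
  assumes dw: "\<And>i x. i \<in> I ==> x \<in> {0..1} ==> (w i has_real_derivative w1 i x) (at x within {0..1})"
    and dw1: "\<And>i x. i \<in> I ==> x \<in> {0..1} ==> w1 i x = w1 i 0 + integral {0..x} (g i)"
    and g: "pequi I g"
    and B: "\<And>i x. i \<in> I ==> x \<in> {0..1} ==> \<bar>w i x\<bar> <= B" "\<And>i x. i \<in> I ==> x \<in> {0..1} ==> \<bar>w1 i x\<bar> <= B"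
    and G: "\<And>i x. i \<in> I ==> x \<in> {0..1} ==> \<bar>g i x\<bar> <= G"
    and bc0: "\<And>i. i \<in> I ==> \<alpha>0 * w1 i 0 + \<beta>0 * w i 0 = 0"
begin

lemma g_int: "i \<in> I ==> g i integrable_on {0..1}"
  using L2_integrable_on(2)[OF pcont_L2[OF pequi_member[OF g]]] by auto

lemma w_cont: "i \<in> I ==> continuous_on {0..1} (w i)"
  using dw by (rule DERIV_continuous_on)

lemma w1_lip: assumes "i \<in> I" "x \<in> {0..1}" "y \<in> {0..1}" shows "\<bar>w1 i y - w1 i x\<bar> <= G * \<bar>y - x\<bar>"
proof -
  have "\<bar>w1 i y - w1 i x - (y - x) * 0\<bar> <= G * \<bar>y - x\<bar>"
  proof (rule increment_bound[OF g_int[OF assms(1)] dw1[OF assms(1)] assms(2,3)])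
    fix z assume "z \<in> {min x y..max x y}"
    then have "z \<in> {0..1}" using assms by (auto simp: min_def max_def split: if_splits)
    then show "\<bar>g i z - 0\<bar> <= G" using G[OF assms(1)] by simp
  qed
  then show ?thesis by simp
qed

lemma w_lip: assumes "i \<in> I" "x \<in> {0..1}" "y \<in> {0..1}" shows "\<bar>w i y - w i x\<bar> <= B * \<bar>y - x\<bar>"
proof -
  have "norm (w i y - w i x) <= B * norm (y - x)"
    by (rule field_differentiable_bound[where S="{0..1}" and f'="w1 i"]) (use dw B assms in auto)
  then show ?thesis by simp
qed

lemma first_order: assumes "i \<in> I" "x \<in> {0..1}" "y \<in> {0..1}"
  shows "\<bar>w i y - w i x - (y - x) * w1 i x\<bar> <= G * (y - x)^2"
proof -
  have G0: "0 <= G" using G[OF assms(1,2)] by linarith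
  have "\<bar>w i y - w i x - (y - x) * w1 i x - (y - x)^2 * 0 / 2\<bar> <= (G * \<bar>y - x\<bar>) * \<bar>y - x\<bar>"
  proof (rule taylor_remainder[OF dw[OF assms(1)] assms(2,3)])
    fix z assume z: "z \<in> {min x y..max x y}"
    then have "z \<in> {0..1}" "\<bar>z - x\<bar> <= \<bar>y - x\<bar>" using assms by (auto simp: min_def max_def split: if_splits)
    then have "\<bar>w1 i z - w1 i x\<bar> <= G * \<bar>z - x\<bar>" "G * \<bar>z - x\<bar> <= G * \<bar>y - x\<bar>"
      using w1_lip[OF assms(1,2)] G0 by (auto intro: mult_left_mono)
    then show "\<bar>w1 i z - w1 i x - (z - x) * 0\<bar> <= G * \<bar>y - x\<bar>" by simp
  qed
  then show ?thesis by (simp add: power2_eq_square mult.assoc)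
qed

text \<open>In the sum of the expansions at \<open>x + h\<close> and \<open>x - h\<close> the first
  order terms cancel; each remainder is at most \<open>h^2\<close> times the oscillation of the
  second derivative.\<close>

lemma second_difference:
  assumes i: "i \<in> I" and x: "x \<in> {0..1}" "x - h \<in> {0..1}" "x + h \<in> {0..1}" and h: "0 < h"
  shows "\<bar>w i (x + h) - 2 * w i x + w i (x - h) - h^2 * g i x\<bar> <= 2 * h^2 * osc (g i) x h"
proof -
  have inc: "\<bar>w1 i z - w1 i x - (z - x) * g i x\<bar> <= h * osc (g i) x h" if z: "z \<in> {0..1}" "\<bar>z - x\<bar> <= h" for z
  proof -
    have "\<bar>w1 i z - w1 i x - (z - x) * g i x\<bar> <= osc (g i) x h * \<bar>z - x\<bar>"
    proof (rule increment_bound[OF g_int[OF i] dw1[OF i] x(1) z(1)])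
      fix y assume "y \<in> {min x z..max x z}"
      then have "y \<in> {0..1}" "\<bar>y - x\<bar> <= h" using x z by (auto simp: min_def max_def split: if_splits)
      then show "\<bar>g i y - g i x\<bar> <= osc (g i) x h" using G[OF i] x(1) by (intro osc_ge[where B=G]) auto
    qed
    also have "\<dots> <= osc (g i) x h * h"
      using osc_nonneg[of "g i" G x h] G[OF i] x h z by (intro mult_left_mono) auto
    finally show ?thesis by (simp add: mult.commute)
  qed
  have tay: "\<bar>w i y - w i x - (y - x) * w1 i x - (y - x)^2 * g i x / 2\<bar> <= (h * osc (g i) x h) * \<bar>y - x\<bar>"
    if y: "y \<in> {0..1}" "\<bar>y - x\<bar> <= h" for y
  proof (rule taylor_remainder[OF dw[OF i] x(1) y(1)])
    fix z assume "z \<in> {min x y..max x y}"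
    then have "z \<in> {0..1}" "\<bar>z - x\<bar> <= h" using x y by (auto simp: min_def max_def split: if_splits)
    then show "\<bar>w1 i z - w1 i x - (z - x) * g i x\<bar> <= h * osc (g i) x h" by (rule inc)
  qed
  have "\<bar>w i (x + h) - w i x - h * w1 i x - h^2 * g i x / 2\<bar> <= h^2 * osc (g i) x h"
    using tay[OF x(3)] h by (simp add: power2_eq_square mult_ac)
  moreover have "\<bar>w i (x - h) - w i x + h * w1 i x - h^2 * g i x / 2\<bar> <= h^2 * osc (g i) x h"
    using tay[OF x(2)] h by (simp add: power2_eq_square mult_ac)
  ultimately show ?thesis by linarith
qed

text \<open>Origin of \<open>r0\<close>: with the one-sided difference
  \<open>(- 3 w(0) + 4 w(h) - w(2h)) / (2h)\<close> for the derivative, the boundary condition reads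
  \<open>w(0) = r0 * (4 w(h) - w(2h))\<close>. The error \<open>O(h^2)\<close> becomes
  \<open>O(1)\<close> after division by \<open>h^2\<close>.\<close>

lemma ghost_left:
  assumes i: "i \<in> I" and n: "1 <= n" and a: "\<bar>\<alpha>0\<bar> <= \<bar>3 * \<alpha>0 - 2 * hh n * \<beta>0\<bar>"
  shows "\<bar>R0 n * (4 * w i (hh n) - w i (2 * hh n)) - w i 0\<bar> <= 8 * G * (hh n)^2"
proof -
  let ?A = "3 * \<alpha>0 - 2 * hh n * \<beta>0" and ?X = "R0 n * (4 * w i (hh n) - w i (2 * hh n)) - w i 0"
  have A: "?A \<noteq> 0" by (rule wd0[OF n])
  have h: "0 < hh n" by (rule hh_pos)
  have grid: "hh n \<in> {0..1}" "2 * hh n \<in> {0..1}" using grid_in[of 1 n] grid_in[of 2 n] n by auto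
  define e1 e2 where "e1 = w i (hh n) - w i 0 - hh n * w1 i 0" and "e2 = w i (2 * hh n) - w i 0 - 2 * hh n * w1 i 0"
  have e: "\<bar>e1\<bar> <= G * (hh n)^2" "\<bar>e2\<bar> <= 4 * G * (hh n)^2"
    using first_order[OF i _ grid(1), of 0] first_order[OF i _ grid(2), of 0]
    by (auto simp: e1_def e2_def power_mult_distrib)
  have "?A * ?X = \<alpha>0 * (4 * w i (hh n) - w i (2 * hh n)) - ?A * w i 0"
    using A by (simp add: r0_def right_diff_distrib)
  also have "\<dots> = \<alpha>0 * (4 * e1 - e2) + 2 * hh n * (\<alpha>0 * w1 i 0 + \<beta>0 * w i 0)"
    by (simp add: e1_def e2_def algebra_simps)
  finally have eq: "?A * ?X = \<alpha>0 * (4 * e1 - e2)" using bc0[OF i] by simp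
  have "\<bar>4 * e1 - e2\<bar> <= 8 * G * (hh n)^2" using e by linarith
  then have "\<bar>\<alpha>0\<bar> * \<bar>4 * e1 - e2\<bar> <= \<bar>?A\<bar> * (8 * G * (hh n)^2)" using a by (intro mult_mono) auto
  then have "\<bar>?A\<bar> * \<bar>?X\<bar> <= \<bar>?A\<bar> * (8 * G * (hh n)^2)" by (simp only: abs_mult[symmetric] eq)
  then show ?thesis using A by simp
qed

text \<open>The mirror image at 1, where the boundary value is not zero. The coefficient
  \<open>2 h / (3 \<alpha>1 + 2 h \<beta>1)\<close> is \<open>bn\<close> without its factor
  \<open>\<theta>\<close>, which explains the form of the input vector.\<close>

lemma ghost_right:
  assumes i: "i \<in> I" and n: "2 <= n" and a: "\<bar>\<alpha>1\<bar> <= \<bar>3 * \<alpha>1 + 2 * hh n * \<beta>1\<bar>"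
  shows "\<bar>R1 n * (4 * w i (gp n n) - w i (real (n-1) * hh n)) - w i 1
     + 2 * hh n / (3 * \<alpha>1 + 2 * hh n * \<beta>1) * (\<alpha>1 * w1 i 1 + \<beta>1 * w i 1)\<bar> <= 8 * G * (hh n)^2"
proof -
  let ?A = "3 * \<alpha>1 + 2 * hh n * \<beta>1" and ?x = "gp n n" and ?y = "real (n-1) * hh n"
  let ?X = "R1 n * (4 * w i ?x - w i ?y) - w i 1 + 2 * hh n / ?A * (\<alpha>1 * w1 i 1 + \<beta>1 * w i 1)"
  have A: "?A \<noteq> 0" using wd1[of n] n by simp
  have h: "0 < hh n" by (rule hh_pos)
  have grid: "?x \<in> {0..1}" "?y \<in> {0..1}" using grid_in[of n n] grid_in[of "n-1" n] by auto
  have xy: "?x - 1 = - hh n" "?y - 1 = - (2 * hh n)" using hh_mult[of n] n by (auto simp: algebra_simps of_nat_diff)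
  define e1 e2 where "e1 = w i ?x - w i 1 + hh n * w1 i 1" and "e2 = w i ?y - w i 1 + 2 * hh n * w1 i 1"
  have e: "\<bar>e1\<bar> <= G * (hh n)^2" "\<bar>e2\<bar> <= 4 * G * (hh n)^2"
    using first_order[OF i _ grid(1), of 1] first_order[OF i _ grid(2), of 1]
    unfolding xy by (auto simp: e1_def e2_def power_mult_distrib)
  have "?A * ?X = \<alpha>1 * (4 * w i ?x - w i ?y) - ?A * w i 1 + 2 * hh n * (\<alpha>1 * w1 i 1 + \<beta>1 * w i 1)"
    using A by (simp add: r1_def right_diff_distrib distrib_left)
  also have "\<dots> = \<alpha>1 * (4 * e1 - e2)"
    by (simp add: e1_def e2_def algebra_simps)
  finally have eq: "?A * ?X = \<alpha>1 * (4 * e1 - e2)" .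
  have "\<bar>4 * e1 - e2\<bar> <= 8 * G * (hh n)^2" using e by linarith
  then have "\<bar>\<alpha>1\<bar> * \<bar>4 * e1 - e2\<bar> <= \<bar>?A\<bar> * (8 * G * (hh n)^2)" using a by (intro mult_mono) auto
  then have "\<bar>?A\<bar> * \<bar>?X\<bar> <= \<bar>?A\<bar> * (8 * G * (hh n)^2)" by (simp only: abs_mult[symmetric] eq)
  then show ?thesis using A by simp
qed

lemma first_difference:
  assumes i: "i \<in> I" and j: "j \<in> {2..n}"
  shows "\<bar>(w i (gp n j) - w i (real (j-1) * hh n)) / hh n - w1 i (gp n j)\<bar> <= G * hh n"
proof -
  let ?x = "gp n j" and ?y = "real (j-1) * hh n"
  have h: "0 < hh n" by (rule hh_pos)
  have grid: "?x \<in> {0..1}" "?y \<in> {0..1}" using grid_in[of j n] grid_in[of "j-1" n] j by auto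
  have xy: "?y - ?x = - hh n" using j by (simp add: algebra_simps of_nat_diff)
  have "\<bar>w i ?y - w i ?x + hh n * w1 i ?x\<bar> <= G * (hh n)^2"
    using first_order[OF i grid] unfolding xy by simp
  then have "\<bar>w i ?y - w i ?x + hh n * w1 i ?x\<bar> / hh n <= G * (hh n)^2 / hh n" using h by (intro divide_right_mono) auto
  moreover have "(w i ?x - w i ?y) / hh n - w1 i ?x = - ((w i ?y - w i ?x + hh n * w1 i ?x) / hh n)"
    using h by (simp add: field_simps)
  moreover have "G * (hh n)^2 / hh n = G * hh n" using h by (simp add: power2_eq_square)
  ultimately show ?thesis using h by (simp add: abs_divide)
qed

abbreviation Rw :: "nat => 'i => nat => real" where "Rw n i \<equiv> %m. w i (gp n m)"

text \<open>Row 1 needs care only for its size: in the Dirichlet case \<open>Q0 n = 1 / h\<close> is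
  compensated by \<open>w i 0 = 0\<close> and the Lipschitz bound, which make
  \<open>w i (hh n)\<close> of order \<open>h\<close>. A bounded error in one row suffices.\<close>

lemma drift_consistent:
  "vanish I (%n i j. \<sigma> (gp n j) * (Dv n (Rw n i) j - w1 i (gp n j)))"
proof -
  obtain S where S: "0 <= S" "\<And>x. x \<in> {0..1} ==> \<bar>\<sigma> x\<bar> <= S" using pequi_bounded[OF pc_sigma] by auto
  define Bm where "Bm = max B 0"
  have Bm: "0 <= Bm" "B <= Bm" by (auto simp: Bm_def)
  have "\<exists>Q\<ge>0. \<forall>\<^sub>F n in sequentially. \<forall>i\<in>I. \<bar>Q0 n * w i (hh n)\<bar> <= Q"
  proof (cases "\<alpha>0 = 0")
    case True
    have "\<bar>Q0 n * w i (hh n)\<bar> <= Bm" if i: "i \<in> I" for n i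
    proof -
      have Q: "Q0 n = 1 / hh n" using True left_BC_nontrivial[OF True] by (simp add: q0_def)
      have w0: "w i 0 = 0" using bc0[OF i] True left_BC_nontrivial[OF True] by simp
      have h: "0 < hh n" by (rule hh_pos)
      have "\<bar>w i (hh n) - w i 0\<bar> <= B * \<bar>hh n - 0\<bar>" using hh_le[of n] h by (intro w_lip[OF i]) auto
      also have "\<dots> <= Bm * hh n" using Bm h by (simp add: mult_right_mono)
      finally show ?thesis unfolding Q w0 using h by (simp add: abs_mult pos_divide_le_eq)
    qed
    then show ?thesis using Bm by (intro exI[of _ Bm]) simp
  next
    case False
    define Q where "Q = (\<bar>\<beta>0 / \<alpha>0\<bar> + 1) * Bm"
    have "\<forall>\<^sub>F n in sequentially. \<forall>i\<in>I. \<bar>Q0 n * w i (hh n)\<bar> <= Q"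
      using Q0_bounded[OF False]
    proof eventually_elim
      case (elim n)
      show ?case
      proof
        fix i assume i: "i \<in> I"
        have "\<bar>w i (hh n)\<bar> <= Bm" using B(1)[OF i, of "hh n"] hh_le[of n] hh_pos[of n] Bm by auto
        then show "\<bar>Q0 n * w i (hh n)\<bar> <= Q" unfolding abs_mult Q_def using elim by (intro mult_mono) auto
      qed
    qed
    moreover have "0 <= Q" using Bm by (simp add: Q_def)
    ultimately show ?thesis by blast
  qed
  then obtain Q where Q: "0 <= Q" and ev: "\<forall>\<^sub>F n in sequentially. \<forall>i\<in>I. \<bar>Q0 n * w i (hh n)\<bar> <= Q" by (elim exE conjE) (rule that)
  define G' where "G' = max G 0"
  have G': "0 <= G'" "G <= G'" by (auto simp: G'_def)
  define C where "C = S * (Q + Bm + G')"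
  have v: "vanish I (%n i j. S * (G' * hh n))"
  proof (rule vanish_uniform[where c="%n. S * (G' * hh n)"])
    have "(%n. S * (G' * hh n)) \<longlonglongrightarrow> S * (G' * 0)" by (intro tendsto_intros hh_tendsto)
    then show "(%n. S * (G' * hh n)) \<longlonglongrightarrow> 0" by simp
  qed (use S G' hh_pos in \<open>auto simp: abs_mult less_imp_le\<close>)
  show ?thesis
  proof (rule vanish_ends[OF v, of C])
    show "0 <= C" using S Q Bm G' by (simp add: C_def)
    show "\<forall>\<^sub>F n in sequentially. \<forall>i\<in>I. \<forall>j\<in>{1..n}.
        \<bar>\<sigma> (gp n j) * (Dv n (Rw n i) j - w1 i (gp n j))\<bar> <= C \<and>
        (j \<noteq> 1 --> j \<noteq> n --> \<bar>\<sigma> (gp n j) * (Dv n (Rw n i) j - w1 i (gp n j))\<bar> <= \<bar>S * (G' * hh n)\<bar>)"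
      using ev
    proof eventually_elim
      case (elim n)
      show ?case
      proof (intro ballI)
        fix i j assume i: "i \<in> I" and j: "j \<in> {1..n}"
        have x: "gp n j \<in> {0..1}" using j by (intro grid_in) auto
        have h: "0 < hh n" "hh n <= 1" by (rule hh_pos, rule hh_le)
        let ?E = "\<bar>\<sigma> (gp n j) * (Dv n (Rw n i) j - w1 i (gp n j))\<bar>"
        have E: "?E <= S * c" if "\<bar>Dv n (Rw n i) j - w1 i (gp n j)\<bar> <= c" for c
          unfolding abs_mult using S x that by (intro mult_mono) auto
        show "?E <= C \<and> (j \<noteq> 1 --> j \<noteq> n --> ?E <= \<bar>S * (G' * hh n)\<bar>)"
        proof (cases "j = 1")
          case True
          have "\<bar>Dv n (Rw n i) j - w1 i (gp n j)\<bar> <= Q + Bm"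
            using elim i B(2)[OF i x] Bm True by (simp add: Dv_def) (smt (verit) Bm(2))
          then have "?E <= S * (Q + Bm)" by (rule E)
          also have "\<dots> <= C" unfolding C_def using S G' by (intro mult_left_mono) auto
          finally show ?thesis using True by simp
        next
          case False
          then have j2: "j \<in> {2..n}" using j by auto
          have "\<bar>Dv n (Rw n i) j - w1 i (gp n j)\<bar> <= G * hh n"
            using first_difference[OF i j2] False by (simp add: Dv_def)
          also have "\<dots> <= G' * hh n" using G' h by (intro mult_right_mono) auto
          finally have 1: "?E <= S * (G' * hh n)" by (rule E)
          also have "\<dots> <= C" unfolding C_def using S G' h Q Bm mult_left_le[of "hh n" G'] by (intro mult_left_mono) auto
          finally show ?thesis using 1 by simp
        qed
      qed
    qed
  qed
qed

text \<open>Here the error is uniform over the rows, since the integrand is continuous in the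
  integration variable with a modulus common to all rows and indices.\<close>

lemma volterra_consistent:
  "vanish I (%n i j. hh n * (\<Sum>m=1..j. \<phi> (gp n j) (gp n m) * w i (gp n m))
      - integral {0..gp n j} (%s. \<phi> (gp n j) s * w i s))"
proof (rule vanish_eps)
  fix e :: real assume e: "e > 0"
  obtain F where F: "0 <= F" "\<And>x y. x \<in> {0..1} ==> y \<in> {0..1} ==> \<bar>\<phi> x y\<bar> <= F" using phi_bounded by metis
  define Bm where "Bm = max B 0"
  have Bm: "0 <= Bm" "B <= Bm" by (auto simp: Bm_def)
  define e1 where "e1 = e / (2 * (Bm + 1))"
  have e1: "e1 > 0" using e Bm by (simp add: e1_def)
  obtain d1 where d1: "d1 > 0" "\<And>x y s t. x \<in> {0..1} ==> y \<in> {0..1} ==> s \<in> {0..1} ==> t \<in> {0..1} ==>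
      \<bar>x - y\<bar> < d1 ==> \<bar>s - t\<bar> < d1 ==> \<bar>\<phi> x s - \<phi> y t\<bar> < e1" using phi_uniform[OF e1] by metis
  define d where "d = min d1 (e / (2 * (F * Bm + 1)))"
  have p: "0 < F * Bm + 1" using F Bm by (simp add: add_nonneg_pos)
  have d: "d > 0" using d1 e p by (simp add: d_def)
  from hh_eventually_less[OF d]
  show "\<forall>\<^sub>F n in sequentially. \<forall>i\<in>I. \<forall>j\<in>{1..n}. \<bar>hh n * (\<Sum>m=1..j. \<phi> (gp n j) (gp n m) * w i (gp n m))
      - integral {0..gp n j} (%s. \<phi> (gp n j) s * w i s)\<bar> <= e"
  proof eventually_elim
    case (elim n)
    show ?case
    proof (intro ballI)
      fix i j assume i: "i \<in> I" and j: "j \<in> {1..n}"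
      let ?x = "gp n j"
      have x: "?x \<in> {0..1}" using j by (intro grid_in) auto
      have h: "0 < hh n" by (rule hh_pos)
      have "\<bar>integral {0..?x} (%s. \<phi> ?x s * w i s) - hh n * (\<Sum>m=1..j. \<phi> ?x (gp n m) * w i (gp n m))\<bar>
          <= hh n * (\<Sum>m=1..j. e)"
      proof (rule riemann_err[where a="%s. \<phi> ?x s * w i s", OF _ h])
        show "(%s. \<phi> ?x s * w i s) integrable_on {0..1}" by (rule volterra_integrable[OF x w_cont[OF i]]) auto
        show "?x <= 1" using x by simp
        fix m y assume m: "m \<in> {1..j}" and y: "y \<in> {gp n m - hh n..gp n m}"
        let ?z = "gp n m"
        have z: "?z \<in> {0..1}" using m j by (intro grid_in) auto
        have "hh n <= ?z" using m h by simp
        then have y1: "y \<in> {0..1}" using y z by auto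
        have yz: "\<bar>y - ?z\<bar> < d" "\<bar>y - ?z\<bar> <= hh n" using y elim by auto
        have "\<phi> ?x y * w i y - \<phi> ?x ?z * w i ?z = (\<phi> ?x y - \<phi> ?x ?z) * w i y + \<phi> ?x ?z * (w i y - w i ?z)"
          by (simp add: algebra_simps)
        then have "\<bar>\<phi> ?x y * w i y - \<phi> ?x ?z * w i ?z\<bar> <= \<bar>\<phi> ?x y - \<phi> ?x ?z\<bar> * \<bar>w i y\<bar> + \<bar>\<phi> ?x ?z\<bar> * \<bar>w i y - w i ?z\<bar>"
          by (simp add: abs_mult[symmetric])
        also have "\<dots> <= e1 * Bm + F * (Bm * \<bar>y - ?z\<bar>)"
        proof (intro add_mono mult_mono)
          show "\<bar>\<phi> ?x y - \<phi> ?x ?z\<bar> <= e1" using d1(2)[OF x x y1 z] yz d1(1) by (simp add: d_def)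
          show "\<bar>w i y\<bar> <= Bm" using B(1)[OF i y1] Bm by simp
          show "\<bar>\<phi> ?x ?z\<bar> <= F" by (rule F(2)[OF x z])
          have "\<bar>w i y - w i ?z\<bar> <= B * \<bar>y - ?z\<bar>" by (rule w_lip[OF i z y1])
          also have "\<dots> <= Bm * \<bar>y - ?z\<bar>" using Bm by (intro mult_right_mono) auto
          finally show "\<bar>w i y - w i ?z\<bar> <= Bm * \<bar>y - ?z\<bar>" .
        qed (use e1 F in auto)
        also have "e1 * Bm <= e / 2" using e Bm by (simp add: e1_def field_simps)
        also have "F * (Bm * \<bar>y - ?z\<bar>) <= e / 2"
        proof -
          have "F * (Bm * \<bar>y - ?z\<bar>) <= (F * Bm + 1) * \<bar>y - ?z\<bar>" by (simp add: algebra_simps)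
          also have "\<dots> <= (F * Bm + 1) * (e / (2 * (F * Bm + 1)))" using yz p by (intro mult_left_mono) (auto simp: d_def)
          also have "\<dots> = e / 2" using p by (simp add: field_simps)
          finally show ?thesis .
        qed
        finally show "\<bar>\<phi> ?x y * w i y - \<phi> ?x ?z * w i ?z\<bar> <= e" by simp
      qed
      also have "hh n * (\<Sum>m=1..j. e) = ?x * e" by simp
      also have "\<dots> <= 1 * e" using x e by (intro mult_right_mono) auto
      finally show "\<bar>hh n * (\<Sum>m=1..j. \<phi> ?x (gp n m) * w i (gp n m)) - integral {0..?x} (%s. \<phi> ?x s * w i s)\<bar> <= e"
        by (simp add: abs_minus_commute)
    qed
  qed
qed

definition bdry_val :: "'i => real" where "bdry_val i = \<alpha>1 * w1 i 1 + \<beta>1 * w i 1"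

text \<open>In interior rows the error is the oscillation of the second derivative. In the end rows
  the eliminated boundary value has error \<open>O(h^2)\<close>, hence the residual is only bounded,
  which \<open>vanish_ends\<close> tolerates.\<close>

lemma laplace_consistent:
  "vanish I (%n i j. \<theta> (gp n j) * (Lv n (Rw n i) j - g i (gp n j)) + Bvec \<theta> \<alpha>1 \<beta>1 n j * bdry_val i)"
proof -
  obtain Th where Th: "0 <= Th" "\<And>x. x \<in> {0..1} ==> \<bar>\<theta> x\<bar> <= Th" using pequi_bounded[OF pc_theta] by auto
  define G' where "G' = max G 0"
  have G': "0 <= G'" "G <= G'" by (auto simp: G'_def)
  have v: "vanish I (%n i j. (2 * Th) * osc (g i) (gp n j) (hh n))"
    by (rule vanish_dom[OF vanish_osc[OF g], of _ "2 * Th"]) (use Th in \<open>simp add: abs_mult\<close>)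
  \<comment> \<open>The 12 is 8 from the eliminated boundary value plus 4 from the second
    difference, whose error is twice an oscillation of at most \<open>2 G'\<close>.\<close>
  define C where "C = Th * (12 * G')"
  show ?thesis
  proof (rule vanish_ends[OF v, of C])
    show "0 <= C" using Th G' by (simp add: C_def)
    show "\<forall>\<^sub>F n in sequentially. \<forall>i\<in>I. \<forall>j\<in>{1..n}.
        \<bar>\<theta> (gp n j) * (Lv n (Rw n i) j - g i (gp n j)) + Bvec \<theta> \<alpha>1 \<beta>1 n j * bdry_val i\<bar> <= C \<and>
        (j \<noteq> 1 --> j \<noteq> n --> \<bar>\<theta> (gp n j) * (Lv n (Rw n i) j - g i (gp n j)) + Bvec \<theta> \<alpha>1 \<beta>1 n j * bdry_val i\<bar>
           <= \<bar>(2 * Th) * osc (g i) (gp n j) (hh n)\<bar>)"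
      using BC_coefficients eventually_ge_at_top[of 2]
    proof eventually_elim
      case (elim n)
      show ?case
      proof (intro ballI)
        fix i j assume i: "i \<in> I" and j: "j \<in> {1..n}"
        let ?x = "gp n j" and ?h = "hh n"
        \<comment> \<open>The input term, freed of \<open>\<theta>\<close>, is moved into the last
          row; \<open>?L\<close> then differs from the true second difference \<open>?D\<close> only
          by the error of the eliminated boundary value.\<close>
        let ?L = "Lv n (Rw n i) j + (if j = n then 2 * ?h / (3 * \<alpha>1 + 2 * ?h * \<beta>1) * bdry_val i / ?h^2 else 0)"
        let ?D = "(w i (?x + ?h) - 2 * w i ?x + w i (?x - ?h)) / ?h^2"
        let ?o = "osc (g i) ?x ?h"
        have h: "0 < ?h" by (rule hh_pos)
        have n: "2 <= n" by (rule elim)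
        have x: "?x \<in> {0..1}" using j by (intro grid_in) auto
        have xp: "?x + ?h = real (j + 1) * ?h" and xm: "?x - ?h = real (j - 1) * ?h"
          using j by (auto simp: algebra_simps of_nat_diff)
        have "j + 1 <= n + 1" "j - 1 <= n + 1" using j by auto
        from this[THEN grid_in] have x3: "?x + ?h \<in> {0..1}" "?x - ?h \<in> {0..1}" unfolding xp xm .
        have eq: "\<theta> ?x * (Lv n (Rw n i) j - g i ?x) + Bvec \<theta> \<alpha>1 \<beta>1 n j * bdry_val i = \<theta> ?x * (?L - g i ?x)"
          by (simp add: Bvec_def bn_def algebra_simps)
        have o: "0 <= ?o" "?o <= 2 * G'"
        proof -
          show "0 <= ?o" using osc_nonneg[of "g i" G ?x ?h] G[OF i] x h by auto
          show "?o <= 2 * G'"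
          proof (rule osc_le[OF x])
            fix y assume "y \<in> {0..1::real}"
            then show "\<bar>g i y - g i ?x\<bar> <= 2 * G'" using G[OF i, of y] G[OF i x] G' by linarith
          qed (use h in simp)
        qed
        have "\<bar>?h^2 * (?D - g i ?x)\<bar> <= ?h^2 * (2 * ?o)"
          using second_difference[OF i x x3(2,1) h] h by (simp add: right_diff_distrib mult_ac)
        then have D: "\<bar>?D - g i ?x\<bar> <= 2 * ?o" using h by (simp add: abs_mult)
        have L: "?L = ?D" if "j \<noteq> 1" "j \<noteq> n" using that xp xm by (simp add: Lv_def)
        have LD: "\<bar>?L - ?D\<bar> <= 8 * G'"
        proof -
          have gh: "8 * G * ?h^2 / ?h^2 <= 8 * G'" using h G' by simp
          consider "j = 1" | "j = n" "j \<noteq> 1" | "j \<noteq> 1" "j \<noteq> n" by blast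
          then show ?thesis
          proof cases
            case 1
            have "?L - ?D = (R0 n * (4 * w i ?h - w i (2 * ?h)) - w i 0) / ?h^2"
              using 1 n by (simp add: Lv_def diff_divide_distrib[symmetric] algebra_simps)
            moreover have "\<bar>(R0 n * (4 * w i ?h - w i (2 * ?h)) - w i 0) / ?h^2\<bar> <= 8 * G * ?h^2 / ?h^2"
              unfolding abs_divide abs_power2 using ghost_left[OF i _ conjunct1[OF elim(1)]] n by (intro divide_right_mono) auto
            ultimately show ?thesis using gh by linarith
          next
            case 2
            have one: "?x + ?h = 1" using 2 hh_mult[of n] by (simp add: algebra_simps)
            have "?L - ?D = (R1 n * (4 * w i (real n * ?h) - w i (real (n-1) * ?h)) - w i 1
                + 2 * ?h / (3 * \<alpha>1 + 2 * ?h * \<beta>1) * bdry_val i) / ?h^2"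
            proof -
              have id: "((4 * r - 2) * p + (1 - r) * q) / s + b / s - (c - 2 * p + q) / s = (r * (4 * p - q) - c + b) / s"
                for r p q s b c :: real
                by (simp only: add_divide_distrib[symmetric] diff_divide_distrib[symmetric]) (simp add: algebra_simps)
              have Lv_n: "Lv n (Rw n i) n = ((4 * R1 n - 2) * w i (real n * ?h) + (1 - R1 n) * w i (real (n-1) * ?h)) / ?h^2"
                using n by (simp add: Lv_def)
              show ?thesis unfolding one xm unfolding 2(1) Lv_n id[symmetric] by simp
            qed
            moreover have "\<bar>(R1 n * (4 * w i (real n * ?h) - w i (real (n-1) * ?h)) - w i 1
                + 2 * ?h / (3 * \<alpha>1 + 2 * ?h * \<beta>1) * bdry_val i) / ?h^2\<bar> <= 8 * G * ?h^2 / ?h^2"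
              unfolding abs_divide abs_power2 bdry_val_def using ghost_right[OF i n conjunct2[OF elim(1)]] by (intro divide_right_mono) auto
            ultimately show ?thesis using gh by linarith
          next
            case 3 then show ?thesis using L G' by simp
          qed
        qed
        have E: "\<bar>\<theta> ?x * (?L - g i ?x)\<bar> <= Th * c" if "\<bar>?L - g i ?x\<bar> <= c" for c
          unfolding abs_mult using Th x that by (intro mult_mono) auto
        have "\<bar>?L - g i ?x\<bar> <= 12 * G'" using LD D o by linarith
        then have 1: "\<bar>\<theta> ?x * (?L - g i ?x)\<bar> <= C" unfolding C_def by (rule E)
        have 2: "\<bar>\<theta> ?x * (?L - g i ?x)\<bar> <= \<bar>(2 * Th) * ?o\<bar>" if "j \<noteq> 1" "j \<noteq> n"
        proof -
          have "\<bar>\<theta> ?x * (?L - g i ?x)\<bar> <= Th * (2 * ?o)" using L[OF that] D by (intro E) simp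
          also have "\<dots> = \<bar>(2 * Th) * ?o\<bar>" using Th o by (simp add: abs_mult)
          finally show ?thesis .
        qed
        show "\<bar>\<theta> ?x * (Lv n (Rw n i) j - g i ?x) + Bvec \<theta> \<alpha>1 \<beta>1 n j * bdry_val i\<bar> <= C \<and>
          (j \<noteq> 1 --> j \<noteq> n --> \<bar>\<theta> ?x * (Lv n (Rw n i) j - g i ?x) + Bvec \<theta> \<alpha>1 \<beta>1 n j * bdry_val i\<bar> <= \<bar>(2 * Th) * ?o\<bar>)"
          unfolding eq using 1 2 by blast
      qed
    qed
  qed
qed

text \<open>The free right boundary value lets one statement serve both the lifting, with value 1,
  and elements of the domain, with value 0.\<close>

theorem consistency:
  "vanish I (%n i j. Pv n (Rw n i) j + Bvec \<theta> \<alpha>1 \<beta>1 n j * (\<alpha>1 * w1 i 1 + \<beta>1 * w i 1) - Pex (w i) (w1 i) (g i) (gp n j))"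
proof (rule vanish_dom[OF vanish_add[OF vanish_add[OF laplace_consistent drift_consistent] volterra_consistent], of _ 1])
  show "\<forall>\<^sub>F n in sequentially. \<forall>i\<in>I. \<forall>j\<in>{1..n}.
     \<bar>Pv n (Rw n i) j + Bvec \<theta> \<alpha>1 \<beta>1 n j * (\<alpha>1 * w1 i 1 + \<beta>1 * w i 1) - Pex (w i) (w1 i) (g i) (gp n j)\<bar>
     <= 1 * \<bar>\<theta> (gp n j) * (Lv n (Rw n i) j - g i (gp n j)) + Bvec \<theta> \<alpha>1 \<beta>1 n j * bdry_val i +
       \<sigma> (gp n j) * (Dv n (Rw n i) j - w1 i (gp n j)) +
       (hh n * (\<Sum>m=1..j. \<phi> (gp n j) (gp n m) * w i (gp n m))
        - integral {0..gp n j} (%s. \<phi> (gp n j) s * w i s))\<bar>"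
    using eventually_ge_at_top[of 2]
  proof eventually_elim
    case (elim n)
    show ?case
    proof (intro ballI)
      fix i j assume j: "j \<in> {1..n}"
      show "\<bar>Pv n (Rw n i) j + Bvec \<theta> \<alpha>1 \<beta>1 n j * (\<alpha>1 * w1 i 1 + \<beta>1 * w i 1) - Pex (w i) (w1 i) (g i) (gp n j)\<bar>
     <= 1 * \<bar>\<theta> (gp n j) * (Lv n (Rw n i) j - g i (gp n j)) + Bvec \<theta> \<alpha>1 \<beta>1 n j * bdry_val i +
       \<sigma> (gp n j) * (Dv n (Rw n i) j - w1 i (gp n j)) +
       (hh n * (\<Sum>m=1..j. \<phi> (gp n j) (gp n m) * w i (gp n m))
        - integral {0..gp n j} (%s. \<phi> (gp n j) s * w i s))\<bar>"
        unfolding Pv_eq[OF elim j] Pex_def bdry_val_def by (simp add: algebra_simps)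
    qed
  qed
qed

end

section \<open>Dissipativity of the continuous operator as a limit of the discrete
  inequality\<close>

lemma vanish_l1:
  assumes r: "vanish I r" and i: "i \<in> I"
  shows "(%n. hh n * (\<Sum>j=1..n. \<bar>r n i j\<bar>)) \<longlonglongrightarrow> 0"
proof (rule LIMSEQ_I)
  fix e :: real assume e: "0 < e"
  define d where "d = e / 4"
  have d: "d > 0" "d^2 > 0" using e by (auto simp: d_def)
  from vanishD[OF r d(2)]
  have "\<forall>\<^sub>F n in sequentially. norm (hh n * (\<Sum>j=1..n. \<bar>r n i j\<bar>) - 0) < e"
  proof eventually_elim
    case (elim n)
    have h: "0 < hh n" by (rule hh_pos)
    have "(\<Sum>j=1..n. \<bar>r n i j\<bar>) <= (\<Sum>j=1..n. d + (r n i j)^2 / d)"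
    proof (rule sum_mono)
      fix j
      have "0 <= (\<bar>r n i j\<bar> - d)^2" by simp
      then have "2 * (\<bar>r n i j\<bar> * d) <= (r n i j)^2 + d^2" by (simp add: power2_diff)
      moreover have "0 <= (r n i j)^2 + d^2" by simp
      ultimately have "\<bar>r n i j\<bar> * d <= d^2 + (r n i j)^2" by linarith
      then show "\<bar>r n i j\<bar> <= d + (r n i j)^2 / d" using d by (simp add: field_simps power2_eq_square)
    qed
    then have "hh n * (\<Sum>j=1..n. \<bar>r n i j\<bar>) <= hh n * (\<Sum>j=1..n. d + (r n i j)^2 / d)" using h by (intro mult_left_mono) auto
    also have "\<dots> = (gp n n) * d + (mean_sq n (r n i)) / d"
      by (simp add: sum.distrib sum_divide_distrib[symmetric] algebra_simps)
    also have "\<dots> <= 1 * d + d^2 / d"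
      using elim i d n_hh_le by (intro add_mono divide_right_mono mult_right_mono) auto
    also have "\<dots> < e" using e by (simp add: d_def power2_eq_square)
    finally have "hh n * (\<Sum>j=1..n. \<bar>r n i j\<bar>) < e" .
    moreover have "0 <= hh n * (\<Sum>j=1..n. \<bar>r n i j\<bar>)" using h by (intro mult_nonneg_nonneg sum_nonneg) auto
    ultimately show ?case by simp
  qed
  then show "\<exists>no. \<forall>n\<ge>no. norm (hh n * (\<Sum>j=1..n. \<bar>r n i j\<bar>) - 0) < e"
    by (simp add: eventually_sequentially)
qed

lemma deriv_unique_01:
  assumes "(f has_real_derivative a) (at x within {0..1})" "(f has_real_derivative b) (at x within {0..1})" "x \<in> {0..1::real}"
  shows "a = b"
  using vector_derivative_unique_within_closed_interval[of 0 1 x f a b] assms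
  by (simp add: has_real_derivative_iff_has_vector_derivative)

lemma L2norm_cont_zero:
  assumes c: "continuous_on {0..1} w" and z: "L2norm w = 0" and x: "x \<in> {0..1}"
  shows "w x = 0"
proof -
  have "continuous_on {0..1} (%x. (w x)^2)" using c by (intro continuous_intros)
  moreover have "integral\<^sup>L M01 (%x. (w x)^2) = 0" using z by (simp add: L2norm_def)
  moreover have "integral\<^sup>L M01 (%x. (w x)^2) = 0 \<longleftrightarrow> (\<forall>x\<in>{0..1}. (w x)^2 = 0)"
    by (rule integralL_eq_0_iff) (use calculation in auto)
  ultimately show ?thesis using x by auto
qed

context pide begin

text \<open>One constant for the discrete energy, for dissipativity, for the admissible resolvent
  parameters and for the growth of the semigroup.\<close>

definition Kd :: real where
  "Kd = (SOME K. K \<ge> 0 \<and> (\<forall>\<^sub>F n in sequentially. \<forall>v. (\<Sum>i=1..n. om n i * v i * Pv n v i) <= K * (\<Sum>i=1..n. om n i * (v i)^2)))"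

lemma Kd: "0 <= Kd" "\<forall>\<^sub>F n in sequentially. \<forall>v. (\<Sum>i=1..n. om n i * v i * Pv n v i) <= Kd * (\<Sum>i=1..n. om n i * (v i)^2)"
  using someI_ex[OF discrete_energy] unfolding Kd_def by blast+

definition wip :: "(real => real) => (real => real) => real" where
  "wip v w = L2inner v (%x. w x / \<theta> x)"

lemma inv_theta_pcont: "pcont (%x. 1 / \<theta> x)"
  by (rule pequi_inverse[OF pc_theta c0]) (use theta_ge in auto)

lemma pcont_div_theta: "pcont a ==> pcont (%x. a x / \<theta> x)"
  using pequi_mult[OF _ inv_theta_pcont, of "%_. a"] by simp

text \<open>The weights differ from \<open>1 / \<theta>\<close> only in the two end rows and by a
  bounded amount, so the difference from an ordinary Riemann sum is \<open>O(h)\<close>.\<close>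

lemma weighted_riemann:
  assumes a: "pcont a"
  shows "(%n. hh n * (\<Sum>j=1..n. om n j * a (gp n j))) \<longlonglongrightarrow> integral {0..1} (%x. a x / \<theta> x)"
proof -
  obtain A where A: "0 <= A" "\<And>x. x \<in> {0..1} ==> \<bar>a x\<bar> <= A" using pequi_bounded[OF a] by auto
  let ?d = "%n. hh n * (\<Sum>j=1..n. (om n j - 1 / \<theta> (gp n j)) * a (gp n j))"
  have "\<forall>\<^sub>F n in sequentially. norm (?d n) <= hh n * (2 * (A / c0))"
    using gw_bounds
  proof eventually_elim
    case (elim n)
    have h: "0 < hh n" by (rule hh_pos)
    have "\<bar>\<Sum>j=1..n. (om n j - 1 / \<theta> (gp n j)) * a (gp n j)\<bar>
       <= (\<Sum>j=1..n. (A / c0) * (if j = 1 then 1 else 0) + (A / c0) * (if j = n then 1 else 0))"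
    proof (rule order_trans[OF sum_abs sum_mono])
      fix j assume j: "j \<in> {1..n}"
      let ?x = "gp n j"
      have x: "?x \<in> {0..1}" using j by (intro grid_in) auto
      have t: "c0 <= \<theta> ?x" by (rule theta_ge[OF x])
      have A0: "0 <= A / c0" using A c0 by simp
      have eq: "om n j - 1 / \<theta> ?x = (gw n j - 1) / \<theta> ?x" by (simp add: om_def diff_divide_distrib)
      show "\<bar>(om n j - 1 / \<theta> ?x) * a ?x\<bar> <= (A / c0) * (if j = 1 then 1 else 0) + (A / c0) * (if j = n then 1 else 0)"
      proof (cases "j = 1 \<or> j = n")
        case True
        have "1/2 <= gw n j" "gw n j <= 2" using elim by auto
        then have "\<bar>gw n j - 1\<bar> <= 1" by linarith
        then have "\<bar>gw n j - 1\<bar> / \<theta> ?x <= 1 / c0" using t c0 by (intro frac_le) auto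
        then have "\<bar>(om n j - 1 / \<theta> ?x) * a ?x\<bar> <= 1 / c0 * A"
          unfolding eq abs_mult abs_divide using t c0 A(2)[OF x] by (intro mult_mono) auto
        also have "\<dots> <= (A / c0) * (if j = 1 then 1 else 0) + (A / c0) * (if j = n then 1 else 0)" using True A0 by auto
        finally show ?thesis .
      next
        case False
        then show ?thesis unfolding eq by (simp add: gw_def)
      qed
    qed
    also have "\<dots> = (A / c0) * (\<Sum>j=1..n. if j = 1 then 1 else 0) + (A / c0) * (\<Sum>j=1..n. if j = n then 1 else 0)"
      by (simp only: sum.distrib sum_distrib_left)
    also have "\<dots> <= (A / c0) * 1 + (A / c0) * 1"
      using A c0 by (intro add_mono mult_left_mono) auto
    also have "\<dots> = 2 * (A / c0)" by simp
    finally have "hh n * \<bar>\<Sum>j=1..n. (om n j - 1 / \<theta> (gp n j)) * a (gp n j)\<bar> <= hh n * (2 * (A / c0))"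
      using h by (intro mult_left_mono) auto
    then show ?case using h by (simp only: real_norm_def abs_mult abs_of_pos)
  qed
  moreover have "(%n. hh n * (2 * (A / c0))) \<longlonglongrightarrow> 0" by (rule tendsto_mult_left_zero[OF hh_tendsto])
  ultimately have d: "?d \<longlonglongrightarrow> 0" by (rule Lim_null_comparison)
  have r: "(%n. hh n * (\<Sum>j=1..n. a (gp n j) / \<theta> (gp n j))) \<longlonglongrightarrow> integral {0..1} (%x. a x / \<theta> x)"
    by (rule riemann_sum_tendsto[OF pcont_div_theta[OF a]])
  have "(%n. ?d n + hh n * (\<Sum>j=1..n. a (gp n j) / \<theta> (gp n j))) \<longlonglongrightarrow> 0 + integral {0..1} (%x. a x / \<theta> x)"
    by (rule tendsto_add[OF d r])
  moreover have "?d n + hh n * (\<Sum>j=1..n. a (gp n j) / \<theta> (gp n j)) = hh n * (\<Sum>j=1..n. om n j * a (gp n j))" for n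
    by (simp add: distrib_left[symmetric] sum.distrib[symmetric] algebra_simps)
  ultimately show ?thesis by simp
qed

lemma wip_integral: "pcont v ==> pcont w ==> wip v w = integral {0..1} (%x. v x * w x / \<theta> x)"
  unfolding wip_def by (subst L2inner_eq_integral) (auto intro: pcont_L2 pcont_div_theta)

lemma Pex_pcont:
  assumes w: "continuous_on {0..1} w" and w1: "continuous_on {0..1} w1" and g: "pcont g"
  shows "pcont (Pex w w1 g)"
proof -
  obtain B where B: "\<And>x. x \<in> {0..1} ==> \<bar>w x\<bar> <= B" using pequi_bounded[OF pcont_continuous[OF w]] by auto
  have v: "pcont (%x. integral {0..x} (%s. \<phi> x s * w s))"
    by (rule volterra_pequi(1)[where w="%_. w" and B=B]) (use w B in auto)
  show ?thesis unfolding Pex_def[abs_def]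
    by (intro pequi_add pequi_mult pc_theta pc_sigma pc_lam g v pcont_continuous w w1)
qed

lemma consistency_single:
  assumes dw: "\<And>x. x \<in> {0..1} ==> (w has_real_derivative w1 x) (at x within {0..1})"
    and dw1: "\<And>x. x \<in> {0..1} ==> w1 x = w1 0 + integral {0..x} g"
    and w1c: "continuous_on {0..1} w1" and g: "pcont g" and bc: "\<alpha>0 * w1 0 + \<beta>0 * w 0 = 0"
  shows "vanish {()} (%n _ j. Pv n (%m. w (gp n m)) j
    + Bvec \<theta> \<alpha>1 \<beta>1 n j * (\<alpha>1 * w1 1 + \<beta>1 * w 1) - Pex w w1 g (gp n j))"
proof -
  have wc: "continuous_on {0..1} w" using dw by (rule DERIV_continuous_on)
  obtain B1 where B1: "\<And>x. x \<in> {0..1} ==> \<bar>w x\<bar> <= B1" using pequi_bounded[OF pcont_continuous[OF wc]] by auto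
  obtain B2 where B2: "\<And>x. x \<in> {0..1} ==> \<bar>w1 x\<bar> <= B2" using pequi_bounded[OF pcont_continuous[OF w1c]] by auto
  obtain G where G: "\<And>x. x \<in> {0..1} ==> \<bar>g x\<bar> <= G" using pequi_bounded[OF g] by auto
  define B where "B = max B1 B2"
  have B: "\<bar>w x\<bar> <= B" "\<bar>w1 x\<bar> <= B" if "x \<in> {0..1}" for x
    using B1[OF that] B2[OF that] by (simp_all add: B_def le_max_iff_disj)
  interpret H: H2_family \<theta> \<sigma> lam \<phi> \<alpha>0 \<beta>0 \<alpha>1 \<beta>1 c0 "{()}" "%_. w" "%_. w1" "%_. g" B G
    by unfold_locales (erule dw dw1 B(1) B(2) G | rule g bc)+
  show ?thesis by (rule H.consistency)
qed

text \<open>The discrete energy inequality is tested with the grid values of \<open>w\<close>;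
  consistency replaces the matrix by the operator, and Riemann sums converge to the weighted inner
  products.\<close>

theorem dissipative:
  assumes dw: "\<And>x. x \<in> {0..1} ==> (w has_real_derivative w1 x) (at x within {0..1})"
    and dw1: "\<And>x. x \<in> {0..1} ==> w1 x = w1 0 + integral {0..x} g"
    and g: "pcont g" and bc: "\<alpha>0 * w1 0 + \<beta>0 * w 0 = 0" "\<alpha>1 * w1 1 + \<beta>1 * w 1 = 0"
  shows "wip w (Pex w w1 g) <= Kd * wip w w"
proof -
  have wc: "continuous_on {0..1} w" using dw by (rule DERIV_continuous_on)
  have "g integrable_on {0..1}" using L2_integrable_on(2)[OF pcont_L2[OF g]] by auto
  then have "continuous_on {0..1} (%x. w1 0 + integral {0..x} g)"
    by (intro continuous_intros indefinite_integral_continuous_1)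
  then have w1c: "continuous_on {0..1} w1" by (rule continuous_on_eq) (rule dw1[symmetric])
  obtain B where B: "0 <= B" "\<And>x. x \<in> {0..1} ==> \<bar>w x\<bar> <= B" using pequi_bounded[OF pcont_continuous[OF wc]] by auto
  let ?p = "Pex w w1 g" and ?x = "%n j. gp n j"
  have p: "pcont ?p" by (rule Pex_pcont[OF wc w1c g])
  define r where "r n j = Pv n (%m. w (?x n m)) j - ?p (?x n j)" for n j
  have vr: "vanish {()} (%n _ j. r n j)" using consistency_single[OF dw dw1 w1c g bc(1)] by (simp add: r_def bc(2))
  obtain cl cu where c: "0 < cl" "0 < cu" and ev_om: "\<forall>\<^sub>F n in sequentially. \<forall>i\<in>{1..n}. cl <= om n i \<and> om n i <= cu"
    using om_bounds by blast
  \<comment> \<open>The pairing of \<open>w\<close> with the consistency residual, which tends to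
    zero in the mean.\<close>
  let ?e = "%n. hh n * (\<Sum>j=1..n. om n j * w (?x n j) * r n j)"
  have e0: "?e \<longlonglongrightarrow> 0"
  proof (rule Lim_null_comparison)
    show "(%n. cu * B * (hh n * (\<Sum>j=1..n. \<bar>r n j\<bar>))) \<longlonglongrightarrow> 0"
      using tendsto_mult_right_zero[OF vanish_l1[OF vr, of "()"]] by simp
    show "\<forall>\<^sub>F n in sequentially. norm (?e n) <= cu * B * (hh n * (\<Sum>j=1..n. \<bar>r n j\<bar>))"
      using ev_om
    proof eventually_elim
      case (elim n)
      have "\<bar>\<Sum>j=1..n. om n j * w (?x n j) * r n j\<bar> <= (\<Sum>j=1..n. cu * B * \<bar>r n j\<bar>)"
      proof (rule order_trans[OF sum_abs sum_mono])
        fix j assume j: "j \<in> {1..n}"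
        have x: "?x n j \<in> {0..1}" using j by (intro grid_in) auto
        have "cl <= om n j \<and> om n j <= cu" using elim j by (rule bspec)
        then show "\<bar>om n j * w (?x n j) * r n j\<bar> <= cu * B * \<bar>r n j\<bar>"
          unfolding abs_mult using B(2)[OF x] c by (intro mult_right_mono mult_mono) auto
      qed
      also have "\<dots> = cu * B * (\<Sum>j=1..n. \<bar>r n j\<bar>)" by (simp only: sum_distrib_left)
      finally have "hh n * \<bar>\<Sum>j=1..n. om n j * w (?x n j) * r n j\<bar> <= hh n * (cu * B * (\<Sum>j=1..n. \<bar>r n j\<bar>))"
        using hh_pos[of n] by (intro mult_left_mono) auto
      then show ?case using hh_pos[of n] by (simp only: real_norm_def abs_mult abs_of_pos mult.left_commute)
    qed
  qed
  have l1: "(%n. hh n * (\<Sum>j=1..n. om n j * (w (?x n j) * ?p (?x n j))) + ?e n) \<longlonglongrightarrow> wip w ?p + 0"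
    unfolding wip_integral[OF pcont_continuous[OF wc] p]
    by (intro tendsto_add e0 weighted_riemann pequi_mult p pcont_continuous wc)
  have l2: "(%n. Kd * (hh n * (\<Sum>j=1..n. om n j * (w (?x n j) * w (?x n j))))) \<longlonglongrightarrow> Kd * wip w w"
    unfolding wip_integral[OF pcont_continuous[OF wc] pcont_continuous[OF wc]]
    by (intro tendsto_mult tendsto_const weighted_riemann pequi_mult pcont_continuous wc)
  have "wip w ?p + 0 <= Kd * wip w w"
  proof (rule tendsto_le[OF _ l2 l1])
    show "\<forall>\<^sub>F n in sequentially. hh n * (\<Sum>j=1..n. om n j * (w (?x n j) * ?p (?x n j))) + ?e n
       <= Kd * (hh n * (\<Sum>j=1..n. om n j * (w (?x n j) * w (?x n j))))"
      using Kd(2)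
    proof eventually_elim
      case (elim n)
      have "(\<Sum>j=1..n. om n j * (w (?x n j) * ?p (?x n j))) + (\<Sum>j=1..n. om n j * w (?x n j) * r n j)
          = (\<Sum>j=1..n. om n j * w (?x n j) * Pv n (%m. w (?x n m)) j)"
        unfolding sum.distrib[symmetric] by (rule sum.cong[OF refl]) (simp add: r_def algebra_simps)
      then have "hh n * (\<Sum>j=1..n. om n j * (w (?x n j) * ?p (?x n j))) + ?e n = hh n * (\<Sum>j=1..n. om n j * w (?x n j) * Pv n (%m. w (?x n m)) j)"
        by (simp only: distrib_left[symmetric])
      also have "\<dots> <= hh n * (Kd * (\<Sum>j=1..n. om n j * (w (?x n j))^2))"
        using elim[rule_format, of "%m. w (?x n m)"] hh_pos[of n] by (intro mult_left_mono) auto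
      finally show ?case by (simp add: power2_eq_square mult.left_commute)
    qed
  qed simp
  then show ?thesis by simp
qed

end

subsection \<open>Linear Volterra equations\<close>

lemma exp_integral_bound:
  fixes L x :: real
  assumes "0 < L" "0 <= x" shows "integral {0..x} (%y. exp (L * y)) <= exp (L * x) / L"
proof -
  have "((%y. exp (L * y)) has_integral exp (L * x) / L - exp (L * 0) / L) {0..x}"
    by (rule fundamental_theorem_of_calculus[where f="%y. exp (L * y) / L"])
       (use assms in \<open>auto intro!: derivative_eq_intros simp: has_real_derivative_iff_has_vector_derivative[symmetric]\<close>)
  then have "integral {0..x} (%y. exp (L * y)) = exp (L * x) / L - 1 / L" by (simp add: integral_unique)
  then show ?thesis using assms by simp
qed

text \<open>Causality is hidden in \<open>H_bound\<close>: together with linearity it makes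
  \<open>H p y\<close> depend only on \<open>p\<close> over \<open>[0,y]\<close>. The image
  \<open>H p\<close> need only be integrable, since the coefficients may jump.\<close>

locale volterra_op =
  fixes H :: "(real => real) => real => real" and M :: real
  assumes M: "0 <= M"
    and H_add: "\<And>p q y. continuous_on {0..1} p ==> continuous_on {0..1} q ==> y \<in> {0..1} ==> H (%x. p x + q x) y = H p y + H q y"
    and H_diff: "\<And>p q y. continuous_on {0..1} p ==> continuous_on {0..1} q ==> y \<in> {0..1} ==> H (%x. p x - q x) y = H p y - H q y"
    and H_bound: "\<And>p y c. continuous_on {0..1} p ==> y \<in> {0..1} ==> (\<And>s. s \<in> {0..y} ==> \<bar>p s\<bar> <= c) ==> \<bar>H p y\<bar> <= M * c"
    and H_int: "\<And>p. continuous_on {0..1} p ==> H p integrable_on {0..1}"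
begin

definition L :: real where "L = 2 * M + 1"

lemma L: "1 <= L" "M / L <= 1 / 2" using M by (auto simp: L_def field_simps)

lemma H_int': "continuous_on {0..1} p ==> x \<in> {0..1} ==> H p integrable_on {0..x}"
  by (rule integrable_on_subinterval[OF H_int]) auto

text \<open>Halving in the norm weighted by \<open>exp (- L x)\<close>, which makes the Neumann series converge on
  all of [0,1].\<close>

lemma contraction:
  assumes p: "continuous_on {0..1} p" and b: "\<And>s. s \<in> {0..1} ==> \<bar>p s\<bar> <= m * exp (L * s)" and x: "x \<in> {0..1}"
  shows "\<bar>integral {0..x} (H p)\<bar> <= m / 2 * exp (L * x)"
proof -
  have m: "0 <= m" using b[of 0] by simp
  have e: "(%y. exp (L * y)) integrable_on {0..x}" by (intro integrable_continuous_interval continuous_intros)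
  have "norm (integral {0..x} (H p)) <= integral {0..x} (%y. M * m * exp (L * y))"
  proof (rule integral_norm_bound_integral[OF H_int'[OF p x]])
    show "(%y. M * m * exp (L * y)) integrable_on {0..x}" using e by (rule integrable_on_mult_right)
    fix y assume y: "y \<in> {0..x}"
    have "\<bar>H p y\<bar> <= M * (m * exp (L * y))"
    proof (rule H_bound[OF p])
      fix s assume s: "s \<in> {0..y}"
      have "\<bar>p s\<bar> <= m * exp (L * s)" using b s y x by auto
      also have "\<dots> <= m * exp (L * y)" using s m L by (intro mult_left_mono) auto
      finally show "\<bar>p s\<bar> <= m * exp (L * y)" .
    qed (use y x in auto)
    then show "norm (H p y) <= M * m * exp (L * y)" by (simp add: mult.assoc)
  qed
  also have "\<dots> = M * m * integral {0..x} (%y. exp (L * y))" by simp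
  also have "\<dots> <= M * m * (exp (L * x) / L)" using exp_integral_bound[of L x] L x M m by (intro mult_left_mono) auto
  also have "\<dots> = (M / L) * (m * exp (L * x))" by simp
  also have "\<dots> <= 1 / 2 * (m * exp (L * x))" using L(2) m by (intro mult_right_mono) auto
  finally show ?thesis by simp
qed

text \<open>At a maximum point of the weighted modulus of \<open>p\<close> the contraction gives
  \<open>m <= Q + m / 2\<close>.\<close>

lemma solution_bound:
  assumes p: "continuous_on {0..1} p" and eq: "\<And>x. x \<in> {0..1} ==> p x = q x + integral {0..x} (H p)"
    and q: "\<And>x. x \<in> {0..1} ==> \<bar>q x\<bar> <= Q" and x: "x \<in> {0..1}"
  shows "\<bar>p x\<bar> <= 2 * Q * exp L"
proof -
  have "continuous_on {0..1} (%x. \<bar>p x\<bar> * exp (- (L * x)))" using p by (intro continuous_intros)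
  then obtain y where y: "y \<in> {0..1}" "\<And>x. x \<in> {0..1} ==> \<bar>p x\<bar> * exp (- (L * x)) <= \<bar>p y\<bar> * exp (- (L * y))"
    using continuous_attains_sup[of "{0..1}" "%x. \<bar>p x\<bar> * exp (- (L * x))"] by auto
  define m where "m = \<bar>p y\<bar> * exp (- (L * y))"
  have b: "\<bar>p s\<bar> <= m * exp (L * s)" if "s \<in> {0..1}" for s
    using y(2)[OF that] by (simp add: m_def exp_minus field_simps)
  have Q: "0 <= Q" using q[OF x] by linarith
  have e1: "1 <= exp (L * y)" using y L by simp
  have "\<bar>p y\<bar> <= \<bar>q y\<bar> + \<bar>integral {0..y} (H p)\<bar>" using eq[OF y(1)] by linarith
  also have "\<dots> <= Q + m / 2 * exp (L * y)" by (intro add_mono q y contraction[OF p b])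
  also have "\<dots> <= (Q + m / 2) * exp (L * y)" using e1 Q mult_left_mono[OF e1 Q] by (simp add: distrib_right)
  finally have "m <= Q + m / 2" by (simp add: m_def exp_minus field_simps)
  then have m: "m <= 2 * Q" by simp
  have "\<bar>p x\<bar> <= m * exp (L * x)" by (rule b[OF x])
  also have "\<dots> <= 2 * Q * exp L" using m x L Q by (intro mult_mono) auto
  finally show ?thesis .
qed

primrec neumann :: "(real => real) => nat => real => real" where
  "neumann q 0 = q"
| "neumann q (Suc k) = (%x. integral {0..x} (H (neumann q k)))"

lemma neumann_cont: "continuous_on {0..1} q ==> continuous_on {0..1} (neumann q k)"
  by (induction k) (auto intro: indefinite_integral_continuous_1 H_int)

lemma neumann_bound:
  assumes q: "continuous_on {0..1} q" and Q: "\<And>x. x \<in> {0..1} ==> \<bar>q x\<bar> <= Q" and x: "x \<in> {0..1}"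
  shows "\<bar>neumann q k x\<bar> <= Q / 2^k * exp (L * x)"
  using x
proof (induction k arbitrary: x)
  case 0
  have "0 <= Q" "1 <= exp (L * x)" using Q[OF 0] 0 L by auto
  then show ?case using Q[OF 0] mult_left_mono[of 1 "exp (L * x)" Q] by simp
next
  case (Suc k)
  have "\<bar>integral {0..x} (H (neumann q k))\<bar> <= Q / 2^k / 2 * exp (L * x)"
    by (rule contraction[OF neumann_cont[OF q] Suc.IH Suc.prems])
  then show ?case by simp
qed

lemma H_zero: assumes "y \<in> {0..1}" shows "H (%x. 0) y = 0"
  using H_add[of "%x. 0" "%x. 0" y] assms by simp

lemma H_sum: "continuous_on {0..1} q ==> y \<in> {0..1} ==> H (%x. \<Sum>k<N. neumann q k x) y = (\<Sum>k<N. H (neumann q k) y)"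
proof (induction N)
  case 0 then show ?case using H_zero by simp
next
  case (Suc N)
  have "continuous_on {0..1} (%x. \<Sum>k<N. neumann q k x)" by (intro continuous_on_sum neumann_cont Suc)
  then show ?case using Suc H_add[OF _ neumann_cont[OF Suc.prems(1)], of "%x. \<Sum>k<N. neumann q k x" y N] by simp
qed

text \<open>The Neumann series has the majorant \<open>Q * exp L * (1/2)^k\<close>; uniform
  convergence passes through \<open>H\<close> by \<open>H_bound\<close> applied to
  differences.\<close>

lemma solution_exists:
  assumes q: "continuous_on {0..1} q"
  shows "\<exists>p. continuous_on {0..1} p \<and> (\<forall>x\<in>{0..1}. p x = q x + integral {0..x} (H p))"
proof -
  obtain Q where Q: "\<And>x. x \<in> {0..1} ==> \<bar>q x\<bar> <= Q" using pequi_bounded[OF pcont_continuous[OF q]] by auto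
  have Q0: "0 <= Q" using Q[of 0] by fastforce
  let ?S = "%N x. \<Sum>k<N. neumann q k x"
  define p where "p x = (\<Sum>k. neumann q k x)" for x
  have ul: "uniform_limit {0..1} ?S p sequentially"
    unfolding p_def[abs_def]
  proof (rule Weierstrass_m_test)
    show "norm (neumann q k x) <= Q * exp L * (1/2)^k" if "x \<in> {0..1}" for k x
    proof -
      have "\<bar>neumann q k x\<bar> <= Q / 2^k * exp (L * x)" by (rule neumann_bound[OF q Q that])
      also have "\<dots> <= Q / 2^k * exp L" using that L Q0 by (intro mult_left_mono) auto
      finally show ?thesis by (simp add: power_one_over)
    qed
    show "summable (%k. Q * exp L * (1/2)^k)" by (intro summable_mult summable_geometric) simp
  qed
  have Sc: "continuous_on {0..1} (?S N)" for N by (intro continuous_on_sum neumann_cont q)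
  have pc: "continuous_on {0..1} p"
    by (rule uniform_limit_theorem[OF _ ul]) (use Sc in auto)
  have "p x = q x + integral {0..x} (H p)" if x: "x \<in> {0..1}" for x
  proof -
    have step: "?S (Suc N) x = q x + integral {0..x} (H (?S N))" for N
    proof -
      have "?S (Suc N) x = q x + (\<Sum>k<N. integral {0..x} (H (neumann q k)))"
        by (simp add: sum.lessThan_Suc_shift del: sum.lessThan_Suc)
      also have "(\<Sum>k<N. integral {0..x} (H (neumann q k))) = integral {0..x} (%y. \<Sum>k<N. H (neumann q k) y)"
        by (rule integral_sum[symmetric]) (auto intro: H_int' neumann_cont q x)
      also have "\<dots> = integral {0..x} (H (?S N))"
        by (rule Henstock_Kurzweil_Integration.integral_cong) (use H_sum[OF q] x in auto)
      finally show ?thesis .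
    qed
    have "(%N. ?S (Suc N) x) \<longlonglongrightarrow> q x + integral {0..x} (H p)"
      unfolding step
    proof (intro tendsto_intros LIMSEQ_I)
      fix r :: real assume r: "0 < r"
      then have "0 < r / (M + 1)" using M by simp
      from uniform_limitD[OF ul this] obtain N0 where N0': "\<forall>N\<ge>N0. \<forall>y\<in>{0..1}. dist (?S N y) (p y) < r / (M + 1)"
        unfolding eventually_sequentially by (elim exE) (rule that)
      note N0 = N0'[rule_format]
      have "norm (integral {0..x} (H (?S N)) - integral {0..x} (H p)) < r" if N: "N \<ge> N0" for N
      proof -
        have "integral {0..x} (H (?S N)) - integral {0..x} (H p) = integral {0..x} (%y. H (?S N) y - H p y)"
          by (rule Henstock_Kurzweil_Integration.integral_diff[symmetric]) (auto intro: H_int' Sc pc x)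
        also have "norm \<dots> <= integral {0..x} (%y. M * (r / (M + 1)))"
        proof (rule integral_norm_bound_integral)
          show "(%y. H (?S N) y - H p y) integrable_on {0..x}" by (intro integrable_diff H_int' Sc pc x)
          fix y assume "y \<in> {0..x}"
          then have y: "y \<in> {0..1}" using x by auto
          have "\<bar>H (%x. ?S N x - p x) y\<bar> <= M * (r / (M + 1))"
          proof (rule H_bound[OF _ y])
            show "continuous_on {0..1} (%x. ?S N x - p x)" by (intro continuous_intros Sc pc)
            show "\<bar>?S N s - p s\<bar> <= r / (M + 1)" if "s \<in> {0..y}" for s
              using N0[OF N, of s] that y by (auto simp: dist_real_def)
          qed
          then show "norm (H (?S N) y - H p y) <= M * (r / (M + 1))" using H_diff[OF Sc pc y] by simp
        qed auto
        also have "\<dots> = x * (M * (r / (M + 1)))" using x by simp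
        also have "\<dots> <= 1 * (M * (r / (M + 1)))" using x M r by (intro mult_right_mono) auto
        also have "\<dots> < r" using M r by (simp add: field_simps)
        finally show ?thesis .
      qed
      then show "\<exists>no. \<forall>n\<ge>no. norm (integral {0..x} (H (?S n)) - integral {0..x} (H p)) < r" by blast
    qed
    moreover have "(%N. ?S (Suc N) x) \<longlonglongrightarrow> p x"
      using tendsto_uniform_limitI[OF ul x] by (rule LIMSEQ_Suc)
    ultimately show ?thesis using LIMSEQ_unique by blast
  qed
  then show ?thesis using pc by blast
qed

end

section \<open>The resolvent equation: initial value problem, shooting, resolvents\<close>

lemma L2norm_mono:
  assumes "f \<in> L2" "g \<in> L2" "0 <= c" "\<And>x. x \<in> {0..1} ==> \<bar>f x\<bar> <= c * \<bar>g x\<bar>"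
  shows "L2norm f <= c * L2norm g"
proof -
  have "(LINT x|M01. (f x)^2) <= (LINT x|M01. c^2 * (g x)^2)"
  proof (rule integral_mono)
    show "(f x)^2 <= c^2 * (g x)^2" if "x \<in> space M01" for x
    proof -
      have "\<bar>f x\<bar>^2 <= (c * \<bar>g x\<bar>)^2" using assms(4)[of x] that by (intro power_mono) auto
      then show ?thesis by (simp add: power_mult_distrib)
    qed
  qed (use assms in \<open>auto simp: L2_def\<close>)
  also have "\<dots> = c^2 * (LINT x|M01. (g x)^2)" by simp
  finally have "sqrt (LINT x|M01. (f x)^2) <= sqrt (c^2 * (LINT x|M01. (g x)^2))" by (rule real_sqrt_le_mono)
  then show ?thesis using assms(3) by (simp add: L2norm_def real_sqrt_mult)
qed

context pide begin

text \<open>The second derivative that the equation \<open>\<kappa> w - P w = g\<close>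
  prescribes.\<close>

definition wpp :: "real => (real => real) => (real => real) => (real => real) => real => real" where
  "wpp \<kappa> g w w1 x = (\<kappa> * w x - g x - \<sigma> x * w1 x - lam x * w x - integral {0..x} (%s. \<phi> x s * w s)) / \<theta> x"

text \<open>Stated in integrated form because \<open>g\<close> is merely in \<open>L2\<close>. The
  boundary conditions are kept apart in \<open>BCs\<close>, so that solutions with prescribed
  initial data can be combined.\<close>

definition sol :: "real => (real => real) => (real => real) => (real => real) => bool" where
  "sol \<kappa> g w w1 \<longleftrightarrow> continuous_on {0..1} w1 \<and> (\<forall>x\<in>{0..1}. (w has_real_derivative w1 x) (at x within {0..1})) \<and>
     (\<forall>x\<in>{0..1}. w1 x = w1 0 + integral {0..x} (wpp \<kappa> g w w1))"

definition BCs :: "(real => real) => (real => real) => bool" where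
  "BCs w w1 \<longleftrightarrow> \<alpha>0 * w1 0 + \<beta>0 * w 0 = 0 \<and> \<alpha>1 * w1 1 + \<beta>1 * w 1 = 0"

lemma solD:
  assumes "sol \<kappa> g w w1"
  shows "continuous_on {0..1} w1" "x \<in> {0..1} ==> (w has_real_derivative w1 x) (at x within {0..1})"
    "x \<in> {0..1} ==> w1 x = w1 0 + integral {0..x} (wpp \<kappa> g w w1)"
  using assms unfolding sol_def by blast+

lemma sol_cont: assumes "sol \<kappa> g w w1" shows "continuous_on {0..1} w" "continuous_on {0..1} w1"
proof -
  show "continuous_on {0..1} w" by (rule DERIV_continuous_on) (rule solD(2)[OF assms])
qed (rule solD(1)[OF assms])

lemma volterra_cont: "continuous_on {0..1} w ==> continuous_on {0..1} (%x. integral {0..x} (%s. \<phi> x s * w s))"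
proof -
  assume w: "continuous_on {0..1} w"
  obtain B where B: "\<And>x. x \<in> {0..1} ==> \<bar>w x\<bar> <= B" using pequi_bounded[OF pcont_continuous[OF w]] by auto
  show ?thesis by (rule volterra_pequi(2)[where I="{()}" and w="%_. w" and B=B]) (use w B in auto)
qed

lemma div_theta_L2: assumes "w \<in> L2" shows "(%x. w x / \<theta> x) \<in> L2"
proof -
  obtain B where B: "\<And>x. x \<in> {0..1} ==> \<bar>1 / \<theta> x\<bar> <= B" using pequi_bounded[OF inv_theta_pcont] by auto
  have "(%x. 1 / \<theta> x * w x) \<in> L2" by (rule L2_mult_bounded[OF assms pcont_measurable[OF inv_theta_pcont] B])
  then show ?thesis by simp
qed

lemma div_theta_norm: assumes "w \<in> L2" shows "L2norm (%x. w x / \<theta> x) <= 1 / c0 * L2norm w"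
proof (rule L2norm_mono[OF div_theta_L2[OF assms] assms])
  fix x :: real assume x: "x \<in> {0..1}"
  have "\<bar>w x / \<theta> x\<bar> = \<bar>w x\<bar> / \<theta> x" using theta_pos[OF x] by (simp add: abs_divide)
  also have "\<dots> <= \<bar>w x\<bar> / c0" using theta_ge[OF x] c0 by (intro divide_left_mono) auto
  finally show "\<bar>w x / \<theta> x\<bar> <= 1 / c0 * \<bar>w x\<bar>" by simp
qed (use c0 in simp)

lemma pcont_prod_L2: "pcont a ==> continuous_on {0..1} w ==> (%x. a x * w x) \<in> L2"
  by (rule pcont_L2[OF pequi_mult[OF _ pcont_continuous]])

lemma wpp_L2:
  assumes "g \<in> L2" "continuous_on {0..1} w" "continuous_on {0..1} w1"
  shows "wpp \<kappa> g w w1 \<in> L2"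
  unfolding wpp_def[abs_def]
  by (rule div_theta_L2, rule L2_diff[OF L2_diff[OF L2_diff[OF L2_diff[OF
      L2_scale[OF L2_cont[OF assms(2)]] assms(1)]
      pcont_prod_L2[OF pc_sigma assms(3)]] pcont_prod_L2[OF pc_lam assms(2)]]
      L2_cont[OF volterra_cont[OF assms(2)]]])

lemma wpp_pcont:
  assumes "pcont g" "continuous_on {0..1} w" "continuous_on {0..1} w1"
  shows "pcont (wpp \<kappa> g w w1)"
  unfolding wpp_def[abs_def]
  by (rule pcont_div_theta, rule pequi_diff[OF pequi_diff[OF pequi_diff[OF pequi_diff[OF
      pcont_scale[OF pcont_continuous[OF assms(2)]] assms(1)]
      pequi_mult[OF pc_sigma pcont_continuous[OF assms(3)]]]
      pequi_mult[OF pc_lam pcont_continuous[OF assms(2)]]]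
      pcont_continuous[OF volterra_cont[OF assms(2)]]])

lemma wpp_lin:
  assumes "continuous_on {0..1} w" "continuous_on {0..1} w'" "y \<in> {0..1}"
  shows "wpp \<kappa> (%x. g x + c * g' x) (%x. w x + c * w' x) (%x. w1 x + c * w1' x) y = wpp \<kappa> g w w1 y + c * wpp \<kappa> g' w' w1' y"
proof -
  have i: "(%s. \<phi> y s * w s) integrable_on {0..y}" "(%s. \<phi> y s * w' s) integrable_on {0..y}"
    using assms by (auto intro: volterra_integrable)
  have "integral {0..y} (%s. \<phi> y s * (w s + c * w' s)) = integral {0..y} (%s. \<phi> y s * w s + c * (\<phi> y s * w' s))"
    by (simp add: algebra_simps)
  also have "\<dots> = integral {0..y} (%s. \<phi> y s * w s) + c * integral {0..y} (%s. \<phi> y s * w' s)"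
    using i by (subst Henstock_Kurzweil_Integration.integral_add) (auto intro: integrable_on_mult_right)
  finally have e: "integral {0..y} (%s. \<phi> y s * (w s + c * w' s)) = integral {0..y} (%s. \<phi> y s * w s) + c * integral {0..y} (%s. \<phi> y s * w' s)" .
  show ?thesis unfolding wpp_def e
    by (simp only: times_divide_eq_right add_divide_distrib[symmetric]) (simp add: algebra_simps)
qed

lemma sol_lin:
  assumes s: "sol \<kappa> g w w1" and s': "sol \<kappa> g' w' w1'" and g: "g \<in> L2" "g' \<in> L2"
  shows "sol \<kappa> (%x. g x + c * g' x) (%x. w x + c * w' x) (%x. w1 x + c * w1' x)"
  unfolding sol_def
proof (intro conjI ballI)
  note c = sol_cont[OF s] and c' = sol_cont[OF s']
  show "continuous_on {0..1} (%x. w1 x + c * w1' x)" by (intro continuous_intros c c')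
  fix x :: real assume x: "x \<in> {0..1}"
  have d: "(w has_real_derivative w1 x) (at x within {0..1})" "(w' has_real_derivative w1' x) (at x within {0..1})"
    by (rule solD(2)[OF s x], rule solD(2)[OF s' x])
  show "((%x. w x + c * w' x) has_real_derivative w1 x + c * w1' x) (at x within {0..1})"
    by (intro DERIV_add DERIV_cmult d)
  have i: "wpp \<kappa> g w w1 integrable_on {0..x}" "wpp \<kappa> g' w' w1' integrable_on {0..x}"
    by (rule L2_integrable_on(2)[OF wpp_L2[OF g(1) c]], use x in simp_all)
       (rule L2_integrable_on(2)[OF wpp_L2[OF g(2) c']], use x in simp_all)
  have "integral {0..x} (wpp \<kappa> (%x. g x + c * g' x) (%x. w x + c * w' x) (%x. w1 x + c * w1' x))
     = integral {0..x} (%y. wpp \<kappa> g w w1 y + c * wpp \<kappa> g' w' w1' y)"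
    by (rule Henstock_Kurzweil_Integration.integral_cong) (use wpp_lin[OF c(1) c'(1)] x in auto)
  also have "\<dots> = integral {0..x} (wpp \<kappa> g w w1) + c * integral {0..x} (wpp \<kappa> g' w' w1')"
    using i by (subst Henstock_Kurzweil_Integration.integral_add) (auto intro: integrable_on_mult_right)
  moreover have "w1 x = w1 0 + integral {0..x} (wpp \<kappa> g w w1)" "w1' x = w1' 0 + integral {0..x} (wpp \<kappa> g' w' w1')"
    by (rule solD(3)[OF s x], rule solD(3)[OF s' x])
  ultimately show "w1 x + c * w1' x = w1 0 + c * w1' 0 + integral {0..x} (wpp \<kappa> (%x. g x + c * g' x) (%x. w x + c * w' x) (%x. w1 x + c * w1' x))"
    by (simp add: algebra_simps)
qed

lemma BCs_lin: "BCs w w1 ==> BCs w' w1' ==> BCs (%x. w x + c * w' x) (%x. w1 x + c * w1' x)"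
proof -
  have e: "a * (u1 + c * v1) + b * (u + c * v) = (a * u1 + b * u) + c * (a * v1 + b * v)" for a b u u1 v v1 :: real
    by (simp add: algebra_simps)
  assume "BCs w w1" "BCs w' w1'"
  then show ?thesis unfolding BCs_def e by simp
qed

lemma wpp_homogeneous_bound:
  "\<exists>M\<ge>0. \<forall>w w1 y c. continuous_on {0..1} w --> y \<in> {0..1} --> (\<forall>s\<in>{0..y}. \<bar>w s\<bar> <= c) --> \<bar>w1 y\<bar> <= c -->
     \<bar>wpp \<kappa> (%_. 0) w w1 y\<bar> <= M * c"
proof -
  obtain S where S: "0 <= S" "\<And>x. x \<in> {0..1} ==> \<bar>\<sigma> x\<bar> <= S" using pequi_bounded[OF pc_sigma] by auto
  obtain L where L: "0 <= L" "\<And>x. x \<in> {0..1} ==> \<bar>lam x\<bar> <= L" using pequi_bounded[OF pc_lam] by auto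
  obtain F where F: "0 <= F" "\<And>x y. x \<in> {0..1} ==> y \<in> {0..1} ==> \<bar>\<phi> x y\<bar> <= F" using phi_bounded by metis
  define M where "M = (\<bar>\<kappa>\<bar> + S + L + F) / c0"
  have "\<bar>wpp \<kappa> (%_. 0) w w1 y\<bar> <= M * c"
    if w: "continuous_on {0..1} w" and y: "y \<in> {0..1}" and b: "\<forall>s\<in>{0..y}. \<bar>w s\<bar> <= c" and b1: "\<bar>w1 y\<bar> <= c" for w w1 y c
  proof -
    let ?N = "\<kappa> * w y - 0 - \<sigma> y * w1 y - lam y * w y - integral {0..y} (%s. \<phi> y s * w s)"
    have c: "0 <= c" using b1 by linarith
    have wy: "\<bar>w y\<bar> <= c" using b y by auto
    have "\<bar>integral {0..y} (%s. \<phi> y s * w s)\<bar> <= F * c" by (rule volterra_bound[OF F y w]) (use b in auto)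
    moreover have "\<bar>\<kappa> * w y\<bar> <= \<bar>\<kappa>\<bar> * c" unfolding abs_mult using wy by (intro mult_left_mono) auto
    moreover have "\<bar>\<sigma> y * w1 y\<bar> <= S * c" unfolding abs_mult using S y b1 by (intro mult_mono) auto
    moreover have "\<bar>lam y * w y\<bar> <= L * c" unfolding abs_mult using L y wy by (intro mult_mono) auto
    ultimately have N: "\<bar>?N\<bar> <= (\<bar>\<kappa>\<bar> + S + L + F) * c" by (simp add: distrib_right)
    have "\<bar>wpp \<kappa> (%_. 0) w w1 y\<bar> = \<bar>?N\<bar> / \<theta> y" unfolding wpp_def using theta_pos[OF y] by (simp add: abs_divide)
    also have "\<dots> <= ((\<bar>\<kappa>\<bar> + S + L + F) * c) / c0" using N theta_ge[OF y] c0 by (intro frac_le) auto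
    finally show ?thesis by (simp add: M_def)
  qed
  moreover have "0 <= M" using S L F c0 by (simp add: M_def)
  ultimately show ?thesis by blast
qed

text \<open>With \<open>w1\<close> as the unknown and \<open>w\<close> as its primitive, the second
  order equation becomes a linear Volterra equation. The bound involves \<open>g\<close> only
  through its \<open>L2\<close> norm, as the resolvent estimate requires.\<close>

lemma ivp:
  "\<exists>C\<ge>0. (\<forall>g\<in>L2. \<forall>a b. \<exists>w w1. sol \<kappa> g w w1 \<and> w 0 = a \<and> w1 0 = b) \<and>
     (\<forall>g\<in>L2. \<forall>w w1. sol \<kappa> g w w1 --> (\<forall>x\<in>{0..1}. \<bar>w x\<bar> <= C * (\<bar>w 0\<bar> + \<bar>w1 0\<bar> + L2norm g) \<and> \<bar>w1 x\<bar> <= C * (\<bar>w 0\<bar> + \<bar>w1 0\<bar> + L2norm g)))"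
proof -
  obtain M where M: "0 <= M" and Mb': "\<forall>w w1 y c. continuous_on {0..1} w --> y \<in> {0..1} --> (\<forall>s\<in>{0..y}. \<bar>w s\<bar> <= c) --> \<bar>w1 y\<bar> <= c -->
     \<bar>wpp \<kappa> (%_. 0) w w1 y\<bar> <= M * c" using wpp_homogeneous_bound[of \<kappa>] by (elim exE conjE) (rule that)
  note Mb = Mb'[rule_format]
  \<comment> \<open>\<open>W p\<close> recovers the function from its derivative \<open>p\<close>,
    and \<open>H p\<close> is the homogeneous right-hand side for zero initial value.\<close>
  define W where "W p s = integral {0..s} p" for p :: "real => real" and s :: real
  define H where "H p = wpp \<kappa> (%_. 0) (W p) p" for p
  have pint: "p integrable_on {0..s}" if "continuous_on {0..1} p" "s \<in> {0..1}" for p :: "real => real" and s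
    by (rule integrable_on_subinterval[OF integrable_continuous_interval[OF that(1)]]) (use that in auto)
  have Wd: "(W p has_real_derivative p x) (at x within {0..1})" if "continuous_on {0..1} p" "x \<in> {0..1}" for p x
    unfolding W_def[abs_def] by (rule integral_has_real_derivative[OF that])
  have Wc: "continuous_on {0..1} (W p)" if "continuous_on {0..1} p" for p
    using Wd[OF that] by (rule DERIV_continuous_on)
  have W_lin: "W (%x. p x + c * q x) s = W p s + c * W q s" if "continuous_on {0..1} p" "continuous_on {0..1} q" "s \<in> {0..1}" for p q c s
    unfolding W_def using pint[OF that(1,3)] pint[OF that(2,3)]
    by (subst Henstock_Kurzweil_Integration.integral_add) (auto intro: integrable_on_mult_right)
  have wpp_cong: "wpp \<kappa> g w w1 y = wpp \<kappa> g w' w1 y" if "\<And>s. s \<in> {0..1} ==> w s = w' s" "y \<in> {0..1}" for g w w' w1 y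
  proof -
    have "integral {0..y} (%s. \<phi> y s * w s) = integral {0..y} (%s. \<phi> y s * w' s)"
      by (rule Henstock_Kurzweil_Integration.integral_cong) (use that in auto)
    then show ?thesis using that by (simp add: wpp_def)
  qed
  have H_lin: "H (%x. p x + c * q x) y = H p y + c * H q y" if "continuous_on {0..1} p" "continuous_on {0..1} q" "y \<in> {0..1}" for p q c y
  proof -
    have "H (%x. p x + c * q x) y = wpp \<kappa> (%x. 0 + c * 0) (%s. W p s + c * W q s) (%x. p x + c * q x) y"
      unfolding H_def using wpp_cong[OF W_lin[OF that(1,2)] that(3)] by simp
    also have "\<dots> = H p y + c * H q y" unfolding H_def by (rule wpp_lin[OF Wc Wc]) (use that in auto)
    finally show ?thesis .
  qed
  have Wb: "\<bar>W p s\<bar> <= c" if p: "continuous_on {0..1} p" and s: "s \<in> {0..1}" and b: "\<And>r. r \<in> {0..s} ==> \<bar>p r\<bar> <= c" for p s c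
  proof -
    have c: "0 <= c" using b[of 0] s by fastforce
    have "norm (integral {0..s} p) <= integral {0..s} (%_. c)"
      by (rule integral_norm_bound_integral[OF pint[OF p s]]) (use b in auto)
    also have "\<dots> <= c" using s c by (simp add: mult_left_le mult.commute)
    finally show ?thesis by (simp add: W_def)
  qed
  interpret V: volterra_op H M
  proof
    show "0 <= M" by (rule M)
    show "H (%x. p x + q x) y = H p y + H q y" if "continuous_on {0..1} p" "continuous_on {0..1} q" "y \<in> {0..1}" for p q y
      using H_lin[OF that, of 1] by simp
    show "H (%x. p x - q x) y = H p y - H q y" if "continuous_on {0..1} p" "continuous_on {0..1} q" "y \<in> {0..1}" for p q y
      using H_lin[OF that, of "-1"] by simp
    show "H p integrable_on {0..1}" if "continuous_on {0..1} p" for p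
      unfolding H_def by (intro L2_integrable_on(2) wpp_L2 Wc L2_zero that) auto
    show "\<bar>H p y\<bar> <= M * c" if p: "continuous_on {0..1} p" and y: "y \<in> {0..1}" and b: "\<And>s. s \<in> {0..y} ==> \<bar>p s\<bar> <= c" for p y c
      unfolding H_def
    proof (rule Mb[OF Wc[OF p] y])
      fix s assume "s \<in> {0..y}"
      then show "\<bar>W p s\<bar> <= c" using y b by (intro Wb[OF p]) auto
    qed (use b y in auto)
  qed
  \<comment> \<open>The forcing collects what does not depend on the unknown: the initial slope
    \<open>b\<close>, the constant initial value \<open>a\<close> fed into the equation, and
    \<open>g\<close>.\<close>
  define q where "q g a b x = b + integral {0..x} (wpp \<kappa> g (%_. a) (%_. 0))" for g a b x
  have wa: "wpp \<kappa> g (%_. a) (%_. 0) integrable_on {0..x}" if "g \<in> L2" "x \<in> {0..1}" for g a x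
    using that by (intro L2_integrable_on(2) wpp_L2) auto
  have split: "wpp \<kappa> g (%s. a + W p s) p y = wpp \<kappa> g (%_. a) (%_. 0) y + H p y" if "continuous_on {0..1} p" "y \<in> {0..1}" for g a p y
    using wpp_lin[OF continuous_on_const Wc[OF that(1)] that(2), of \<kappa> g 1 "%_. 0" a "%_. 0" p] by (simp add: H_def)
  have isplit: "integral {0..x} (wpp \<kappa> g (%s. a + W p s) p) = integral {0..x} (wpp \<kappa> g (%_. a) (%_. 0)) + integral {0..x} (H p)"
    if "continuous_on {0..1} p" "x \<in> {0..1}" "g \<in> L2" for g a p x
  proof -
    have "integral {0..x} (wpp \<kappa> g (%s. a + W p s) p) = integral {0..x} (%y. wpp \<kappa> g (%_. a) (%_. 0) y + H p y)"
      by (rule Henstock_Kurzweil_Integration.integral_cong) (use split[OF that(1)] that(2) in auto)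
    also have "\<dots> = integral {0..x} (wpp \<kappa> g (%_. a) (%_. 0)) + integral {0..x} (H p)"
      by (rule Henstock_Kurzweil_Integration.integral_add[OF wa[OF that(3,2)] V.H_int'[OF that(1,2)]])
    finally show ?thesis .
  qed
  have ex: "\<exists>w w1. sol \<kappa> g w w1 \<and> w 0 = a \<and> w1 0 = b" if g: "g \<in> L2" for g a b
  proof -
    have "continuous_on {0..1} (q g a b)" unfolding q_def[abs_def]
      by (intro continuous_intros indefinite_integral_continuous_1 wa[OF g]) auto
    from V.solution_exists[OF this] obtain p where p: "continuous_on {0..1} p" and eq: "\<forall>x\<in>{0..1}. p x = q g a b x + integral {0..x} (H p)"
      by (elim exE conjE) (rule that)
    have p0: "p 0 = b" using eq by (simp add: q_def)
    have "sol \<kappa> g (%s. a + W p s) p" unfolding sol_def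
    proof (intro conjI ballI p)
      fix x :: real assume x: "x \<in> {0..1}"
      show "((%s. a + W p s) has_real_derivative p x) (at x within {0..1})"
        using DERIV_add[OF DERIV_const Wd[OF p x], of a] by simp
      have "p x = q g a b x + integral {0..x} (H p)" using eq x by (rule bspec)
      then show "p x = p 0 + integral {0..x} (wpp \<kappa> g (%s. a + W p s) p)"
        unfolding isplit[OF p x g] p0 q_def by simp
    qed
    moreover have "a + W p 0 = a" by (simp add: W_def)
    ultimately show ?thesis using p0 by blast
  qed
  \<comment> \<open>One for the initial slope, \<open>M\<close> for the initial value and
    \<open>1 / c0\<close> for the integral of \<open>g / \<theta>\<close>.\<close>
  define K where "K = 1 + M + 1 / c0"
  have K: "1 <= K" using M c0 by (simp add: K_def)
  define C where "C = 1 + 2 * K * exp V.L"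
  have C: "0 <= C" using K by (simp add: C_def)
  have bd: "\<bar>w x\<bar> <= C * (\<bar>w 0\<bar> + \<bar>w1 0\<bar> + L2norm g) \<and> \<bar>w1 x\<bar> <= C * (\<bar>w 0\<bar> + \<bar>w1 0\<bar> + L2norm g)"
    if g: "g \<in> L2" and s: "sol \<kappa> g w w1" and x: "x \<in> {0..1}" for g w w1 x
  proof -
    note c = sol_cont[OF s]
    define m where "m = \<bar>w 0\<bar> + \<bar>w1 0\<bar> + L2norm g"
    have m: "0 <= m" "\<bar>w 0\<bar> <= m" "\<bar>w1 0\<bar> <= m" "L2norm g <= m" using L2norm_nonneg[of g] by (auto simp: m_def)
    have dw: "(w has_real_derivative w1 y) (at y within {0..1})" if "y \<in> {0..1}" for y by (rule solD(2)[OF s that])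
    have ww: "w y = w 0 + W w1 y" if y: "y \<in> {0..1}" for y
    proof -
      have "(w1 has_integral w y - w 0) {0..y}"
      proof (rule fundamental_theorem_of_calculus)
        fix z assume z: "z \<in> {0..y}"
        have "(w has_real_derivative w1 z) (at z within {0..y})"
          by (rule DERIV_subset[OF dw]) (use z y in auto)
        then show "(w has_vector_derivative w1 z) (at z within {0..y})"
          by (simp add: has_real_derivative_iff_has_vector_derivative)
      qed (use y in auto)
      then show ?thesis by (simp add: W_def integral_unique)
    qed
    have eq: "w1 y = q g (w 0) (w1 0) y + integral {0..y} (H w1)" if y: "y \<in> {0..1}" for y
    proof -
      have "w1 y = w1 0 + integral {0..y} (wpp \<kappa> g w w1)" by (rule solD(3)[OF s y])
      also have "integral {0..y} (wpp \<kappa> g w w1) = integral {0..y} (wpp \<kappa> g (%s. w 0 + W w1 s) w1)"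
        by (rule Henstock_Kurzweil_Integration.integral_cong) (use wpp_cong[OF ww] y in auto)
      finally show ?thesis unfolding isplit[OF c(2) y g] q_def by simp
    qed
    have qb: "\<bar>q g (w 0) (w1 0) y\<bar> <= K * m" if y: "y \<in> {0..1}" for y
    proof -
      have gL: "(%z. g z / \<theta> z) \<in> L2" by (rule div_theta_L2[OF g])
      have i1: "wpp \<kappa> (%_. 0) (%_. w 0) (%_. 0) integrable_on {0..y}" by (rule wa[OF L2_zero y])
      have i2: "(%z. g z / \<theta> z) integrable_on {0..y}" using y by (intro L2_integrable_on(2)[OF gL]) auto
      have "integral {0..y} (wpp \<kappa> g (%_. w 0) (%_. 0)) = integral {0..y} (%z. wpp \<kappa> (%_. 0) (%_. w 0) (%_. 0) z - g z / \<theta> z)"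
        by (rule Henstock_Kurzweil_Integration.integral_cong) (simp add: wpp_def diff_divide_distrib)
      also have "\<dots> = integral {0..y} (wpp \<kappa> (%_. 0) (%_. w 0) (%_. 0)) - integral {0..y} (%z. g z / \<theta> z)"
        by (rule Henstock_Kurzweil_Integration.integral_diff[OF i1 i2])
      finally have e: "integral {0..y} (wpp \<kappa> g (%_. w 0) (%_. 0)) = integral {0..y} (wpp \<kappa> (%_. 0) (%_. w 0) (%_. 0)) - integral {0..y} (%z. g z / \<theta> z)" .
      have "norm (integral {0..y} (wpp \<kappa> (%_. 0) (%_. w 0) (%_. 0))) <= integral {0..y} (%_. M * m)"
      proof (rule integral_norm_bound_integral[OF i1])
        fix z assume "z \<in> {0..y}"
        then show "norm (wpp \<kappa> (%_. 0) (%_. w 0) (%_. 0) z) <= M * m"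
          unfolding real_norm_def using y m by (intro Mb) auto
      qed auto
      also have "\<dots> = y * (M * m)" using y by simp
      also have "\<dots> <= 1 * (M * m)" using y M m by (intro mult_right_mono mult_nonneg_nonneg) auto
      finally have 1: "\<bar>integral {0..y} (wpp \<kappa> (%_. 0) (%_. w 0) (%_. 0))\<bar> <= M * m" by simp
      have "\<bar>integral {0..y} (%z. g z / \<theta> z)\<bar> <= L2norm (%z. g z / \<theta> z)"
        using y by (intro L2_integral_bound[OF gL]) auto
      also have "\<dots> <= 1 / c0 * L2norm g" by (rule div_theta_norm[OF g])
      also have "\<dots> <= 1 / c0 * m" using m c0 by (intro mult_left_mono) auto
      finally have 2: "\<bar>integral {0..y} (%z. g z / \<theta> z)\<bar> <= 1 / c0 * m" .
      have "\<bar>q g (w 0) (w1 0) y\<bar> <= m + (M * m + 1 / c0 * m)" unfolding q_def e using 1 2 m(3) by linarith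
      also have "\<dots> = K * m" by (simp add: K_def distrib_right)
      finally show ?thesis .
    qed
    have b1: "\<bar>w1 y\<bar> <= 2 * (K * m) * exp V.L" if "y \<in> {0..1}" for y
      by (rule V.solution_bound[OF c(2) eq qb that])
    have b0: "\<bar>W w1 x\<bar> <= 2 * (K * m) * exp V.L"
      by (rule Wb[OF c(2) x]) (use b1 x in auto)
    have "2 * (K * m) * exp V.L + m = C * m" by (simp add: C_def algebra_simps)
    then show ?thesis unfolding m_def[symmetric] using b0 b1[OF x] ww[OF x] m by linarith
  qed
  show ?thesis using C ex bd by blast
qed

text \<open>For \<open>g = 0\<close> the operator multiplies \<open>w\<close> by
  \<open>\<kappa>\<close>, so dissipativity gives
  \<open>(\<kappa> - Kd) * wip w w <= 0\<close>.\<close>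

lemma energy_zero:
  assumes \<kappa>: "Kd < \<kappa>" and s: "sol \<kappa> (%_. 0) w w1" and bc: "BCs w w1" and x: "x \<in> {0..1}"
  shows "w x = 0" "w1 x = 0"
proof -
  note c = sol_cont[OF s]
  have p: "pcont (wpp \<kappa> (%_. 0) w w1)" by (rule wpp_pcont[OF pequi_zero c])
  note d = solD(2)[OF s]
  have "wip w (Pex w w1 (wpp \<kappa> (%_. 0) w w1)) <= Kd * wip w w"
    by (rule dissipative[OF d solD(3)[OF s] p]) (use bc in \<open>simp_all add: BCs_def\<close>)
  moreover have "wip w (Pex w w1 (wpp \<kappa> (%_. 0) w w1)) = wip w (%x. \<kappa> * w x)"
    unfolding wip_def
  proof (rule L2inner_cong)
    fix x :: real assume x: "x \<in> {0..1}"
    show "Pex w w1 (wpp \<kappa> (%_. 0) w w1) x / \<theta> x = \<kappa> * w x / \<theta> x"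
      using theta_pos[OF x] by (simp add: Pex_def wpp_def)
  qed simp
  moreover have "wip w (%x. \<kappa> * w x) = \<kappa> * wip w w"
    unfolding wip_def by (simp add: L2inner_scale_right[symmetric])
  ultimately have "(\<kappa> - Kd) * wip w w <= 0" by (simp add: left_diff_distrib)
  then have le: "wip w w <= 0" using \<kappa> by (simp add: mult_le_0_iff)
  obtain B where B: "0 <= B" "\<And>x. x \<in> {0..1} ==> \<bar>\<theta> x\<bar> <= B" using pequi_bounded[OF pc_theta] by auto
  have cw: "continuous_on {0..1} (%x. w x * w x)" by (intro continuous_intros c)
  have i1: "(%x. w x * w x) integrable_on {0..1}" by (rule integrable_continuous_interval[OF cw])
  have pq: "pcont (%x. w x * w x / \<theta> x)" by (rule pcont_div_theta[OF pcont_continuous[OF cw]])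
  have i2: "(%x. w x * w x / \<theta> x) integrable_on {0..1}" using L2_integrable_on(2)[OF pcont_L2[OF pq]] by auto
  have "integral {0..1} (%x. w x * w x) <= integral {0..1} (%x. B * (w x * w x / \<theta> x))"
  proof (rule integral_le[OF i1 integrable_on_mult_right[OF i2]])
    fix x :: real assume x: "x \<in> {0..1}"
    have "w x * w x * \<theta> x <= w x * w x * B" using B(2)[OF x] by (intro mult_left_mono) auto
    then show "w x * w x <= B * (w x * w x / \<theta> x)" using theta_pos[OF x] by (simp add: pos_le_divide_eq mult.commute)
  qed
  also have "\<dots> = B * wip w w" unfolding wip_integral[OF pcont_continuous[OF c(1)] pcont_continuous[OF c(1)]]
    by (rule integral_mult_right)
  also have "\<dots> <= 0" using B le by (simp add: mult_nonneg_nonpos)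
  finally have "L2inner w w <= 0" using L2inner_eq_integral[OF L2_cont[OF c(1)] L2_cont[OF c(1)]] by simp
  then have "(L2norm w)^2 <= 0" by (simp add: L2norm_power2)
  then have n: "L2norm w = 0" by simp
  have w0: "w y = 0" if "y \<in> {0..1}" for y by (rule L2norm_cont_zero[OF c(1) n that])
  show "w x = 0" by (rule w0[OF x])
  have "((%_. 0) has_real_derivative w1 x) (at x within {0..1})"
    by (rule has_field_derivative_transform_within[OF d[OF x], of 1]) (use w0 x in simp_all)
  then show "w1 x = 0" by (rule deriv_unique_01) (use x in auto)
qed

text \<open>The right-hand side enters only through integrals, so changing it on a null set is
  harmless; uniqueness can therefore be stated up to \<open>L2eq\<close>.\<close>

lemma sol_AE:
  assumes s: "sol \<kappa> d u u1" and d: "d \<in> L2" "L2norm d = 0"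
  shows "sol \<kappa> (%_. 0) u u1"
  unfolding sol_def
proof (intro conjI ballI)
  note c = sol_cont[OF s]
  show "continuous_on {0..1} u1" by (rule c)
  fix x :: real assume x: "x \<in> {0..1}"
  show "(u has_real_derivative u1 x) (at x within {0..1})" by (rule solD(2)[OF s x])
  have dL: "(%z. d z / \<theta> z) \<in> L2" by (rule div_theta_L2[OF d(1)])
  have i1: "wpp \<kappa> (%_. 0) u u1 integrable_on {0..x}" using x by (intro L2_integrable_on(2) wpp_L2 L2_zero c) auto
  have i2: "(%z. d z / \<theta> z) integrable_on {0..x}" using x by (intro L2_integrable_on(2)[OF dL]) auto
  have "integral {0..x} (wpp \<kappa> d u u1) = integral {0..x} (%z. wpp \<kappa> (%_. 0) u u1 z - d z / \<theta> z)"
    by (rule Henstock_Kurzweil_Integration.integral_cong) (simp add: wpp_def diff_divide_distrib)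
  also have "\<dots> = integral {0..x} (wpp \<kappa> (%_. 0) u u1) - integral {0..x} (%z. d z / \<theta> z)"
    by (rule Henstock_Kurzweil_Integration.integral_diff[OF i1 i2])
  finally have e: "integral {0..x} (wpp \<kappa> d u u1) = integral {0..x} (wpp \<kappa> (%_. 0) u u1) - integral {0..x} (%z. d z / \<theta> z)" .
  have "\<bar>integral {0..x} (%z. d z / \<theta> z)\<bar> <= L2norm (%z. d z / \<theta> z)"
    using x by (intro L2_integral_bound[OF dL]) auto
  also have "\<dots> <= 1 / c0 * L2norm d" by (rule div_theta_norm[OF d(1)])
  finally have "integral {0..x} (%z. d z / \<theta> z) = 0" using d(2) by simp
  then show "u1 x = u1 0 + integral {0..x} (wpp \<kappa> (%_. 0) u u1)" using solD(3)[OF s x] e by simp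
qed

lemma sol_unique:
  assumes \<kappa>: "Kd < \<kappa>" and s: "sol \<kappa> g w w1" "BCs w w1" and s': "sol \<kappa> g' w' w1'" "BCs w' w1'"
    and g: "g \<in> L2" "g' \<in> L2" "L2eq g g'" and x: "x \<in> {0..1}"
  shows "w x = w' x" "w1 x = w1' x"
proof -
  have a: "sol \<kappa> (%x. g x + (-1) * g' x) (%x. w x + (-1) * w' x) (%x. w1 x + (-1) * w1' x)"
    by (rule sol_lin[OF s(1) s'(1) g(1,2)])
  have "sol \<kappa> (%_. 0) (%x. w x + (-1) * w' x) (%x. w1 x + (-1) * w1' x)"
    by (rule sol_AE[OF a]) (use g L2_diff[OF g(1,2)] in \<open>simp_all add: L2eq_def\<close>)
  from energy_zero[OF \<kappa> this BCs_lin[OF s(2) s'(2)] x]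
  show "w x = w' x" "w1 x = w1' x" by simp_all
qed

text \<open>Linear shooting: the solution \<open>V\<close> with zero initial data is corrected by a
  multiple of a homogeneous solution \<open>W\<close> satisfying the left condition, so as to meet
  the right one.\<close>

lemma resolvent_exists:
  assumes \<kappa>: "Kd < \<kappa>"
  shows "\<exists>C\<ge>0. \<forall>g\<in>L2. \<exists>w w1. sol \<kappa> g w w1 \<and> BCs w w1 \<and> (\<forall>x\<in>{0..1}. \<bar>w x\<bar> <= C * L2norm g \<and> \<bar>w1 x\<bar> <= C * L2norm g)"
proof -
  obtain C0 where C0: "0 <= C0" and ex: "\<forall>g\<in>L2. \<forall>a b. \<exists>w w1. sol \<kappa> g w w1 \<and> w 0 = a \<and> w1 0 = b"
    and bd': "\<forall>g\<in>L2. \<forall>w w1. sol \<kappa> g w w1 --> (\<forall>x\<in>{0..1}. \<bar>w x\<bar> <= C0 * (\<bar>w 0\<bar> + \<bar>w1 0\<bar> + L2norm g) \<and> \<bar>w1 x\<bar> <= C0 * (\<bar>w 0\<bar> + \<bar>w1 0\<bar> + L2norm g))"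
    using ivp[of \<kappa>] by (elim exE conjE) (rule that)
  have bd: "\<bar>w x\<bar> <= C0 * (\<bar>w 0\<bar> + \<bar>w1 0\<bar> + L2norm g)" "\<bar>w1 x\<bar> <= C0 * (\<bar>w 0\<bar> + \<bar>w1 0\<bar> + L2norm g)"
    if "g \<in> L2" "sol \<kappa> g w w1" "x \<in> {0..1}" for g w w1 x
    using bd'[THEN bspec, OF that(1), THEN spec, THEN spec, THEN mp, OF that(2), THEN bspec, OF that(3)] by auto
  \<comment> \<open>Initial data \<open>(\<alpha>0, - \<beta>0)\<close> span the solutions of the
    left boundary condition.\<close>
  obtain W W1 where W: "sol \<kappa> (%_. 0) W W1" "W 0 = \<alpha>0" "W1 0 = - \<beta>0"
    using ex[THEN bspec, OF L2_zero, THEN spec, THEN spec, of \<alpha>0 "- \<beta>0"] by (elim exE conjE) (rule that)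
  define D where "D = \<alpha>1 * W1 1 + \<beta>1 * W 1"
  \<comment> \<open>Otherwise \<open>W\<close> would satisfy both conditions, hence vanish by
    \<open>energy_zero\<close>, and its initial data would make the left condition trivial.\<close>
  have D: "D \<noteq> 0"
  proof
    assume "D = 0"
    then have "BCs W W1" using W by (simp add: BCs_def D_def)
    from energy_zero[OF \<kappa> W(1) this, of 0] have "\<alpha>0 = 0" "\<beta>0 = 0" using W by auto
    then show False using left_BC_nontrivial by simp
  qed
  define Cw where "Cw = C0 * (\<bar>\<alpha>0\<bar> + \<bar>\<beta>0\<bar>)"
  have Cw: "0 <= Cw" using C0 by (simp add: Cw_def)
  have Wb: "\<bar>W x\<bar> <= Cw" "\<bar>W1 x\<bar> <= Cw" if "x \<in> {0..1}" for x
    using bd[OF L2_zero W(1) that] W by (auto simp: Cw_def L2norm_def)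
  define Cs where "Cs = (\<bar>\<alpha>1\<bar> + \<bar>\<beta>1\<bar>) * C0 / \<bar>D\<bar>"
  have Cs: "0 <= Cs" using C0 by (simp add: Cs_def)
  define C where "C = C0 + Cs * Cw"
  have "\<exists>w w1. sol \<kappa> g w w1 \<and> BCs w w1 \<and> (\<forall>x\<in>{0..1}. \<bar>w x\<bar> <= C * L2norm g \<and> \<bar>w1 x\<bar> <= C * L2norm g)" if g: "g \<in> L2" for g
  proof -
    obtain V V1 where V: "sol \<kappa> g V V1" "V 0 = 0" "V1 0 = 0"
      using ex[THEN bspec, OF g, THEN spec, THEN spec, of 0 0] by (elim exE conjE) (rule that)
    have Vb: "\<bar>V x\<bar> <= C0 * L2norm g" "\<bar>V1 x\<bar> <= C0 * L2norm g" if "x \<in> {0..1}" for x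
      using bd[OF g V(1) that] V by auto
    define s where "s = - (\<alpha>1 * V1 1 + \<beta>1 * V 1) / D"
    have s: "\<bar>s\<bar> <= Cs * L2norm g"
    proof -
      have "\<bar>\<alpha>1 * V1 1 + \<beta>1 * V 1\<bar> <= \<bar>\<alpha>1\<bar> * \<bar>V1 1\<bar> + \<bar>\<beta>1\<bar> * \<bar>V 1\<bar>"
        by (metis abs_mult abs_triangle_ineq)
      also have "\<dots> <= \<bar>\<alpha>1\<bar> * (C0 * L2norm g) + \<bar>\<beta>1\<bar> * (C0 * L2norm g)"
        using Vb[of 1] by (intro add_mono mult_left_mono) auto
      also have "\<dots> = (\<bar>\<alpha>1\<bar> + \<bar>\<beta>1\<bar>) * C0 * L2norm g" by (simp add: algebra_simps)
      finally have "\<bar>\<alpha>1 * V1 1 + \<beta>1 * V 1\<bar> / \<bar>D\<bar> <= (\<bar>\<alpha>1\<bar> + \<bar>\<beta>1\<bar>) * C0 * L2norm g / \<bar>D\<bar>"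
        by (rule divide_right_mono) simp
      moreover have "\<bar>s\<bar> = \<bar>\<alpha>1 * V1 1 + \<beta>1 * V 1\<bar> / \<bar>D\<bar>"
        by (simp only: s_def abs_divide abs_minus_cancel)
      ultimately show ?thesis by (simp add: Cs_def)
    qed
    have sl: "sol \<kappa> (%x. g x + s * 0) (%x. V x + s * W x) (%x. V1 x + s * W1 x)"
      by (rule sol_lin[OF V(1) W(1) g L2_zero])
    then have 1: "sol \<kappa> g (%x. V x + s * W x) (%x. V1 x + s * W1 x)" by simp
    have "\<alpha>1 * (V1 1 + s * W1 1) + \<beta>1 * (V 1 + s * W 1) = (\<alpha>1 * V1 1 + \<beta>1 * V 1) + s * D"
      by (simp add: D_def algebra_simps)
    also have "\<dots> = 0" using D by (simp add: s_def)
    finally have 2: "BCs (%x. V x + s * W x) (%x. V1 x + s * W1 x)" using V W by (simp add: BCs_def)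
    have 3: "\<bar>a + s * b\<bar> <= C * L2norm g" if "\<bar>a\<bar> <= C0 * L2norm g" "\<bar>b\<bar> <= Cw" for a b
    proof -
      have "\<bar>s * b\<bar> <= Cs * L2norm g * Cw" unfolding abs_mult using s that Cs L2norm_nonneg by (intro mult_mono) auto
      then have "\<bar>a + s * b\<bar> <= C0 * L2norm g + Cs * L2norm g * Cw" using that by linarith
      then show ?thesis by (simp add: C_def algebra_simps)
    qed
    show ?thesis using 1 2 3 Vb Wb by blast
  qed
  moreover have "0 <= C" using C0 Cs Cw by (simp add: C_def)
  ultimately show ?thesis by blast
qed

text \<open>Function and derivative are chosen together. They are determined on \<open>[0,1]\<close>
  only, so later identities are pointwise there or modulo \<open>L2eq\<close>.\<close>

definition resolvent_pair :: "real => (real => real) => (real => real) \<times> (real => real)" where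
  "resolvent_pair \<kappa> g = (SOME p. sol \<kappa> g (fst p) (snd p) \<and> BCs (fst p) (snd p))"
definition Rk :: "real => (real => real) => real => real" where "Rk \<kappa> g = fst (resolvent_pair \<kappa> g)"
definition Rk1 :: "real => (real => real) => real => real" where "Rk1 \<kappa> g = snd (resolvent_pair \<kappa> g)"

lemma Rk_sol:
  assumes "Kd < \<kappa>" "g \<in> L2"
  shows "sol \<kappa> g (Rk \<kappa> g) (Rk1 \<kappa> g)" "BCs (Rk \<kappa> g) (Rk1 \<kappa> g)"
proof -
  from resolvent_exists[OF assms(1)] obtain C where
    "\<forall>g\<in>L2. \<exists>w w1. sol \<kappa> g w w1 \<and> BCs w w1 \<and> (\<forall>x\<in>{0..1}. \<bar>w x\<bar> <= C * L2norm g \<and> \<bar>w1 x\<bar> <= C * L2norm g)"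
    by (elim exE conjE) (rule that)
  from bspec[OF this assms(2)] obtain w w1 where "sol \<kappa> g w w1" "BCs w w1" by (elim exE conjE) (rule that)
  then have "\<exists>p. sol \<kappa> g (fst p) (snd p) \<and> BCs (fst p) (snd p)" by (intro exI[of _ "(w, w1)"]) simp
  from someI_ex[OF this] show "sol \<kappa> g (Rk \<kappa> g) (Rk1 \<kappa> g)" "BCs (Rk \<kappa> g) (Rk1 \<kappa> g)"
    by (simp_all only: Rk_def Rk1_def resolvent_pair_def)
qed

lemma Rk_bound:
  assumes "Kd < \<kappa>"
  obtains C where "0 <= C" "\<And>g x. g \<in> L2 ==> x \<in> {0..1} ==> \<bar>Rk \<kappa> g x\<bar> <= C * L2norm g"
    "\<And>g x. g \<in> L2 ==> x \<in> {0..1} ==> \<bar>Rk1 \<kappa> g x\<bar> <= C * L2norm g"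
proof -
  from resolvent_exists[OF assms(1)] obtain C where C: "0 <= C" and
    ex: "\<forall>g\<in>L2. \<exists>w w1. sol \<kappa> g w w1 \<and> BCs w w1 \<and> (\<forall>x\<in>{0..1}. \<bar>w x\<bar> <= C * L2norm g \<and> \<bar>w1 x\<bar> <= C * L2norm g)"
    by (elim exE conjE) (rule that)
  have "\<bar>Rk \<kappa> g x\<bar> <= C * L2norm g \<and> \<bar>Rk1 \<kappa> g x\<bar> <= C * L2norm g" if g: "g \<in> L2" and x: "x \<in> {0..1}" for g x
  proof -
    from bspec[OF ex g] obtain w w1 where w: "sol \<kappa> g w w1" "BCs w w1" "\<forall>x\<in>{0..1}. \<bar>w x\<bar> <= C * L2norm g \<and> \<bar>w1 x\<bar> <= C * L2norm g"
      by (elim exE conjE) (rule that)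
    show ?thesis using sol_unique[OF assms w(1,2) Rk_sol[OF assms g] g g L2eq_refl x] bspec[OF w(3) x] by simp
  qed
  then show thesis using that[OF C] by blast
qed

lemma Rk_lin:
  assumes "Kd < \<kappa>" "g \<in> L2" "g' \<in> L2" "x \<in> {0..1}"
  shows "Rk \<kappa> (%x. g x + c * g' x) x = Rk \<kappa> g x + c * Rk \<kappa> g' x" "Rk1 \<kappa> (%x. g x + c * g' x) x = Rk1 \<kappa> g x + c * Rk1 \<kappa> g' x"
proof -
  have L: "(%x. g x + c * g' x) \<in> L2" by (intro L2_add L2_scale assms)
  note s = sol_unique[OF assms(1) Rk_sol[OF assms(1) L] sol_lin[OF Rk_sol(1)[OF assms(1,2)] Rk_sol(1)[OF assms(1,3)] assms(2,3)]
      BCs_lin[OF Rk_sol(2)[OF assms(1,2)] Rk_sol(2)[OF assms(1,3)]] L L L2eq_refl assms(4)]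
  show "Rk \<kappa> (%x. g x + c * g' x) x = Rk \<kappa> g x + c * Rk \<kappa> g' x" "Rk1 \<kappa> (%x. g x + c * g' x) x = Rk1 \<kappa> g x + c * Rk1 \<kappa> g' x"
    by (rule s)+
qed

lemma Rk_cong:
  assumes "Kd < \<kappa>" "g \<in> L2" "g' \<in> L2" "L2eq g g'" "x \<in> {0..1}"
  shows "Rk \<kappa> g x = Rk \<kappa> g' x"
  by (rule sol_unique[OF assms(1) Rk_sol[OF assms(1,2)] Rk_sol[OF assms(1,3)] assms(2-5)])

lemma Rk_scale:
  assumes "Kd < \<kappa>" "g \<in> L2" "x \<in> {0..1}" shows "Rk \<kappa> (%x. c * g x) x = c * Rk \<kappa> g x"
proof -
  have "Rk \<kappa> (%x. g x + (c - 1) * g x) x = Rk \<kappa> g x + (c - 1) * Rk \<kappa> g x" by (rule Rk_lin(1)[OF assms(1,2,2,3)])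
  moreover have "(%x. g x + (c - 1) * g x) = (%x. c * g x)" by (simp add: algebra_simps)
  ultimately show ?thesis by (simp add: algebra_simps)
qed

lemma Rk_diff:
  assumes "Kd < \<kappa>" "g \<in> L2" "g' \<in> L2" "x \<in> {0..1}"
  shows "Rk \<kappa> (%x. g x - g' x) x = Rk \<kappa> g x - Rk \<kappa> g' x" "Rk1 \<kappa> (%x. g x - g' x) x = Rk1 \<kappa> g x - Rk1 \<kappa> g' x"
  using Rk_lin[OF assms, of "-1"] by simp_all

lemma Rk_cont: "Kd < \<kappa> ==> g \<in> L2 ==> continuous_on {0..1} (Rk \<kappa> g)"
  "Kd < \<kappa> ==> g \<in> L2 ==> continuous_on {0..1} (Rk1 \<kappa> g)"
  using sol_cont[OF Rk_sol(1)] by blast+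

lemma Rk_L2: "Kd < \<kappa> ==> g \<in> L2 ==> Rk \<kappa> g \<in> L2"
  by (rule L2_cont, rule Rk_cont(1))

text \<open>If the resolvent value vanishes, so does its derivative, and the equation reduces to
  vanishing integrals of \<open>g / \<theta>\<close>. Needed to identify the value of the
  generator.\<close>

lemma Rk_injective:
  assumes \<kappa>: "Kd < \<kappa>" and g: "g \<in> L2" and z: "\<And>x. x \<in> {0..1} ==> Rk \<kappa> g x = 0"
  shows "L2norm g = 0"
proof -
  note s = Rk_sol(1)[OF \<kappa> g]
  have z1: "Rk1 \<kappa> g x = 0" if x: "x \<in> {0..1}" for x
  proof -
    have "((%_. 0) has_real_derivative Rk1 \<kappa> g x) (at x within {0..1})"
      by (rule has_field_derivative_transform_within[OF solD(2)[OF s x], of 1]) (use z x in simp_all)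
    then show ?thesis by (rule deriv_unique_01) (use x in auto)
  qed
  have gL: "(%x. g x / \<theta> x) \<in> L2" by (rule div_theta_L2[OF g])
  have "integral {0..x} (%y. g y / \<theta> y) = 0" if x: "x \<in> {0..1}" for x
  proof -
    have w: "wpp \<kappa> g (Rk \<kappa> g) (Rk1 \<kappa> g) y = - (g y / \<theta> y)" if y: "y \<in> {0..1}" for y
    proof -
      have "integral {0..y} (%s. \<phi> y s * Rk \<kappa> g s) = integral {0..y} (%s. 0)"
        by (rule Henstock_Kurzweil_Integration.integral_cong) (use z y in auto)
      then show ?thesis using z[OF y] z1[OF y] by (simp add: wpp_def)
    qed
    have "integral {0..x} (wpp \<kappa> g (Rk \<kappa> g) (Rk1 \<kappa> g)) = integral {0..x} (%y. - (g y / \<theta> y))"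
      by (rule Henstock_Kurzweil_Integration.integral_cong) (use w x in auto)
    then show ?thesis using solD(3)[OF s x] z1[OF x] z1[of 0] by simp
  qed
  from L2_AE_zero_of_integrals[OF gL this] have "AE x in M01. g x / \<theta> x = 0" .
  moreover have "AE x in M01. x \<in> {0..1}" using AE_space[of M01] by simp
  ultimately have "AE x in M01. g x = 0" by eventually_elim (use theta_pos in fastforce)
  then show ?thesis using L2norm_zero_AE[OF g] by simp
qed

lemma Rk_H2: assumes "Kd < \<kappa>" "g \<in> L2"
  shows "H2_rep (Rk \<kappa> g) (Rk1 \<kappa> g) (wpp \<kappa> g (Rk \<kappa> g) (Rk1 \<kappa> g))"
  unfolding H2_rep_def
  by (intro conjI ballI wpp_L2 assms(2) Rk_cont assms(1) solD(2,3)[OF Rk_sol(1)[OF assms]])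

lemma Rk_Dom: assumes "Kd < \<kappa>" "g \<in> L2" shows "Rk \<kappa> g \<in> DomP \<alpha>0 \<beta>0 \<alpha>1 \<beta>1"
  using Rk_H2[OF assms] Rk_sol(2)[OF assms] unfolding DomP_def BCs_def by blast

text \<open>Turns the relational description of the operator into an equation: every domain element
  is the resolvent of \<open>\<kappa> w - P w\<close>.\<close>

lemma P_rel_Rk:
  assumes \<kappa>: "Kd < \<kappa>" and w: "w \<in> DomP \<alpha>0 \<beta>0 \<alpha>1 \<beta>1" and P: "P_rel \<theta> \<sigma> lam \<phi> w z" and z: "z \<in> L2" and x: "x \<in> {0..1}"
  shows "w x = Rk \<kappa> (%x. \<kappa> * w x - z x) x"
proof -
  obtain w1 g where h: "H2_rep w w1 g" and eq: "L2eq z (%x. \<theta> x * g x + \<sigma> x * w1 x + lam x * w x + integral {0..x} (%s. \<phi> x s * w s))"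
    using P unfolding P_rel_def by (elim exE conjE) (rule that)
  obtain v1 g' where h': "H2_rep w v1 g'" and bc: "\<alpha>0 * v1 0 + \<beta>0 * w 0 = 0" "\<alpha>1 * v1 1 + \<beta>1 * w 1 = 0"
    using w unfolding DomP_def mem_Collect_eq by (elim exE conjE) (rule that)
  have g: "g \<in> L2" and dw: "\<And>x. x \<in> {0..1} ==> (w has_real_derivative w1 x) (at x within {0..1})"
    and dw1: "\<And>x. x \<in> {0..1} ==> w1 x = w1 0 + integral {0..x} g" using h unfolding H2_rep_def by blast+
  have dv: "\<And>x. x \<in> {0..1} ==> (w has_real_derivative v1 x) (at x within {0..1})" using h' unfolding H2_rep_def by blast
  \<comment> \<open>Membership in the domain and the action of the operator come with separate
    derivative witnesses; the boundary conditions must be carried from one to the other.\<close>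
  have vw: "v1 x = w1 x" if "x \<in> {0..1}" for x by (rule deriv_unique_01[OF dv[OF that] dw[OF that] that])
  have B: "BCs w w1" using bc vw[of 0] vw[of 1] by (simp add: BCs_def)
  have cw: "continuous_on {0..1} w" using dw by (rule DERIV_continuous_on)
  have "continuous_on {0..1} (%x. w1 0 + integral {0..x} g)"
    by (intro continuous_intros indefinite_integral_continuous_1 L2_integrable_on(2)[OF g]) auto
  then have cw1: "continuous_on {0..1} w1" by (rule continuous_on_eq) (rule dw1[symmetric])
  define q where "q x = \<theta> x * g x + \<sigma> x * w1 x + lam x * w x + integral {0..x} (%s. \<phi> x s * w s)" for x
  obtain Th where Th: "\<And>x. x \<in> {0..1} ==> \<bar>\<theta> x\<bar> <= Th" using pequi_bounded[OF pc_theta] by auto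
  have q: "q \<in> L2" unfolding q_def[abs_def]
    by (rule L2_add[OF L2_add[OF L2_add[OF L2_mult_bounded[OF g pcont_measurable[OF pc_theta] Th]
        pcont_prod_L2[OF pc_sigma cw1]] pcont_prod_L2[OF pc_lam cw]] L2_cont[OF volterra_cont[OF cw]]])
  have zq: "(%x. z x - q x) \<in> L2" "L2norm (%x. z x - q x) = 0"
    using L2_diff[OF z q] eq unfolding L2eq_def q_def[abs_def] by auto
  have gL: "(%x. \<kappa> * w x - z x) \<in> L2" by (intro L2_diff L2_scale L2_cont cw z)
  have "sol \<kappa> (%x. \<kappa> * w x - z x) w w1"
    unfolding sol_def
  proof (intro conjI ballI cw1 dw)
    fix x :: real assume x: "x \<in> {0..1}"
    have d: "(%y. (z y - q y) / \<theta> y) \<in> L2" by (rule div_theta_L2[OF zq(1)])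
    have i: "g integrable_on {0..x}" "(%y. (z y - q y) / \<theta> y) integrable_on {0..x}"
      using x by (auto intro!: L2_integrable_on(2) g d)
    have "integral {0..x} (wpp \<kappa> (%x. \<kappa> * w x - z x) w w1) = integral {0..x} (%y. g y + (z y - q y) / \<theta> y)"
    proof (rule Henstock_Kurzweil_Integration.integral_cong)
      fix y assume "y \<in> {0..x}"
      then have "0 < \<theta> y" using x by (intro theta_pos) auto
      then show "wpp \<kappa> (%x. \<kappa> * w x - z x) w w1 y = g y + (z y - q y) / \<theta> y"
        by (simp add: wpp_def q_def field_simps)
    qed
    also have "\<dots> = integral {0..x} g + integral {0..x} (%y. (z y - q y) / \<theta> y)"
      by (rule Henstock_Kurzweil_Integration.integral_add[OF i])
    also have "integral {0..x} (%y. (z y - q y) / \<theta> y) = 0"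
    proof -
      have "\<bar>integral {0..x} (%y. (z y - q y) / \<theta> y)\<bar> <= L2norm (%y. (z y - q y) / \<theta> y)"
        using x by (intro L2_integral_bound[OF d]) auto
      also have "\<dots> <= 1 / c0 * L2norm (%y. z y - q y)" by (rule div_theta_norm[OF zq(1)])
      finally show ?thesis using zq(2) by simp
    qed
    finally show "w1 x = w1 0 + integral {0..x} (wpp \<kappa> (%x. \<kappa> * w x - z x) w w1)" using dw1[OF x] by simp
  qed
  then show ?thesis by (rule sol_unique(1)[OF \<kappa> _ B Rk_sol[OF \<kappa> gL] gL gL L2eq_refl x])
qed

text \<open>The weight \<open>1/\<theta>\<close> makes \<open>\<theta> \<partial>\<^sub>x\<^sub>x\<close> symmetric; it is absorbed by dividing by \<open>\<surd>\<theta>\<close>.\<close>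

definition sc :: "(real => real) => real => real" where "sc w x = w x / sqrt (\<theta> x)"
definition wnorm :: "(real => real) => real" where "wnorm w = L2norm (sc w)"

lemma sc_L2: assumes "w \<in> L2" shows "sc w \<in> L2"
proof -
  have m: "(%x. 1 / sqrt (\<theta> x)) \<in> borel_measurable M01" using pcont_measurable[OF pc_theta] by measurable
  have "(%x. 1 / sqrt (\<theta> x) * w x) \<in> L2"
  proof (rule L2_mult_bounded[OF assms m])
    fix x :: real assume x: "x \<in> {0..1}"
    have "sqrt c0 <= sqrt (\<theta> x)" using theta_ge[OF x] by simp
    moreover have "0 < sqrt c0" using c0 by simp
    ultimately show "\<bar>1 / sqrt (\<theta> x)\<bar> <= 1 / sqrt c0" by (simp add: frac_le)
  qed
  then show ?thesis by (simp add: sc_def[abs_def])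
qed

lemma wip_sc: "wip v w = L2inner (sc v) (sc w)"
  unfolding wip_def L2inner_def
proof (rule Bochner_Integration.integral_cong[OF refl])
  fix x assume "x \<in> space M01"
  then have "0 < \<theta> x" using theta_pos by simp
  then have "sqrt (\<theta> x) * sqrt (\<theta> x) = \<theta> x" by simp
  then show "v x * (w x / \<theta> x) = sc v x * sc w x" unfolding sc_def by (simp add: times_divide_times_eq)
qed

lemma wnorm_sq: "(wnorm w)^2 = wip w w" by (simp add: wnorm_def wip_sc L2norm_power2)
lemma wnorm_nonneg: "0 <= wnorm w" by (simp add: wnorm_def L2norm_nonneg)
lemma wip_le: "v \<in> L2 ==> w \<in> L2 ==> \<bar>wip v w\<bar> <= wnorm v * wnorm w"
  unfolding wip_sc wnorm_def by (intro L2_Cauchy_Schwarz sc_L2)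
lemma sc_add: "sc (%x. v x + w x) = (%x. sc v x + sc w x)" by (simp add: sc_def[abs_def] add_divide_distrib)
lemma sc_diff: "sc (%x. v x - w x) = (%x. sc v x - sc w x)" by (simp add: sc_def[abs_def] diff_divide_distrib)
lemma sc_scale: "sc (%x. c * w x) = (%x. c * sc w x)" by (simp add: sc_def[abs_def])
lemma wnorm_triangle: "v \<in> L2 ==> w \<in> L2 ==> wnorm (%x. v x + w x) <= wnorm v + wnorm w"
  unfolding wnorm_def sc_add by (intro L2norm_triangle sc_L2)
lemma wnorm_scale: "wnorm (%x. c * w x) = \<bar>c\<bar> * wnorm w"
  unfolding wnorm_def sc_scale by (rule L2norm_scale)

lemma wnorm_le: assumes "w \<in> L2" shows "wnorm w <= 1 / sqrt c0 * L2norm w"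
  unfolding wnorm_def
proof (rule L2norm_mono[OF sc_L2[OF assms] assms])
  fix x :: real assume x: "x \<in> {0..1}"
  have p: "sqrt c0 <= sqrt (\<theta> x)" "0 < sqrt c0" using theta_ge[OF x] c0 by auto
  have "\<bar>sc w x\<bar> = \<bar>w x\<bar> / sqrt (\<theta> x)" using theta_pos[OF x] by (simp add: sc_def abs_divide)
  also have "\<dots> <= \<bar>w x\<bar> / sqrt c0" using p by (intro divide_left_mono) auto
  finally show "\<bar>sc w x\<bar> <= 1 / sqrt c0 * \<bar>w x\<bar>" by simp
qed (use c0 in simp)

lemma wnorm_ge: obtains C where "0 < C" "\<And>w. w \<in> L2 ==> L2norm w <= C * wnorm w"
proof -
  obtain B where B: "0 <= B" "\<And>x. x \<in> {0..1} ==> \<bar>\<theta> x\<bar> <= B" using pequi_bounded[OF pc_theta] by auto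
  have "L2norm w <= sqrt (B + 1) * wnorm w" if w: "w \<in> L2" for w
    unfolding wnorm_def
  proof (rule L2norm_mono[OF w sc_L2[OF w]])
    fix x :: real assume x: "x \<in> {0..1}"
    have p: "sqrt (\<theta> x) <= sqrt (B + 1)" "0 < sqrt (\<theta> x)" using B(2)[OF x] theta_pos[OF x] by auto
    have "\<bar>w x\<bar> = sqrt (\<theta> x) * \<bar>sc w x\<bar>" using p by (simp add: sc_def abs_divide)
    also have "\<dots> <= sqrt (B + 1) * \<bar>sc w x\<bar>" using p by (intro mult_right_mono) auto
    finally show "\<bar>w x\<bar> <= sqrt (B + 1) * \<bar>sc w x\<bar>" .
  qed (use B in simp)
  moreover have "0 < sqrt (B + 1)" using B by simp
  ultimately show thesis using that by blast
qed

lemma Pex_Rk: "x \<in> {0..1} ==> Pex (Rk \<kappa> g) (Rk1 \<kappa> g) (wpp \<kappa> g (Rk \<kappa> g) (Rk1 \<kappa> g)) x = \<kappa> * Rk \<kappa> g x - g x"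
  using theta_pos[of x] by (simp add: Pex_def wpp_def)

lemma Rk_energy:
  assumes \<kappa>: "Kd < \<kappa>" and g: "pcont g"
  shows "wip (Rk \<kappa> g) (%x. \<kappa> * Rk \<kappa> g x - g x) <= Kd * wip (Rk \<kappa> g) (Rk \<kappa> g)"
proof -
  have gL: "g \<in> L2" by (rule pcont_L2[OF g])
  note s = Rk_sol[OF \<kappa> gL]
  have "wip (Rk \<kappa> g) (Pex (Rk \<kappa> g) (Rk1 \<kappa> g) (wpp \<kappa> g (Rk \<kappa> g) (Rk1 \<kappa> g))) <= Kd * wip (Rk \<kappa> g) (Rk \<kappa> g)"
    by (rule dissipative[OF solD(2)[OF s(1)] solD(3)[OF s(1)] wpp_pcont[OF g Rk_cont[OF \<kappa> gL]]])
       (use s(2) in \<open>simp_all add: BCs_def\<close>)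
  moreover have "wip (Rk \<kappa> g) (Pex (Rk \<kappa> g) (Rk1 \<kappa> g) (wpp \<kappa> g (Rk \<kappa> g) (Rk1 \<kappa> g))) = wip (Rk \<kappa> g) (%x. \<kappa> * Rk \<kappa> g x - g x)"
    unfolding wip_def by (rule L2inner_cong) (simp_all add: Pex_Rk)
  ultimately show ?thesis by simp
qed

text \<open>Hille-Yosida estimate, by testing the resolvent equation with its solution. The data are
  piecewise continuous because \<open>dissipative\<close> requires such a second derivative.\<close>

lemma Rk_contract:
  assumes \<kappa>: "Kd < \<kappa>" and g: "pcont g"
  shows "(\<kappa> - Kd) * wnorm (Rk \<kappa> g) <= wnorm g"
proof -
  have gL: "g \<in> L2" by (rule pcont_L2[OF g])
  let ?w = "Rk \<kappa> g"
  have w: "?w \<in> L2" by (rule Rk_L2[OF \<kappa> gL])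
  have "wip ?w (%x. \<kappa> * ?w x - g x) = \<kappa> * wip ?w ?w - wip ?w g"
    unfolding wip_sc sc_diff sc_scale by (subst L2inner_diff_right) (auto intro: L2_scale sc_L2 w gL simp: L2inner_scale_right)
  then have "(\<kappa> - Kd) * (wnorm ?w)^2 <= wip ?w g" using Rk_energy[OF assms] by (simp add: wnorm_sq left_diff_distrib)
  also have "\<dots> <= wnorm ?w * wnorm g" using wip_le[OF w gL] by simp
  finally have le: "wnorm ?w * ((\<kappa> - Kd) * wnorm ?w) <= wnorm ?w * wnorm g" by (simp add: power2_eq_square algebra_simps)
  show ?thesis
  proof (cases "wnorm ?w = 0")
    case True then show ?thesis by (simp add: wnorm_nonneg)
  next
    case False
    then have "0 < wnorm ?w" using wnorm_nonneg[of ?w] by simp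
    then show ?thesis using le by simp
  qed
qed

end

section \<open>Density of smooth functions and strong convergence of scaled resolvents\<close>

lemma real_polynomial_derivatives:
  assumes "real_polynomial_function p"
  obtains p1 p2 where "\<And>x. DERIV p x :> p1 x" "\<And>x. DERIV p1 x :> p2 x" "continuous_on UNIV p2"
proof -
  obtain p1 where p1: "real_polynomial_function p1" "\<forall>x. (p has_real_derivative p1 x) (at x)"
    using has_real_derivative_polynomial_function[OF assms] by blast
  obtain p2 where p2: "real_polynomial_function p2" "\<forall>x. (p1 has_real_derivative p2 x) (at x)"
    using has_real_derivative_polynomial_function[OF p1(1)] by blast
  have "continuous_on UNIV p2" using p2(1) by (simp add: continuous_on_polymonial_function real_polynomial_function_eq)
  then show thesis using that p1 p2 by blast
qed

text \<open>Multiples of \<open>x\<^sup>2(1-x)\<^sup>2\<close> satisfy every homogeneous Robin condition.\<close>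

lemma pcont_dense:
  assumes d: "pcont d" and e: "0 < (e::real)"
  obtains w w1 w2 where "\<forall>x\<in>{0..1}. (w has_real_derivative w1 x) (at x within {0..1})"
    "\<forall>x\<in>{0..1}. (w1 has_real_derivative w2 x) (at x within {0..1})" "continuous_on {0..1} w2"
    "w 0 = 0" "w1 0 = 0" "w 1 = 0" "w1 1 = 0" "L2norm (%x. d x - w x) < e"
proof -
  obtain B where B0: "0 <= B" and B: "\<And>x. x \<in> {0..1} ==> \<bar>d x\<bar> <= B" using pequi_bounded[OF d] by auto
  have dm: "d \<in> borel_measurable M01" by (rule pcont_measurable[OF d])
  then have "d measurable_on {0..1}" by (simp add: measurable_on_iff_borel_measurable)
  then obtain N g where N: "negligible N" and gc: "\<forall>n. continuous_on UNIV (g n)"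
    and gl: "\<forall>x. x \<notin> N --> (%n. g n x) \<longlonglongrightarrow> (if x \<in> {0..1} then d x else 0)"
    unfolding measurable_on_def by (elim exE conjE) (rule that)
  \<comment> \<open>Clipping to \<open>[-B,B]\<close> gives a dominating function. The second factor
    is 0 where \<open>n x (1-x) <= 1\<close> and 1 where it is at least 2, so \<open>c n\<close>
    vanishes near both ends.\<close>
  define c where "c n x = max (- B) (min B (g n x)) * max 0 (min 1 (real n * (x * (1 - x)) - 1))" for n :: nat and x :: real
  have gcn: "continuous_on UNIV (g n)" for n using gc by simp
  have cc: "continuous_on UNIV (c n)" for n unfolding c_def by (intro continuous_intros gcn)
  have cc1: "continuous_on {0..1} (c n)" for n by (rule continuous_on_subset[OF cc]) simp
  have cB: "\<bar>c n x\<bar> <= B" for n x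
  proof -
    have "\<bar>max (- B) (min B (g n x))\<bar> * \<bar>max 0 (min 1 (real n * (x * (1 - x)) - 1))\<bar> <= B * 1"
      using B0 by (intro mult_mono) auto
    then show ?thesis by (simp add: c_def abs_mult)
  qed
  have cl: "(%n. c n x) \<longlonglongrightarrow> d x" if x: "x \<in> {0<..<1}" "x \<notin> N" for x
  proof -
    have g1: "(%n. g n x) \<longlonglongrightarrow> d x" using gl x by auto
    have "(%n. max (- B) (min B (g n x))) \<longlonglongrightarrow> max (- B) (min B (d x))"
      by (intro tendsto_max tendsto_min tendsto_const g1)
    moreover have "max (- B) (min B (d x)) = d x" using B[of x] x by auto
    ultimately have 1: "(%n. max (- B) (min B (g n x))) \<longlonglongrightarrow> d x" by simp
    have p: "0 < x * (1 - x)" using x by simp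
    obtain m where m: "2 / (x * (1 - x)) < real m" using reals_Archimedean2 by blast
    have "max 0 (min 1 (real n * (x * (1 - x)) - 1)) = 1" if "n \<ge> m" for n
    proof -
      have "2 / (x * (1 - x)) < real n" using m that by linarith
      then have "2 < real n * (x * (1 - x))" using p by (simp add: pos_divide_less_eq)
      then show ?thesis by simp
    qed
    then have "\<forall>\<^sub>F n in sequentially. max 0 (min 1 (real n * (x * (1 - x)) - 1)) = 1"
      unfolding eventually_sequentially by blast
    then have 2: "(%n. max 0 (min 1 (real n * (x * (1 - x)) - 1))) \<longlonglongrightarrow> 1" by (rule tendsto_eventually)
    show ?thesis unfolding c_def using tendsto_mult[OF 1 2] by simp
  qed
  have "(%n. LINT x|M01. (d x - c n x)^2) \<longlonglongrightarrow> (LINT x|M01. 0)"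
  proof (rule integral_dominated_convergence[where w="%_. (2 * B)^2"])
    show "(%x. (d x - c n x)^2) \<in> borel_measurable M01" for n
      using dm borel_measurable_M01_cont[OF cc1[of n]] by measurable
    show "AE x in M01. (%n. (d x - c n x)^2) \<longlonglongrightarrow> 0"
    proof -
      have "N \<union> {0,1} \<in> null_sets lebesgue" using N by (simp add: negligible_iff_null_sets[symmetric])
      then have "AE x in lebesgue. x \<notin> N \<union> {0,1}" by (rule AE_not_in)
      then have "AE x in lebesgue. x \<in> {0..1} --> (%n. (d x - c n x)^2) \<longlonglongrightarrow> 0"
      proof eventually_elim
        case (elim x)
        show ?case
        proof
          assume "x \<in> {0..1}"
          then have "(%n. c n x) \<longlonglongrightarrow> d x" using elim by (intro cl) auto
          then have "(%n. (d x - c n x)^2) \<longlonglongrightarrow> (d x - d x)^2" by (intro tendsto_intros)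
          then show "(%n. (d x - c n x)^2) \<longlonglongrightarrow> 0" by simp
        qed
      qed
      then show ?thesis by (simp add: AE_restrict_space_iff)
    qed
    show "AE x in M01. norm ((d x - c n x)^2) <= (2 * B)^2" for n
    proof (rule AE_I2)
      fix x assume "x \<in> space M01"
      then have "\<bar>d x - c n x\<bar> <= 2 * B" using B[of x] cB[of n x] by auto
      then have "\<bar>d x - c n x\<bar>^2 <= (2 * B)^2" by (intro power_mono) auto
      then show "norm ((d x - c n x)^2) <= (2 * B)^2" by simp
    qed
  qed auto
  then have "(%n. sqrt (LINT x|M01. (d x - c n x)^2)) \<longlonglongrightarrow> sqrt 0" by (intro tendsto_real_sqrt) simp
  then have "(%n. L2norm (%x. d x - c n x)) \<longlonglongrightarrow> 0" by (simp add: L2norm_def)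
  moreover have "0 < e / 2" using e by simp
  ultimately have "\<forall>\<^sub>F n in sequentially. L2norm (%x. d x - c n x) < e / 2" by (rule order_tendstoD(2))
  from eventually_conj[OF this eventually_ge_at_top[of 1]]
  obtain n where n: "L2norm (%x. d x - c n x) < e / 2" "1 <= n" by (auto dest: eventually_happens)
  let ?m = "%x::real. (x * (1 - x))^2"
  \<comment> \<open>Division by \<open>(x (1-x))^2\<close>, regularised by the maximum. Where
    \<open>c n\<close> is nonzero the maximum is the polynomial itself, so \<open>c n\<close> is
    exactly the polynomial times the continuous \<open>q\<close>.\<close>
  define q where "q x = c n x / max (?m x) (1 / (real n)^2)" for x
  have mp: "0 < max (?m x) (1 / (real n)^2)" for x using n(2) by (simp add: less_max_iff_disj)
  have "continuous_on {0..1} q" unfolding q_def[abs_def] using mp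
    by (intro continuous_intros cc1) (simp add: less_imp_neq[symmetric] order_less_imp_not_eq2)
  then obtain p where p: "real_polynomial_function p" "\<And>x. x \<in> {0..1} ==> \<bar>q x - p x\<bar> < e / 2"
    using Stone_Weierstrass_real_polynomial_function[of "{0..1}" q "e / 2"] e by auto
  have cq: "c n x = ?m x * q x" if x: "x \<in> {0..1}" for x
  proof (cases "c n x = 0")
    case True then show ?thesis by (simp add: q_def)
  next
    case False
    have n0: "0 < real n" using n(2) by simp
    have "\<not> real n * (x * (1 - x)) - 1 <= 0" using False by (auto simp: c_def)
    then have "1 / real n <= x * (1 - x)" using n0 by (simp add: pos_divide_le_eq mult.commute)
    then have "(1 / real n)^2 <= ?m x" using n0 by (intro power_mono) auto
    then have mx: "max (?m x) (1 / (real n)^2) = ?m x" by (simp add: power_divide)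
    have "0 < ?m x" using mp[of x] unfolding mx .
    then show ?thesis unfolding q_def mx by simp
  qed
  obtain p1 p2 where p12: "\<And>x. DERIV p x :> p1 x" "\<And>x. DERIV p1 x :> p2 x" "continuous_on UNIV p2"
    using real_polynomial_derivatives[OF p(1)] by metis
  define w w1 w2 where "w x = ?m x * p x"
    and "w1 x = ?m x * p1 x + 2 * (x * (1 - x)) * (1 - 2 * x) * p x"
    and "w2 x = ?m x * p2 x + 4 * (x * (1 - x)) * (1 - 2 * x) * p1 x + (2 * (1 - 2 * x)^2 - 4 * (x * (1 - x))) * p x" for x
  have dw: "DERIV w x :> w1 x" for x unfolding w_def[abs_def] w1_def
    by (rule derivative_eq_intros p12 refl | simp add: algebra_simps power2_eq_square)+
  have dw1: "DERIV w1 x :> w2 x" for x unfolding w1_def[abs_def] w2_def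
    by (rule derivative_eq_intros p12 refl | simp add: algebra_simps power2_eq_square)+
  have pc: "continuous_on {0..1} p" "continuous_on {0..1} p1" "continuous_on {0..1} p2"
    using p12 by (auto intro: DERIV_continuous_on continuous_on_subset has_field_derivative_at_within)
  have "continuous_on {0..1} w" by (rule DERIV_continuous_on) (rule has_field_derivative_at_within[OF dw])
  then have wL: "w \<in> L2" by (rule L2_cont)
  have cL: "c n \<in> L2" by (rule L2_cont[OF cc1])
  have "L2norm (%x. d x - w x) <= L2norm (%x. d x - c n x) + L2norm (%x. c n x - w x)"
    by (rule L2norm_triangle3[OF pcont_L2[OF d] cL wL])
  also have "L2norm (%x. c n x - w x) <= e / 2"
  proof (rule L2norm_le_bound)
    show "(%x. c n x - w x) \<in> L2" by (rule L2_diff[OF cL wL])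
    fix x :: real assume x: "x \<in> {0..1}"
    have "x * (1 - x) <= 1 * 1" using x by (intro mult_mono) auto
    then have m1: "0 <= ?m x" "?m x <= 1" using x power_mono[of "x * (1 - x)" 1 2] by auto
    have "c n x - w x = ?m x * (q x - p x)" unfolding cq[OF x] w_def by (simp add: algebra_simps)
    then have "\<bar>c n x - w x\<bar> = ?m x * \<bar>q x - p x\<bar>" using m1 by (simp add: abs_mult)
    also have "\<dots> <= 1 * (e / 2)" using m1 p(2)[OF x] by (intro mult_mono) auto
    finally show "\<bar>c n x - w x\<bar> <= e / 2" by simp
  qed
  finally have L: "L2norm (%x. d x - w x) < e" using n(1) by simp
  have w2c: "continuous_on {0..1} w2" unfolding w2_def[abs_def] by (intro continuous_intros pc)
  show thesis
  proof (rule that[OF _ _ w2c _ _ _ _ L])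
    show "\<forall>x\<in>{0..1}. (w has_real_derivative w1 x) (at x within {0..1})" by (rule ballI, rule has_field_derivative_at_within[OF dw])
    show "\<forall>x\<in>{0..1}. (w1 has_real_derivative w2 x) (at x within {0..1})" by (rule ballI, rule has_field_derivative_at_within[OF dw1])
  qed (simp_all add: w_def w1_def)
qed

context pide begin

lemma resolvent_of_smooth:
  assumes \<kappa>: "Kd < \<kappa>" and dw: "\<And>x. x \<in> {0..1} ==> (w has_real_derivative w1 x) (at x within {0..1})"
    and dw1: "\<And>x. x \<in> {0..1} ==> (w1 has_real_derivative w2 x) (at x within {0..1})" and w2: "continuous_on {0..1} w2"
    and bc: "BCs w w1" and x: "x \<in> {0..1}"
  shows "w x = Rk \<kappa> (%x. \<kappa> * w x - Pex w w1 w2 x) x"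
proof -
  have c: "continuous_on {0..1} w" by (rule DERIV_continuous_on) (rule dw)
  have c1: "continuous_on {0..1} w1" by (rule DERIV_continuous_on) (rule dw1)
  let ?g = "%x. \<kappa> * w x - Pex w w1 w2 x"
  have g: "?g \<in> L2" by (intro L2_diff L2_scale L2_cont c pcont_L2 Pex_pcont c1 pcont_continuous w2)
  have wpp: "wpp \<kappa> ?g w w1 y = w2 y" if "y \<in> {0..1}" for y
    using theta_pos[OF that] by (simp add: wpp_def Pex_def)
  have "sol \<kappa> ?g w w1" unfolding sol_def
  proof (intro conjI ballI c1 dw)
    fix x :: real assume x: "x \<in> {0..1}"
    have "integral {0..x} (wpp \<kappa> ?g w w1) = integral {0..x} w2"
      by (rule Henstock_Kurzweil_Integration.integral_cong) (use wpp x in auto)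
    moreover have "(w2 has_integral w1 x - w1 0) {0..x}"
    proof (rule fundamental_theorem_of_calculus)
      fix z assume z: "z \<in> {0..x}"
      have "(w1 has_real_derivative w2 z) (at z within {0..x})" by (rule DERIV_subset[OF dw1]) (use z x in auto)
      then show "(w1 has_vector_derivative w2 z) (at z within {0..x})" by (simp add: has_real_derivative_iff_has_vector_derivative)
    qed (use x in auto)
    ultimately show "w1 x = w1 0 + integral {0..x} (wpp \<kappa> ?g w w1)" by (simp add: integral_unique)
  qed
  then show ?thesis by (rule sol_unique(1)[OF \<kappa> _ bc Rk_sol[OF \<kappa> g] g g L2eq_refl x])
qed

lemma wnorm_cong: "(\<And>x. x \<in> {0..1} ==> v x = w x) ==> wnorm v = wnorm w"
  unfolding wnorm_def sc_def[abs_def] by (rule L2norm_cong) simp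

lemma wnorm_minus_commute: "wnorm (%x. v x - w x) = wnorm (%x. w x - v x)"
  unfolding wnorm_def sc_diff by (rule L2norm_minus_commute)

lemma Rk_pcont: "Kd < \<kappa> ==> g \<in> L2 ==> pcont (Rk \<kappa> g)"
  by (rule pcont_continuous, rule Rk_cont(1))

text \<open>For \<open>w\<close> in the domain \<open>\<kappa> R w - w = R (P w)\<close>, which is
  small for large \<open>\<kappa>\<close>. Density gives the general case, as
  \<open>\<kappa> R\<close> has norm at most 2 on piecewise continuous functions once
  \<open>\<kappa> >= 2 Kd + 1\<close>.\<close>

lemma resolvent_approx:
  assumes d: "pcont d" and e: "0 < e"
  obtains K where "Kd < K" "\<forall>\<kappa>\<ge>K. wnorm (%x. \<kappa> * Rk \<kappa> d x - d x) <= e"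
proof -
  \<comment> \<open>\<open>sqrt c0\<close> converts to the weighted norm. The approximation then has
    error \<open>e/6\<close>, which enters once as it is and once doubled by
    \<open>\<kappa> R\<close>; the remaining \<open>e/2\<close> is for \<open>R p\<close>.\<close>
  define e' where "e' = e * sqrt c0 / 6"
  have e': "0 < e'" using e c0 by (simp add: e'_def)
  obtain w w1 w2 where dw': "\<forall>x\<in>{0..1}. (w has_real_derivative w1 x) (at x within {0..1})"
    "\<forall>x\<in>{0..1}. (w1 has_real_derivative w2 x) (at x within {0..1})" "continuous_on {0..1} w2"
    and z: "w 0 = 0" "w1 0 = 0" "w 1 = 0" "w1 1 = 0" and L: "L2norm (%x. d x - w x) < e'"
    by (rule pcont_dense[OF d e'])
  note dw = dw'(1)[rule_format] dw'(2)[rule_format] dw'(3)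
  have bc: "BCs w w1" using z by (simp add: BCs_def)
  have c: "continuous_on {0..1} w" by (rule DERIV_continuous_on) (rule dw)
  have c1: "continuous_on {0..1} w1" by (rule DERIV_continuous_on) (rule dw)
  define p where "p = Pex w w1 w2"
  have p: "pcont p" unfolding p_def by (rule Pex_pcont[OF c c1 pcont_continuous[OF dw(3)]])
  have pw: "pcont w" by (rule pcont_continuous[OF c])
  have pdw: "pcont (%x. d x - w x)" by (rule pequi_diff[OF d pw])
  \<comment> \<open>The first part ensures \<open>\<kappa> <= 2 (\<kappa> - Kd)\<close>, the last
    that \<open>wnorm p / (\<kappa> - Kd)\<close> is at most \<open>e/2\<close>.\<close>
  define K where "K = 2 * Kd + 1 + 2 * wnorm p / e"
  have wp: "0 <= 2 * wnorm p / e" using e wnorm_nonneg[of p] by simp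
  have K: "Kd < K" using Kd(1) wp by (simp add: K_def)
  have dl: "wnorm (%x. d x - w x) <= e / 6"
  proof -
    have "wnorm (%x. d x - w x) <= 1 / sqrt c0 * L2norm (%x. d x - w x)" by (rule wnorm_le[OF pcont_L2[OF pdw]])
    also have "\<dots> <= 1 / sqrt c0 * e'" using L c0 by (intro mult_left_mono) auto
    also have "\<dots> = e / 6" using c0 by (simp add: e'_def)
    finally show ?thesis .
  qed
  have "wnorm (%x. \<kappa> * Rk \<kappa> d x - d x) <= e" if k: "K <= \<kappa>" for \<kappa>
  proof -
    have \<kappa>: "Kd < \<kappa>" using K k by simp
    have \<kappa>2: "\<kappa> <= 2 * (\<kappa> - Kd)" "0 < \<kappa> - Kd" using k K wp Kd(1) by (auto simp: K_def)
    note dL = pcont_L2[OF d] and wL = pcont_L2[OF pw] and pL = pcont_L2[OF p] and dwL = pcont_L2[OF pdw]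
    have a: "wnorm (%x. \<kappa> * Rk \<kappa> (%x. d x - w x) x) <= e / 3"
    proof -
      have "wnorm (%x. \<kappa> * Rk \<kappa> (%x. d x - w x) x) = \<kappa> * wnorm (Rk \<kappa> (%x. d x - w x))"
        using \<kappa> Kd(1) by (simp add: wnorm_scale)
      also have "\<dots> <= 2 * (\<kappa> - Kd) * wnorm (Rk \<kappa> (%x. d x - w x))" using \<kappa>2 wnorm_nonneg by (intro mult_right_mono) auto
      also have "\<dots> = 2 * ((\<kappa> - Kd) * wnorm (Rk \<kappa> (%x. d x - w x)))" by simp
      also have "\<dots> <= 2 * (e / 6)" using Rk_contract[OF \<kappa> pdw] dl by (intro mult_left_mono) auto
      finally show ?thesis by simp
    qed
    have b: "wnorm (Rk \<kappa> p) <= e / 2"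
    proof -
      have "wnorm (Rk \<kappa> p) <= wnorm p / (\<kappa> - Kd)" using Rk_contract[OF \<kappa> p] \<kappa>2 by (simp add: pos_le_divide_eq mult.commute)
      also have "\<dots> <= e / 2"
      proof -
        have "2 * wnorm p / e <= \<kappa> - Kd" using k Kd(1) by (simp add: K_def)
        then have "2 * wnorm p <= (\<kappa> - Kd) * e" using e by (simp add: pos_divide_le_eq)
        then show ?thesis using \<kappa>2 by (simp add: pos_divide_le_eq mult.commute)
      qed
      finally show ?thesis .
    qed
    have kwL: "(%x. \<kappa> * w x) \<in> L2" by (rule L2_scale[OF wL])
    have "\<kappa> * Rk \<kappa> d x - d x = (\<kappa> * Rk \<kappa> (%x. d x - w x) x + Rk \<kappa> p x) + (w x - d x)" if x: "x \<in> {0..1}" for x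
    proof -
      have "w x = Rk \<kappa> (%x. \<kappa> * w x - p x) x" unfolding p_def by (rule resolvent_of_smooth[OF \<kappa> dw bc x])
      also have "\<dots> = \<kappa> * Rk \<kappa> w x - Rk \<kappa> p x"
        using Rk_diff(1)[OF \<kappa> kwL pL x] Rk_scale[OF \<kappa> wL x] by simp
      finally have 1: "w x = \<kappa> * Rk \<kappa> w x - Rk \<kappa> p x" .
      show ?thesis unfolding Rk_diff(1)[OF \<kappa> dL wL x] right_diff_distrib using 1 by linarith
    qed
    then have "wnorm (%x. \<kappa> * Rk \<kappa> d x - d x) = wnorm (%x. (\<kappa> * Rk \<kappa> (%x. d x - w x) x + Rk \<kappa> p x) + (w x - d x))"
      by (rule wnorm_cong)
    also have "\<dots> <= wnorm (%x. \<kappa> * Rk \<kappa> (%x. d x - w x) x + Rk \<kappa> p x) + wnorm (%x. w x - d x)"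
      by (intro wnorm_triangle L2_add L2_scale Rk_L2 \<kappa> dwL pL L2_diff wL dL)
    also have "wnorm (%x. \<kappa> * Rk \<kappa> (%x. d x - w x) x + Rk \<kappa> p x) <= wnorm (%x. \<kappa> * Rk \<kappa> (%x. d x - w x) x) + wnorm (Rk \<kappa> p)"
      by (intro wnorm_triangle L2_scale Rk_L2 \<kappa> dwL pL)
    finally show ?thesis using a b dl wnorm_minus_commute[of w d] by simp
  qed
  then show thesis using that K by blast
qed

text \<open>With \<open>b = \<kappa> R d - d\<close> the double resolvent satisfies
  \<open>(\<kappa> R)^2 d - d = \<kappa> R b + b\<close>, so the single approximation is used
  twice.\<close>

lemma resolvent_sq_approx:
  assumes d: "pcont d" and e: "0 < e"
  obtains \<kappa> where "Kd < \<kappa>" "wnorm (%x. Rk \<kappa> (Rk \<kappa> (%x. \<kappa>^2 * d x)) x - d x) <= e"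
proof -
  have e3: "0 < e / 3" using e by simp
  obtain K where K: "Kd < K" "\<forall>\<kappa>\<ge>K. wnorm (%x. \<kappa> * Rk \<kappa> d x - d x) <= e / 3"
    by (rule resolvent_approx[OF d e3])
  define \<kappa> where "\<kappa> = max K (2 * Kd + 1)"
  have "K <= \<kappa>" "2 * Kd + 1 <= \<kappa>" by (simp_all add: \<kappa>_def)
  then have \<kappa>: "Kd < \<kappa>" "K <= \<kappa>" "\<kappa> <= 2 * (\<kappa> - Kd)" using K(1)
    by (simp_all add: right_diff_distrib)
  note dL = pcont_L2[OF d]
  let ?b = "%x. \<kappa> * Rk \<kappa> d x - d x"
  have b: "wnorm ?b <= e / 3" by (rule K(2)[rule_format, OF \<kappa>(2)])
  have pb: "pcont ?b" by (intro pequi_diff pcont_scale Rk_pcont \<kappa> dL d)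
  note bL = pcont_L2[OF pb]
  have RL: "Rk \<kappa> d \<in> L2" by (rule Rk_L2[OF \<kappa>(1) dL])
  have "Rk \<kappa> (Rk \<kappa> (%x. \<kappa>^2 * d x)) x - d x = \<kappa> * Rk \<kappa> ?b x + ?b x" if x: "x \<in> {0..1}" for x
  proof -
    have "L2eq (Rk \<kappa> (%x. \<kappa>^2 * d x)) (%x. \<kappa>^2 * Rk \<kappa> d x)"
      unfolding L2eq_def using Rk_scale[OF \<kappa>(1) dL, of _ "\<kappa>^2"]
      by (subst L2norm_cong[where v'="%_. 0"]) (auto simp: L2norm_def)
    then have "Rk \<kappa> (Rk \<kappa> (%x. \<kappa>^2 * d x)) x = Rk \<kappa> (%x. \<kappa>^2 * Rk \<kappa> d x) x"
      by (intro Rk_cong \<kappa> Rk_L2 L2_scale dL x)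
    also have "\<dots> = \<kappa>^2 * Rk \<kappa> (Rk \<kappa> d) x" by (rule Rk_scale[OF \<kappa>(1) RL x])
    finally have 1: "Rk \<kappa> (Rk \<kappa> (%x. \<kappa>^2 * d x)) x = \<kappa>^2 * Rk \<kappa> (Rk \<kappa> d) x" .
    have 2: "Rk \<kappa> ?b x = \<kappa> * Rk \<kappa> (Rk \<kappa> d) x - Rk \<kappa> d x"
      using Rk_diff(1)[OF \<kappa>(1) L2_scale[OF RL] dL x] Rk_scale[OF \<kappa>(1) RL x] by simp
    show ?thesis unfolding 1 2 by (simp add: power2_eq_square right_diff_distrib)
  qed
  then have "wnorm (%x. Rk \<kappa> (Rk \<kappa> (%x. \<kappa>^2 * d x)) x - d x) = wnorm (%x. \<kappa> * Rk \<kappa> ?b x + ?b x)"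
    by (rule wnorm_cong)
  also have "\<dots> <= wnorm (%x. \<kappa> * Rk \<kappa> ?b x) + wnorm ?b" by (intro wnorm_triangle L2_scale Rk_L2 \<kappa> bL)
  also have "wnorm (%x. \<kappa> * Rk \<kappa> ?b x) <= 2 * (e / 3)"
  proof -
    have "wnorm (%x. \<kappa> * Rk \<kappa> ?b x) = \<kappa> * wnorm (Rk \<kappa> ?b)" using \<kappa> Kd(1) by (simp add: wnorm_scale)
    also have "\<dots> <= 2 * (\<kappa> - Kd) * wnorm (Rk \<kappa> ?b)" using \<kappa> wnorm_nonneg by (intro mult_right_mono) auto
    also have "\<dots> = 2 * ((\<kappa> - Kd) * wnorm (Rk \<kappa> ?b))" by simp
    also have "\<dots> <= 2 * (e / 3)" using Rk_contract[OF \<kappa>(1) pb] b by (intro mult_left_mono) auto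
    finally show ?thesis .
  qed
  finally show thesis using that[OF \<kappa>(1)] b by simp
qed

end

lemma L2norm_L2eq: assumes "f \<in> L2" "g \<in> L2" "L2eq f g" shows "L2norm f = L2norm g"
  by (rule L2norm_cong_AE) (use assms L2eq_AE in auto)

lemma L2eq_add: assumes "f \<in> L2" "g \<in> L2" "f' \<in> L2" "g' \<in> L2" "L2eq f f'" "L2eq g g'"
  shows "L2eq (%x. f x + c * g x) (%x. f' x + c * g' x)"
proof -
  have "AE x in M01. f x = f' x" "AE x in M01. g x = g' x" using assms L2eq_AE by blast+
  then have "AE x in M01. f x + c * g x = f' x + c * g' x" by eventually_elim simp
  then show ?thesis
    by (subst L2eq_AE[OF L2_add[OF assms(1) L2_scale[OF assms(2)]] L2_add[OF assms(3) L2_scale[OF assms(4)]]])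
qed

lemma L2eq_cong: "(\<And>x. x \<in> {0..1} ==> v x = w x) ==> L2eq v w"
  unfolding L2eq_def by (subst L2norm_cong[where v'="%_. 0"]) (auto simp: L2norm_def)

subsection \<open>One-sided derivatives\<close>

text \<open>Continuous induction: the comparison line of slope \<open>e\<close> exceeds every
  nonpositive right derivative strictly, so the set of good times can be extended beyond its
  supremum.\<close>

lemma right_deriv_nonincreasing_aux:
  fixes f :: "real => real"
  assumes c: "continuous_on {a..b} f" and ab: "a <= b" and e: "0 < e"
    and d: "\<And>t. t \<in> {a..<b} ==> \<exists>D\<le>0. (f has_real_derivative D) (at_right t)"
  shows "f b <= f a + e * (b - a)"
proof -
  define A where "A = {t\<in>{a..b}. \<forall>s\<in>{a..t}. f s <= f a + e * (s - a)}"
  define u where "u = Sup A"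
  have aA: "a \<in> A" using ab by (auto simp: A_def)
  have bdd: "bdd_above A" by (rule bdd_aboveI[of _ b]) (auto simp: A_def)
  have u1: "a <= u" unfolding u_def by (rule cSup_upper[OF aA bdd])
  have u2: "u <= b" unfolding u_def by (rule cSup_least) (use aA in blast, simp add: A_def)
  note u = u1 u2
  have below: "f s <= f a + e * (s - a)" if "s \<in> {a..<u}" for s
  proof -
    have "s < Sup A" using that by (simp add: u_def)
    then obtain t where "t \<in> A" "s < t" using less_cSupD[of A s] aA by blast
    then show ?thesis using that by (auto simp: A_def)
  qed
  have cu: "continuous (at u within {a..b}) f" using c u by (simp add: continuous_on_eq_continuous_within)
  have fu: "f u <= f a + e * (u - a)"
  proof (cases "u = a")
    case False
    then have au: "a < u" using u by simp
    have "(f \<longlongrightarrow> f u) (at u within {a..b})" using cu by (simp add: continuous_within)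
    then have "(f \<longlongrightarrow> f u) (at u within {a..u})" by (rule tendsto_within_subset) (use u in auto)
    moreover have "at u within {a..u} = at_left u" using au by (rule at_within_Icc_at_left)
    ultimately have 1: "(f \<longlongrightarrow> f u) (at_left u)" by simp
    have 2: "((%s. f a + e * (s - a)) \<longlongrightarrow> f a + e * (u - a)) (at_left u)" by (intro tendsto_intros)
    have "\<forall>\<^sub>F s in at_left u. s \<in> {a<..<u}" using au by (intro eventually_at_left_real)
    then have "\<forall>\<^sub>F s in at_left u. f s <= f a + e * (s - a)" by eventually_elim (use below in auto)
    then show ?thesis by (rule tendsto_le[OF _ 2 1, rotated]) simp
  qed simp
  have "u = b"
  proof (rule ccontr)
    assume "u \<noteq> b"
    then have ub: "u < b" using u by simp
    then obtain D where D: "D <= 0" "(f has_real_derivative D) (at_right u)" using d[of u] u by auto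
    have "((%y. (f y - f u) / (y - u)) \<longlongrightarrow> D) (at_right u)" using D(2) by (simp add: has_field_derivative_iff)
    then have ev1: "\<forall>\<^sub>F y in at_right u. (f y - f u) / (y - u) < e" by (rule order_tendstoD) (use D e in simp)
    then obtain v where v: "u < v" "\<And>y. u < y ==> y < v ==> (f y - f u) / (y - u) < e"
      unfolding eventually_at_right_field by blast
    define t where "t = min b ((u + v) / 2)"
    have t: "u < t" "t < v" "t <= b" using ub v(1) by (auto simp: t_def min_less_iff_disj)
    have "t \<in> A" unfolding A_def
    proof (intro CollectI conjI ballI)
      fix s assume s: "s \<in> {a..t}"
      show "f s <= f a + e * (s - a)"
      proof (cases "s <= u")
        case True then show ?thesis using below[of s] fu s by (cases "s = u") auto
      next
        case False
        then have "(f s - f u) / (s - u) < e" using s t by (intro v(2)) auto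
        then have "f s - f u < e * (s - u)" using False by (simp add: pos_divide_less_eq)
        then show ?thesis using fu by (simp add: algebra_simps)
      qed
    qed (use u t in auto)
    then have "t <= u" unfolding u_def using bdd by (rule cSup_upper)
    then show False using t by simp
  qed
  then show ?thesis using fu by simp
qed

lemma right_deriv_nonincreasing:
  fixes f :: "real => real"
  assumes "continuous_on {a..b} f" "a <= b"
    and "\<And>t. t \<in> {a..<b} ==> \<exists>D\<le>0. (f has_real_derivative D) (at_right t)"
  shows "f b <= f a"
proof (rule field_le_epsilon)
  fix e :: real assume e: "0 < e"
  define e' where "e' = e / (b - a + 1)"
  have e': "0 < e'" using e assms(2) by (simp add: e'_def)
  have "f b <= f a + e' * (b - a)" by (rule right_deriv_nonincreasing_aux[OF assms(1,2) e' assms(3)])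
  also have "e' * (b - a) <= e" using e assms(2) by (simp add: e'_def field_simps)
  finally show "f b <= f a + e" by simp
qed

text \<open>Both \<open>f\<close> minus the primitive of \<open>k\<close> and its negative are
  nonincreasing, hence constant. In this way a continuous right derivative becomes a two-sided one,
  as needed for semigroup orbits.\<close>

lemma right_deriv_imp_deriv:
  fixes f k :: "real => real"
  assumes c: "continuous_on {0..T} f" and k: "continuous_on {0..T} k"
    and d: "\<And>t. t \<in> {0..<T} ==> (f has_real_derivative k t) (at_right t)" and t: "t \<in> {0..T}"
  shows "(f has_real_derivative k t) (at t within {0..T})"
proof -
  define K where "K t = integral {0..t} k" for t
  have dK: "(K has_real_derivative k t) (at t within {0..T})" if "t \<in> {0..T}" for t
    unfolding K_def[abs_def] by (rule integral_has_real_derivative[OF k that])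
  have cK: "continuous_on {0..T} K" by (rule DERIV_continuous_on) (rule dK)
  have dKr: "(K has_real_derivative k t) (at_right t)" if t: "t \<in> {0..<T}" for t
  proof -
    have "(K has_real_derivative k t) (at t within {t..T})" by (rule DERIV_subset[OF dK]) (use t in auto)
    then show ?thesis using t by (simp add: at_within_Icc_at_right)
  qed
  have eq: "f s = f 0 + K s" if s: "s \<in> {0..T}" for s
  proof -
    have sub: "{0..s} \<subseteq> {0..T}" using s by auto
    have "f s - K s <= f 0 - K 0"
    proof (rule right_deriv_nonincreasing[where f="%s. f s - K s"])
      show "continuous_on {0..s} (%s. f s - K s)"
        by (intro continuous_intros continuous_on_subset[OF c sub] continuous_on_subset[OF cK sub])
      fix t assume t: "t \<in> {0..<s}"
      then have "((%s. f s - K s) has_real_derivative k t - k t) (at_right t)" using s by (intro DERIV_diff d dKr) auto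
      then show "\<exists>D\<le>0. ((%s. f s - K s) has_real_derivative D) (at_right t)" by (intro exI[of _ "k t - k t"]) simp
    qed (use s in auto)
    moreover have "K s - f s <= K 0 - f 0"
    proof (rule right_deriv_nonincreasing[where f="%s. K s - f s"])
      show "continuous_on {0..s} (%s. K s - f s)"
        by (intro continuous_intros continuous_on_subset[OF c sub] continuous_on_subset[OF cK sub])
      fix t assume t: "t \<in> {0..<s}"
      then have "((%s. K s - f s) has_real_derivative k t - k t) (at_right t)" using s by (intro DERIV_diff d dKr) auto
      then show "\<exists>D\<le>0. ((%s. K s - f s) has_real_derivative D) (at_right t)" by (intro exI[of _ "k t - k t"]) simp
    qed (use s in auto)
    moreover have "K 0 = 0" by (simp add: K_def)
    ultimately show ?thesis by simp
  qed
  have "((%s. f 0 + K s) has_real_derivative 0 + k t) (at t within {0..T})"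
    by (intro DERIV_add DERIV_const dK t)
  then have "((%s. f 0 + K s) has_real_derivative k t) (at t within {0..T})" by simp
  then show ?thesis by (rule has_field_derivative_transform_within[where d=1]) (simp, rule t, rule eq[symmetric])
qed

lemma has_right_deriv_quotient:
  fixes f :: "real => real"
  assumes "((%h. (f (t + h) - f t) / h) \<longlongrightarrow> D) (at_right 0)"
  shows "(f has_real_derivative D) (at_right t)"
  unfolding has_field_derivative_iff filterlim_at_right_to_0[of _ _ t]
  using assms by (simp add: add.commute)

subsection \<open>The semigroup\<close>

locale pide_semigroup = pide +
  fixes S :: "real => (real => real) => (real => real)"
  assumes gen: "generates_semigroup (DomP \<alpha>0 \<beta>0 \<alpha>1 \<beta>1) (P_rel \<theta> \<sigma> lam \<phi>) S"
begin

lemmas gen_facts = gen[unfolded generates_semigroup_def]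

lemma S_L2: "0 <= t ==> w \<in> L2 ==> S t w \<in> L2"
  using gen_facts[THEN conjunct1] by blast

lemma S_lin': "0 <= t ==> v \<in> L2 ==> w \<in> L2 ==> L2eq (S t (%x. a * v x + b * w x)) (%x. a * S t v x + b * S t w x)"
  using gen_facts[THEN conjunct2, THEN conjunct1] by blast

lemma S_lin: "0 <= t ==> v \<in> L2 ==> w \<in> L2 ==> L2eq (S t (%x. v x + b * w x)) (%x. S t v x + b * S t w x)"
  using S_lin'[of t v w 1 b] by simp

lemma S_bound:
  assumes "0 <= t" obtains C where "0 <= C" "\<forall>w\<in>L2. L2norm (S t w) <= C * L2norm w"
proof -
  have "\<forall>t\<ge>0. \<exists>C. \<forall>w\<in>L2. L2norm (S t w) <= C * L2norm w"
    by (rule gen_facts[THEN conjunct2, THEN conjunct2, THEN conjunct1])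
  then obtain C where C: "\<forall>w\<in>L2. L2norm (S t w) <= C * L2norm w" using assms by blast
  have "\<forall>w\<in>L2. L2norm (S t w) <= \<bar>C\<bar> * L2norm w"
  proof
    fix w assume "w \<in> L2"
    then have "L2norm (S t w) <= C * L2norm w" using C by blast
    also have "\<dots> <= \<bar>C\<bar> * L2norm w" using L2norm_nonneg by (intro mult_right_mono) auto
    finally show "L2norm (S t w) <= \<bar>C\<bar> * L2norm w" .
  qed
  then show thesis using that[of "\<bar>C\<bar>"] by simp
qed

lemma S_zero: "w \<in> L2 ==> L2eq (S 0 w) w"
  using gen_facts[THEN conjunct2, THEN conjunct2, THEN conjunct2, THEN conjunct1] by blast

lemma S_plus: "0 <= s ==> 0 <= t ==> w \<in> L2 ==> L2eq (S (s + t) w) (S s (S t w))"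
  using gen_facts[THEN conjunct2, THEN conjunct2, THEN conjunct2, THEN conjunct2, THEN conjunct1] by blast

lemma S_strong: "w \<in> L2 ==> ((%t. L2norm (%x. S t w x - w x)) \<longlongrightarrow> 0) (at_right 0)"
  using gen_facts[THEN conjunct2, THEN conjunct2, THEN conjunct2, THEN conjunct2, THEN conjunct2, THEN conjunct1] by blast

lemma gen_dom: "w \<in> L2 ==> (\<exists>z\<in>L2. gen_lim S w z) \<longleftrightarrow> (\<exists>w'\<in>DomP \<alpha>0 \<beta>0 \<alpha>1 \<beta>1. L2eq w w')"
  using gen_facts[THEN conjunct2, THEN conjunct2, THEN conjunct2, THEN conjunct2, THEN conjunct2, THEN conjunct2, THEN conjunct1] by blast

lemma gen_act: "w \<in> L2 ==> z \<in> L2 ==> w' \<in> DomP \<alpha>0 \<beta>0 \<alpha>1 \<beta>1 ==> L2eq w w' ==> gen_lim S w z ==> P_rel \<theta> \<sigma> lam \<phi> w' z"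
  using gen_facts[THEN conjunct2, THEN conjunct2, THEN conjunct2, THEN conjunct2, THEN conjunct2, THEN conjunct2, THEN conjunct2] by blast

lemma S_diff_norm:
  assumes "0 <= t" "v \<in> L2" "w \<in> L2"
  shows "L2norm (%x. S t v x - S t w x) = L2norm (S t (%x. v x - w x))"
  using L2norm_L2eq[OF S_L2[OF assms(1) L2_diff[OF assms(2,3)]] L2_diff[OF S_L2[OF assms(1,2)] S_L2[OF assms(1,3)]]]
    S_lin[OF assms, of "-1"] by simp

lemma gen_lim_cong: assumes "w \<in> L2" "z \<in> L2" "z' \<in> L2" "L2eq z z'" "gen_lim S w z" shows "gen_lim S w z'"
proof -
  have "\<forall>\<^sub>F h in at_right 0. L2norm (%x. (S h w x - w x) / h - z x) = L2norm (%x. (S h w x - w x) / h - z' x)"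
    using eventually_at_right_less[of 0]
  proof eventually_elim
    case (elim h)
    have a: "(%x. (S h w x - w x) / h) \<in> L2" using elim assms by (intro L2_divide L2_diff S_L2) auto
    show ?case
    proof (rule L2norm_L2eq)
      show "L2eq (%x. (S h w x - w x) / h - z x) (%x. (S h w x - w x) / h - z' x)"
        using L2eq_add[OF a assms(2) a assms(3) L2eq_refl assms(4), of "-1"] by simp
    qed (intro L2_diff a assms)+
  qed
  then show ?thesis using assms(5) unfolding gen_lim_def by (rule tendsto_cong[THEN iffD1])
qed

text \<open>The limit \<open>z\<close> exists because the resolvent lands in the domain;
  \<open>P_rel_Rk\<close> shows that \<open>\<kappa> R g - z\<close> and \<open>g\<close> have the
  same resolvent, and injectivity identifies \<open>z\<close>.\<close>

lemma gen_Rk: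
  assumes \<kappa>: "Kd < \<kappa>" and g: "g \<in> L2"
  shows "gen_lim S (Rk \<kappa> g) (%x. \<kappa> * Rk \<kappa> g x - g x)"
proof -
  let ?w = "Rk \<kappa> g"
  have w: "?w \<in> L2" by (rule Rk_L2[OF \<kappa> g])
  have "\<exists>w'\<in>DomP \<alpha>0 \<beta>0 \<alpha>1 \<beta>1. L2eq ?w w'" using Rk_Dom[OF \<kappa> g] L2eq_refl by blast
  then obtain z where z: "z \<in> L2" "gen_lim S ?w z" using gen_dom[OF w] by blast
  have P: "P_rel \<theta> \<sigma> lam \<phi> ?w z" by (rule gen_act[OF w z(1) Rk_Dom[OF \<kappa> g] L2eq_refl z(2)])
  have kL: "(%x. \<kappa> * ?w x - z x) \<in> L2" by (intro L2_diff L2_scale w z)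
  have "Rk \<kappa> (%x. (\<kappa> * ?w x - z x) - g x) x = 0" if x: "x \<in> {0..1}" for x
    using P_rel_Rk[OF \<kappa> Rk_Dom[OF \<kappa> g] P z(1) x] Rk_diff(1)[OF \<kappa> kL g x] by simp
  from Rk_injective[OF \<kappa> L2_diff[OF kL g] this] have "L2norm (%x. (\<kappa> * ?w x - z x) - g x) = 0" .
  then have "L2eq (%x. \<kappa> * ?w x - g x) z" unfolding L2eq_def by (simp add: algebra_simps)
  then show ?thesis by (intro gen_lim_cong[OF w z(1) _ L2eq_sym z(2)] L2_diff L2_scale w g)
qed

text \<open>By the semigroup law the quotient at \<open>t\<close> is \<open>S t\<close> applied to
  the quotient at 0, and \<open>S t\<close> is bounded. The length comes from laws that hold only
  modulo \<open>L2eq\<close>.\<close>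

lemma orbit_quotient:
  assumes t: "0 <= t" and w: "w \<in> L2" and z: "z \<in> L2" and g: "gen_lim S w z"
  shows "((%h. L2norm (%x. (S (t + h) w x - S t w x) / h - S t z x)) \<longlongrightarrow> 0) (at_right 0)"
proof -
  obtain C where C: "0 <= C" "\<forall>w\<in>L2. L2norm (S t w) <= C * L2norm w" using t by (rule S_bound)
  show ?thesis
  proof (rule Lim_null_comparison)
    show "((%h. C * L2norm (%x. (S h w x - w x) / h - z x)) \<longlongrightarrow> 0) (at_right 0)"
      using tendsto_mult_right_zero[OF g[unfolded gen_lim_def]] .
    show "\<forall>\<^sub>F h in at_right 0. norm (L2norm (%x. (S (t + h) w x - S t w x) / h - S t z x)) <= C * L2norm (%x. (S h w x - w x) / h - z x)"
      using eventually_at_right_less[of 0]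
    proof eventually_elim
      case (elim h)
      then have h: "0 <= h" "0 < h" by auto
      note Sh = S_L2[OF h(1) w] and St = S_L2[OF t w] and Sz = S_L2[OF t z]
      have Sth: "S (t + h) w \<in> L2" using t h by (intro S_L2 w) auto
      let ?a = "%x. S h w x + (-1) * w x"
      have aL: "?a \<in> L2" by (intro L2_add L2_scale Sh w)
      have 1: "L2eq (S t ?a) (%x. S t (S h w) x + (-1) * S t w x)" by (rule S_lin[OF t Sh w])
      have 2: "L2eq (%x. S t (S h w) x + (-1) * S t w x) (%x. S (t + h) w x + (-1) * S t w x)"
        by (rule L2eq_add[OF S_L2[OF t Sh] St Sth St L2eq_sym[OF S_plus[OF t h(1) w]] L2eq_refl])
      have 3: "L2eq (S t ?a) (%x. S (t + h) w x + (-1) * S t w x)"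
        by (rule L2eq_trans[OF S_L2[OF t aL] _ _ 1 2]) (intro L2_add L2_scale S_L2 t Sh St Sth)+
      have 4: "L2eq (S t (%x. z x + (- 1 / h) * ?a x)) (%x. S t z x + (- 1 / h) * S t ?a x)"
        by (rule S_lin[OF t z aL])
      have dL: "(%x. S (t + h) w x + (-1) * S t w x) \<in> L2" by (intro L2_add L2_scale Sth St)
      have 5: "L2eq (%x. S t z x + (- 1 / h) * S t ?a x) (%x. S t z x + (- 1 / h) * (S (t + h) w x + (-1) * S t w x))"
        by (rule L2eq_add[OF Sz S_L2[OF t aL] Sz dL L2eq_refl 3])
      have zaL: "(%x. z x + (- 1 / h) * ?a x) \<in> L2" by (intro L2_add L2_scale z aL Sh w)
      have "L2norm (%x. (S (t + h) w x - S t w x) / h - S t z x) = L2norm (%x. S t z x - (S (t + h) w x - S t w x) / h)"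
        by (rule L2norm_minus_commute)
      also have "(%x. S t z x - (S (t + h) w x - S t w x) / h) = (%x. S t z x + (- 1 / h) * (S (t + h) w x + (-1) * S t w x))"
        using h by (simp add: fun_eq_iff)
      also have "L2norm \<dots> = L2norm (S t (%x. z x + (- 1 / h) * ?a x))"
      proof (rule L2norm_L2eq[symmetric])
        show "L2eq (S t (%x. z x + (- 1 / h) * ?a x)) (%x. S t z x + (- 1 / h) * (S (t + h) w x + (-1) * S t w x))"
          by (rule L2eq_trans[OF S_L2[OF t zaL] _ _ 4 5]) (intro L2_add L2_scale Sz S_L2 t aL dL)+
      qed (intro S_L2 t zaL L2_add L2_scale Sz dL Sth St)+
      also have "\<dots> <= C * L2norm (%x. z x + (- 1 / h) * ?a x)" using C zaL by blast
      also have "(%x. z x + (- 1 / h) * ?a x) = (%x. z x - (S h w x - w x) / h)" using h by (simp add: fun_eq_iff)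
      also have "L2norm \<dots> = L2norm (%x. (S h w x - w x) / h - z x)" by (rule L2norm_minus_commute)
      finally show ?case using L2norm_nonneg by simp
    qed
  qed
qed

lemma gen_lim_orbit:
  assumes t: "0 <= t" and w: "w \<in> L2" and z: "z \<in> L2" and g: "gen_lim S w z"
  shows "gen_lim S (S t w) (S t z)"
  unfolding gen_lim_def
proof (rule Lim_transform_eventually[OF orbit_quotient[OF assms]])
  show "\<forall>\<^sub>F h in at_right 0. L2norm (%x. (S (t + h) w x - S t w x) / h - S t z x) = L2norm (%x. (S h (S t w) x - S t w x) / h - S t z x)"
    using eventually_at_right_less[of 0]
  proof eventually_elim
    case (elim h)
    then have h: "0 <= h" by simp
    note St = S_L2[OF t w] and Sz = S_L2[OF t z]
    have Sht: "S (h + t) w \<in> L2" using t h by (intro S_L2 w) auto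
    have L: "(%x. (- 1 / h) * S t w x - S t z x) \<in> L2" by (intro L2_diff L2_scale St Sz)
    have "L2eq (%x. ((- 1 / h) * S t w x - S t z x) + (1 / h) * S (h + t) w x) (%x. ((- 1 / h) * S t w x - S t z x) + (1 / h) * S h (S t w) x)"
      by (rule L2eq_add[OF L Sht L S_L2[OF h St] L2eq_refl S_plus[OF h t w]])
    then have "L2norm (%x. ((- 1 / h) * S t w x - S t z x) + (1 / h) * S (h + t) w x) = L2norm (%x. ((- 1 / h) * S t w x - S t z x) + (1 / h) * S h (S t w) x)"
      by (intro L2norm_L2eq L2_add L2_scale L Sht S_L2 h St)
    moreover have "(%x. ((- 1 / h) * S t w x - S t z x) + (1 / h) * S (h + t) w x) = (%x. (S (t + h) w x - S t w x) / h - S t z x)"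
      by (simp add: fun_eq_iff add.commute diff_divide_distrib)
    moreover have "(%x. ((- 1 / h) * S t w x - S t z x) + (1 / h) * S h (S t w) x) = (%x. (S h (S t w) x - S t w x) / h - S t z x)"
      by (simp add: fun_eq_iff diff_divide_distrib)
    ultimately show ?case by simp
  qed
qed

lemma Dom_L2: "w \<in> DomP \<alpha>0 \<beta>0 \<alpha>1 \<beta>1 ==> w \<in> L2"
proof -
  assume "w \<in> DomP \<alpha>0 \<beta>0 \<alpha>1 \<beta>1"
  then obtain w1 g where "H2_rep w w1 g" unfolding DomP_def by blast
  then have "\<And>x. x \<in> {0..1} ==> (w has_real_derivative w1 x) (at x within {0..1})" unfolding H2_rep_def by blast
  then show ?thesis by (intro L2_cont DERIV_continuous_on)
qed

text \<open>The orbit of a resolvent value stays in the domain and \<open>\<kappa> - P\<close> sends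
  it to \<open>S t g\<close>; applying the resolvent gives the claim.\<close>

lemma S_Rk_commute:
  assumes \<kappa>: "Kd < \<kappa>" and g: "g \<in> L2" and t: "0 <= t"
  shows "L2eq (S t (Rk \<kappa> g)) (Rk \<kappa> (S t g))"
proof -
  let ?w = "Rk \<kappa> g" and ?z = "%x. \<kappa> * Rk \<kappa> g x - g x"
  have w: "?w \<in> L2" by (rule Rk_L2[OF \<kappa> g])
  have z: "?z \<in> L2" by (intro L2_diff L2_scale w g)
  note Sw = S_L2[OF t w] and Sz = S_L2[OF t z] and Sg = S_L2[OF t g]
  have gl: "gen_lim S (S t ?w) (S t ?z)" by (rule gen_lim_orbit[OF t w z gen_Rk[OF \<kappa> g]])
  then obtain w' where w': "w' \<in> DomP \<alpha>0 \<beta>0 \<alpha>1 \<beta>1" "L2eq (S t ?w) w'" using gen_dom[OF Sw] Sz by blast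
  have w'L: "w' \<in> L2" by (rule Dom_L2[OF w'(1)])
  have P: "P_rel \<theta> \<sigma> lam \<phi> w' (S t ?z)" by (rule gen_act[OF Sw Sz w' gl])
  let ?u = "%x. \<kappa> * w' x - S t ?z x"
  have uL: "?u \<in> L2" by (intro L2_diff L2_scale w'L Sz)
  have u: "L2eq ?u (S t g)"
  proof -
    have 1: "L2eq (%x. - S t ?z x + \<kappa> * w' x) (%x. - S t ?z x + \<kappa> * S t ?w x)"
      by (rule L2eq_add[OF L2_uminus[OF Sz] w'L L2_uminus[OF Sz] Sw L2eq_refl L2eq_sym[OF w'(2)]])
    have 2: "L2eq (S t (%x. (-1) * ?z x + \<kappa> * ?w x)) (%x. (-1) * S t ?z x + \<kappa> * S t ?w x)" by (rule S_lin'[OF t z w])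
    have 3: "(%x. (-1) * ?z x + \<kappa> * ?w x) = g" by (simp add: fun_eq_iff)
    have 4: "L2eq (%x. - S t ?z x + \<kappa> * S t ?w x) (S t g)" using L2eq_sym[OF 2] unfolding 3 by simp
    have 5: "(%x. - S t ?z x + \<kappa> * w' x) = ?u" by (simp add: fun_eq_iff)
    show ?thesis
      by (rule L2eq_trans[OF uL _ Sg 1[unfolded 5] 4]) (intro L2_add L2_scale L2_uminus Sz Sw)
  qed
  have "w' x = Rk \<kappa> (S t g) x" if x: "x \<in> {0..1}" for x
    using P_rel_Rk[OF \<kappa> w'(1) P Sz x] Rk_cong[OF \<kappa> uL Sg u x] by simp
  then have "L2eq w' (Rk \<kappa> (S t g))" by (rule L2eq_cong)
  then show ?thesis by (rule L2eq_trans[OF Sw w'L Rk_L2[OF \<kappa> Sg] w'(2)])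
qed

end

text \<open>A right-continuous function is continuous on a dense set: nested intervals with shrinking oscillation.\<close>
lemma right_cont_imp_cont_point:
  fixes d :: "real => real => real"
  assumes d: "\<And>r s t. 0 <= r ==> 0 <= s ==> 0 <= t ==> d r t <= d r s + d t s"
    and rc: "\<And>t e. 0 <= t ==> 0 < e ==> \<exists>\<delta>>0. \<forall>s\<in>{t..t+\<delta>}. d s t < e" and T: "0 < T"
  obtains c where "0 < c" "c < T" "\<forall>e>0. \<exists>\<delta>>0. \<forall>s. \<bar>s - c\<bar> < \<delta> --> d s c < e"
proof -
  \<comment> \<open>Level \<open>n\<close> controls the oscillation on a closed interval by
    \<open>1 / (n + 1)\<close>; \<open>Q\<close> demands strict nesting at both ends, so the limit
    point is interior to every interval.\<close>
  define P where "P n p \<longleftrightarrow> 0 < fst p \<and> fst p < snd p \<and> snd p < T \<and> (\<forall>s\<in>{fst p..snd p}. \<forall>s'\<in>{fst p..snd p}. d s s' < 1 / real (Suc n))"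
    for n and p :: "real \<times> real"
  define Q where "Q p q \<longleftrightarrow> fst p < fst q \<and> snd q < snd p" for p q :: "real \<times> real"
  have step: "\<exists>q. P n q \<and> Q (a, b) q" if ab: "0 < a" "a < b" "b < T + 1" and bT: "b <= T" for a b n
  proof -
    define m where "m = (a + b) / 2"
    have m: "a < m" "m < b" using ab by (auto simp: m_def)
    obtain \<delta> where \<delta>: "0 < \<delta>" "\<forall>s\<in>{m..m+\<delta>}. d s m < 1 / (2 * real (Suc n))"
      using rc[of m "1 / (2 * real (Suc n))"] m ab by auto
    define b' where "b' = min (m + \<delta>) ((m + b) / 2)"
    have b': "m < b'" "b' < b" "b' <= m + \<delta>" using m \<delta>(1) by (auto simp: b'_def min_less_iff_disj)
    have "d s s' < 1 / real (Suc n)" if s: "s \<in> {m..b'}" "s' \<in> {m..b'}" for s s'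
    proof -
      have "d s s' <= d s m + d s' m" by (rule d) (use s m ab in auto)
      also have "\<dots> < 1 / (2 * real (Suc n)) + 1 / (2 * real (Suc n))" using \<delta>(2) s b' by (intro add_strict_mono) auto
      also have "\<dots> = 1 / real (Suc n)" by (simp add: field_simps)
      finally show ?thesis .
    qed
    then show ?thesis using m b' ab bT by (intro exI[of _ "(m, b')"]) (auto simp: P_def Q_def)
  qed
  have "\<exists>f. \<forall>n. P n (f n) \<and> Q (f n) (f (Suc n))"
  proof (rule dependent_nat_choice)
    show "\<exists>x. P 0 x" using step[of "T / 2" T 0] T by auto
    fix p n assume "P n p"
    then show "\<exists>q. P (Suc n) q \<and> Q p q" using step[of "fst p" "snd p" "Suc n"] by (simp add: P_def)
  qed
  then obtain f where f: "\<And>n. P n (f n)" "\<And>n. Q (f n) (f (Suc n))" by blast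
  let ?a = "%n. fst (f n)" and ?b = "%n. snd (f n)"
  have ab: "0 < ?a n" "?a n < ?b n" "?b n < T" for n using f(1)[of n] by (auto simp: P_def)
  have mono: "mono ?a" by (rule incseq_SucI) (use f(2) in \<open>auto simp: Q_def less_imp_le\<close>)
  have anti: "antimono ?b" by (rule decseq_SucI) (use f(2) in \<open>auto simp: Q_def less_imp_le\<close>)
  have le: "?a m <= ?b n" for m n
  proof -
    have "?a m <= ?a (max m n)" using mono by (auto simp: mono_def)
    also have "\<dots> < ?b (max m n)" by (rule ab)
    also have "\<dots> <= ?b n" using anti by (auto simp: antimono_def)
    finally show ?thesis by simp
  qed
  define c where "c = (SUP n. ?a n)"
  have bdd: "bdd_above (range ?a)" by (rule bdd_aboveI[of _ "?b 0"]) (use le in auto)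
  have ac: "?a n <= c" for n unfolding c_def by (rule cSUP_upper[OF _ bdd]) simp
  have cb: "c <= ?b n" for n unfolding c_def by (rule cSUP_least) (use le in auto)
  have c: "?a n < c" "c < ?b n" for n using ac[of "Suc n"] cb[of "Suc n"] f(2)[of n] by (auto simp: Q_def)
  show thesis
  proof (rule that[of c])
    show "0 < c" "c < T" using c[of 0] ab[of 0] by auto
    show "\<forall>e>0. \<exists>\<delta>>0. \<forall>s. \<bar>s - c\<bar> < \<delta> --> d s c < e"
    proof (intro allI impI)
      fix e :: real assume "0 < e"
      then obtain n where n: "1 / real (Suc n) < e" using nat_approx_posE by blast
      define \<delta> where "\<delta> = min (c - ?a n) (?b n - c)"
      have "d s c < e" if "\<bar>s - c\<bar> < \<delta>" for s
      proof -
        have "s \<in> {?a n..?b n}" "c \<in> {?a n..?b n}" using that c[of n] by (auto simp: \<delta>_def)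
        then have "d s c < 1 / real (Suc n)" using f(1)[of n] unfolding P_def by blast
        then show ?thesis using n by simp
      qed
      moreover have "0 < \<delta>" using c[of n] by (simp add: \<delta>_def)
      ultimately show "\<exists>\<delta>>0. \<forall>s. \<bar>s - c\<bar> < \<delta> --> d s c < e" by blast
    qed
  qed
qed

section \<open>Bounded functionals and continuity of orbits\<close>

lemma le_of_le_eps:
  fixes a b K :: real
  assumes "\<And>e. 0 < e ==> a <= b + K * e" "0 <= K" shows "a <= b"
proof (rule field_le_epsilon)
  fix e :: real assume e: "0 < e"
  have "K * (e / (K + 1)) <= e" using e assms(2) by (simp add: field_simps)
  then show "a <= b + e" using assms(1)[of "e / (K + 1)"] e assms(2) by simp
qed

text \<open>Bounded linear functionals on representatives. Composing an orbit with one of them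
  reduces calculus with values in \<open>L2\<close> to scalar calculus; the instances are inner
  products and point values of resolvents.\<close>

definition bfun :: "((real => real) => real) => bool" where
  "bfun l \<longleftrightarrow> (\<exists>C. 0 <= C \<and> (\<forall>f\<in>L2. \<bar>l f\<bar> <= C * L2norm f)) \<and> (\<forall>f\<in>L2. \<forall>g\<in>L2. \<forall>c. l (%x. f x + c * g x) = l f + c * l g)"

lemma bfun_bound: assumes "bfun l" obtains C where "0 <= C" "\<forall>f\<in>L2. \<bar>l f\<bar> <= C * L2norm f"
  using assms unfolding bfun_def by (elim exE conjE) (rule that)

lemma bfun_lin: "bfun l ==> f \<in> L2 ==> g \<in> L2 ==> l (%x. f x + c * g x) = l f + c * l g"
  unfolding bfun_def by blast

lemma bfun_diff: "bfun l ==> f \<in> L2 ==> g \<in> L2 ==> l (%x. f x - g x) = l f - l g"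
  using bfun_lin[of l f g "-1"] by simp

lemma bfun_scale: assumes "bfun l" "f \<in> L2" shows "l (%x. c * f x) = c * l f"
  using bfun_lin[OF assms(1,2,2), of "c - 1"] by (simp add: algebra_simps)

lemma bfun_cong:
  assumes l: "bfun l" and f: "f \<in> L2" and g: "g \<in> L2" and e: "L2eq f g" shows "l f = l g"
proof -
  obtain C where C: "0 <= C" "\<forall>f\<in>L2. \<bar>l f\<bar> <= C * L2norm f" using l by (rule bfun_bound)
  have "\<bar>l (%x. f x - g x)\<bar> <= C * L2norm (%x. f x - g x)" using C L2_diff[OF f g] by blast
  then show ?thesis using e by (simp add: L2eq_def bfun_diff[OF l f g])
qed

lemma bfun_L2inner: assumes p: "p \<in> L2" shows "bfun (%f. L2inner f p)"
  unfolding bfun_def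
proof (intro conjI ballI allI exI[of _ "L2norm p"])
  fix f assume f: "f \<in> L2"
  show "\<bar>L2inner f p\<bar> <= L2norm p * L2norm f" using L2_Cauchy_Schwarz[OF f p] by (simp add: mult.commute)
  fix g c assume g: "g \<in> L2"
  show "L2inner (%x. f x + c * g x) p = L2inner f p + c * L2inner g p"
    using L2inner_add[OF f L2_scale[OF g] p] by (simp add: L2inner_scale)
qed (rule L2norm_nonneg)

context pide
begin

lemma wip_commute: "wip v w = wip w v" unfolding wip_sc by (rule L2inner_commute)

lemma bfun_wip: assumes "p \<in> L2" shows "bfun (%f. wip f p)"
  unfolding wip_def using bfun_L2inner[OF div_theta_L2[OF assms]] .

lemma bfun_Rk: assumes \<kappa>: "Kd < \<kappa>" and x: "x \<in> {0..1}" shows "bfun (%f. Rk \<kappa> f x)"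
proof -
  obtain C where C: "0 <= C" "\<And>g x. g \<in> L2 ==> x \<in> {0..1} ==> \<bar>Rk \<kappa> g x\<bar> <= C * L2norm g" using Rk_bound[OF \<kappa>] by metis
  have "\<exists>C. 0 <= C \<and> (\<forall>f\<in>L2. \<bar>Rk \<kappa> f x\<bar> <= C * L2norm f)"
    by (rule exI[of _ C], intro conjI ballI C x)
  moreover have "\<forall>f\<in>L2. \<forall>g\<in>L2. \<forall>c. Rk \<kappa> (%x. f x + c * g x) x = Rk \<kappa> f x + c * Rk \<kappa> g x"
    by (intro ballI allI Rk_lin(1) \<kappa> x)
  ultimately show ?thesis unfolding bfun_def by (rule conjI)
qed

lemma wip_cong:
  assumes "L2eq v v'" "L2eq w w'" "v \<in> L2" "v' \<in> L2" "w \<in> L2" "w' \<in> L2" shows "wip v w = wip v' w'"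
  using bfun_cong[OF bfun_wip[OF assms(5)] assms(3,4,1)] bfun_cong[OF bfun_wip[OF assms(4)] assms(5,6,2)]
  by (simp add: wip_commute)

lemma wnorm_L2eq: assumes "L2eq v v'" "v \<in> L2" "v' \<in> L2" shows "wnorm v = wnorm v'"
proof -
  have "(wnorm v)^2 = (wnorm v')^2" unfolding wnorm_sq by (rule wip_cong[OF assms(1,1,2,3,2,3)])
  then show ?thesis using wnorm_nonneg by (simp add: power2_eq_iff_nonneg)
qed

end

context pide_semigroup
begin

lemma orbit_triangle:
  assumes "0 <= r" "0 <= s" "0 <= t" "g \<in> L2"
  shows "L2norm (%x. S r g x - S t g x) <= L2norm (%x. S r g x - S s g x) + L2norm (%x. S t g x - S s g x)"
  using L2norm_triangle3[OF S_L2[OF assms(1,4)] S_L2[OF assms(2,4)] S_L2[OF assms(3,4)]] L2norm_minus_commute[of "S s g" "S t g"] by simp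

lemma orbit_shift:
  assumes "0 <= r" "0 <= s" "0 <= t" and g: "g \<in> L2"
  shows "L2norm (%x. S (r + s) g x - S (r + t) g x) = L2norm (S r (%x. S s g x - S t g x))"
proof -
  note L = S_L2[OF assms(2) g] S_L2[OF assms(3) g] S_L2[OF _ g, of "r + s"] S_L2[OF _ g, of "r + t"]
  have "L2eq (%x. S (r + s) g x + (-1) * S (r + t) g x) (%x. S r (S s g) x + (-1) * S r (S t g) x)"
    by (rule L2eq_add) (use assms L in \<open>auto intro!: S_L2 S_plus\<close>)
  then have "L2norm (%x. S (r + s) g x - S (r + t) g x) = L2norm (%x. S r (S s g) x - S r (S t g) x)"
    by (intro L2norm_L2eq L2_diff S_L2 L g) (use assms in auto)
  then show ?thesis using S_diff_norm[OF assms(1) L(1,2)] by simp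
qed

lemma orbit_right_cont:
  assumes t: "0 <= t" and g: "g \<in> L2" and e: "0 < e"
  shows "\<exists>\<delta>>0. \<forall>s\<in>{t..t+\<delta>}. L2norm (%x. S s g x - S t g x) < e"
proof -
  obtain C where C: "0 <= C" "\<forall>w\<in>L2. L2norm (S t w) <= C * L2norm w" using t by (rule S_bound)
  have "0 < e / (C + 1)" using e C by simp
  then have "\<forall>\<^sub>F h in at_right 0. L2norm (%x. S h g x - g x) < e / (C + 1)" by (rule order_tendstoD(2)[OF S_strong[OF g]])
  then obtain d where d: "0 < d" "\<And>h. 0 < h ==> h < d ==> L2norm (%x. S h g x - g x) < e / (C + 1)"
    unfolding eventually_at_right_field by blast
  have "L2norm (%x. S s g x - S t g x) < e" if s: "s \<in> {t..t+d/2}" for s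
  proof (cases "s = t")
    case True
    then show ?thesis using e by (simp add: L2norm_def)
  next
    case False
    then have h: "0 < s - t" "s - t < d" using s d by auto
    have S0: "S 0 g \<in> L2" by (rule S_L2[OF _ g]) simp
    have Sh: "S (s - t) g \<in> L2" by (rule S_L2[OF _ g]) (use h in simp)
    have "L2norm (%x. S s g x - S t g x) = L2norm (S t (%x. S (s - t) g x - S 0 g x))"
      using orbit_shift[of t "s - t" 0 g] t h g by simp
    also have "\<dots> <= C * L2norm (%x. S (s - t) g x - S 0 g x)" using C L2_diff[OF Sh S0] by blast
    also have "L2norm (%x. S (s - t) g x - S 0 g x) = L2norm (%x. S (s - t) g x - g x)"
      using L2eq_add[OF Sh S0 Sh g L2eq_refl S_zero[OF g], of "-1"] by (intro L2norm_L2eq L2_diff Sh S0 g) simp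
    also have "C * \<dots> <= C * (e / (C + 1))" using d(2)[OF h] C by (intro mult_left_mono) auto
    also have "\<dots> < e" using C e by (simp add: field_simps)
    finally show ?thesis .
  qed
  then show ?thesis using d(1) by (intro exI[of _ "d/2"]) auto
qed

text \<open>The bounds on \<open>S t\<close> are separate for each time, so left continuity is not
  immediate. Right continuity yields one continuity point \<open>c < t\<close>, and the single
  operator \<open>S (t - c)\<close> carries continuity from \<open>c\<close> to
  \<open>t\<close>.\<close>

lemma orbit_cont:
  assumes t: "0 <= t" and g: "g \<in> L2" and e: "0 < e"
  shows "\<exists>\<delta>>0. \<forall>s\<ge>0. \<bar>s - t\<bar> < \<delta> --> L2norm (%x. S s g x - S t g x) < e"
proof (cases "t = 0")
  case True
  obtain \<delta> where \<delta>: "0 < \<delta>" "\<forall>s\<in>{t..t+\<delta>}. L2norm (%x. S s g x - S t g x) < e" using orbit_right_cont[OF t g e] by blast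
  then show ?thesis using True by (intro exI[of _ \<delta>]) auto
next
  case False
  then have tp: "0 < t" using t by simp
  obtain c where c: "0 < c" "c < t" "\<forall>e>0. \<exists>\<delta>>0. \<forall>s. \<bar>s - c\<bar> < \<delta> --> L2norm (%x. S s g x - S c g x) < e"
  proof (rule right_cont_imp_cont_point[of "%s t. L2norm (%x. S s g x - S t g x)" t])
    fix r s t :: real assume "0 <= r" "0 <= s" "0 <= t"
    then show "L2norm (%x. S r g x - S t g x) <= L2norm (%x. S r g x - S s g x) + L2norm (%x. S t g x - S s g x)"
      by (rule orbit_triangle[OF _ _ _ g])
  next
    fix t e :: real assume "0 <= t" "0 < e"
    then show "\<exists>\<delta>>0. \<forall>s\<in>{t..t+\<delta>}. L2norm (%x. S s g x - S t g x) < e" by (rule orbit_right_cont[OF _ g])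
  qed (use tp in simp)
  have tc: "0 <= t - c" using c by simp
  obtain C where C: "0 <= C" "\<forall>w\<in>L2. L2norm (S (t - c) w) <= C * L2norm w" using tc by (rule S_bound)
  have "0 < e / (C + 1)" using e C by simp
  then obtain \<delta> where \<delta>: "0 < \<delta>" "\<forall>s. \<bar>s - c\<bar> < \<delta> --> L2norm (%x. S s g x - S c g x) < e / (C + 1)" using c(3) by blast
  have "L2norm (%x. S s g x - S t g x) < e" if s: "\<bar>s - t\<bar> < min \<delta> c" for s
  proof -
    define r where "r = s - (t - c)"
    have r: "0 <= r" "\<bar>r - c\<bar> < \<delta>" using s c by (auto simp: r_def)
    have "L2norm (%x. S s g x - S t g x) = L2norm (S (t - c) (%x. S r g x - S c g x))"
      using orbit_shift[of "t - c" r c g] tc r c g by (simp add: r_def)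
    also have "\<dots> <= C * L2norm (%x. S r g x - S c g x)" using C(2) L2_diff[OF S_L2[OF r(1) g] S_L2[OF _ g]] c by auto
    also have "\<dots> <= C * (e / (C + 1))" using \<delta>(2) r C(1) by (intro mult_left_mono less_imp_le[of "L2norm _"]) auto
    also have "\<dots> < e" using C e by (simp add: field_simps)
    finally show ?thesis .
  qed
  then show ?thesis using \<delta>(1) c(1) by (intro exI[of _ "min \<delta> c"]) auto
qed

lemma bfun_orbit_cont: assumes l: "bfun l" and g: "g \<in> L2" shows "continuous_on {0..T} (%t. l (S t g))"
  unfolding continuous_on_iff
proof (intro ballI allI impI)
  fix t e :: real assume t: "t \<in> {0..T}" and e: "0 < e"
  have t0: "0 <= t" using t by simp
  obtain C where C: "0 <= C" "\<forall>f\<in>L2. \<bar>l f\<bar> <= C * L2norm f" using l by (rule bfun_bound)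
  have "0 < e / (C + 1)" using e C by simp
  then obtain \<delta> where \<delta>: "0 < \<delta>" "\<forall>s\<ge>0. \<bar>s - t\<bar> < \<delta> --> L2norm (%x. S s g x - S t g x) < e / (C + 1)"
    using orbit_cont[OF t0 g] by blast
  show "\<exists>d>0. \<forall>s\<in>{0..T}. dist s t < d --> dist (l (S s g)) (l (S t g)) < e"
  proof (intro exI[of _ \<delta>] conjI ballI impI \<delta>(1))
    fix s assume s: "s \<in> {0..T}" "dist s t < \<delta>"
    have s0: "0 <= s" using s by simp
    have "\<bar>l (S s g) - l (S t g)\<bar> <= C * L2norm (%x. S s g x - S t g x)"
      using C(2) L2_diff[OF S_L2[OF s0 g] S_L2[OF t0 g]] bfun_diff[OF l S_L2[OF s0 g] S_L2[OF t0 g]] by metis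
    also have "\<dots> <= C * (e / (C + 1))" using \<delta>(2) s C(1) by (intro mult_left_mono less_imp_le[of "L2norm _"]) (auto simp: dist_real_def)
    also have "\<dots> < e" using C e by (simp add: field_simps)
    finally show "dist (l (S s g)) (l (S t g)) < e" by (simp add: dist_real_def)
  qed
qed

lemma wnorm_orbit_cont: assumes g: "g \<in> L2" shows "continuous_on {0..T} (%t. wnorm (S t g))"
  unfolding continuous_on_iff
proof (intro ballI allI impI)
  fix t e :: real assume t: "t \<in> {0..T}" and e: "0 < e"
  have t0: "0 <= t" using t by simp
  define C where "C = 1 / sqrt c0"
  have C: "0 < C" using c0 by (simp add: C_def)
  have "0 < e / C" using e C by simp
  then obtain \<delta> where \<delta>: "0 < \<delta>" "\<forall>s\<ge>0. \<bar>s - t\<bar> < \<delta> --> L2norm (%x. S s g x - S t g x) < e / C"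
    using orbit_cont[OF t0 g] by blast
  show "\<exists>d>0. \<forall>s\<in>{0..T}. dist s t < d --> dist (wnorm (S s g)) (wnorm (S t g)) < e"
  proof (intro exI[of _ \<delta>] conjI ballI impI \<delta>(1))
    fix s assume s: "s \<in> {0..T}" "dist s t < \<delta>"
    have s0: "0 <= s" using s by simp
    note L = S_L2[OF s0 g] S_L2[OF t0 g]
    have "wnorm (S s g) <= wnorm (%x. S s g x - S t g x) + wnorm (S t g)"
      using wnorm_triangle[OF L2_diff[OF L] L(2)] by simp
    moreover have "wnorm (S t g) <= wnorm (%x. S t g x - S s g x) + wnorm (S s g)"
      using wnorm_triangle[OF L2_diff[OF L(2,1)] L(1)] by simp
    moreover have "wnorm (%x. S s g x - S t g x) <= C * L2norm (%x. S s g x - S t g x)"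
      unfolding C_def by (rule wnorm_le[OF L2_diff[OF L]])
    moreover have "C * L2norm (%x. S s g x - S t g x) < C * (e / C)" using \<delta>(2) s C by (intro mult_strict_left_mono) (auto simp: dist_real_def)
    moreover have "C * (e / C) = e" using C by simp
    moreover have "wnorm (%x. S t g x - S s g x) = wnorm (%x. S s g x - S t g x)" by (rule wnorm_minus_commute)
    ultimately show "dist (wnorm (S s g)) (wnorm (S t g)) < e" unfolding dist_real_def by linarith
  qed
qed

lemma orbit_bounded:
  assumes g: "g \<in> L2" obtains B where "0 <= B" "\<forall>t\<in>{0..T}. L2norm (S t g) <= B"
proof -
  obtain C where C: "0 < C" "\<And>w. w \<in> L2 ==> L2norm w <= C * wnorm w" using wnorm_ge by blast
  have "compact ((%t. wnorm (S t g)) ` {0..T})" by (rule compact_continuous_image[OF wnorm_orbit_cont[OF g]]) simp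
  then have "bounded ((%t. wnorm (S t g)) ` {0..T})" by (rule compact_imp_bounded)
  then obtain B where B: "\<forall>y\<in>(%t. wnorm (S t g)) ` {0..T}. norm y <= B" unfolding bounded_iff by blast
  have "L2norm (S t g) <= C * \<bar>B\<bar>" if t: "t \<in> {0..T}" for t
  proof -
    have "norm (wnorm (S t g)) <= B" using B t by blast
    then have "wnorm (S t g) <= \<bar>B\<bar>" by simp
    then have "C * wnorm (S t g) <= C * \<bar>B\<bar>" using C by simp
    moreover have "L2norm (S t g) <= C * wnorm (S t g)" using t by (intro C S_L2 g) simp
    ultimately show ?thesis by simp
  qed
  then show thesis using C(1) by (intro that[of "C * \<bar>B\<bar>"]) auto
qed

text \<open>The right derivative comes from \<open>orbit_quotient\<close>; it is continuous in time,
  so \<open>right_deriv_imp_deriv\<close> makes it two-sided.\<close>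

lemma orbit_functional:
  assumes l: "bfun l" and w: "w \<in> L2" and z: "z \<in> L2" and g: "gen_lim S w z" and t: "t \<in> {0..T}"
  shows "((%t. l (S t w)) has_real_derivative l (S t z)) (at t within {0..T})"
proof (rule right_deriv_imp_deriv[OF bfun_orbit_cont[OF l w] bfun_orbit_cont[OF l z] _ t])
  fix t assume "t \<in> {0..<T}"
  then have t: "0 <= t" by simp
  obtain C where C: "0 <= C" "\<forall>f\<in>L2. \<bar>l f\<bar> <= C * L2norm f" using l by (rule bfun_bound)
  note St = S_L2[OF t w] and Sz = S_L2[OF t z]
  have "((%h. (l (S (t + h) w) - l (S t w)) / h - l (S t z)) \<longlongrightarrow> 0) (at_right 0)"
  proof (rule Lim_null_comparison)
    show "((%h. C * L2norm (%x. (S (t + h) w x - S t w x) / h - S t z x)) \<longlongrightarrow> 0) (at_right 0)"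
      by (rule tendsto_mult_right_zero[OF orbit_quotient[OF t w z g]])
    show "\<forall>\<^sub>F h in at_right 0. norm ((l (S (t + h) w) - l (S t w)) / h - l (S t z)) <= C * L2norm (%x. (S (t + h) w x - S t w x) / h - S t z x)"
      using eventually_at_right_less[of 0]
    proof eventually_elim
      case (elim h)
      have Sth: "S (t + h) w \<in> L2" using t elim by (intro S_L2 w) auto
      have D: "(%x. S (t + h) w x - S t w x) \<in> L2" by (rule L2_diff[OF Sth St])
      have 1: "(%x. (S (t + h) w x - S t w x) / h - S t z x) = (%x. (1 / h) * (S (t + h) w x - S t w x) - S t z x)" by simp
      have L: "(%x. (1 / h) * (S (t + h) w x - S t w x)) \<in> L2" by (rule L2_scale[OF D])
      have "l (%x. (S (t + h) w x - S t w x) / h - S t z x) = (l (S (t + h) w) - l (S t w)) / h - l (S t z)"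
        unfolding 1 bfun_diff[OF l L Sz] bfun_scale[OF l D] bfun_diff[OF l Sth St] by simp
      moreover have "(%x. (S (t + h) w x - S t w x) / h - S t z x) \<in> L2" unfolding 1 by (rule L2_diff[OF L Sz])
      ultimately show ?case using C(2) by (metis real_norm_def)
    qed
  qed
  then have "((%h. (l (S (t + h) w) - l (S t w)) / h) \<longlongrightarrow> l (S t z)) (at_right 0)" by (simp add: LIM_zero_iff)
  then show "((%t. l (S t w)) has_real_derivative l (S t z)) (at_right t)" by (rule has_right_deriv_quotient)
qed

lemma wnorm_sq_right_deriv:
  assumes t: "0 <= t" and w: "w \<in> L2" and z: "z \<in> L2" and g: "gen_lim S w z"
  shows "((%t. (wnorm (S t w))^2) has_real_derivative 2 * wip (S t w) (S t z)) (at_right t)"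
proof (rule has_right_deriv_quotient)
  note St = S_L2[OF t w] and Sz = S_L2[OF t z]
  let ?q = "%h x. (S (t + h) w x - S t w x) / h"
  have d0: "((%h. L2norm (%x. ?q h x - S t z x)) \<longlongrightarrow> 0) (at_right 0)" by (rule orbit_quotient[OF t w z g])
  have ev: "\<forall>\<^sub>F h in at_right (0::real). 0 < h" by (rule eventually_at_right_less)
  have qL: "?q h \<in> L2" if "0 < h" for h using t that by (intro L2_divide L2_diff S_L2 w) auto
  let ?N = "%h. wnorm (%x. ?q h x - S t z x)"
  have N0: "(?N \<longlongrightarrow> 0) (at_right 0)"
  proof (rule Lim_null_comparison)
    show "((%h. 1 / sqrt c0 * L2norm (%x. ?q h x - S t z x)) \<longlongrightarrow> 0) (at_right 0)" by (rule tendsto_mult_right_zero[OF d0])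
    show "\<forall>\<^sub>F h in at_right 0. norm (?N h) <= 1 / sqrt c0 * L2norm (%x. ?q h x - S t z x)"
      using ev by eventually_elim (use wnorm_le[OF L2_diff[OF qL Sz]] wnorm_nonneg in simp)
  qed
  \<comment> \<open>The first term pairs the error of the quotient with the orbit; the second is
    \<open>h\<close> times the squared norm of the quotient, bounded through its limit.\<close>
  let ?E = "%h. 2 * (?N h * wnorm (S t w)) + h * (?N h + wnorm (S t z))^2"
  have "((%h. ((wnorm (S (t + h) w))^2 - (wnorm (S t w))^2) / h - 2 * wip (S t w) (S t z)) \<longlongrightarrow> 0) (at_right 0)"
  proof (rule Lim_null_comparison)
    have "(?E \<longlongrightarrow> 2 * (0 * wnorm (S t w)) + 0 * (0 + wnorm (S t z))^2) (at_right 0)" by (intro tendsto_intros N0)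
    then show "(?E \<longlongrightarrow> 0) (at_right 0)" by simp
    show "\<forall>\<^sub>F h in at_right 0. norm (((wnorm (S (t + h) w))^2 - (wnorm (S t w))^2) / h - 2 * wip (S t w) (S t z)) <= ?E h"
      using ev
    proof eventually_elim
      case (elim h)
      then have h: "0 < h" .
      note q = qL[OF h]
      have eq: "S (t + h) w = (%x. S t w x + h * ?q h x)" using h by (simp add: fun_eq_iff)
      have "(wnorm (S (t + h) w))^2 = wip (S t w) (S t w) + h * wip (?q h) (S t w) + h * (wip (S t w) (?q h) + h * wip (?q h) (?q h))"
      proof -
        let ?s = "%x. S t w x + h * ?q h x"
        have sL: "?s \<in> L2" by (rule L2_add[OF St L2_scale[OF q]])
        have "(wnorm (S (t + h) w))^2 = wip ?s ?s" unfolding wnorm_sq by (subst eq, subst eq) (rule refl)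
        also have "\<dots> = wip (S t w) ?s + h * wip (?q h) ?s" by (rule bfun_lin[OF bfun_wip[OF sL] St q])
        also have "wip (S t w) ?s = wip ?s (S t w)" by (rule wip_commute)
        also have "\<dots> = wip (S t w) (S t w) + h * wip (?q h) (S t w)" by (rule bfun_lin[OF bfun_wip[OF St] St q])
        also have "wip (?q h) ?s = wip ?s (?q h)" by (rule wip_commute)
        also have "\<dots> = wip (S t w) (?q h) + h * wip (?q h) (?q h)" by (rule bfun_lin[OF bfun_wip[OF q] St q])
        finally show ?thesis .
      qed
      also have "wip (S t w) (?q h) = wip (?q h) (S t w)" by (rule wip_commute)
      finally have "((wnorm (S (t + h) w))^2 - (wnorm (S t w))^2) / h = 2 * wip (?q h) (S t w) + h * (wnorm (?q h))^2"
        using h by (simp add: wnorm_sq field_simps)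
      moreover have "wip (?q h) (S t w) - wip (S t w) (S t z) = wip (%x. ?q h x - S t z x) (S t w)"
        using bfun_diff[OF bfun_wip[OF St] q Sz] wip_commute[of "S t w" "S t z"] by simp
      moreover have "\<bar>wip (%x. ?q h x - S t z x) (S t w)\<bar> <= ?N h * wnorm (S t w)" by (rule wip_le[OF L2_diff[OF q Sz] St])
      moreover have "h * (wnorm (?q h))^2 <= h * (?N h + wnorm (S t z))^2"
        using wnorm_triangle[OF L2_diff[OF q Sz] Sz] h wnorm_nonneg by (intro mult_left_mono power_mono) auto
      moreover have "0 <= h * (wnorm (?q h))^2" using h by simp
      ultimately show ?case unfolding real_norm_def by linarith
    qed
  qed
  then show "((%h. ((wnorm (S (t + h) w))^2 - (wnorm (S t w))^2) / h) \<longlongrightarrow> 2 * wip (S t w) (S t z)) (at_right 0)"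
    by (simp add: LIM_zero_iff)
qed

text \<open>The energy inequality for resolvents is available for piecewise continuous data. With
  two resolvents the orbit is the resolvent of the continuous function \<open>R (S t g)\<close>, so
  the inequality applies along it.\<close>

lemma S_Rk_energy:
  assumes \<kappa>: "Kd < \<kappa>" and g: "g \<in> L2" and t: "0 <= t"
  defines "w \<equiv> Rk \<kappa> (Rk \<kappa> g)" and "z \<equiv> %x. \<kappa> * Rk \<kappa> (Rk \<kappa> g) x - Rk \<kappa> g x"
  shows "wip (S t w) (S t z) <= Kd * (wnorm (S t w))^2"
proof -
  define p where "p = Rk \<kappa> (S t g)"
  have Rg: "Rk \<kappa> g \<in> L2" by (rule Rk_L2[OF \<kappa> g])
  have wL: "w \<in> L2" unfolding w_def by (rule Rk_L2[OF \<kappa> Rg])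
  have pc: "pcont p" unfolding p_def by (rule Rk_pcont[OF \<kappa> S_L2[OF t g]])
  have pL: "p \<in> L2" by (rule pcont_L2[OF pc])
  have RpL: "Rk \<kappa> p \<in> L2" by (rule Rk_L2[OF \<kappa> pL])
  have e1: "L2eq (S t (Rk \<kappa> g)) p" unfolding p_def by (rule S_Rk_commute[OF \<kappa> g t])
  have SRg: "S t (Rk \<kappa> g) \<in> L2" by (rule S_L2[OF t Rg])
  have "L2eq (Rk \<kappa> (S t (Rk \<kappa> g))) (Rk \<kappa> p)" by (rule L2eq_cong) (rule Rk_cong[OF \<kappa> SRg pL e1])
  then have e2: "L2eq (S t w) (Rk \<kappa> p)" unfolding w_def
    by (rule L2eq_trans[OF S_L2[OF t wL[unfolded w_def]] Rk_L2[OF \<kappa> SRg] RpL S_Rk_commute[OF \<kappa> Rg t]])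
  note Sw = S_L2[OF t wL]
  have zL: "z \<in> L2" unfolding z_def using wL[unfolded w_def] by (intro L2_diff L2_scale Rg)
  have zw: "z = (%x. (-1) * Rk \<kappa> g x + \<kappa> * w x)" by (simp add: z_def w_def)
  have "L2eq (S t z) (%x. (-1) * S t (Rk \<kappa> g) x + \<kappa> * S t w x)" unfolding zw by (rule S_lin'[OF t Rg wL])
  moreover have "L2eq (%x. (-1) * S t (Rk \<kappa> g) x + \<kappa> * S t w x) (%x. (-1) * S t (Rk \<kappa> g) x + \<kappa> * Rk \<kappa> p x)"
    by (rule L2eq_add[OF L2_scale[OF SRg] Sw L2_scale[OF SRg] RpL L2eq_refl e2])
  moreover have "L2eq (%x. \<kappa> * Rk \<kappa> p x + (-1) * S t (Rk \<kappa> g) x) (%x. \<kappa> * Rk \<kappa> p x + (-1) * p x)"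
    by (rule L2eq_add[OF L2_scale[OF RpL] SRg L2_scale[OF RpL] pL L2eq_refl e1])
  then have "L2eq (%x. (-1) * S t (Rk \<kappa> g) x + \<kappa> * Rk \<kappa> p x) (%x. \<kappa> * Rk \<kappa> p x - p x)" by simp
  ultimately have e3: "L2eq (S t z) (%x. \<kappa> * Rk \<kappa> p x - p x)"
    using L2eq_trans[OF S_L2[OF t zL] L2_add[OF L2_scale[OF SRg, of "-1"] L2_scale[OF Sw, of \<kappa>]] L2_add[OF L2_scale[OF SRg, of "-1"] L2_scale[OF RpL, of \<kappa>]]]
      L2eq_trans[OF S_L2[OF t zL] L2_add[OF L2_scale[OF SRg, of "-1"] L2_scale[OF RpL, of \<kappa>]] L2_diff[OF L2_scale[OF RpL, of \<kappa>] pL]] by blast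
  have "wip (S t w) (S t z) = wip (Rk \<kappa> p) (%x. \<kappa> * Rk \<kappa> p x - p x)"
    by (rule wip_cong[OF e2 e3 Sw RpL S_L2[OF t zL] L2_diff[OF L2_scale[OF RpL] pL]])
  also have "\<dots> <= Kd * wip (Rk \<kappa> p) (Rk \<kappa> p)" by (rule Rk_energy[OF \<kappa> pc])
  also have "wip (Rk \<kappa> p) (Rk \<kappa> p) = (wnorm (S t w))^2" unfolding wnorm_L2eq[OF e2 Sw RpL] by (rule wnorm_sq[symmetric])
  finally show ?thesis .
qed

text \<open>The square of the weighted norm, multiplied by \<open>exp (- 2 * Kd * t)\<close>, has
  nonpositive right derivative.\<close>

lemma S_Rk_growth:
  assumes \<kappa>: "Kd < \<kappa>" and g: "g \<in> L2" and t: "0 <= t"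
  shows "wnorm (S t (Rk \<kappa> (Rk \<kappa> g))) <= exp (Kd * t) * wnorm (Rk \<kappa> (Rk \<kappa> g))"
proof -
  let ?w = "Rk \<kappa> (Rk \<kappa> g)" and ?z = "%x. \<kappa> * Rk \<kappa> (Rk \<kappa> g) x - Rk \<kappa> g x"
  have Rg: "Rk \<kappa> g \<in> L2" by (rule Rk_L2[OF \<kappa> g])
  have wL: "?w \<in> L2" by (rule Rk_L2[OF \<kappa> Rg])
  have zL: "?z \<in> L2" by (intro L2_diff L2_scale wL Rg)
  let ?f = "%t. exp (- (2 * Kd * t)) * (wnorm (S t ?w))^2"
  have "?f t <= ?f 0"
  proof (rule right_deriv_nonincreasing[OF _ t])
    show "continuous_on {0..t} ?f" by (intro continuous_intros wnorm_orbit_cont wL)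
    fix s assume "s \<in> {0..<t}"
    then have s: "0 <= s" by simp
    let ?D = "exp (- (2 * Kd * s)) * (2 * wip (S s ?w) (S s ?z)) + (exp (- (2 * Kd * s)) * (- (2 * Kd))) * (wnorm (S s ?w))^2"
    have "((%t. exp (- (2 * Kd * t))) has_real_derivative exp (- (2 * Kd * s)) * (- (2 * Kd))) (at_right s)"
      by (auto intro!: derivative_eq_intros)
    from DERIV_mult'[OF this wnorm_sq_right_deriv[OF s wL zL gen_Rk[OF \<kappa> Rg]]]
    have D: "(?f has_real_derivative ?D) (at_right s)" .
    have "?D = 2 * exp (- (2 * Kd * s)) * (wip (S s ?w) (S s ?z) - Kd * (wnorm (S s ?w))^2)" by (simp add: algebra_simps)
    also have "\<dots> <= 0" using S_Rk_energy[OF \<kappa> g s] by (intro mult_nonneg_nonpos) auto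
    finally show "\<exists>D\<le>0. (?f has_real_derivative D) (at_right s)" using D by blast
  qed
  moreover have "wnorm (S 0 ?w) = wnorm ?w" by (rule wnorm_L2eq[OF S_zero[OF wL] S_L2[OF _ wL] wL]) simp
  ultimately have "exp (- (2 * Kd * t)) * (wnorm (S t ?w))^2 <= (wnorm ?w)^2" by simp
  then have "(wnorm (S t ?w))^2 <= exp (2 * Kd * t) * (wnorm ?w)^2" by (simp add: exp_minus field_simps)
  also have "\<dots> = (exp (Kd * t) * wnorm ?w)^2" by (simp add: power_mult_distrib exp_double[symmetric] mult.assoc)
  finally show ?thesis by (rule power2_le_imp_le) (simp add: wnorm_nonneg)
qed

text \<open>Approximation by double resolvents. The uncontrolled bound \<open>C\<close> of the
  individual operator \<open>S t\<close> multiplies only the approximation error and disappears in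
  the limit, leaving a factor uniform on bounded time intervals.\<close>

lemma S_stable_wnorm:
  assumes d: "pcont d" and t: "0 <= t"
  shows "wnorm (S t d) <= exp (Kd * t) * wnorm d"
proof -
  obtain C where C: "0 <= C" "\<forall>w\<in>L2. L2norm (S t w) <= C * L2norm w" using t by (rule S_bound)
  obtain C' where C': "0 < C'" "\<And>w. w \<in> L2 ==> L2norm w <= C' * wnorm w" using wnorm_ge by blast
  define A where "A = 1 / sqrt c0"
  have A: "0 < A" using c0 by (simp add: A_def)
  note dL = pcont_L2[OF d]
  show ?thesis
  proof (rule le_of_le_eps)
    fix e :: real assume e: "0 < e"
    obtain \<kappa> where \<kappa>: "Kd < \<kappa>" "wnorm (%x. Rk \<kappa> (Rk \<kappa> (%x. \<kappa>^2 * d x)) x - d x) <= e" using resolvent_sq_approx[OF d e] by blast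
    let ?g = "%x. \<kappa>^2 * d x" and ?J = "Rk \<kappa> (Rk \<kappa> (%x. \<kappa>^2 * d x))"
    have gL: "?g \<in> L2" by (rule L2_scale[OF dL])
    have JL: "?J \<in> L2" by (rule Rk_L2[OF \<kappa>(1) Rk_L2[OF \<kappa>(1) gL]])
    note DL = L2_diff[OF JL dL] and SJ = S_L2[OF t JL] and Sd = S_L2[OF t dL]
    have "wnorm (S t d) <= wnorm (%x. S t d x - S t ?J x) + wnorm (S t ?J)"
      using wnorm_triangle[OF L2_diff[OF Sd SJ] SJ] by simp
    moreover have "wnorm (%x. S t d x - S t ?J x) <= A * (C * (C' * e))"
    proof -
      have "wnorm (%x. S t d x - S t ?J x) = wnorm (%x. S t ?J x - S t d x)" by (rule wnorm_minus_commute)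
      also have "\<dots> <= A * L2norm (%x. S t ?J x - S t d x)" unfolding A_def by (rule wnorm_le[OF L2_diff[OF SJ Sd]])
      also have "L2norm (%x. S t ?J x - S t d x) = L2norm (S t (%x. ?J x - d x))" by (rule S_diff_norm[OF t JL dL])
      also have "\<dots> <= C * L2norm (%x. ?J x - d x)" using C(2) DL by blast
      also have "L2norm (%x. ?J x - d x) <= C' * wnorm (%x. ?J x - d x)" by (rule C'(2)[OF DL])
      also have "\<dots> <= C' * e" using \<kappa>(2) C'(1) by simp
      finally show ?thesis using A C(1) by (simp add: mult_left_mono)
    qed
    moreover have "wnorm (S t ?J) <= exp (Kd * t) * wnorm ?J" by (rule S_Rk_growth[OF \<kappa>(1) gL t])
    moreover have "exp (Kd * t) * wnorm ?J <= exp (Kd * t) * (wnorm d + e)"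
    proof -
      have "wnorm ?J <= wnorm (%x. ?J x - d x) + wnorm d" using wnorm_triangle[OF DL dL] by simp
      then show ?thesis using \<kappa>(2) by simp
    qed
    ultimately show "wnorm (S t d) <= exp (Kd * t) * wnorm d + (A * (C * C') + exp (Kd * t)) * e" by (simp add: algebra_simps)
  qed (use A C C' in simp)
qed

lemma S_stable:
  obtains C where "0 <= C" "\<forall>t\<in>{0..T}. \<forall>d. pcont d --> L2norm (S t d) <= C * L2norm d"
proof -
  obtain C' where C': "0 < C'" "\<And>w. w \<in> L2 ==> L2norm w <= C' * wnorm w" using wnorm_ge by blast
  define A where "A = 1 / sqrt c0"
  have A: "0 < A" using c0 by (simp add: A_def)
  have "L2norm (S t d) <= C' * (exp (Kd * T) * A) * L2norm d" if t: "t \<in> {0..T}" and d: "pcont d" for t d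
  proof -
    have t0: "0 <= t" "t <= T" using t by auto
    have "L2norm (S t d) <= C' * wnorm (S t d)" by (rule C'(2)[OF S_L2[OF t0(1) pcont_L2[OF d]]])
    also have "wnorm (S t d) <= exp (Kd * t) * wnorm d" by (rule S_stable_wnorm[OF d t0(1)])
    also have "exp (Kd * t) * wnorm d <= exp (Kd * T) * (A * L2norm d)" unfolding A_def
      using t0 Kd(1) by (intro mult_mono wnorm_le pcont_L2 d) (auto simp: wnorm_nonneg mult_left_mono)
    finally show ?thesis using C'(1) by (simp add: mult_left_mono mult.assoc)
  qed
  then show thesis using C'(1) A by (intro that[of "C' * (exp (Kd * T) * A)"]) auto
qed

end

section \<open>Regularity of the lifting and of the kernel; exponential sums\<close>

lemma powr_cont_01: "0 < a ==> continuous_on {0..1} (%x::real. x powr a)"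
  by (rule continuous_on_powr') (auto intro: continuous_intros)

lemma powr_deriv_01:
  fixes a x :: real
  assumes a: "1 < a" and x: "x \<in> {0..1}"
  shows "((%x. x powr a) has_real_derivative a * x powr (a - 1)) (at x within {0..1})"
proof (cases "x = 0")
  case False
  then have "((%x. x powr a) has_real_derivative a * x powr (a - 1)) (at x)" using x by (intro has_real_derivative_powr) auto
  then show ?thesis by (rule has_field_derivative_at_within)
next
  \<comment> \<open>At 0 the difference quotient is \<open>y powr (a - 1)\<close> itself, which
    tends to 0 because \<open>a > 1\<close>.\<close>
  case True
  have "continuous (at 0 within {0..1}) (%x::real. x powr (a - 1))"
    using powr_cont_01[of "a - 1"] a by (simp add: continuous_on_eq_continuous_within)
  then have "((%x::real. x powr (a - 1)) \<longlongrightarrow> 0) (at 0 within {0..1})" using a by (simp add: continuous_within)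
  moreover have "\<forall>\<^sub>F y in at 0 within {0..1}. y powr (a - 1) = (y powr a - 0 powr a) / (y - (0::real))"
    unfolding eventually_at_filter by (rule always_eventually) (auto simp: powr_diff)
  ultimately have "((%y. (y powr a - 0 powr a) / (y - (0::real))) \<longlongrightarrow> 0) (at 0 within {0..1})" by (rule Lim_transform_eventually)
  then show ?thesis using True a by (simp add: has_field_derivative_iff)
qed

lemma C1_01_abs_le_norm:
  assumes "C1_01 g" "s \<in> {0..1}" shows "\<bar>g s\<bar> <= C1norm_01 g"
proof -
  obtain g' where g': "\<forall>x\<in>{0..1}. (g has_real_derivative g' x) (at x within {0..1})" "continuous_on {0..1} g'"
    using assms(1) unfolding C1_01_def by blast
  have gc: "continuous_on {0..1} g" by (rule DERIV_continuous_on) (use g' in blast)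
  have v: "vector_derivative g (at x within {0..1}) = g' x" if "x \<in> {0..1}" for x
    by (rule vector_derivative_within_cbox[of 0 1 x, unfolded cbox_interval])
      (use g' that in \<open>auto simp: has_real_derivative_iff_has_vector_derivative\<close>)
  have b: "bdd_above ((%x. \<bar>h x\<bar>) ` {0..1})" if "continuous_on {0..1} h" for h :: "real => real"
    by (rule bounded_imp_bdd_above, rule compact_imp_bounded, rule compact_continuous_image) (use that in \<open>auto intro: continuous_intros\<close>)
  have "\<bar>g s\<bar> <= (SUP x\<in>{0..1}. \<bar>g x\<bar>)" by (rule cSUP_upper[OF assms(2) b[OF gc]])
  moreover have "0 <= (SUP x\<in>{0..1}. \<bar>vector_derivative g (at x within {0..1})\<bar>)"
  proof -
    have "(SUP x\<in>{0..1}. \<bar>vector_derivative g (at x within {0..1})\<bar>) = (SUP x\<in>{0..1}. \<bar>g' x\<bar>)"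
      by (rule SUP_cong) (auto simp: v)
    moreover have "\<bar>g' s\<bar> <= (SUP x\<in>{0..1}. \<bar>g' x\<bar>)" by (rule cSUP_upper[OF assms(2) b[OF g'(2)]])
    ultimately show ?thesis by simp
  qed
  ultimately show ?thesis unfolding C1norm_01_def by linarith
qed

lemma C1_01_lin:
  assumes "C1_01 a" "C1_01 b" "C1_01 c" shows "C1_01 (%s. a s - b s - k * c s)"
proof -
  obtain a' b' c' where "\<forall>x\<in>{0..1}. (a has_real_derivative a' x) (at x within {0..1})" "continuous_on {0..1} a'"
    "\<forall>x\<in>{0..1}. (b has_real_derivative b' x) (at x within {0..1})" "continuous_on {0..1} b'"
    "\<forall>x\<in>{0..1}. (c has_real_derivative c' x) (at x within {0..1})" "continuous_on {0..1} c'"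
    using assms unfolding C1_01_def by blast
  then show ?thesis unfolding C1_01_def
    by (intro exI[of _ "%x. a' x - b' x - k * c' x"] conjI ballI DERIV_diff DERIV_cmult continuous_intros) auto
qed

text \<open>Differentiability with values in \<open>C^1\<close> gives an increment bound in the
  first variable that is uniform in the second; for fixed first variable the section is
  Lipschitz.\<close>

lemma kernel_continuous:
  assumes "C1_C1_kernel \<phi>" shows "continuous_on ({0..1} \<times> {0..1}) (%p. \<phi> (fst p) (snd p))"
  unfolding continuous_on_iff
proof (intro ballI allI impI)
  fix p :: "real \<times> real" and e :: real assume p: "p \<in> {0..1} \<times> {0..1}" and e: "0 < e"
  obtain x s where ps: "p = (x, s)" and x: "x \<in> {0..1}" and s: "s \<in> {0..1}" using p by auto
  obtain \<phi>' where C: "\<forall>x\<in>{0..1}. C1_01 (\<phi> x)" "\<forall>x\<in>{0..1}. C1_01 (\<phi>' x)"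
    and lim: "\<forall>x\<in>{0..1}. ((%y. C1norm_01 (%s. \<phi> y s - \<phi> x s - (y - x) * \<phi>' x s) / \<bar>y - x\<bar>) \<longlongrightarrow> 0) (at x within {0..1})"
    using assms unfolding C1_C1_kernel_def by blast
  obtain F where F: "\<forall>s\<in>{0..1}. \<bar>\<phi>' x s\<bar> <= F" using C1_01_bounds[of "\<phi>' x"] C x by blast
  have F0: "0 <= F" using F s by fastforce
  have "\<forall>\<^sub>F y in at x within {0..1}. C1norm_01 (%s. \<phi> y s - \<phi> x s - (y - x) * \<phi>' x s) / \<bar>y - x\<bar> < 1"
    using lim x by (intro order_tendstoD(2)[of _ 0]) auto
  then obtain d where d: "0 < d" "\<And>y. y \<in> {0..1} ==> y \<noteq> x ==> dist y x < d ==>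
      C1norm_01 (%s. \<phi> y s - \<phi> x s - (y - x) * \<phi>' x s) / \<bar>y - x\<bar> < 1"
    unfolding eventually_at by blast
  have 1: "\<bar>\<phi> y r - \<phi> x r\<bar> <= (F + 1) * \<bar>y - x\<bar>" if y: "y \<in> {0..1}" "\<bar>y - x\<bar> < d" and r: "r \<in> {0..1}" for y r
  proof (cases "y = x")
    case False
    have "C1_01 (%s. \<phi> y s - \<phi> x s - (y - x) * \<phi>' x s)" using C x y by (intro C1_01_lin) auto
    then have "\<bar>\<phi> y r - \<phi> x r - (y - x) * \<phi>' x r\<bar> <= C1norm_01 (%s. \<phi> y s - \<phi> x s - (y - x) * \<phi>' x s)"
      using r by (rule C1_01_abs_le_norm)
    also have "\<dots> <= \<bar>y - x\<bar>" using d(2)[of y] y False by (simp add: dist_real_def)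
    finally have "\<bar>\<phi> y r - \<phi> x r - (y - x) * \<phi>' x r\<bar> <= \<bar>y - x\<bar>" .
    moreover have "\<bar>(y - x) * \<phi>' x r\<bar> <= F * \<bar>y - x\<bar>" unfolding abs_mult mult.commute[of "\<bar>y - x\<bar>"] by (rule mult_right_mono) (use F r in auto)
    ultimately show ?thesis by (simp add: distrib_right)
  qed simp
  obtain B where B: "\<forall>s\<in>{0..1}. \<forall>r\<in>{0..1}. \<bar>\<phi> x s - \<phi> x r\<bar> <= B * \<bar>s - r\<bar>" using C1_01_bounds[of "\<phi> x"] C x by blast
  define M where "M = F + 1 + \<bar>B\<bar>"
  have M: "0 < M" using F0 by (simp add: M_def)
  show "\<exists>d>0. \<forall>q\<in>{0..1} \<times> {0..1}. dist q p < d --> dist (\<phi> (fst q) (snd q)) (\<phi> (fst p) (snd p)) < e"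
  proof (intro exI[of _ "min d (e / M)"] conjI ballI impI)
    fix q :: "real \<times> real" assume q: "q \<in> {0..1} \<times> {0..1}" "dist q p < min d (e / M)"
    obtain y r where qy: "q = (y, r)" and y: "y \<in> {0..1}" and r: "r \<in> {0..1}" using q(1) by auto
    have d1: "\<bar>y - x\<bar> <= dist q p" "\<bar>r - s\<bar> <= dist q p"
      using dist_fst_le[of q p] dist_snd_le[of q p] by (auto simp: qy ps dist_real_def)
    have "\<bar>\<phi> y r - \<phi> x s\<bar> <= \<bar>\<phi> y r - \<phi> x r\<bar> + \<bar>\<phi> x r - \<phi> x s\<bar>" by linarith
    also have "\<bar>\<phi> y r - \<phi> x r\<bar> <= (F + 1) * \<bar>y - x\<bar>" using d1 q y r by (intro 1) auto
    also have "\<dots> <= (F + 1) * dist q p" using d1 F0 by (intro mult_left_mono) auto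
    also have "\<bar>\<phi> x r - \<phi> x s\<bar> <= B * \<bar>r - s\<bar>" using B r s by blast
    also have "\<dots> <= \<bar>B\<bar> * dist q p" using d1 by (intro mult_mono) auto
    finally have "\<bar>\<phi> y r - \<phi> x s\<bar> <= M * dist q p" by (simp add: M_def distrib_right)
    also have "\<dots> < M * (e / M)" using q(2) M by (intro mult_strict_left_mono) auto
    finally show "dist (\<phi> (fst q) (snd q)) (\<phi> (fst p) (snd p)) < e" using M by (simp add: qy ps dist_real_def)
  qed (use d e M in simp)
qed

text \<open>Weierstrass approximation in the variable \<open>exp t\<close>.\<close>
lemma exp_sum_approx:
  fixes f :: "real => real"
  assumes f: "continuous_on {0..T} f" and e: "0 < e" and K: "0 <= K"
  shows "\<exists>N c. \<forall>t\<in>{0..T}. \<bar>f t - (\<Sum>i\<le>N. c i * exp ((K + real i) * t))\<bar> <= e"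
proof -
  \<comment> \<open>The factor \<open>exp (K t)\<close> is removed before the polynomial
    approximation and restored afterwards, so that all rates start at \<open>K\<close>; restoring it
    costs at most \<open>exp (K * T)\<close>.\<close>
  define e' where "e' = e / exp (K * T)"
  have e': "0 < e'" using e by (simp add: e'_def)
  let ?g = "%s. exp (- (K * ln s)) * f (ln s)"
  have ln: "ln s \<in> {0..T}" if "s \<in> {1..exp T}" for s :: real
  proof -
    have "ln s <= ln (exp T)" using that by (subst ln_le_cancel_iff) auto
    then show ?thesis using that by simp
  qed
  have lc: "continuous_on {1..exp T} (%s::real. ln s)" by (intro continuous_intros) auto
  have "continuous_on {1..exp T} (%s. f (ln s))" by (rule continuous_on_compose2[OF f lc]) (use ln in auto)
  then have gc: "continuous_on {1..exp T} ?g" by (intro continuous_intros lc)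
  obtain p where p: "real_polynomial_function p" "\<And>s. s \<in> {1..exp T} ==> \<bar>?g s - p s\<bar> < e'"
    using Stone_Weierstrass_real_polynomial_function[OF _ gc e'] compact_Icc by blast
  obtain c N where pc: "p = (%x. \<Sum>i\<le>N. c i * x^i)" using p(1) unfolding real_polynomial_function_iff_sum by blast
  have "\<bar>f t - (\<Sum>i\<le>N. c i * exp ((K + real i) * t))\<bar> <= e" if t: "t \<in> {0..T}" for t
  proof -
    have s: "exp t \<in> {1..exp T}" using t by simp
    have "(\<Sum>i\<le>N. c i * exp ((K + real i) * t)) = exp (K * t) * p (exp t)"
      unfolding pc sum_distrib_left by (rule sum.cong) (auto simp: distrib_right exp_add exp_of_nat_mult)
    moreover have "exp (K * t) * ?g (exp t) = f t" by (simp add: exp_minus)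
    ultimately have "f t - (\<Sum>i\<le>N. c i * exp ((K + real i) * t)) = exp (K * t) * (?g (exp t) - p (exp t))"
      by (simp add: right_diff_distrib)
    then have "\<bar>f t - (\<Sum>i\<le>N. c i * exp ((K + real i) * t))\<bar> = exp (K * t) * \<bar>?g (exp t) - p (exp t)\<bar>" by (simp add: abs_mult)
    also have "\<dots> <= exp (K * T) * e'" using p(2)[OF s] t K by (intro mult_mono) (auto simp: mult_left_mono)
    also have "\<dots> = e" by (simp add: e'_def)
    finally show ?thesis .
  qed
  then show ?thesis by blast
qed

text \<open>The input and its derivative are approximated separately; padding gives both sums the
  same length.\<close>

lemma exp_sum_pad:
  fixes c :: "nat => real"
  assumes "N <= M" shows "(\<Sum>i\<le>M. (if i <= N then c i else 0) * g i) = (\<Sum>i\<le>N. c i * g i)"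
proof -
  have "(\<Sum>i\<le>N. c i * g i) = (\<Sum>i\<le>N. (if i <= N then c i else 0) * g i)" by (rule sum.cong) auto
  also have "\<dots> = (\<Sum>i\<le>M. (if i <= N then c i else 0) * g i)" by (rule sum.mono_neutral_left) (use assms in auto)
  finally show ?thesis by simp
qed

lemma bfun_sum:
  assumes l: "bfun l" and f: "f \<in> L2" and m: "\<And>i. i <= N ==> m i \<in> L2"
  shows "l (%x. f x - (\<Sum>i\<le>(N::nat). a i * m i x)) = l f - (\<Sum>i\<le>N. a i * l (m i))"
  using m
proof (induction N)
  case 0
  then show ?case using bfun_lin[OF l f, of "m 0" "- a 0"] by simp
next
  case (Suc N)
  have L: "(%x. f x - (\<Sum>i\<le>N. a i * m i x)) \<in> L2" by (intro L2_diff f L2_sum L2_scale) (use Suc in auto)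
  have "l (%x. (f x - (\<Sum>i\<le>N. a i * m i x)) + (- a (Suc N)) * m (Suc N) x) = l (%x. f x - (\<Sum>i\<le>N. a i * m i x)) + (- a (Suc N)) * l (m (Suc N))"
    by (rule bfun_lin[OF l L]) (use Suc in auto)
  then show ?case using Suc by (simp add: algebra_simps)
qed

section \<open>Mild solutions for exponential inputs\<close>

context pide_semigroup
begin

lemma bfun_S: assumes l: "bfun l" and t: "0 <= t" shows "bfun (%g. l (S t g))"
proof -
  obtain C where C: "0 <= C" "\<forall>f\<in>L2. \<bar>l f\<bar> <= C * L2norm f" using l by (rule bfun_bound)
  obtain D where D: "0 <= D" "\<forall>w\<in>L2. L2norm (S t w) <= D * L2norm w" using t by (rule S_bound)
  have "\<bar>l (S t f)\<bar> <= C * D * L2norm f" if f: "f \<in> L2" for f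
  proof -
    have "\<bar>l (S t f)\<bar> <= C * L2norm (S t f)" using C S_L2[OF t f] by blast
    also have "\<dots> <= C * (D * L2norm f)" using D f C by (intro mult_left_mono) auto
    finally show ?thesis by (simp add: mult.assoc)
  qed
  moreover have "l (S t (%x. f x + c * g x)) = l (S t f) + c * l (S t g)" if f: "f \<in> L2" and g: "g \<in> L2" for f g c
  proof -
    have "l (S t (%x. f x + c * g x)) = l (%x. S t f x + c * S t g x)"
      by (rule bfun_cong[OF l S_L2[OF t L2_add[OF f L2_scale[OF g]]] L2_add[OF S_L2[OF t f] L2_scale[OF S_L2[OF t g]]] S_lin[OF t f g]])
    also have "\<dots> = l (S t f) + c * l (S t g)" by (rule bfun_lin[OF l S_L2[OF t f] S_L2[OF t g]])
    finally show ?thesis .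
  qed
  ultimately show ?thesis unfolding bfun_def using C D by (intro conjI exI[of _ "C * D"] ballI allI) auto
qed

text \<open>The integrand has the antiderivative
  \<open>exp (\<kappa> \<tau>) * l (S (t - \<tau>) (Rk \<kappa> k))\<close>, because
  \<open>\<kappa>\<close> times the resolvent minus its image under the generator is
  \<open>k\<close>. Hence the rate of the exponential must be an admissible resolvent
  parameter.\<close>

lemma duhamel_exp:
  assumes \<kappa>: "Kd < \<kappa>" and k: "k \<in> L2" and l: "bfun l" and t: "0 <= t"
  shows "((%\<tau>. exp (\<kappa> * \<tau>) * l (S (t - \<tau>) k)) has_integral exp (\<kappa> * t) * l (Rk \<kappa> k) - l (S t (Rk \<kappa> k))) {0..t}"
proof -
  let ?m = "Rk \<kappa> k" and ?z = "%x. \<kappa> * Rk \<kappa> k x - k x"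
  have m: "?m \<in> L2" by (rule Rk_L2[OF \<kappa> k])
  have z: "?z \<in> L2" by (intro L2_diff L2_scale m k)
  have im: "(%\<tau>. t - \<tau>) ` {0..t} = {0..t}"
  proof -
    have "x \<in> (%\<tau>. t - \<tau>) ` {0..t}" if "x \<in> {0..t}" for x using that by (intro image_eqI[of _ _ "t - x"]) auto
    then show ?thesis by auto
  qed
  have D: "((%\<tau>. exp (\<kappa> * \<tau>) * l (S (t - \<tau>) ?m)) has_real_derivative exp (\<kappa> * \<tau>) * l (S (t - \<tau>) k)) (at \<tau> within {0..t})"
    if \<tau>: "\<tau> \<in> {0..t}" for \<tau>
  proof -
    have 0: "0 <= t - \<tau>" "t - \<tau> \<in> {0..t}" using \<tau> by auto
    have 1: "((%s. l (S s ?m)) has_real_derivative l (S (t - \<tau>) ?z)) (at (t - \<tau>) within {0..t})"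
      by (rule orbit_functional[OF l m z gen_Rk[OF \<kappa> k] 0(2)])
    have 2: "((%\<tau>. t - \<tau>) has_real_derivative -1) (at \<tau> within {0..t})" by (auto intro!: derivative_eq_intros)
    have 3: "((%\<tau>. l (S (t - \<tau>) ?m)) has_real_derivative l (S (t - \<tau>) ?z) * -1) (at \<tau> within {0..t})"
      using DERIV_image_chain[OF _ 2, of "%s. l (S s ?m)" "l (S (t - \<tau>) ?z)", unfolded im, OF 1] by (simp add: o_def)
    have 4: "((%\<tau>. exp (\<kappa> * \<tau>)) has_real_derivative \<kappa> * exp (\<kappa> * \<tau>)) (at \<tau> within {0..t})"
      by (auto intro!: derivative_eq_intros)
    have 5: "l (S (t - \<tau>) ?z) = \<kappa> * l (S (t - \<tau>) ?m) - l (S (t - \<tau>) k)"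
      unfolding bfun_diff[OF bfun_S[OF l 0(1)] L2_scale[OF m] k] bfun_scale[OF bfun_S[OF l 0(1)] m] ..
    show ?thesis by (rule DERIV_cong[OF DERIV_mult'[OF 4 3]]) (simp add: 5 algebra_simps)
  qed
  have "((%\<tau>. exp (\<kappa> * \<tau>) * l (S (t - \<tau>) k)) has_integral exp (\<kappa> * t) * l (S (t - t) ?m) - exp (\<kappa> * 0) * l (S (t - 0) ?m)) {0..t}"
    using t D by (intro fundamental_theorem_of_calculus) (auto simp: has_real_derivative_iff_has_vector_derivative)
  moreover have "l (S 0 ?m) = l ?m" by (rule bfun_cong[OF l S_L2[OF _ m] m S_zero[OF m]]) simp
  ultimately show ?thesis by simp
qed

text \<open>The resolvents carry the forced response; subtracting their sum from \<open>y0\<close>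
  corrects the initial value, and the rest is a free orbit. The tolerance \<open>E\<close> for the
  state is kept separate from the tolerance \<open>e\<close> for the inputs.\<close>

definition exp_sum_input where
  "exp_sum_input k1 k2 f f1 y0 y T E e N c c' \<longleftrightarrow> (\<forall>t\<in>{0..T}. \<bar>f t - (\<Sum>i\<le>N. c i * exp ((Kd + 1 + real i) * t))\<bar> <= e \<and>
     \<bar>f1 t - (\<Sum>i\<le>N. c' i * exp ((Kd + 1 + real i) * t))\<bar> <= e \<and>
     L2norm (%x. y t x - (S t (%x. y0 x - (\<Sum>i\<le>N. Rk (Kd + 1 + real i) (%x. c i * k1 x - c' i * k2 x) x)) x
       + (\<Sum>i\<le>N. exp ((Kd + 1 + real i) * t) * Rk (Kd + 1 + real i) (%x. c i * k1 x - c' i * k2 x) x))) <= E)"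

text \<open>Exponential inputs have explicit mild solutions, so a uniform approximation of the input by exponential
  sums replaces the convolution integral by resolvents.\<close>
lemma duhamel_approx:
  fixes y :: "real => real => real"
  assumes k1: "pcont k1" and k2: "pcont k2" and f: "continuous_on {0..T} f" and f1: "continuous_on {0..T} f1"
    and y0: "pcont y0" and yL': "\<forall>t\<in>{0..T}. y t \<in> L2" and T: "0 <= T"
    and weak': "\<forall>t\<in>{0..T}. \<forall>\<psi>\<in>L2. L2inner (y t) \<psi> = L2inner (S t y0) \<psi>
        + integral {0..t} (%\<tau>. L2inner (S (t - \<tau>) (%x. k1 x * f \<tau> - k2 x * f1 \<tau>)) \<psi>)"
  shows "\<exists>C\<ge>0. \<forall>e>0. \<exists>N c c'. exp_sum_input k1 k2 f f1 y0 y T (C * e) e N c c'"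
proof -
  obtain C where C: "0 <= C" "\<forall>t\<in>{0..T}. \<forall>d. pcont d --> L2norm (S t d) <= C * L2norm d" by (rule S_stable)
  note yL = yL'[rule_format] and weak = weak'[rule_format]
  note k1L = pcont_L2[OF k1] and k2L = pcont_L2[OF k2] and y0L = pcont_L2[OF y0]
  define M where "M = L2norm k1 + L2norm k2"
  have M: "0 <= M" by (simp add: M_def L2norm_nonneg)
  have main: "\<exists>N c c'. exp_sum_input k1 k2 f f1 y0 y T ((T * (C * M)) * e) e N c c'"
    if e: "0 < e" for e
  proof -
    have K1: "0 <= Kd + 1" using Kd(1) by simp
    obtain N1 c1 where c1: "\<forall>t\<in>{0..T}. \<bar>f t - (\<Sum>i\<le>N1. c1 i * exp ((Kd + 1 + real i) * t))\<bar> <= e"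
      using exp_sum_approx[OF f e K1] by blast
    obtain N2 c2 where c2: "\<forall>t\<in>{0..T}. \<bar>f1 t - (\<Sum>i\<le>N2. c2 i * exp ((Kd + 1 + real i) * t))\<bar> <= e"
      using exp_sum_approx[OF f1 e K1] by blast
    define N where "N = max N1 N2"
    define c where "c i = (if i <= N1 then c1 i else 0)" for i
    define c' where "c' i = (if i <= N2 then c2 i else 0)" for i
    define \<kappa> where "\<kappa> i = Kd + 1 + real i" for i
    define p where "p t = (\<Sum>i\<le>N. c i * exp (\<kappa> i * t))" for t
    define q where "q t = (\<Sum>i\<le>N. c' i * exp (\<kappa> i * t))" for t
    have pf: "\<bar>f t - p t\<bar> <= e" if "t \<in> {0..T}" for t
      using c1 that unfolding p_def c_def \<kappa>_def by (subst exp_sum_pad) (auto simp: N_def)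
    have qf: "\<bar>f1 t - q t\<bar> <= e" if "t \<in> {0..T}" for t
      using c2 that unfolding q_def c'_def \<kappa>_def by (subst exp_sum_pad) (auto simp: N_def)
    define k where "k i x = c i * k1 x - c' i * k2 x" for i x
    define m where "m i = Rk (\<kappa> i) (k i)" for i
    have \<kappa>: "Kd < \<kappa> i" for i by (simp add: \<kappa>_def)
    have kL: "k i \<in> L2" for i unfolding k_def[abs_def] by (intro L2_diff L2_scale k1L k2L)
    have mL: "m i \<in> L2" for i unfolding m_def by (rule Rk_L2[OF \<kappa> kL])
    let ?y = "%x. y0 x - (\<Sum>i\<le>N. m i x)"
    have ytL: "?y \<in> L2" by (intro L2_diff y0L L2_sum mL)
    have "L2norm (%x. y t x - (S t ?y x + (\<Sum>i\<le>N. exp (\<kappa> i * t) * m i x))) <= (T * (C * M)) * e" if t: "t \<in> {0..T}" for t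
    proof -
      have t0: "0 <= t" "t <= T" using t by auto
      let ?D = "%x. (y t x - S t ?y x) - (\<Sum>i\<le>N. exp (\<kappa> i * t) * m i x)"
      have SyL: "S t ?y \<in> L2" by (rule S_L2[OF t0(1) ytL])
      have D1L: "(%x. y t x - S t ?y x) \<in> L2" by (rule L2_diff[OF yL[OF t] SyL])
      have DL: "?D \<in> L2" by (intro L2_diff[OF D1L] L2_sum L2_scale mL)
      \<comment> \<open>The weak identity is tested with the error \<open>?D\<close> itself, so the
        left-hand side becomes its squared norm and one factor cancels at the end.\<close>
      define l where "l g = L2inner g ?D" for g
      have l: "bfun l" unfolding l_def[abs_def] by (rule bfun_L2inner[OF DL])
      have lS: "bfun (%g. l (S t g))" by (rule bfun_S[OF l t0(1)])
      define G where "G \<tau> = f \<tau> * l (S (t - \<tau>) k1) - f1 \<tau> * l (S (t - \<tau>) k2)" for \<tau>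
      have sub: "{0..t} \<subseteq> {0..T}" using t0 by auto
      have orb: "continuous_on {0..t} (%\<tau>. l (S (t - \<tau>) g))" if "g \<in> L2" for g
        by (rule continuous_on_compose2[OF bfun_orbit_cont[OF l that, of t]]) (auto intro!: continuous_intros)
      have Gc: "continuous_on {0..t} G" unfolding G_def
        by (intro continuous_intros orb k1L k2L continuous_on_subset[OF f sub] continuous_on_subset[OF f1 sub])
      have ev: "l (S (t - \<tau>) (%x. k1 x * a - k2 x * b)) = a * l (S (t - \<tau>) k1) - b * l (S (t - \<tau>) k2)" if "\<tau> \<in> {0..t}" for \<tau> a b
      proof -
        have b: "bfun (%g. l (S (t - \<tau>) g))" by (rule bfun_S[OF l]) (use that in simp)
        have "(%x. k1 x * a - k2 x * b) = (%x. a * k1 x - b * k2 x)" by (simp add: mult.commute)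
        then show ?thesis using bfun_diff[OF b L2_scale[OF k1L, of a] L2_scale[OF k2L, of b]] bfun_scale[OF b k1L, of a] bfun_scale[OF b k2L, of b] by simp
      qed
      have "l (y t) = l (S t y0) + integral {0..t} (%\<tau>. l (S (t - \<tau>) (%x. k1 x * f \<tau> - k2 x * f1 \<tau>)))"
        unfolding l_def by (rule weak[OF t DL])
      also have "integral {0..t} (%\<tau>. l (S (t - \<tau>) (%x. k1 x * f \<tau> - k2 x * f1 \<tau>))) = integral {0..t} G"
        by (rule integral_cong) (simp add: ev G_def)
      finally have ly: "l (y t) = l (S t y0) + integral {0..t} G" .
      have lSy: "l (S t ?y) = l (S t y0) - (\<Sum>i\<le>N. l (S t (m i)))"
        using bfun_sum[OF lS y0L, of N m "%_. 1"] mL by simp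
      have lD: "l ?D = l (%x. y t x - S t ?y x) - (\<Sum>i\<le>N. exp (\<kappa> i * t) * l (m i))"
        by (rule bfun_sum[OF l D1L mL])
      have I: "((%\<tau>. \<Sum>i\<le>N. exp (\<kappa> i * \<tau>) * l (S (t - \<tau>) (k i))) has_integral (\<Sum>i\<le>N. exp (\<kappa> i * t) * l (m i) - l (S t (m i)))) {0..t}"
        unfolding m_def by (intro has_integral_sum duhamel_exp \<kappa> kL l t0) simp
      have "l ?D = integral {0..t} G - (\<Sum>i\<le>N. exp (\<kappa> i * t) * l (m i) - l (S t (m i)))"
        unfolding lD bfun_diff[OF l yL[OF t] SyL] ly lSy by (simp add: sum_subtractf)
      then have J: "((%\<tau>. G \<tau> - (\<Sum>i\<le>N. exp (\<kappa> i * \<tau>) * l (S (t - \<tau>) (k i)))) has_integral l ?D) {0..t}"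
        using has_integral_diff[OF integrable_integral[OF integrable_continuous_interval[OF Gc]] I] by simp
      have "norm (l ?D) <= (C * M * e * L2norm ?D) * measure lborel (cbox 0 t)"
      proof (rule has_integral_bound)
        show "((%\<tau>. G \<tau> - (\<Sum>i\<le>N. exp (\<kappa> i * \<tau>) * l (S (t - \<tau>) (k i)))) has_integral l ?D) (cbox 0 t)" using J by simp
        show "0 <= C * M * e * L2norm ?D" using C M e by (simp add: L2norm_nonneg)
        fix \<tau> assume "\<tau> \<in> cbox 0 t"
        then have \<tau>: "\<tau> \<in> {0..t}" "\<tau> \<in> {0..T}" "t - \<tau> \<in> {0..T}" "0 <= t - \<tau>" using t0 by auto
        \<comment> \<open>The residual input at time \<open>\<tau>\<close>. It is piecewise
          continuous in space, so the uniform bound \<open>C\<close> for the semigroup applies to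
          it.\<close>
        let ?r = "%x. k1 x * (f \<tau> - p \<tau>) - k2 x * (f1 \<tau> - q \<tau>)"
        have rp: "pcont ?r" using pequi_diff[OF pcont_scale[OF k1, of "f \<tau> - p \<tau>"] pcont_scale[OF k2, of "f1 \<tau> - q \<tau>"]] by (simp add: mult.commute)
        have "(\<Sum>i\<le>N. exp (\<kappa> i * \<tau>) * l (S (t - \<tau>) (k i))) = (\<Sum>i\<le>N. exp (\<kappa> i * \<tau>) * (c i * l (S (t - \<tau>) k1) - c' i * l (S (t - \<tau>) k2)))"
        proof (rule sum.cong)
          fix i
          have "k i = (%x. k1 x * c i - k2 x * c' i)" by (simp add: k_def[abs_def] mult.commute)
          then show "exp (\<kappa> i * \<tau>) * l (S (t - \<tau>) (k i)) = exp (\<kappa> i * \<tau>) * (c i * l (S (t - \<tau>) k1) - c' i * l (S (t - \<tau>) k2))"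
            using ev[OF \<tau>(1)] by simp
        qed simp
        also have "\<dots> = p \<tau> * l (S (t - \<tau>) k1) - q \<tau> * l (S (t - \<tau>) k2)"
          unfolding p_def q_def sum_distrib_right sum_subtractf[symmetric] by (rule sum.cong) (auto simp: right_diff_distrib)
        finally have "G \<tau> - (\<Sum>i\<le>N. exp (\<kappa> i * \<tau>) * l (S (t - \<tau>) (k i))) = l (S (t - \<tau>) ?r)"
          unfolding ev[OF \<tau>(1)] G_def by (simp add: left_diff_distrib)
        then have "norm (G \<tau> - (\<Sum>i\<le>N. exp (\<kappa> i * \<tau>) * l (S (t - \<tau>) (k i)))) = \<bar>L2inner (S (t - \<tau>) ?r) ?D\<bar>" by (simp add: l_def)
        also have "\<dots> <= L2norm (S (t - \<tau>) ?r) * L2norm ?D" by (rule L2_Cauchy_Schwarz[OF S_L2[OF \<tau>(4) pcont_L2[OF rp]] DL])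
        also have "\<dots> <= (C * M * e) * L2norm ?D"
        proof (rule mult_right_mono[OF _ L2norm_nonneg])
          have "L2norm (S (t - \<tau>) ?r) <= C * L2norm ?r" using C(2) \<tau>(3) rp by blast
          also have "L2norm ?r <= L2norm (%x. k1 x * (f \<tau> - p \<tau>)) + L2norm (%x. k2 x * (f1 \<tau> - q \<tau>))"
            using L2norm_triangle_diff[OF L2_scale[OF k1L, of "f \<tau> - p \<tau>"] L2_scale[OF k2L, of "f1 \<tau> - q \<tau>"]] by (simp add: mult.commute)
          also have "\<dots> = \<bar>f \<tau> - p \<tau>\<bar> * L2norm k1 + \<bar>f1 \<tau> - q \<tau>\<bar> * L2norm k2"
            using L2norm_scale[of "f \<tau> - p \<tau>" k1] L2norm_scale[of "f1 \<tau> - q \<tau>" k2] by (simp add: mult.commute)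
          also have "\<dots> <= e * L2norm k1 + e * L2norm k2" by (intro add_mono mult_right_mono pf qf \<tau>(2) L2norm_nonneg)
          also have "\<dots> = M * e" by (simp add: M_def algebra_simps)
          finally show "L2norm (S (t - \<tau>) ?r) <= C * M * e" using C(1) by (simp add: mult_left_mono mult.assoc)
        qed
        finally show "norm (G \<tau> - (\<Sum>i\<le>N. exp (\<kappa> i * \<tau>) * l (S (t - \<tau>) (k i)))) <= C * M * e * L2norm ?D" .
      qed
      also have "\<dots> <= (C * M * e * L2norm ?D) * T" using t0 C M e by (intro mult_left_mono) (auto simp: L2norm_nonneg)
      finally have "l ?D <= L2norm ?D * (T * (C * M) * e)" by (simp add: mult_ac)
      then have "L2norm ?D * L2norm ?D <= L2norm ?D * (T * (C * M) * e)" by (simp add: l_def L2norm_power2[symmetric] power2_eq_square)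
      then have "L2norm ?D <= T * (C * M) * e"
        using T C M e L2norm_nonneg[of ?D] by (cases "L2norm ?D = 0") auto
      moreover have "?D = (%x. y t x - (S t ?y x + (\<Sum>i\<le>N. exp (\<kappa> i * t) * m i x)))" by (simp add: fun_eq_iff)
      ultimately show ?thesis by simp
    qed
    then show ?thesis using pf qf unfolding exp_sum_input_def p_def q_def m_def \<kappa>_def k_def by blast
  qed
  show ?thesis using main T C M by (intro exI[of _ "T * (C * M)"]) simp
qed

end

subsection \<open>Piecewise constant extension\<close>

lemma Sn_on_cell:
  assumes j: "j \<in> {1..n}" and x: "real (j - 1) * hh n < x" "x <= gp n j"
  shows "Sn n v x = v j"
proof -
  have h: "0 < hh n" by (rule hh_pos)
  have x0: "0 < x" using x(1) h by (auto intro: le_less_trans[rotated])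
  have "gp n j <= gp n n" using j h by (intro mult_right_mono) auto
  moreover have "\<lceil>x / hh n\<rceil> = int j"
  proof (rule ceiling_unique)
    show "real_of_int (int j) - 1 < x / hh n" using x(1) j h by (simp add: pos_less_divide_eq of_nat_diff)
    show "x / hh n <= real_of_int (int j)" using x(2) h by (simp add: pos_divide_le_eq)
  qed
  ultimately show ?thesis using x0 x(2) by (simp add: Sn_def)
qed

lemma cell_exists:
  assumes x: "0 < x" "x <= gp n n"
  obtains j where "j \<in> {1..n}" "real (j - 1) * hh n < x" "x <= gp n j"
proof -
  have h: "0 < hh n" by (rule hh_pos)
  define j where "j = nat \<lceil>x / hh n\<rceil>"
  have p: "0 < x / hh n" "x / hh n <= real n" using x h by (auto simp: pos_divide_le_eq)
  have c: "0 < \<lceil>x / hh n\<rceil>" "\<lceil>x / hh n\<rceil> <= int n" using p by (simp_all add: ceiling_le_iff)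
  have ij: "int j = \<lceil>x / hh n\<rceil>" unfolding j_def by (rule nat_0_le[OF less_imp_le[OF c(1)]])
  have j: "j \<in> {1..n}" using c unfolding ij[symmetric] by simp
  have rj: "real j = of_int \<lceil>x / hh n\<rceil>" unfolding ij[symmetric] by simp
  have "real j - 1 < x / hh n" "x / hh n <= real j" unfolding rj using ceiling_correct[of "x / hh n"] by auto
  then have "real (j - 1) * hh n < x" "x <= gp n j" using j h
    by (simp_all add: pos_less_divide_eq pos_divide_le_eq of_nat_diff)
  then show thesis using that j by blast
qed

lemma Sn_eq_sum:
  assumes x: "x \<in> {0..1}"
  shows "Sn n v x = v 1 * indicator {0} x + (\<Sum>j=1..n. v j * indicator {real (j - 1) * hh n<..gp n j} x)"
proof -
  have h: "0 < hh n" by (rule hh_pos)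
  consider "x = 0" | "0 < x" "x <= gp n n" | "0 < x" "gp n n < x" using x by fastforce
  then show ?thesis
  proof cases
    case 1
    have "(\<Sum>j=1..n. v j * indicator {real (j - 1) * hh n<..gp n j} x) = 0"
    proof (rule sum.neutral, intro ballI)
      fix j
      have "0 <= real (j - 1) * hh n" using h by (intro mult_nonneg_nonneg) auto
      then show "v j * indicator {real (j - 1) * hh n<..gp n j} x = 0" using 1 by simp
    qed
    then show ?thesis using 1 by (simp add: Sn_def)
  next
    case 2
    obtain k where k: "k \<in> {1..n}" "real (k - 1) * hh n < x" "x <= gp n k" by (rule cell_exists[OF 2])
    have "v j * indicator {real (j - 1) * hh n<..gp n j} x = (if j = k then v k else 0)" if j: "j \<in> {1..n}" for j
    proof (cases "j = k")
      case False
      have "x \<notin> {real (j - 1) * hh n<..gp n j}"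
      proof
        assume "x \<in> {real (j - 1) * hh n<..gp n j}"
        \<comment> \<open>Evaluating the extension of the identity grid function shows that a point
          lies in at most one cell.\<close>
        then have "Sn n (%i. real i) x = real j" by (intro Sn_on_cell j) auto
        moreover have "Sn n (%i. real i) x = real k" by (rule Sn_on_cell[OF k])
        ultimately show False using False by simp
      qed
      then show ?thesis using False by simp
    qed (use k in simp)
    then have "(\<Sum>j=1..n. v j * indicator {real (j - 1) * hh n<..gp n j} x) = (\<Sum>j=1..n. if j = k then v k else 0)"
      by (rule sum.cong[OF refl])
    then show ?thesis using Sn_on_cell[OF k] k 2 by simp
  next
    case 3
    have "(\<Sum>j=1..n. v j * indicator {real (j - 1) * hh n<..gp n j} x) = 0"
    proof (rule sum.neutral, intro ballI)
      fix j assume "j \<in> {1..n}"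
      then have "gp n j <= gp n n" using h by (intro mult_right_mono) auto
      then show "v j * indicator {real (j - 1) * hh n<..gp n j} x = 0" using 3 by simp
    qed
    then show ?thesis using 3 by (simp add: Sn_def)
  qed
qed

lemma indicator_M01:
  assumes "0 <= a" "a <= b" "b <= 1"
  shows "integrable M01 (indicator {a<..b} :: real => real)" "integral\<^sup>L M01 (indicator {a<..b}) = b - a"
proof -
  have s: "{a<..b} \<subseteq> {0..1}" using assms by auto
  have "{a<..b} \<in> sets M01" using s by (auto simp: sets_restrict_space_iff)
  then show "integrable M01 (indicator {a<..b} :: real => real)"
    by (intro integrable_M01_bounded[where B=1]) (auto simp: indicator_def)
  have "integral\<^sup>L M01 (indicator {a<..b}) = measure M01 ({a<..b} \<inter> space M01)" by simp
  also have "{a<..b} \<inter> space M01 = {a<..b}" using s by auto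
  also have "measure M01 {a<..b} = measure lebesgue {a<..b}" by (rule measure_restrict_space) (use s in auto)
  also have "\<dots> = b - a" using assms by simp
  finally show "integral\<^sup>L M01 (indicator {a<..b}) = b - a" .
qed

lemma Sn_integral:
  "integrable M01 (Sn n v)" "integral\<^sup>L M01 (Sn n v) = hh n * (\<Sum>j=1..n. v j)"
proof -
  let ?i = "%j. indicator {real (j - 1) * hh n<..gp n j} :: real => real"
  let ?z = "indicator {0} :: real => real"
  let ?g = "%x. v 1 * ?z x + (\<Sum>j=1..n. v j * ?i j x)"
  have I: "integrable M01 (?i j)" "integral\<^sup>L M01 (?i j) = hh n" if j: "j \<in> {1..n}" for j
  proof -
    have 1: "0 <= real (j - 1) * hh n" "gp n j <= 1" using grid_in[of "j - 1" n] grid_in[of j n] j by auto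
    have 2: "real (j - 1) * hh n <= gp n j" using hh_pos[of n] by (intro mult_right_mono) auto
    show "integrable M01 (?i j)" by (rule indicator_M01(1)[OF 1(1) 2 1(2)])
    have "integral\<^sup>L M01 (?i j) = gp n j - real (j - 1) * hh n" by (rule indicator_M01(2)[OF 1(1) 2 1(2)])
    then show "integral\<^sup>L M01 (?i j) = hh n" using j by (simp add: of_nat_diff algebra_simps)
  qed
  have zs: "{0::real} \<in> sets M01" by (auto simp: sets_restrict_space_iff)
  have Z: "integrable M01 ?z" by (rule integrable_M01_bounded[where B=1]) (use zs in \<open>auto simp: indicator_def\<close>)
  have "integral\<^sup>L M01 ?z = measure M01 {0}" by simp
  also have "\<dots> = measure lebesgue {0::real}" by (rule measure_restrict_space) auto
  finally have Z0: "integral\<^sup>L M01 ?z = 0" by simp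
  have gI: "integrable M01 ?g" by (intro Bochner_Integration.integrable_add Bochner_Integration.integrable_sum integrable_mult_right Z I)
  have eq: "Sn n v x = ?g x" if "x \<in> space M01" for x using Sn_eq_sum[of x n v] that by simp
  show "integrable M01 (Sn n v)" using gI by (subst Bochner_Integration.integrable_cong[OF refl eq])
  have "integral\<^sup>L M01 (Sn n v) = integral\<^sup>L M01 ?g" by (rule Bochner_Integration.integral_cong[OF refl eq])
  also have "\<dots> = v 1 * integral\<^sup>L M01 ?z + (\<Sum>j=1..n. v j * integral\<^sup>L M01 (?i j))"
  proof -
    have S: "integrable M01 (%x. v j * ?i j x)" if "j \<in> {1..n}" for j by (rule integrable_mult_right[OF I(1)[OF that]])
    have "integral\<^sup>L M01 ?g = integral\<^sup>L M01 (%x. v 1 * ?z x) + integral\<^sup>L M01 (%x. \<Sum>j=1..n. v j * ?i j x)"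
      by (rule Bochner_Integration.integral_add[OF integrable_mult_right[OF Z] Bochner_Integration.integrable_sum[OF S]])
    also have "integral\<^sup>L M01 (%x. \<Sum>j=1..n. v j * ?i j x) = (\<Sum>j=1..n. integral\<^sup>L M01 (%x. v j * ?i j x))"
      by (rule Bochner_Integration.integral_sum[OF S])
    finally show ?thesis by simp
  qed
  also have "\<dots> = hh n * (\<Sum>j=1..n. v j)" using I Z0 by (simp add: sum_distrib_left mult.commute)
  finally show "integral\<^sup>L M01 (Sn n v) = hh n * (\<Sum>j=1..n. v j)" .
qed

lemma Sn_apply: "f 0 = 0 ==> f (Sn n v x) = Sn n (%j. f (v j)) x"
  by (simp add: Sn_def)

lemma Sn_L2: "Sn n v \<in> L2"
proof -
  have "(%x. (Sn n v x)^2) = Sn n (%j. (v j)^2)" by (rule ext) (rule Sn_apply, simp)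
  then show ?thesis using Sn_integral(1) borel_measurable_integrable[OF Sn_integral(1)] by (simp add: L2_def)
qed

lemma Sn_norm: "(L2norm (Sn n v))^2 = mean_sq n v"
proof -
  have "(%x. (Sn n v x)^2) = Sn n (%j. (v j)^2)" by (rule ext) (rule Sn_apply, simp)
  moreover have "0 <= mean_sq n v" using hh_pos[of n] by (intro mult_nonneg_nonneg sum_nonneg) auto
  ultimately show ?thesis by (simp add: L2norm_def Sn_integral(2))
qed

lemma Sn_diff: "Sn n (%j. v j - w j) x = Sn n v x - Sn n w x" by (simp add: Sn_def)

text \<open>On the cells the variation of \<open>F\<close> over a distance \<open>h\<close> counts;
  on \<open>(n h, 1]\<close>, where the extension is zero, the full size of \<open>F\<close> counts,
  but over a length \<open>h\<close> only.\<close>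

lemma Sn_approx:
  assumes n: "1 <= n" and FL: "F \<in> L2" and e: "0 <= e"
    and F: "\<And>x y. x \<in> {0..1} ==> y \<in> {0..1} ==> \<bar>x - y\<bar> <= hh n ==> \<bar>F x - F y\<bar> <= e"
    and B: "\<And>x. x \<in> {0..1} ==> \<bar>F x\<bar> <= B"
  shows "(L2norm (%x. F x - Sn n (%j. F (gp n j)) x))^2 <= e^2 + hh n * B^2"
proof -
  let ?v = "%j. F (gp n j)" and ?D = "%x. F x - Sn n (%j. F (gp n j)) x"
  let ?i = "indicator {gp n n<..1} :: real => real"
  have h: "0 < hh n" by (rule hh_pos)
  have DL: "?D \<in> L2" by (rule L2_diff[OF FL Sn_L2])
  have nh: "gp n n + hh n = 1" using hh_mult[of n] by (simp add: algebra_simps)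
  have nh0: "0 <= gp n n" "gp n n <= 1" using h nh by auto
  note iI = indicator_M01[OF nh0 order_refl]
  have le: "(?D x)^2 <= e^2 + B^2 * ?i x" if x: "x \<in> {0..1}" for x
  proof -
    have in_cell: "\<bar>?D x\<bar> <= e" if xn: "x <= gp n n"
    proof (cases "x = 0")
      case True
      have "hh n \<in> {0..1}" using grid_in[of 1 n] n by simp
      then show ?thesis using True F[of 0 "hh n"] by (simp add: Sn_def)
    next
      case False
      then have "0 < x" using x by simp
      then obtain j where j: "j \<in> {1..n}" "real (j - 1) * hh n < x" "x <= gp n j" using xn by (rule cell_exists)
      have "gp n j \<in> {0..1}" by (rule grid_in) (use j in simp)
      moreover have "\<bar>x - gp n j\<bar> <= hh n" using j by (simp add: of_nat_diff left_diff_distrib)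
      ultimately show ?thesis using F[OF x] Sn_on_cell[OF j, of ?v] by simp
    qed
    show ?thesis
    proof (cases "x <= gp n n")
      case True
      then have "\<bar>?D x\<bar>^2 <= e^2" using in_cell by (intro power_mono) auto
      then show ?thesis using True by simp
    next
      case False
      then have "?D x = F x" using nh0 by (auto simp: Sn_def)
      moreover have "\<bar>F x\<bar>^2 <= B^2" using B[OF x] by (intro power_mono) auto
      moreover have "0 <= e^2" by simp
      moreover have "?i x = 1" using False x by simp
      ultimately show ?thesis by (simp add: add_increasing)
    qed
  qed
  have "(L2norm ?D)^2 = integral\<^sup>L M01 (%x. (?D x)^2)" by (simp add: L2norm_def)
  also have "\<dots> <= integral\<^sup>L M01 (%x. e^2 + B^2 * ?i x)"
  proof (rule integral_mono)
    show "integrable M01 (%x. (?D x)^2)" using DL by (simp add: L2_def)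
    have "integrable M01 (%x::real. e^2)" by (rule integrable_M01_bounded[where B="e^2"]) auto
    then show "integrable M01 (%x. e^2 + B^2 * ?i x)" by (intro Bochner_Integration.integrable_add integrable_mult_right iI)
  qed (use le in simp)
  also have "\<dots> = e^2 + B^2 * (1 - gp n n)"
  proof -
    have 1: "integrable M01 (%x::real. e^2)" by (rule integrable_M01_bounded[where B="e^2"]) auto
    have "integral\<^sup>L M01 (%x. e^2 + B^2 * ?i x) = integral\<^sup>L M01 (%x. e^2) + integral\<^sup>L M01 (%x. B^2 * ?i x)"
      by (rule Bochner_Integration.integral_add[OF 1 integrable_mult_right[OF iI(1)]])
    then show ?thesis using iI(2) emeasure_M01_UNIV by simp
  qed
  also have "1 - gp n n = hh n" using nh by simp
  finally show ?thesis by (simp add: mult.commute)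
qed

context pide
begin

lemma Pv_add: "Pv n (%m. v m + w m) j = Pv n v j + Pv n w j"
  by (simp add: Pv_def distrib_left sum.distrib)
lemma Pv_scale: "Pv n (%m. c * v m) j = c * Pv n v j"
  by (simp add: Pv_def sum_distrib_left mult.left_commute)
lemma Pv_diff: "Pv n (%m. v m - w m) j = Pv n v j - Pv n w j"
  by (simp add: Pv_def right_diff_distrib sum_subtractf)
lemma Pv_sum: "Pv n (%m. \<Sum>i\<in>A. g i m) j = (\<Sum>i\<in>A. Pv n (g i) j)"
  unfolding Pv_def by (simp add: sum_distrib_left) (rule sum.swap)

lemma Rk_consistency:
  assumes \<kappa>: "Kd < \<kappa>" and k: "pcont k"
  shows "vanish {()} (%n _ j. Pv n (%m. Rk \<kappa> k (gp n m)) j - (\<kappa> * Rk \<kappa> k (gp n j) - k (gp n j)))"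
proof (rule vanish_dom[where C=1])
  note kL = pcont_L2[OF k]
  note s = Rk_sol(1)[OF \<kappa> kL]
  have bc: "\<alpha>0 * Rk1 \<kappa> k 0 + \<beta>0 * Rk \<kappa> k 0 = 0" "\<alpha>1 * Rk1 \<kappa> k 1 + \<beta>1 * Rk \<kappa> k 1 = 0"
    using Rk_sol(2)[OF \<kappa> kL] by (simp_all add: BCs_def)
  show "vanish {()} (%n _ j. Pv n (%m. Rk \<kappa> k (gp n m)) j + Bvec \<theta> \<alpha>1 \<beta>1 n j * (\<alpha>1 * Rk1 \<kappa> k 1 + \<beta>1 * Rk \<kappa> k 1)
     - Pex (Rk \<kappa> k) (Rk1 \<kappa> k) (wpp \<kappa> k (Rk \<kappa> k) (Rk1 \<kappa> k)) (gp n j))"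
    by (rule consistency_single[OF solD(2)[OF s] solD(3)[OF s] solD(1)[OF s] wpp_pcont[OF k sol_cont[OF s]] bc(1)])
  show "\<forall>\<^sub>F n in sequentially. \<forall>i\<in>{()}. \<forall>j\<in>{1..n}. \<bar>Pv n (%m. Rk \<kappa> k (gp n m)) j - (\<kappa> * Rk \<kappa> k (gp n j) - k (gp n j))\<bar>
    <= 1 * \<bar>Pv n (%m. Rk \<kappa> k (gp n m)) j + Bvec \<theta> \<alpha>1 \<beta>1 n j * (\<alpha>1 * Rk1 \<kappa> k 1 + \<beta>1 * Rk \<kappa> k 1)
     - Pex (Rk \<kappa> k) (Rk1 \<kappa> k) (wpp \<kappa> k (Rk \<kappa> k) (Rk1 \<kappa> k)) (gp n j)\<bar>"
  proof (intro always_eventually allI ballI)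
    fix n j :: nat and i :: unit assume "j \<in> {1..n}"
    then have x: "gp n j \<in> {0..1}" by (intro grid_in) simp
    show "\<bar>Pv n (%m. Rk \<kappa> k (gp n m)) j - (\<kappa> * Rk \<kappa> k (gp n j) - k (gp n j))\<bar>
    <= 1 * \<bar>Pv n (%m. Rk \<kappa> k (gp n m)) j + Bvec \<theta> \<alpha>1 \<beta>1 n j * (\<alpha>1 * Rk1 \<kappa> k 1 + \<beta>1 * Rk \<kappa> k 1)
     - Pex (Rk \<kappa> k) (Rk1 \<kappa> k) (wpp \<kappa> k (Rk \<kappa> k) (Rk1 \<kappa> k)) (gp n j)\<bar>"
      unfolding Pex_Rk[OF x] bc(2) by simp
  qed
qed

end

context pide_semigroup
begin

text \<open>The orbit is bounded in \<open>L2\<close> on \<open>[0,T]\<close>, and the resolvent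
  maps \<open>L2\<close> bounds to bounds on values and first derivatives.\<close>

lemma orbit_Rk_bounds:
  assumes \<kappa>: "Kd < \<kappa>" and g: "g \<in> L2"
  shows "\<exists>B\<ge>0. \<forall>t\<in>{0..T}. \<forall>x\<in>{0..1}. \<bar>Rk \<kappa> (S t g) x\<bar> <= B \<and> \<bar>Rk1 \<kappa> (S t g) x\<bar> <= B \<and>
    (\<forall>y\<in>{0..1}. \<bar>Rk \<kappa> (S t g) x - Rk \<kappa> (S t g) y\<bar> <= B * \<bar>x - y\<bar>)"
proof -
  obtain C where C: "0 <= C" "\<And>g x. g \<in> L2 ==> x \<in> {0..1} ==> \<bar>Rk \<kappa> g x\<bar> <= C * L2norm g"
    "\<And>g x. g \<in> L2 ==> x \<in> {0..1} ==> \<bar>Rk1 \<kappa> g x\<bar> <= C * L2norm g" using Rk_bound[OF \<kappa>] by blast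
  obtain D where D: "0 <= D" "\<forall>t\<in>{0..T}. L2norm (S t g) <= D" by (rule orbit_bounded[OF g])
  have "\<bar>Rk \<kappa> (S t g) x\<bar> <= C * D \<and> \<bar>Rk1 \<kappa> (S t g) x\<bar> <= C * D \<and>
    (\<forall>y\<in>{0..1}. \<bar>Rk \<kappa> (S t g) x - Rk \<kappa> (S t g) y\<bar> <= C * D * \<bar>x - y\<bar>)" if t: "t \<in> {0..T}" and x: "x \<in> {0..1}" for t x
  proof -
    have L: "S t g \<in> L2" using t by (intro S_L2 g) simp
    have le: "C * L2norm (S t g) <= C * D" using C(1) D(2) t by (intro mult_left_mono) auto
    have b: "\<bar>Rk \<kappa> (S t g) x\<bar> <= C * D" "\<bar>Rk1 \<kappa> (S t g) x\<bar> <= C * D" if "x \<in> {0..1}" for x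
      using C(2)[OF L that] C(3)[OF L that] le by linarith+
    have "norm (Rk \<kappa> (S t g) x - Rk \<kappa> (S t g) y) <= C * D * norm (x - y)" if y: "y \<in> {0..1}" for y
      by (rule field_differentiable_bound[where S="{0..1}" and f'="Rk1 \<kappa> (S t g)"])
        (use solD(2)[OF Rk_sol(1)[OF \<kappa> L]] b x y in auto)
    then show ?thesis using b x by simp
  qed
  then show ?thesis using C(1) D(1) by (intro exI[of _ "C * D"]) simp
qed

text \<open>Evaluation at \<open>x\<close> is a bounded functional only after a resolvent. One
  resolvent is spent on that, the other puts the orbit in the domain; commutation brings both to the
  outside.\<close>

lemma orbit_Rk2_deriv:
  assumes \<kappa>: "Kd < \<kappa>" and g: "g \<in> L2" and t: "t \<in> {0..T}" and x: "x \<in> {0..1}"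
  shows "((%t. Rk \<kappa> (Rk \<kappa> (S t g)) x) has_real_derivative
    \<kappa> * Rk \<kappa> (Rk \<kappa> (S t g)) x - Rk \<kappa> (S t g) x) (at t within {0..T})"
proof -
  let ?m = "Rk \<kappa> g" and ?z = "%x. \<kappa> * Rk \<kappa> g x - g x"
  have m: "?m \<in> L2" by (rule Rk_L2[OF \<kappa> g])
  have z: "?z \<in> L2" by (intro L2_diff L2_scale m g)
  have l: "bfun (%f. Rk \<kappa> f x)" by (rule bfun_Rk[OF \<kappa> x])
  have eq: "Rk \<kappa> (S s ?m) x = Rk \<kappa> (Rk \<kappa> (S s g)) x" if "s \<in> {0..T}" for s
  proof -
    have s: "0 <= s" using that by simp
    show ?thesis by (rule Rk_cong[OF \<kappa> S_L2[OF s m] Rk_L2[OF \<kappa> S_L2[OF s g]] S_Rk_commute[OF \<kappa> g s] x])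
  qed
  have t0: "0 <= t" using t by simp
  note lS = bfun_S[OF l t0]
  have "((%t. Rk \<kappa> (S t ?m) x) has_real_derivative Rk \<kappa> (S t ?z) x) (at t within {0..T})"
    by (rule orbit_functional[OF l m z gen_Rk[OF \<kappa> g] t])
  moreover have "Rk \<kappa> (S t ?z) x = \<kappa> * Rk \<kappa> (Rk \<kappa> (S t g)) x - Rk \<kappa> (S t g) x"
    unfolding bfun_diff[OF lS L2_scale[OF m] g] bfun_scale[OF lS m] eq[OF t] ..
  ultimately have "((%t. Rk \<kappa> (S t ?m) x) has_real_derivative \<kappa> * Rk \<kappa> (Rk \<kappa> (S t g)) x - Rk \<kappa> (S t g) x) (at t within {0..T})"
    by simp
  then show ?thesis by (rule has_field_derivative_transform_within[where d=1]) (simp, rule t, rule eq)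
qed

text \<open>The second derivative of \<open>w t\<close> is an expression in \<open>w\<close>,
  \<open>w1\<close> and \<open>p\<close>, all Lipschitz in space uniformly in time, and in
  coefficients with fixed jumps. The family is therefore piecewise equicontinuous over
  \<open>[0,T]\<close>.\<close>

lemma orbit_Rk2_consistency:
  assumes \<kappa>: "Kd < \<kappa>" and g: "g \<in> L2"
  shows "vanish {0..T} (%n t j. Pv n (%m. Rk \<kappa> (Rk \<kappa> (S t g)) (gp n m)) j
    - (\<kappa> * Rk \<kappa> (Rk \<kappa> (S t g)) (gp n j) - Rk \<kappa> (S t g) (gp n j)))"
proof -
  define p where "p t = Rk \<kappa> (S t g)" for t
  define w where "w t = Rk \<kappa> (p t)" for t
  define w1 where "w1 t = Rk1 \<kappa> (p t)" for t
  define h where "h t = wpp \<kappa> (p t) (w t) (w1 t)" for t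
  have SL: "S t g \<in> L2" if "t \<in> {0..T}" for t using that by (intro S_L2 g) simp
  have pL: "p t \<in> L2" if "t \<in> {0..T}" for t unfolding p_def by (rule Rk_L2[OF \<kappa> SL[OF that]])
  have s: "sol \<kappa> (p t) (w t) (w1 t)" "BCs (w t) (w1 t)" if "t \<in> {0..T}" for t
    unfolding w_def w1_def by (rule Rk_sol[OF \<kappa> pL[OF that]])+
  obtain A where A: "0 <= A" "\<forall>t\<in>{0..T}. \<forall>x\<in>{0..1}. \<bar>p t x\<bar> <= A \<and> \<bar>Rk1 \<kappa> (S t g) x\<bar> <= A \<and> (\<forall>y\<in>{0..1}. \<bar>p t x - p t y\<bar> <= A * \<bar>x - y\<bar>)"
    using orbit_Rk_bounds[OF assms, of T] unfolding p_def by blast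
  have pq: "pequi {0..T} p" by (rule pequi_lipschitz[where C=A and L=A]) (use A(2) in auto)
  obtain C where C: "0 <= C" "\<And>g x. g \<in> L2 ==> x \<in> {0..1} ==> \<bar>Rk \<kappa> g x\<bar> <= C * L2norm g"
    "\<And>g x. g \<in> L2 ==> x \<in> {0..1} ==> \<bar>Rk1 \<kappa> g x\<bar> <= C * L2norm g" using Rk_bound[OF \<kappa>] by blast
  define B where "B = C * A"
  have pA: "C * L2norm (p t) <= B" if t: "t \<in> {0..T}" for t
    unfolding B_def using A(2) t by (intro mult_left_mono[OF _ C(1)] L2norm_le_bound pL) auto
  have B: "\<bar>w t x\<bar> <= B" "\<bar>w1 t x\<bar> <= B" if "t \<in> {0..T}" "x \<in> {0..1}" for t x
    using C(2)[OF pL[OF that(1)] that(2)] C(3)[OF pL[OF that(1)] that(2)] pA[OF that(1)] by (auto simp: w_def w1_def)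
  note wc = sol_cont[OF s(1)]
  have "\<bar>w t x - w t y\<bar> <= B * \<bar>x - y\<bar>" if t: "t \<in> {0..T}" and x: "x \<in> {0..1}" and y: "y \<in> {0..1}" for t x y
  proof -
    have "norm (w t x - w t y) <= B * norm (x - y)"
      by (rule field_differentiable_bound[where S="{0..1}" and f'="w1 t"]) (use solD(2)[OF s(1)[OF t]] B(2)[OF t] x y in auto)
    then show ?thesis by simp
  qed
  then have wq: "pequi {0..T} w" by (intro pequi_lipschitz[where C=B and L=B] B)
  have vq: "pequi {0..T} (%t x. integral {0..x} (%s. \<phi> x s * w t s))"
    by (rule volterra_pequi(1)[where B=B]) (use wc B in auto)
  note inv = pequi_const_family[OF inv_theta_pcont, of "{0..T}"]
  have q1: "pequi {0..T} (%t x. \<kappa> * w t x)" using pequi_mult[OF pequi_const[of "{0..T}" "%_. \<kappa>" "\<bar>\<kappa>\<bar>"] wq] by simp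
  \<comment> \<open>The term with \<open>w1\<close> is split off: equicontinuity of
    \<open>w1\<close> needs a bound on \<open>h\<close>, and only afterwards can the equicontinuity
    of \<open>h\<close> itself follow.\<close>
  have q2: "pequi {0..T} (%t x. (\<kappa> * w t x - p t x - lam x * w t x - integral {0..x} (%s. \<phi> x s * w t s)) * (1 / \<theta> x))"
    by (intro pequi_mult pequi_diff q1 pq wq vq inv pequi_const_family[OF pc_lam])
  have q3: "pequi {0..T} (%t x. \<sigma> x * (1 / \<theta> x))" by (intro pequi_mult inv pequi_const_family[OF pc_sigma])
  have h_eq: "h t x = (\<kappa> * w t x - p t x - lam x * w t x - integral {0..x} (%s. \<phi> x s * w t s)) * (1 / \<theta> x) - \<sigma> x * (1 / \<theta> x) * w1 t x" for t x
    by (simp add: h_def wpp_def diff_divide_distrib)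
  obtain G1 where G1: "\<And>t x. t \<in> {0..T} ==> x \<in> {0..1} ==>
     \<bar>(\<kappa> * w t x - p t x - lam x * w t x - integral {0..x} (%s. \<phi> x s * w t s)) * (1 / \<theta> x)\<bar> <= G1" by (rule pequi_bounded[OF q2]) blast
  obtain G2 where G2: "0 <= G2" "\<And>t x. t \<in> {0..T} ==> x \<in> {0..1} ==> \<bar>\<sigma> x * (1 / \<theta> x)\<bar> <= G2" by (rule pequi_bounded[OF q3]) blast
  define G where "G = G1 + G2 * B"
  have G: "\<bar>h t x\<bar> <= G" if t: "t \<in> {0..T}" and x: "x \<in> {0..1}" for t x
  proof -
    have "\<bar>\<sigma> x * (1 / \<theta> x) * w1 t x\<bar> <= G2 * B" unfolding abs_mult[of _ "w1 t x"] using G2(2)[OF t x] B(2)[OF t x] G2(1) by (intro mult_mono) auto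
    then show ?thesis unfolding h_eq G_def using G1[OF t x] by linarith
  qed
  have hp: "pcont (h t)" if t: "t \<in> {0..T}" for t unfolding h_def by (rule wpp_pcont[OF pequi_member[OF pq t] wc[OF t]])
  have "\<bar>w1 t x - w1 t y\<bar> <= G * \<bar>x - y\<bar>" if t: "t \<in> {0..T}" and x: "x \<in> {0..1}" and y: "y \<in> {0..1}" for t x y
  proof -
    have "\<bar>w1 t x - w1 t y - (x - y) * 0\<bar> <= G * \<bar>x - y\<bar>"
    proof (rule increment_bound[OF _ solD(3)[OF s(1)[OF t], folded h_def] y x])
      show "h t integrable_on {0..1}" using L2_integrable_on(2)[OF pcont_L2[OF hp[OF t]]] by auto
      fix z assume "z \<in> {min y x..max y x}"
      then have "z \<in> {0..1}" using x y by (auto simp: min_def max_def split: if_splits)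
      then show "\<bar>h t z - 0\<bar> <= G" using G[OF t] by simp
    qed
    then show ?thesis by simp
  qed
  then have w1q: "pequi {0..T} w1" by (intro pequi_lipschitz[where C=B and L=G] B)
  have hq: "pequi {0..T} h"
  proof -
    have "h = (%t x. (\<kappa> * w t x - p t x - lam x * w t x - integral {0..x} (%s. \<phi> x s * w t s)) * (1 / \<theta> x) - \<sigma> x * (1 / \<theta> x) * w1 t x)"
      by (intro ext) (rule h_eq)
    then show ?thesis using pequi_diff[OF q2 pequi_mult[OF q3 w1q]] by simp
  qed
  interpret H: H2_family \<theta> \<sigma> lam \<phi> \<alpha>0 \<beta>0 \<alpha>1 \<beta>1 c0 "{0..T}" w w1 h B G
  proof unfold_locales
    fix t x assume t: "t \<in> {0..T}" and x: "x \<in> {0..1::real}"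
    show "(w t has_real_derivative w1 t x) (at x within {0..1})" by (rule solD(2)[OF s(1)[OF t] x])
    show "w1 t x = w1 t 0 + integral {0..x} (h t)" unfolding h_def by (rule solD(3)[OF s(1)[OF t] x])
    show "\<bar>w t x\<bar> <= B" "\<bar>w1 t x\<bar> <= B" by (rule B[OF t x])+
    show "\<bar>h t x\<bar> <= G" by (rule G[OF t x])
  next
    fix t assume t: "t \<in> {0..T}"
    show "\<alpha>0 * w1 t 0 + \<beta>0 * w t 0 = 0" using s(2)[OF t] by (simp add: BCs_def)
  qed (rule hq)
  show ?thesis
  proof (rule vanish_dom[OF H.consistency, where C=1], intro always_eventually allI ballI)
    fix n j :: nat and t assume t: "t \<in> {0..T}" and "j \<in> {1..n}"
    then have x: "gp n j \<in> {0..1}" by (intro grid_in) simp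
    have "\<alpha>1 * w1 t 1 + \<beta>1 * w t 1 = 0" using s(2)[OF t] by (simp add: BCs_def)
    then show "\<bar>Pv n (%m. Rk \<kappa> (Rk \<kappa> (S t g)) (gp n m)) j
        - (\<kappa> * Rk \<kappa> (Rk \<kappa> (S t g)) (gp n j) - Rk \<kappa> (S t g) (gp n j))\<bar>
      <= 1 * \<bar>Pv n (%m. w t (gp n m)) j + Bvec \<theta> \<alpha>1 \<beta>1 n j * (\<alpha>1 * w1 t 1 + \<beta>1 * w t 1) - Pex (w t) (w1 t) (h t) (gp n j)\<bar>"
      unfolding h_def w_def w1_def Pex_Rk[OF x] p_def by simp
  qed
qed

end

lemma grid_sum_sq_add:
  fixes a b :: "nat => real"
  assumes "mean_sq n a <= A" "mean_sq n b <= B"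
  shows "hh n * (\<Sum>j=1..n. (a j + b j)^2) <= 2 * A + 2 * B"
proof -
  have "(\<Sum>j=1..n. (a j + b j)^2) <= (\<Sum>j=1..n. 2 * (a j)^2 + 2 * (b j)^2)"
  proof (rule sum_mono)
    fix j show "(a j + b j)^2 <= 2 * (a j)^2 + 2 * (b j)^2"
      using zero_le_power2[of "a j - b j"] by (simp add: power2_eq_square algebra_simps)
  qed
  then have "hh n * (\<Sum>j=1..n. (a j + b j)^2) <= hh n * (\<Sum>j=1..n. 2 * (a j)^2 + 2 * (b j)^2)"
    using hh_pos[of n] by (intro mult_left_mono) auto
  also have "\<dots> = 2 * (mean_sq n a) + 2 * (mean_sq n b)"
    unfolding sum.distrib sum_distrib_left[symmetric] by (simp add: algebra_simps)
  finally show ?thesis using assms by linarith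
qed

lemma grid_sum_sq_bound:
  assumes "\<And>j. j \<in> {1..n} ==> \<bar>a j\<bar> <= C" shows "mean_sq n a <= C^2"
proof -
  have "(\<Sum>j=1..n. (a j)^2) <= (\<Sum>j=1..n. C^2)"
    by (rule sum_mono) (metis assms abs_ge_zero power2_abs power_mono)
  then have "mean_sq n a <= hh n * (real n * C^2)" using hh_pos[of n] by (intro mult_left_mono) auto
  also have "\<dots> = gp n n * C^2" by simp
  also have "\<dots> <= 1 * C^2" using n_hh_le by (intro mult_right_mono) auto
  finally show ?thesis by simp
qed

subsection \<open>Convergence\<close>

text \<open>The lifting enters through its boundary values alone: 0 on the left and 1 on the right.
  The latter matches the input vector with coefficient exactly one in the consistency
  statement.\<close>

locale cauchy_problem = pide_semigroup +
  fixes \<nu> \<nu>1 \<nu>2 u0 f f1 :: "real => real" and T M C' :: real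
    and fn fn1 :: "nat => real => real" and v :: "nat => real => nat => real"
  assumes T: "0 <= T"
    and d\<nu>: "\<And>x. x \<in> {0..1} ==> (\<nu> has_real_derivative \<nu>1 x) (at x within {0..1})"
    and d\<nu>1: "\<And>x. x \<in> {0..1} ==> (\<nu>1 has_real_derivative \<nu>2 x) (at x within {0..1})"
    and \<nu>2: "continuous_on {0..1} \<nu>2"
    and bc: "\<alpha>0 * \<nu>1 0 + \<beta>0 * \<nu> 0 = 0" "\<alpha>1 * \<nu>1 1 + \<beta>1 * \<nu> 1 = 1"
    and M: "0 <= M" "\<And>x. x \<in> {0..1} ==> \<bar>\<nu> x\<bar> <= M" "\<And>x. x \<in> {0..1} ==> \<bar>Pex \<nu> \<nu>1 \<nu>2 x\<bar> <= M"
    and C': "0 <= C'" "\<And>w. w \<in> L2 ==> L2norm w <= C' * wnorm w"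
    and u0: "continuous_on {0..1} u0" and f: "continuous_on {0..T} f" and f1: "continuous_on {0..T} f1"
    and dfn: "\<And>n t. 1 <= n ==> t \<in> {0..T} ==> (fn n has_real_derivative fn1 n t) (at t within {0..T})"
    and fn_conv: "\<And>e. 0 < e ==> \<forall>\<^sub>F n in sequentially. \<forall>t\<in>{0..T}. \<bar>fn n t - f t\<bar> <= e \<and> \<bar>fn1 n t - f1 t\<bar> <= e"
    and v_init: "\<And>n j. 1 <= n ==> j \<in> {1..n} ==> v n 0 j = u0 (gp n j)"
    and v_ode: "\<And>n t j. 1 <= n ==> t \<in> {0..T} ==> j \<in> {1..n} ==>
        ((%s. v n s j) has_real_derivative (Pv n (v n t) j + Bvec \<theta> \<alpha>1 \<beta>1 n j * fn n t)) (at t within {0..T})"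
begin

abbreviation P\<nu> :: "real => real" where "P\<nu> \<equiv> Pex \<nu> \<nu>1 \<nu>2"

lemma \<nu>_cont: "continuous_on {0..1} \<nu>" "continuous_on {0..1} \<nu>1"
  by (rule DERIV_continuous_on, erule d\<nu> d\<nu>1)+

lemma P\<nu>_pcont: "pcont P\<nu>"
  by (rule Pex_pcont[OF \<nu>_cont pcont_continuous[OF \<nu>2]])

lemma \<nu>_pcont: "pcont \<nu>" by (rule pcont_continuous[OF \<nu>_cont(1)])

lemma \<nu>_consistency:
  "vanish {()} (%n _ j. Pv n (%m. \<nu> (gp n m)) j + Bvec \<theta> \<alpha>1 \<beta>1 n j - P\<nu> (gp n j))"
proof -
  have "\<nu>1 x = \<nu>1 0 + integral {0..x} \<nu>2" if x: "x \<in> {0..1}" for x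
  proof -
    have "(\<nu>2 has_integral \<nu>1 x - \<nu>1 0) {0..x}"
    proof (rule fundamental_theorem_of_calculus)
      fix y assume y: "y \<in> {0..x}"
      have "(\<nu>1 has_real_derivative \<nu>2 y) (at y within {0..x})" by (rule DERIV_subset[OF d\<nu>1]) (use x y in auto)
      then show "(\<nu>1 has_vector_derivative \<nu>2 y) (at y within {0..x})" by (simp add: has_real_derivative_iff_has_vector_derivative)
    qed (use x in simp)
    then show ?thesis by (simp add: integral_unique)
  qed
  from consistency_single[OF d\<nu> this \<nu>_cont(2) pcont_continuous[OF \<nu>2] bc(1)] show ?thesis by (simp add: bc(2))
qed

end

text \<open>For exponential-sum inputs close to \<open>f\<close>, the state is the sum of the lifting \<open>\<nu> f\<close>, explicit resolvent modes
  \<open>exp (kap i t) md i\<close> and the semigroup orbit of \<open>y0\<close>; replacing \<open>y0\<close> by its double resolvent makes the latter a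
  classical solution \<open>w\<close>, to which the consistency estimates apply.\<close>
locale input_approximation = cauchy_problem +
  fixes e \<kappa> :: real and N :: nat and c c' :: "nat => real"
  assumes e: "0 < e" "e <= 1" and \<kappa>: "Kd < \<kappa>"
    and pf: "\<And>t. t \<in> {0..T} ==> \<bar>f t - (\<Sum>i\<le>N. c i * exp ((Kd + 1 + real i) * t))\<bar> <= e"
    and qf: "\<And>t. t \<in> {0..T} ==> \<bar>f1 t - (\<Sum>i\<le>N. c' i * exp ((Kd + 1 + real i) * t))\<bar> <= e"
begin

definition kap :: "nat => real" where "kap i = Kd + 1 + real i"
definition inp :: "nat => real => real" where "inp i x = c i * P\<nu> x - c' i * \<nu> x"
definition md :: "nat => real => real" where "md i = Rk (kap i) (inp i)"
definition y0 :: "real => real" where "y0 x = (u0 x - \<nu> x * f 0) - (\<Sum>i\<le>N. md i x)"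
definition g0 :: "real => real" where "g0 x = \<kappa>^2 * y0 x"
definition w :: "real => real => real" where "w t = Rk \<kappa> (Rk \<kappa> (S t g0))"
definition modes :: "real => real => real" where "modes t x = (\<Sum>i\<le>N. exp (kap i * t) * md i x)"
definition approx :: "real => real => real" where "approx t x = \<nu> x * f t + w t x + modes t x"
text \<open>The lifting is multiplied by \<open>fn n\<close>, not by \<open>f\<close>. The input
  term of the scheme is then contained in the consistency defect of the lifting; with
  \<open>f\<close> it would leave the unbounded \<open>Bvec\<close> times
  \<open>fn n - f\<close>.\<close>

definition err :: "nat => real => nat => real" where
  "err n t j = v n t j - (\<nu> (gp n j) * fn n t + w t (gp n j) + modes t (gp n j))"
definition res :: "nat => real => nat => real" where
  "res n t j = fn n t * (Pv n (%m. \<nu> (gp n m)) j + Bvec \<theta> \<alpha>1 \<beta>1 n j - P\<nu> (gp n j))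
    + (Pv n (%m. w t (gp n m)) j - (\<kappa> * w t (gp n j) - Rk \<kappa> (S t g0) (gp n j)))
    + (\<Sum>i\<le>N. exp (kap i * t) * (Pv n (%m. md i (gp n m)) j - (kap i * md i (gp n j) - inp i (gp n j))))"
text \<open>What remains from replacing the actual input and its derivative by the exponential sums;
  both factors in space are bounded, hence convergence in \<open>C^1\<close> in time
  suffices.\<close>

definition inp_err :: "nat => real => nat => real" where
  "inp_err n t j = P\<nu> (gp n j) * (fn n t - (\<Sum>i\<le>N. c i * exp (kap i * t)))
    - \<nu> (gp n j) * (fn1 n t - (\<Sum>i\<le>N. c' i * exp (kap i * t)))"

lemma kap: "Kd < kap i" by (simp add: kap_def)
lemma inp_pcont: "pcont (inp i)"
  unfolding inp_def[abs_def] by (intro pequi_diff pcont_scale P\<nu>_pcont \<nu>_pcont)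
lemma md_pcont: "pcont (md i)" unfolding md_def by (rule Rk_pcont[OF kap pcont_L2[OF inp_pcont]])
lemma y0_pcont: "pcont y0"
  unfolding y0_def[abs_def]
proof (intro pequi_diff pcont_sum md_pcont)
  show "pcont (%x. \<nu> x * f 0)" using pcont_scale[OF \<nu>_pcont, of "f 0"] by (simp add: mult.commute)
qed (rule pcont_continuous[OF u0])
lemma g0_L2: "g0 \<in> L2" unfolding g0_def[abs_def] by (rule L2_scale[OF pcont_L2[OF y0_pcont]])
lemma SL: "t \<in> {0..T} ==> S t g0 \<in> L2" by (rule S_L2[OF _ g0_L2]) simp

lemma w_bounds: "\<exists>B\<ge>0. \<forall>t\<in>{0..T}. \<forall>x\<in>{0..1}. \<bar>w t x\<bar> <= B \<and> (\<forall>y\<in>{0..1}. \<bar>w t x - w t y\<bar> <= B * \<bar>x - y\<bar>)"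
proof -
  obtain B where B: "0 <= B" "\<forall>t\<in>{0..T}. \<forall>x\<in>{0..1}. \<bar>Rk \<kappa> (S t (Rk \<kappa> g0)) x\<bar> <= B \<and> \<bar>Rk1 \<kappa> (S t (Rk \<kappa> g0)) x\<bar> <= B \<and>
    (\<forall>y\<in>{0..1}. \<bar>Rk \<kappa> (S t (Rk \<kappa> g0)) x - Rk \<kappa> (S t (Rk \<kappa> g0)) y\<bar> <= B * \<bar>x - y\<bar>)"
    using orbit_Rk_bounds[OF \<kappa> Rk_L2[OF \<kappa> g0_L2], of T] by blast
  \<comment> \<open>The outer of the two resolvents is applied to the orbit of
    \<open>Rk \<kappa> g0\<close>, so that the bounds for one resolvent cover
    \<open>w\<close>.\<close>
  have eq: "Rk \<kappa> (S t (Rk \<kappa> g0)) x = w t x" if t: "t \<in> {0..T}" and x: "x \<in> {0..1}" for t x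
  proof -
    have t0: "0 <= t" using t by simp
    show ?thesis unfolding w_def
      by (rule Rk_cong[OF \<kappa> S_L2[OF t0 Rk_L2[OF \<kappa> g0_L2]] Rk_L2[OF \<kappa> SL[OF t]] S_Rk_commute[OF \<kappa> g0_L2 t0] x])
  qed
  have "\<bar>w t x\<bar> <= B \<and> (\<forall>y\<in>{0..1}. \<bar>w t x - w t y\<bar> <= B * \<bar>x - y\<bar>)" if t: "t \<in> {0..T}" and x: "x \<in> {0..1}" for t x
  proof (intro conjI ballI)
    show "\<bar>w t x\<bar> <= B" using B(2) t x by (simp add: eq)
    fix y :: real assume "y \<in> {0..1}"
    then show "\<bar>w t x - w t y\<bar> <= B * \<bar>x - y\<bar>" using B(2) t x by (simp add: eq)
  qed
  then show ?thesis using B(1) by blast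
qed

text \<open>The time derivatives of the resolvent modes and of \<open>w\<close> equal the continuous
  operator applied to them, up to \<open>inp i\<close> for the modes; comparison with the matrix
  yields \<open>res\<close>, and the sum of the \<open>inp i\<close> against the lifting yields
  \<open>inp_err\<close>.\<close>

lemma err_ode:
  assumes n: "1 <= n" and t: "t \<in> {0..T}" and j: "j \<in> {1..n}"
  shows "((%s. err n s j) has_real_derivative (Pv n (err n t) j + (res n t j + inp_err n t j))) (at t within {0..T})"
proof -
  define x where "x = gp n j"
  have x01: "x \<in> {0..1}" unfolding x_def by (rule grid_in) (use j in simp)
  define Bj where "Bj = Bvec \<theta> \<alpha>1 \<beta>1 n j"
  define V where "V = Pv n (%m. \<nu> (gp n m)) j"
  define W where "W = Pv n (%m. w t (gp n m)) j"
  define E where "E i = exp (kap i * t)" for i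
  define Q where "Q i = Pv n (%m. md i (gp n m)) j" for i
  have "((%s. exp (kap i * s) * md i x) has_real_derivative kap i * E i * md i x) (at t within {0..T})" for i
    unfolding E_def by (auto intro!: derivative_eq_intros)
  then have dm: "((%s. modes s x) has_real_derivative (\<Sum>i\<le>N. kap i * E i * md i x)) (at t within {0..T})"
    unfolding modes_def by (intro DERIV_sum)
  have dw: "((%s. w s x) has_real_derivative \<kappa> * w t x - Rk \<kappa> (S t g0) x) (at t within {0..T})"
    unfolding w_def by (rule orbit_Rk2_deriv[OF \<kappa> g0_L2 t x01])
  have d: "((%s. err n s j) has_real_derivative
      (Pv n (v n t) j + Bj * fn n t) - (\<nu> x * fn1 n t + (\<kappa> * w t x - Rk \<kappa> (S t g0) x) + (\<Sum>i\<le>N. kap i * E i * md i x))) (at t within {0..T})"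
    unfolding err_def x_def[symmetric] Bj_def
    by (intro DERIV_diff DERIV_add v_ode n t j dw dm DERIV_cmult dfn)
  have "Pv n (err n t) j = Pv n (v n t) j - (V * fn n t + W + Pv n (%m. modes t (gp n m)) j)"
    unfolding err_def[abs_def] Pv_diff Pv_add V_def W_def using Pv_scale[of n "fn n t" "%m. \<nu> (gp n m)" j] by (simp add: mult.commute)
  also have "Pv n (%m. modes t (gp n m)) j = (\<Sum>i\<le>N. E i * Q i)"
    unfolding modes_def Pv_sum Pv_scale E_def Q_def ..
  finally have Pe: "Pv n (err n t) j = Pv n (v n t) j - (V * fn n t + W + (\<Sum>i\<le>N. E i * Q i))" .
  have I: "P\<nu> x * (\<Sum>i\<le>N. c i * E i) - \<nu> x * (\<Sum>i\<le>N. c' i * E i) = (\<Sum>i\<le>N. E i * inp i x)"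
    unfolding inp_def sum_distrib_left sum_subtractf[symmetric] by (rule sum.cong) (auto simp: algebra_simps)
  have R: "(\<Sum>i\<le>N. E i * (Q i - (kap i * md i x - inp i x))) = (\<Sum>i\<le>N. E i * Q i) - (\<Sum>i\<le>N. kap i * E i * md i x) + (\<Sum>i\<le>N. E i * inp i x)"
    unfolding sum_subtractf[symmetric] sum.distrib[symmetric] by (rule sum.cong) (auto simp: algebra_simps)
  have res: "res n t j = fn n t * (V + Bj - P\<nu> x) + (W - (\<kappa> * w t x - Rk \<kappa> (S t g0) x)) + (\<Sum>i\<le>N. E i * (Q i - (kap i * md i x - inp i x)))"
    unfolding res_def V_def W_def Bj_def E_def Q_def x_def ..
  have ie: "inp_err n t j = P\<nu> x * fn n t - \<nu> x * fn1 n t - (P\<nu> x * (\<Sum>i\<le>N. c i * E i) - \<nu> x * (\<Sum>i\<le>N. c' i * E i))"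
    unfolding inp_err_def E_def x_def by (simp add: right_diff_distrib)
  show ?thesis
  proof (rule DERIV_cong[OF d])
    show "(Pv n (v n t) j + Bj * fn n t) - (\<nu> x * fn1 n t + (\<kappa> * w t x - Rk \<kappa> (S t g0) x) + (\<Sum>i\<le>N. kap i * E i * md i x))
      = Pv n (err n t) j + (res n t j + inp_err n t j)"
      unfolding Pe res ie I R by (simp add: algebra_simps)
  qed
qed

lemma f_bounded: obtains F where "0 <= F" "\<And>t. t \<in> {0..T} ==> \<bar>f t\<bar> <= F"
proof -
  have "bounded (f ` {0..T})" by (rule compact_imp_bounded, rule compact_continuous_image[OF f]) simp
  then obtain F where "\<forall>y\<in>f ` {0..T}. norm y <= F" unfolding bounded_iff by blast
  then have "\<bar>f t\<bar> <= \<bar>F\<bar>" if "t \<in> {0..T}" for t using that by (metis abs_ge_self image_eqI order_trans real_norm_def)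
  then show thesis by (intro that[of "\<bar>F\<bar>"]) simp_all
qed

lemma res_vanish: "vanish {0..T} res"
proof -
  let ?V = "%n j. Pv n (%m. \<nu> (gp n m)) j + Bvec \<theta> \<alpha>1 \<beta>1 n j - P\<nu> (gp n j)"
  let ?D = "%i n j. Pv n (%m. md i (gp n m)) j - (kap i * md i (gp n j) - inp i (gp n j))"
  obtain F where F: "0 <= F" "\<And>t. t \<in> {0..T} ==> \<bar>f t\<bar> <= F" by (rule f_bounded) blast
  have "vanish {0..T} (%n t j. ?V n j)"
    using vanish_reindex[OF \<nu>_consistency, of "{0..T}" "%_. ()"] by simp
  then have 1: "vanish {0..T} (%n t j. fn n t * ?V n j)"
  proof (rule vanish_dom[where C="F + 1"])
    have "\<forall>\<^sub>F n in sequentially. \<forall>t\<in>{0..T}. \<bar>fn n t - f t\<bar> <= 1 \<and> \<bar>fn1 n t - f1 t\<bar> <= 1" by (rule fn_conv) simp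
    then show "\<forall>\<^sub>F n in sequentially. \<forall>t\<in>{0..T}. \<forall>j\<in>{1..n}. \<bar>fn n t * ?V n j\<bar>
       <= (F + 1) * \<bar>?V n j\<bar>"
    proof eventually_elim
      case (elim n)
      show ?case
      proof (intro ballI)
        fix t j assume t: "t \<in> {0..T}"
        have "\<bar>fn n t - f t\<bar> <= 1" using elim t by blast
        then have "\<bar>fn n t\<bar> <= F + 1" using F(2)[OF t] by linarith
        then show "\<bar>fn n t * ?V n j\<bar>
       <= (F + 1) * \<bar>?V n j\<bar>"
          unfolding abs_mult by (rule mult_right_mono) simp
      qed
    qed
  qed
  have 2: "vanish {0..T} (%n t j. Pv n (%m. w t (gp n m)) j - (\<kappa> * w t (gp n j) - Rk \<kappa> (S t g0) (gp n j)))"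
    unfolding w_def by (rule orbit_Rk2_consistency[OF \<kappa> g0_L2])
  have 3: "vanish {0..T} (%n t j. exp (kap i * t) * ?D i n j)" for i
  proof -
    have "vanish {0..T} (%n t j. ?D i n j)"
      using vanish_reindex[OF Rk_consistency[OF kap inp_pcont], of "{0..T}" "%_. ()" i i] unfolding md_def by simp
    then show ?thesis
    proof (rule vanish_dom[where C="exp (kap i * T)"], intro always_eventually allI ballI)
      fix n j :: nat and t assume t: "t \<in> {0..T}"
      have "exp (kap i * t) <= exp (kap i * T)" using t kap[of i] Kd(1) by (simp add: mult_left_mono)
      then show "\<bar>exp (kap i * t) * ?D i n j\<bar>
        <= exp (kap i * T) * \<bar>?D i n j\<bar>"
        unfolding abs_mult by (intro mult_right_mono) auto
    qed
  qed
  have 4: "vanish {0..T} (%n t j. \<Sum>i\<le>K. exp (kap i * t) * ?D i n j)" for K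
  proof (induction K)
    case 0 then show ?case using 3[of 0] by simp
  next
    case (Suc K) then show ?case using vanish_add[OF Suc 3[of "Suc K"]] by simp
  qed
  show ?thesis unfolding res_def[abs_def] by (rule vanish_add[OF vanish_add[OF 1 2] 4])
qed

text \<open>From \<open>fn n\<close> to the exponential sum the distance is \<open>2 e\<close>,
  through \<open>f\<close>; there are two such terms, each with a factor bounded by
  \<open>M\<close>.\<close>

lemma inp_err_bound:
  assumes "\<forall>t\<in>{0..T}. \<bar>fn n t - f t\<bar> <= e \<and> \<bar>fn1 n t - f1 t\<bar> <= e" "t \<in> {0..T}" "j \<in> {1..n}"
  shows "\<bar>inp_err n t j\<bar> <= 4 * M * e"
proof -
  have x: "gp n j \<in> {0..1}" by (rule grid_in) (use assms in simp)
  have a: "\<bar>fn n t - (\<Sum>i\<le>N. c i * exp (kap i * t))\<bar> <= 2 * e" "\<bar>fn1 n t - (\<Sum>i\<le>N. c' i * exp (kap i * t))\<bar> <= 2 * e"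
    using assms pf[OF assms(2)] qf[OF assms(2)] unfolding kap_def by fastforce+
  have "\<bar>P\<nu> (gp n j) * (fn n t - (\<Sum>i\<le>N. c i * exp (kap i * t)))\<bar> <= M * (2 * e)"
    unfolding abs_mult using M x a by (intro mult_mono) auto
  moreover have "\<bar>\<nu> (gp n j) * (fn1 n t - (\<Sum>i\<le>N. c' i * exp (kap i * t)))\<bar> <= M * (2 * e)"
    unfolding abs_mult using M x a by (intro mult_mono) auto
  ultimately show ?thesis unfolding inp_err_def by (simp add: abs_le_iff)
qed

end

text \<open>Uniform in time, as needed to compare a trajectory with its piecewise constant
  interpolant for all times with the same mesh.\<close>

definition equi_lip :: "real => (real => real => real) => bool" where
  "equi_lip T F \<longleftrightarrow> (\<exists>B\<ge>0. \<forall>t\<in>{0..T}. \<forall>x\<in>{0..1}. \<bar>F t x\<bar> <= B \<and> (\<forall>y\<in>{0..1}. \<bar>F t x - F t y\<bar> <= B * \<bar>x - y\<bar>))"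

lemma equi_lip_add:
  assumes "equi_lip T F" "equi_lip T G" shows "equi_lip T (%t x. F t x + G t x)"
proof -
  obtain A where A: "0 <= A" "\<forall>t\<in>{0..T}. \<forall>x\<in>{0..1}. \<bar>F t x\<bar> <= A \<and> (\<forall>y\<in>{0..1}. \<bar>F t x - F t y\<bar> <= A * \<bar>x - y\<bar>)"
    using assms(1) unfolding equi_lip_def by blast
  obtain B where B: "0 <= B" "\<forall>t\<in>{0..T}. \<forall>x\<in>{0..1}. \<bar>G t x\<bar> <= B \<and> (\<forall>y\<in>{0..1}. \<bar>G t x - G t y\<bar> <= B * \<bar>x - y\<bar>)"
    using assms(2) unfolding equi_lip_def by blast
  show ?thesis unfolding equi_lip_def
  proof (intro exI[of _ "A + B"] conjI ballI)
    fix t x assume t: "t \<in> {0..T}" and x: "x \<in> {0..1::real}"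
    show "\<bar>F t x + G t x\<bar> <= A + B" using A(2)[rule_format, OF t x] B(2)[rule_format, OF t x] by linarith
    fix y :: real assume y: "y \<in> {0..1}"
    have "\<bar>F t x - F t y\<bar> <= A * \<bar>x - y\<bar>" "\<bar>G t x - G t y\<bar> <= B * \<bar>x - y\<bar>" using A(2) B(2) t x y by blast+
    then show "\<bar>F t x + G t x - (F t y + G t y)\<bar> <= (A + B) * \<bar>x - y\<bar>" unfolding distrib_right by linarith
  qed (use A B in simp)
qed

lemma equi_lip_mult:
  assumes F: "equi_lip T F" and a: "\<And>t. t \<in> {0..T} ==> \<bar>a t\<bar> <= K" and K: "0 <= K"
  shows "equi_lip T (%t x. a t * F t x)"
proof -
  obtain A where A: "0 <= A" "\<forall>t\<in>{0..T}. \<forall>x\<in>{0..1}. \<bar>F t x\<bar> <= A \<and> (\<forall>y\<in>{0..1}. \<bar>F t x - F t y\<bar> <= A * \<bar>x - y\<bar>)"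
    using F unfolding equi_lip_def by blast
  show ?thesis unfolding equi_lip_def
  proof (intro exI[of _ "K * A"] conjI ballI)
    fix t x assume t: "t \<in> {0..T}" and x: "x \<in> {0..1::real}"
    show "\<bar>a t * F t x\<bar> <= K * A" unfolding abs_mult using A(1) A(2)[rule_format, OF t x] a[OF t] K by (intro mult_mono) auto
    fix y :: real assume y: "y \<in> {0..1}"
    have "\<bar>F t x - F t y\<bar> <= A * \<bar>x - y\<bar>" using A(2) t x y by blast
    then have "\<bar>a t\<bar> * \<bar>F t x - F t y\<bar> <= K * (A * \<bar>x - y\<bar>)" using a[OF t] K by (intro mult_mono) auto
    then show "\<bar>a t * F t x - a t * F t y\<bar> <= K * A * \<bar>x - y\<bar>"
      unfolding right_diff_distrib[symmetric] abs_mult by (simp add: mult.assoc)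
  qed (use A K in simp)
qed

lemma equi_lip_sum:
  assumes "\<And>i. i <= N ==> equi_lip T (F i)" shows "equi_lip T (%t x. \<Sum>i\<le>(N::nat). F i t x)"
  using assms
proof (induction N)
  case 0 then show ?case by simp
next
  case (Suc N)
  have "equi_lip T (%t x. \<Sum>i\<le>N. F i t x)" using Suc by simp
  from equi_lip_add[OF this Suc.prems[OF order_refl]] show ?case by simp
qed

lemma equi_lip_deriv:
  assumes d: "\<And>x. x \<in> {0..1} ==> (h has_real_derivative h1 x) (at x within {0..1})" and h1: "continuous_on {0..1} h1"
  shows "equi_lip T (%_. h)"
proof -
  have hc: "continuous_on {0..1} h" using d by (rule DERIV_continuous_on)
  obtain A where A: "0 <= A" "\<And>x. x \<in> {0..1} ==> \<bar>h x\<bar> <= A" using pequi_bounded[OF pcont_continuous[OF hc]] by auto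
  obtain B where B: "0 <= B" "\<And>x. x \<in> {0..1} ==> \<bar>h1 x\<bar> <= B" using pequi_bounded[OF pcont_continuous[OF h1]] by auto
  show ?thesis unfolding equi_lip_def
  proof (intro exI[of _ "A + B"] conjI ballI)
    fix x :: real assume x: "x \<in> {0..1}"
    show "\<bar>h x\<bar> <= A + B" using A(2)[OF x] B(1) by simp
    fix y :: real assume y: "y \<in> {0..1}"
    have "norm (h x - h y) <= B * norm (x - y)"
      by (rule field_differentiable_bound[where S="{0..1}" and f'=h1]) (use d B x y in auto)
    also have "\<dots> <= (A + B) * norm (x - y)" using A(1) by (intro mult_right_mono) auto
    finally show "\<bar>h x - h y\<bar> <= (A + B) * \<bar>x - y\<bar>" by simp
  qed (use A B in simp)
qed

context pide_semigroup
begin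

lemma S_Rk2_commute:
  assumes \<kappa>: "Kd < \<kappa>" and g: "g \<in> L2" and t: "0 <= t"
  shows "L2eq (S t (Rk \<kappa> (Rk \<kappa> g))) (Rk \<kappa> (Rk \<kappa> (S t g)))"
proof -
  have Rg: "Rk \<kappa> g \<in> L2" by (rule Rk_L2[OF \<kappa> g])
  have SRg: "S t (Rk \<kappa> g) \<in> L2" by (rule S_L2[OF t Rg])
  have RS: "Rk \<kappa> (S t g) \<in> L2" by (rule Rk_L2[OF \<kappa> S_L2[OF t g]])
  have "L2eq (Rk \<kappa> (S t (Rk \<kappa> g))) (Rk \<kappa> (Rk \<kappa> (S t g)))"
    by (rule L2eq_cong) (rule Rk_cong[OF \<kappa> SRg RS S_Rk_commute[OF \<kappa> g t]])
  then show ?thesis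
    by (rule L2eq_trans[OF S_L2[OF t Rk_L2[OF \<kappa> Rg]] Rk_L2[OF \<kappa> SRg] Rk_L2[OF \<kappa> RS] S_Rk_commute[OF \<kappa> Rg t]])
qed

end

context input_approximation
begin

lemma approx_equi_lip: "equi_lip T approx"
proof -
  obtain F where F: "0 <= F" "\<And>t. t \<in> {0..T} ==> \<bar>f t\<bar> <= F" by (rule f_bounded) blast
  have 1: "equi_lip T (%t x. f t * \<nu> x)" by (rule equi_lip_mult[OF equi_lip_deriv[OF d\<nu> \<nu>_cont(2)] F(2) F(1)])
  have 2: "equi_lip T w" unfolding equi_lip_def by (rule w_bounds)
  have 3: "equi_lip T (%t x. exp (kap i * t) * md i x)" for i
  proof (rule equi_lip_mult[where K="exp (kap i * T)"])
    note s = Rk_sol(1)[OF kap pcont_L2[OF inp_pcont], of i i]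
    show "equi_lip T (%_. md i)" unfolding md_def by (rule equi_lip_deriv[OF solD(2)[OF s] solD(1)[OF s]])
    fix t assume "t \<in> {0..T}"
    then show "\<bar>exp (kap i * t)\<bar> <= exp (kap i * T)" using kap[of i] Kd(1) by (simp add: mult_left_mono)
  qed simp
  have "approx = (%t x. f t * \<nu> x + w t x + (\<Sum>i\<le>N. exp (kap i * t) * md i x))"
    by (intro ext) (simp add: approx_def modes_def mult.commute)
  then show ?thesis using equi_lip_add[OF equi_lip_add[OF 1 2] equi_lip_sum[where N=N, OF 3]] by simp
qed

lemma w_L2: "t \<in> {0..T} ==> w t \<in> L2"
  unfolding w_def by (intro Rk_L2 \<kappa> SL)

lemma modes_L2: "modes t \<in> L2"
  unfolding modes_def[abs_def] by (intro L2_sum L2_scale pcont_L2 md_pcont)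

lemma \<nu>f_L2: "(%x. \<nu> x * a) \<in> L2"
  using L2_scale[OF pcont_L2[OF \<nu>_pcont], of a] by (simp add: mult.commute)

lemma approx_L2: "t \<in> {0..T} ==> approx t \<in> L2"
  unfolding approx_def[abs_def] by (intro L2_add \<nu>f_L2 w_L2 modes_L2)

text \<open>At \<open>t = 0\<close> the modes cancel against the correction inside
  \<open>y0\<close>; what is left is \<open>y0\<close> minus its double resolvent, plus the lifting
  times \<open>f 0 - fn n 0\<close>. The mean square of the former is a Riemann sum of an
  \<open>L2\<close> distance.\<close>

lemma initial_error:
  assumes J: "L2norm (%x. Rk \<kappa> (Rk \<kappa> g0) x - y0 x) <= C' * e"
  shows "\<forall>\<^sub>F n in sequentially. mean_sq n (err n 0) <= (2 * C'^2 + 2 * M^2 + 2) * e^2"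
proof -
  let ?J = "Rk \<kappa> (Rk \<kappa> g0)"
  have Jp: "pcont ?J" by (rule Rk_pcont[OF \<kappa> Rk_L2[OF \<kappa> g0_L2]])
  have dp: "pcont (%x. y0 x - ?J x)" by (rule pequi_diff[OF y0_pcont Jp])
  note dL = pcont_L2[OF dp]
  have "pcont (%x. (y0 x - ?J x)^2)" using pequi_mult[OF dp dp] by (simp add: power2_eq_square)
  then have lim: "(%n. hh n * (\<Sum>j=1..n. (y0 (gp n j) - ?J (gp n j))^2)) \<longlonglongrightarrow> integral {0..1} (%x. (y0 x - ?J x)^2)"
    by (rule riemann_sum_tendsto)
  have "integral {0..1} (%x. (y0 x - ?J x)^2) = (L2norm (%x. y0 x - ?J x))^2"
    unfolding L2norm_power2 L2inner_eq_integral[OF dL dL] by (simp add: power2_eq_square)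
  also have "\<dots> <= (C' * e)^2" using J L2norm_minus_commute[of y0 ?J] by (intro power_mono) (auto simp: L2norm_nonneg)
  \<comment> \<open>The additional \<open>e^2\<close> gives strict room above the limit, so that the
    Riemann sums are eventually below the bound.\<close>
  also have "\<dots> < C'^2 * e^2 + e^2" using e by (simp add: power_mult_distrib)
  finally have ev1: "\<forall>\<^sub>F n in sequentially. hh n * (\<Sum>j=1..n. (y0 (gp n j) - ?J (gp n j))^2) < C'^2 * e^2 + e^2"
    by (rule order_tendstoD(2)[OF lim])
  have w0: "w 0 x = ?J x" if x: "x \<in> {0..1}" for x
  proof -
    have 0: "0 \<in> {0..T}" using T by simp
    have "L2eq (Rk \<kappa> (S 0 g0)) (Rk \<kappa> g0)" by (rule L2eq_cong) (rule Rk_cong[OF \<kappa> SL[OF 0] g0_L2 S_zero[OF g0_L2]])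
    then show ?thesis unfolding w_def by (rule Rk_cong[OF \<kappa> Rk_L2[OF \<kappa> SL[OF 0]] Rk_L2[OF \<kappa> g0_L2] _ x])
  qed
  show ?thesis using ev1 fn_conv[OF e(1)] eventually_ge_at_top[of 1]
  proof eventually_elim
    case (elim n)
    let ?a = "%j. y0 (gp n j) - ?J (gp n j)" and ?b = "%j. \<nu> (gp n j) * (f 0 - fn n 0)"
    have b: "\<bar>?b j\<bar> <= M * e" if "j \<in> {1..n}" for j
    proof -
      have "gp n j \<in> {0..1}" by (rule grid_in) (use that in simp)
      moreover have "\<bar>fn n 0 - f 0\<bar> <= e" using elim(2) T by auto
      then have "\<bar>f 0 - fn n 0\<bar> <= e" by linarith
      ultimately show ?thesis unfolding abs_mult using M by (intro mult_mono) auto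
    qed
    have eq: "err n 0 j = ?a j + ?b j" if j: "j \<in> {1..n}" for j
    proof -
      have x: "gp n j \<in> {0..1}" by (rule grid_in) (use j in simp)
      show ?thesis unfolding err_def v_init[OF elim(3) j] w0[OF x] y0_def modes_def by (simp add: algebra_simps)
    qed
    have "mean_sq n (err n 0) = hh n * (\<Sum>j=1..n. (?a j + ?b j)^2)" using eq by simp
    also have "\<dots> <= 2 * (C'^2 * e^2 + e^2) + 2 * (M * e)^2"
      by (rule grid_sum_sq_add[OF less_imp_le[OF elim(1)] grid_sum_sq_bound[OF b]])
    also have "\<dots> = (2 * C'^2 + 2 * M^2 + 2) * e^2" by (simp add: power_mult_distrib algebra_simps)
    finally show ?case .
  qed
qed

lemma residual_bound:
  "\<forall>\<^sub>F n in sequentially. \<forall>t\<in>{0..T}. hh n * (\<Sum>j=1..n. (res n t j + inp_err n t j)^2) <= (2 + 32 * M^2) * e^2"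
proof -
  have "0 < e^2" using e by simp
  from vanishD[OF res_vanish this] fn_conv[OF e(1)] show ?thesis
  proof eventually_elim
    case (elim n)
    show ?case
    proof
      fix t assume t: "t \<in> {0..T}"
      have "hh n * (\<Sum>j=1..n. (res n t j + inp_err n t j)^2) <= 2 * e^2 + 2 * (4 * M * e)^2"
        by (rule grid_sum_sq_add[OF elim(1)[rule_format, OF t] grid_sum_sq_bound[OF inp_err_bound[OF elim(2) t]]])
      also have "\<dots> = (2 + 32 * M^2) * e^2" by (simp add: power_mult_distrib algebra_simps)
      finally show "hh n * (\<Sum>j=1..n. (res n t j + inp_err n t j)^2) <= (2 + 32 * M^2) * e^2" .
    qed
  qed
qed

text \<open>Four contributions: the approximation of the mild solution (\<open>Cd\<close>), the
  smoothing of \<open>y0\<close> transported by the semigroup (\<open>Cs * C'\<close>), the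
  piecewise constant interpolation (2), and the error of the scheme together with the lifting of
  \<open>f - fn n\<close> (the root). None of the constants depends on the chosen
  approximation.\<close>

lemma total_error:
  assumes J: "L2norm (%x. Rk \<kappa> (Rk \<kappa> g0) x - y0 x) <= C' * e"
    and Cst: "0 <= Cst" "stable T Cst"
    and Cs: "0 <= Cs" "\<forall>t\<in>{0..T}. \<forall>d. pcont d --> L2norm (S t d) <= Cs * L2norm d"
    and yL': "\<forall>t\<in>{0..T}. y t \<in> L2"
    and yd': "\<forall>t\<in>{0..T}. L2norm (%x. y t x - (S t y0 x + modes t x)) <= Cd * e"
  shows "\<forall>\<^sub>F n in sequentially. \<forall>t\<in>{0..T}. L2norm (%x. (y t x + \<nu> x * f t) - Sn n (v n t) x)
     <= (Cd + Cs * C' + 2 + sqrt (2 * M^2 + 2 * (Cst * (2 * C'^2 + 34 * M^2 + 4)))) * e"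
proof -
  note yL = yL'[rule_format] and yd = yd'[rule_format]
  \<comment> \<open>Stability constant times the sum of the initial and residual coefficients
    \<open>2 C'^2 + 2 M^2 + 2\<close> and \<open>2 + 32 M^2\<close>.\<close>
  define Q where "Q = Cst * (2 * C'^2 + 34 * M^2 + 4)"
  have Q: "0 <= Q" unfolding Q_def using Cst(1) by simp
  obtain B where B: "0 <= B" "\<forall>t\<in>{0..T}. \<forall>x\<in>{0..1}. \<bar>approx t x\<bar> <= B \<and> (\<forall>y\<in>{0..1}. \<bar>approx t x - approx t y\<bar> <= B * \<bar>x - y\<bar>)"
    using approx_equi_lip unfolding equi_lip_def by blast
  let ?J = "Rk \<kappa> (Rk \<kappa> g0)"
  have JL: "?J \<in> L2" by (rule Rk_L2[OF \<kappa> Rk_L2[OF \<kappa> g0_L2]])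
  have y0L: "y0 \<in> L2" by (rule pcont_L2[OF y0_pcont])
  \<comment> \<open>Two mesh thresholds: below the first \<open>approx\<close> varies by at most
    \<open>e\<close> over a cell, below the second the uncovered interval next to 1 contributes at
    most \<open>e^2\<close>.\<close>
  have "0 < e / (B + 1)" "0 < e^2 / (B^2 + 1)" using e B(1) by (simp_all add: add_nonneg_pos)
  from Cst(2)[unfolded stable_def] initial_error[OF J] residual_bound fn_conv[OF e(1)] eventually_ge_at_top[of 1]
    hh_eventually_less[OF this(1)] hh_eventually_less[OF this(2)]
  show ?thesis
  proof eventually_elim
    case (elim n)
    have n: "1 <= n" by (rule elim(5))
    have "\<forall>t\<in>{0..T}. mean_sq n (err n t) <= Cst * (mean_sq n (err n 0) + (2 + 32 * M^2) * e^2)"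
    proof (rule elim(1)[THEN spec[of _ "err n"], THEN spec[of _ "%t j. res n t j + inp_err n t j"], THEN spec[of _ "(2 + 32 * M^2) * e^2"], THEN mp, THEN mp])
      show "\<forall>t\<in>{0..T}. \<forall>j\<in>{1..n}. ((%s. err n s j) has_real_derivative (Pv n (err n t) j + (res n t j + inp_err n t j))) (at t within {0..T})"
        by (intro ballI err_ode n)
    qed (rule elim(3))
    moreover have "Cst * (mean_sq n (err n 0) + (2 + 32 * M^2) * e^2)
      <= Cst * ((2 * C'^2 + 2 * M^2 + 2) * e^2 + (2 + 32 * M^2) * e^2)"
      using elim(2) by (intro mult_left_mono add_right_mono Cst(1))
    moreover have "Cst * ((2 * C'^2 + 2 * M^2 + 2) * e^2 + (2 + 32 * M^2) * e^2) = Q * e^2" by (simp add: Q_def algebra_simps)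
    ultimately have err: "mean_sq n (err n t) <= Q * e^2" if "t \<in> {0..T}" for t using that by fastforce
    show ?case
    proof
      fix t assume t: "t \<in> {0..T}"
      have t0: "0 <= t" using t by simp
      note Sy = S_L2[OF t0 y0L] and SJ = S_L2[OF t0 JL] and aL = approx_L2[OF t]
      let ?U = "%x. S t y0 x + modes t x"
      have UL: "?U \<in> L2" by (intro L2_add Sy modes_L2)
      let ?a = "%j. approx t (gp n j)"
      have d2: "L2norm (%x. S t y0 x - w t x) <= Cs * C' * e"
      proof -
        have "L2norm (%x. S t y0 x - w t x) <= L2norm (%x. S t y0 x - S t ?J x) + L2norm (%x. S t ?J x - w t x)"
          by (rule L2norm_triangle3[OF Sy SJ w_L2[OF t]])
        also have "L2norm (%x. S t ?J x - w t x) = 0"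
          using S_Rk2_commute[OF \<kappa> g0_L2 t0] unfolding w_def L2eq_def .
        also have "L2norm (%x. S t y0 x - S t ?J x) = L2norm (S t (%x. y0 x - ?J x))" by (rule S_diff_norm[OF t0 y0L JL])
        also have "\<dots> <= Cs * L2norm (%x. y0 x - ?J x)"
          using Cs(2) t pequi_diff[OF y0_pcont Rk_pcont[OF \<kappa> Rk_L2[OF \<kappa> g0_L2]]] by blast
        also have "L2norm (%x. y0 x - ?J x) <= C' * e" using J L2norm_minus_commute[of y0 ?J] by simp
        finally show ?thesis using Cs(1) by (simp add: mult_left_mono mult.assoc)
      qed
      have d3: "L2norm (%x. approx t x - Sn n ?a x) <= 2 * e"
      proof (rule power2_le_imp_le)
        have "(L2norm (%x. approx t x - Sn n ?a x))^2 <= e^2 + hh n * B^2"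
        proof (rule Sn_approx[OF n aL])
          fix x y :: real assume x: "x \<in> {0..1}" and y: "y \<in> {0..1}" and xy: "\<bar>x - y\<bar> <= hh n"
          have "\<bar>approx t x - approx t y\<bar> <= B * \<bar>x - y\<bar>" using B(2) t x y by blast
          also have "\<dots> <= B * (e / (B + 1))" using xy elim(6) B(1) by (intro mult_left_mono) auto
          also have "\<dots> <= e" using B(1) e by (simp add: field_simps)
          finally show "\<bar>approx t x - approx t y\<bar> <= e" .
        qed (use e B(2) t in auto)
        also have "hh n * B^2 <= e^2 / (B^2 + 1) * B^2" using elim(7) by (intro mult_right_mono) auto
        also have "\<dots> <= e^2 / (B^2 + 1) * (B^2 + 1)" by (intro mult_left_mono) auto
        also have "\<dots> = e^2" by (simp add: add_nonneg_eq_0_iff)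
        also have "e^2 + e^2 <= (2 * e)^2" by (simp add: power_mult_distrib)
        finally show "(L2norm (%x. approx t x - Sn n ?a x))^2 <= (2 * e)^2" by simp
      qed (use e in simp)
      have d4: "L2norm (Sn n (%j. ?a j - v n t j)) <= sqrt (2 * M^2 + 2 * Q) * e"
      proof (rule power2_le_imp_le)
        let ?b = "%j. \<nu> (gp n j) * (f t - fn n t)"
        have b: "\<bar>?b j\<bar> <= M * e" if "j \<in> {1..n}" for j
        proof -
          have "gp n j \<in> {0..1}" by (rule grid_in) (use that in simp)
          moreover have "\<bar>fn n t - f t\<bar> <= e" using elim(4) t by blast
          then have "\<bar>f t - fn n t\<bar> <= e" by linarith
          ultimately show ?thesis unfolding abs_mult using M by (intro mult_mono) auto
        qed
        \<comment> \<open>\<open>approx\<close> is built with \<open>f\<close> and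
          \<open>err\<close> with \<open>fn n\<close>; the lifting of the difference accounts for
          the discrepancy.\<close>
        have eq: "?a j - v n t j = ?b j + - err n t j" for j
          unfolding err_def approx_def by (simp add: algebra_simps)
        have "(L2norm (Sn n (%j. ?a j - v n t j)))^2 = hh n * (\<Sum>j=1..n. (?b j + - err n t j)^2)"
          unfolding Sn_norm eq ..
        also have "\<dots> <= 2 * (M * e)^2 + 2 * (Q * e^2)"
          by (rule grid_sum_sq_add[OF grid_sum_sq_bound[OF b]]) (use err[OF t] in simp_all)
        also have "\<dots> = (2 * M^2 + 2 * Q) * e^2" by (simp add: power_mult_distrib algebra_simps)
        also have "\<dots> = (sqrt (2 * M^2 + 2 * Q) * e)^2" using Q by (simp add: power_mult_distrib)
        finally show "(L2norm (Sn n (%j. ?a j - v n t j)))^2 <= (sqrt (2 * M^2 + 2 * Q) * e)^2" .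
      qed (use e Q in simp)
      have "L2norm (%x. (y t x + \<nu> x * f t) - Sn n (v n t) x)
        = L2norm (%x. ((y t x - ?U x) + (S t y0 x - w t x)) + ((approx t x - Sn n ?a x) + Sn n (%j. ?a j - v n t j) x))"
        by (rule L2norm_cong) (simp add: Sn_diff approx_def)
      also have "\<dots> <= L2norm (%x. (y t x - ?U x) + (S t y0 x - w t x)) + L2norm (%x. (approx t x - Sn n ?a x) + Sn n (%j. ?a j - v n t j) x)"
        by (rule L2norm_triangle[OF L2_add[OF L2_diff[OF yL[OF t] UL] L2_diff[OF Sy w_L2[OF t]]] L2_add[OF L2_diff[OF aL Sn_L2] Sn_L2]])
      also have "\<dots> <= (L2norm (%x. y t x - ?U x) + L2norm (%x. S t y0 x - w t x))
         + (L2norm (%x. approx t x - Sn n ?a x) + L2norm (Sn n (%j. ?a j - v n t j)))"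
        by (rule add_mono[OF L2norm_triangle[OF L2_diff[OF yL[OF t] UL] L2_diff[OF Sy w_L2[OF t]]] L2norm_triangle[OF L2_diff[OF aL Sn_L2] Sn_L2]])
      also have "\<dots> <= (Cd * e + Cs * C' * e) + (2 * e + sqrt (2 * M^2 + 2 * Q) * e)"
        by (rule add_mono[OF add_mono[OF yd[OF t] d2] add_mono[OF d3 d4]])
      also have "\<dots> = (Cd + Cs * C' + 2 + sqrt (2 * M^2 + 2 * Q)) * e" by (simp add: algebra_simps)
      finally show "L2norm (%x. (y t x + \<nu> x * f t) - Sn n (v n t) x)
        <= (Cd + Cs * C' + 2 + sqrt (2 * M^2 + 2 * (Cst * (2 * C'^2 + 34 * M^2 + 4)))) * e" unfolding Q_def .
    qed
  qed
qed

end

context cauchy_problem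
begin

text \<open>The order of choices matters: \<open>K\<close> is fixed first, then \<open>e\<close>
  determines the exponential sums, these the remaining initial value \<open>z\<close>, this the
  parameter \<open>\<kappa>\<close>, and only then the threshold for \<open>n\<close>. Large
  coefficients of the sums thus affect the threshold but not \<open>K\<close>.\<close>

lemma uniform_error:
  assumes uL: "\<forall>t\<in>{0..T}. u t \<in> L2"
    and weak: "\<forall>t\<in>{0..T}. \<forall>\<psi>\<in>L2. L2inner (%x. u t x - \<nu> x * f t) \<psi> = L2inner (S t (%x. u0 x - \<nu> x * f 0)) \<psi>
        + integral {0..t} (%\<tau>. L2inner (S (t - \<tau>) (%x. P\<nu> x * f \<tau> - \<nu> x * f1 \<tau>)) \<psi>)"
  shows "\<exists>K\<ge>0. \<forall>e. 0 < e --> e <= 1 --> (\<forall>\<^sub>F n in sequentially. \<forall>t\<in>{0..T}. L2norm (%x. u t x - Sn n (v n t) x) <= K * e)"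
proof -
  let ?y = "%t x. u t x - \<nu> x * f t"
  have \<nu>aL: "(%x. \<nu> x * a) \<in> L2" for a using L2_scale[OF pcont_L2[OF \<nu>_pcont], of a] by (simp add: mult.commute)
  have yL: "\<forall>t\<in>{0..T}. ?y t \<in> L2" using uL by (intro ballI L2_diff \<nu>aL) blast
  have z0: "pcont (%x. u0 x - \<nu> x * f 0)" by (intro pcont_continuous continuous_intros u0 \<nu>_cont)
  obtain Cd where Cd: "0 <= Cd" and ap: "\<forall>e>0. \<exists>N c c'. exp_sum_input P\<nu> \<nu> f f1 (%x. u0 x - \<nu> x * f 0) ?y T (Cd * e) e N c c'"
    using duhamel_approx[where y="?y", OF P\<nu>_pcont \<nu>_pcont f f1 z0 yL T weak] by (elim exE conjE) (rule that)
  obtain Cst where Cst: "0 <= Cst" "stable T Cst"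
    using discrete_stability[OF T] by (elim exE conjE) (rule that)
  obtain Cs where Cs: "0 <= Cs" "\<forall>t\<in>{0..T}. \<forall>d. pcont d --> L2norm (S t d) <= Cs * L2norm d" by (rule S_stable)
  define K where "K = Cd + Cs * C' + 2 + sqrt (2 * M^2 + 2 * (Cst * (2 * C'^2 + 34 * M^2 + 4)))"
  have K: "0 <= K" unfolding K_def using Cd Cs(1) C'(1) Cst(1) by simp
  have "\<forall>\<^sub>F n in sequentially. \<forall>t\<in>{0..T}. L2norm (%x. u t x - Sn n (v n t) x) <= K * e" if e: "0 < e" "e <= 1" for e
  proof -
    obtain N c c' where A': "exp_sum_input P\<nu> \<nu> f f1 (%x. u0 x - \<nu> x * f 0) ?y T (Cd * e) e N c c'"
      using ap[rule_format, OF e(1)] by (elim exE) (rule that)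
    note A = A'[unfolded exp_sum_input_def]
    define z where "z x = (u0 x - \<nu> x * f 0) - (\<Sum>i\<le>N. Rk (Kd + 1 + real i) (%x. c i * P\<nu> x - c' i * \<nu> x) x)" for x
    have mp: "pcont (Rk (Kd + 1 + real i) (%x. c i * P\<nu> x - c' i * \<nu> x))" for i
      by (intro Rk_pcont pcont_L2 pequi_diff pcont_scale P\<nu>_pcont \<nu>_pcont) simp
    have zp: "pcont z" unfolding z_def[abs_def] by (intro pequi_diff z0 pcont_sum mp)
    obtain \<kappa> where \<kappa>: "Kd < \<kappa>" and Jz: "wnorm (%x. Rk \<kappa> (Rk \<kappa> (%x. \<kappa>^2 * z x)) x - z x) <= e"
      using resolvent_sq_approx[OF zp e(1)] by blast
    interpret A: input_approximation \<theta> \<sigma> lam \<phi> \<alpha>0 \<beta>0 \<alpha>1 \<beta>1 c0 S \<nu> \<nu>1 \<nu>2 u0 f f1 T M C' fn fn1 v e \<kappa> N c c'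
    proof unfold_locales
      fix t assume t: "t \<in> {0..T}"
      show "\<bar>f t - (\<Sum>i\<le>N. c i * exp ((Kd + 1 + real i) * t))\<bar> <= e" by (rule A[THEN bspec, OF t, THEN conjunct1])
      show "\<bar>f1 t - (\<Sum>i\<le>N. c' i * exp ((Kd + 1 + real i) * t))\<bar> <= e" by (rule A[THEN bspec, OF t, THEN conjunct2, THEN conjunct1])
    qed (rule e \<kappa>)+
    \<comment> \<open>\<open>z\<close> was needed to choose \<open>\<kappa>\<close>, before the
      locale with its own \<open>y0\<close> could be instantiated; here the two are
      identified.\<close>
    have zy: "z = A.y0" by (simp add: fun_eq_iff z_def A.y0_def A.md_def A.inp_def[abs_def] A.kap_def)
    have gz: "(%x. \<kappa>^2 * z x) = A.g0" by (simp add: fun_eq_iff A.g0_def zy)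
    have zL: "z \<in> L2" by (rule pcont_L2[OF zp])
    have JL: "Rk \<kappa> (Rk \<kappa> A.g0) \<in> L2" by (rule Rk_L2[OF \<kappa> Rk_L2[OF \<kappa> A.g0_L2]])
    have "L2norm (%x. Rk \<kappa> (Rk \<kappa> A.g0) x - A.y0 x) <= C' * wnorm (%x. Rk \<kappa> (Rk \<kappa> A.g0) x - A.y0 x)"
      by (rule C'(2)[OF L2_diff[OF JL zL[unfolded zy]]])
    also have "\<dots> <= C' * e" using Jz C'(1) unfolding gz unfolding zy by (rule mult_left_mono)
    finally have J: "L2norm (%x. Rk \<kappa> (Rk \<kappa> A.g0) x - A.y0 x) <= C' * e" .
    have yd: "\<forall>t\<in>{0..T}. L2norm (%x. ?y t x - (S t A.y0 x + A.modes t x)) <= Cd * e"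
    proof
      fix t assume t: "t \<in> {0..T}"
      show "L2norm (%x. ?y t x - (S t A.y0 x + A.modes t x)) <= Cd * e"
        using A[THEN bspec, OF t, THEN conjunct2, THEN conjunct2] unfolding z_def[symmetric]
        unfolding zy A.modes_def A.md_def A.inp_def[abs_def] A.kap_def .
    qed
    from A.total_error[where y="?y", OF J Cst Cs yL yd] show ?thesis
      unfolding K_def[symmetric] by (simp only: diff_add_cancel)
  qed
  then show ?thesis using K by blast
qed

end

section \<open>Assembly: from the given data to the abstract Cauchy problem\<close>

lemma C3_on_cont:
  assumes "C3_on T g g1 g2 g3"
  shows "continuous_on {0..T} g" "continuous_on {0..T} g1" "t \<in> {0..T} ==> (g has_real_derivative g1 t) (at t within {0..T})"
proof -
  have d: "\<And>t. t \<in> {0..T} ==> (g has_real_derivative g1 t) (at t within {0..T})"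
    "\<And>t. t \<in> {0..T} ==> (g1 has_real_derivative g2 t) (at t within {0..T})"
    using assms unfolding C3_on_def by blast+
  show "continuous_on {0..T} g" "continuous_on {0..T} g1" by (rule DERIV_continuous_on, erule d)+
  show "t \<in> {0..T} ==> (g has_real_derivative g1 t) (at t within {0..T})" by (rule d(1))
qed

lemma C1dist_bound:
  assumes c: "continuous_on {0..T} g" "continuous_on {0..T} g1" "continuous_on {0..T} f" "continuous_on {0..T} f1"
    and t: "t \<in> {0..T}"
  shows "\<bar>g t - f t\<bar> <= C1dist_on T g g1 f f1" "\<bar>g1 t - f1 t\<bar> <= C1dist_on T g g1 f f1"
proof -
  have b: "bdd_above ((%x. \<bar>h x - k x\<bar>) ` {0..T})" if "continuous_on {0..T} h" "continuous_on {0..T} k" for h k :: "real => real"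
    by (rule bounded_imp_bdd_above, rule compact_imp_bounded, rule compact_continuous_image) (use that in \<open>auto intro: continuous_intros\<close>)
  note u = cSUP_upper[OF t b[OF c(1,3)]] cSUP_upper[OF t b[OF c(2,4)]]
  have "0 <= \<bar>g t - f t\<bar>" "0 <= \<bar>g1 t - f1 t\<bar>" by simp_all
  then show "\<bar>g t - f t\<bar> <= C1dist_on T g g1 f f1" "\<bar>g1 t - f1 t\<bar> <= C1dist_on T g g1 f f1"
    unfolding C1dist_on_def using u by linarith+
qed

theorem theorem1:
  fixes \<theta> \<sigma> lam :: "real \<Rightarrow> real" and \<phi> :: "real \<Rightarrow> real \<Rightarrow> real"
    and \<alpha>0 \<beta>0 \<alpha>1 \<beta>1 \<mu>1 \<mu>2 T :: real
    and S :: "real \<Rightarrow> (real \<Rightarrow> real) \<Rightarrow> (real \<Rightarrow> real)"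
    and u0 f f1 f2 f3 :: "real \<Rightarrow> real"
    and fn fn1 fn2 fn3 :: "nat \<Rightarrow> real \<Rightarrow> real"
    and u :: "real \<Rightarrow> real \<Rightarrow> real"
    and v :: "nat \<Rightarrow> real \<Rightarrow> nat \<Rightarrow> real"
  assumes reg: "PC1_01 \<theta>" "PC1_01 \<sigma>" "PC1_01 lam"
    and theta_pos: "\<exists>c>0. \<forall>x\<in>{0..1}. c \<le> \<theta> x"
    and kernel: "C1_C1_kernel \<phi>"
    and well_def: "\<forall>n\<ge>1. 3 * \<alpha>0 - 2 * hh n * \<beta>0 \<noteq> 0 \<and> 3 * \<alpha>1 + 2 * hh n * \<beta>1 \<noteq> 0
                         \<and> \<alpha>0 - hh n * \<beta>0 \<noteq> 0"
    and semigroup: "generates_semigroup (DomP \<alpha>0 \<beta>0 \<alpha>1 \<beta>1) (P_rel \<theta> \<sigma> lam \<phi>) S"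
    and mu: "\<mu>2 \<ge> 3" "\<mu>1 * (\<mu>2 * \<alpha>1 + \<beta>1) = 1"
    and T_pos: "T > 0"
    and u0: "continuous_on {0..1} u0"
    and f: "C3_on T f f1 f2 f3"
    and fn: "\<forall>n\<ge>1. C3_on T (fn n) (fn1 n) (fn2 n) (fn3 n)"
    and fn_conv: "(\<lambda>n. C1dist_on T (fn n) (fn1 n) f f1) \<longlonglongrightarrow> 0"
    and u: "PIDE_solution \<theta> \<sigma> lam \<phi> \<mu>1 \<mu>2 S T u0 f f1 u"
    and v_init: "\<forall>n\<ge>1. \<forall>j\<in>{1..n}. v n 0 j = Rn n u0 j"
    and v_ode: "\<forall>n\<ge>1. \<forall>t\<in>{0..T}. \<forall>j\<in>{1..n}.
        ((\<lambda>s. v n s j) has_real_derivative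
           ((\<Sum>m=1..n. Pmat \<theta> \<sigma> lam \<phi> \<alpha>0 \<beta>0 \<alpha>1 \<beta>1 n j m * v n t m)
            + Bvec \<theta> \<alpha>1 \<beta>1 n j * fn n t)) (at t within {0..T})"
  shows "(\<lambda>n. SUP t\<in>{0..T}. L2norm (\<lambda>x. u t x - Sn n (v n t) x)) \<longlonglongrightarrow> 0"
proof -
  obtain c0 where c0: "0 < c0" "\<forall>x\<in>{0..1}. c0 \<le> \<theta> x" using theta_pos by blast
  interpret pide_semigroup \<theta> \<sigma> lam \<phi> \<alpha>0 \<beta>0 \<alpha>1 \<beta>1 c0 S
    by unfold_locales
      (use reg[THEN PC1_pcont] c0 kernel_continuous[OF kernel] well_def semigroup in auto)
  \<comment> \<open>Nested products in the shape that repeated differentiation of a scaled power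
    produces, so both derivative facts follow by the same rule.\<close>
  define \<nu>1 where "\<nu>1 x = \<mu>1 * (\<mu>2 * x powr (\<mu>2 - 1))" for x
  define \<nu>2 where "\<nu>2 x = \<mu>1 * (\<mu>2 * ((\<mu>2 - 1) * x powr (\<mu>2 - 1 - 1)))" for x
  have d\<nu>: "(nu \<mu>1 \<mu>2 has_real_derivative \<nu>1 x) (at x within {0..1})" if "x \<in> {0..1}" for x
    unfolding nu_def[abs_def] \<nu>1_def by (intro DERIV_cmult powr_deriv_01 that) (use mu in simp)
  have d\<nu>1: "(\<nu>1 has_real_derivative \<nu>2 x) (at x within {0..1})" if "x \<in> {0..1}" for x
    unfolding \<nu>1_def[abs_def] \<nu>2_def by (intro DERIV_cmult powr_deriv_01 that) (use mu in simp)
  have \<nu>2: "continuous_on {0..1} \<nu>2"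
    unfolding \<nu>2_def[abs_def] by (intro continuous_on_mult_left powr_cont_01) (use mu in simp)
  have \<nu>c: "continuous_on {0..1} (nu \<mu>1 \<mu>2)" "continuous_on {0..1} \<nu>1"
    by (rule DERIV_continuous_on, erule d\<nu> d\<nu>1)+
  have Pnu: "Pnu \<theta> \<sigma> lam \<phi> \<mu>1 \<mu>2 = Pex (nu \<mu>1 \<mu>2) \<nu>1 \<nu>2"
    by (rule ext) (simp add: Pnu_def Pex_def \<nu>1_def \<nu>2_def algebra_simps)
  obtain M1 where M1: "0 \<le> M1" "\<And>x. x \<in> {0..1} \<Longrightarrow> \<bar>nu \<mu>1 \<mu>2 x\<bar> \<le> M1"
    using pequi_bounded[OF pcont_continuous[OF \<nu>c(1)]] by auto
  obtain M2 where M2: "0 \<le> M2" "\<And>x. x \<in> {0..1} \<Longrightarrow> \<bar>Pex (nu \<mu>1 \<mu>2) \<nu>1 \<nu>2 x\<bar> \<le> M2"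
    using pequi_bounded[OF Pex_pcont[OF \<nu>c pcont_continuous[OF \<nu>2]]] by auto
  obtain C' where C': "0 < C'" "\<And>w. w \<in> L2 \<Longrightarrow> L2norm w \<le> C' * wnorm w" using wnorm_ge by blast
  note fc = C3_on_cont[OF f] and fnc = C3_on_cont[OF fn[rule_format]]
  interpret cauchy_problem \<theta> \<sigma> lam \<phi> \<alpha>0 \<beta>0 \<alpha>1 \<beta>1 c0 S "nu \<mu>1 \<mu>2" \<nu>1 \<nu>2 u0 f f1 T "M1 + M2" C' fn fn1 v
  proof unfold_locales
    \<comment> \<open>A power of 0 is 0, so the lifting and its derivative vanish there and satisfy
      the left condition for any coefficients.\<close>
    show "\<alpha>0 * \<nu>1 0 + \<beta>0 * nu \<mu>1 \<mu>2 0 = 0" by (simp add: \<nu>1_def nu_def)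
    show "\<alpha>1 * \<nu>1 1 + \<beta>1 * nu \<mu>1 \<mu>2 1 = 1" using mu(2) by (simp add: \<nu>1_def nu_def algebra_simps)
    fix x :: real assume x: "x \<in> {0..1}"
    show "\<bar>nu \<mu>1 \<mu>2 x\<bar> \<le> M1 + M2" "\<bar>Pex (nu \<mu>1 \<mu>2) \<nu>1 \<nu>2 x\<bar> \<le> M1 + M2" using M1(1) M1(2)[OF x] M2(1) M2(2)[OF x] by simp_all
  next
    fix e :: real assume e: "0 < e"
    show "\<forall>\<^sub>F n in sequentially. \<forall>t\<in>{0..T}. \<bar>fn n t - f t\<bar> \<le> e \<and> \<bar>fn1 n t - f1 t\<bar> \<le> e"
      using order_tendstoD(2)[OF fn_conv e] eventually_ge_at_top[of 1]
    proof eventually_elim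
      case (elim n)
      show ?case
      proof
        fix t assume t: "t \<in> {0..T}"
        show "\<bar>fn n t - f t\<bar> \<le> e \<and> \<bar>fn1 n t - f1 t\<bar> \<le> e"
          using C1dist_bound[OF fnc(1,2)[OF elim(2)] fc(1,2) t] elim(1) by linarith
      qed
    qed
  next
    fix n j :: nat assume "1 \<le> n" "j \<in> {1..n}"
    then show "v n 0 j = u0 (real j * hh n)" using v_init by (simp add: Rn_def)
  next
    fix n j :: nat and t assume "1 \<le> n" "t \<in> {0..T}" "j \<in> {1..n}"
    then show "((\<lambda>s. v n s j) has_real_derivative (Pv n (v n t) j + Bvec \<theta> \<alpha>1 \<beta>1 n j * fn n t)) (at t within {0..T})"
      using v_ode unfolding Pv_def by blast
  qed (use T_pos d\<nu> d\<nu>1 \<nu>2 M1(1) M2(1) C' u0 fc fnc(3) in auto)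
  have uL: "\<forall>t\<in>{0..T}. u t \<in> L2" and weak: "\<forall>t\<in>{0..T}. \<forall>\<psi>\<in>L2. L2inner (\<lambda>x. u t x - nu \<mu>1 \<mu>2 x * f t) \<psi>
      = L2inner (S t (\<lambda>x. u0 x - nu \<mu>1 \<mu>2 x * f 0)) \<psi>
        + integral {0..t} (\<lambda>\<tau>. L2inner (S (t - \<tau>) (\<lambda>x. Pex (nu \<mu>1 \<mu>2) \<nu>1 \<nu>2 x * f \<tau> - nu \<mu>1 \<mu>2 x * f1 \<tau>)) \<psi>)"
    using u unfolding PIDE_solution_def Pnu by blast+
  obtain K where K: "0 \<le> K" and lim: "\<forall>e. 0 < e \<longrightarrow> e \<le> 1 \<longrightarrow> (\<forall>\<^sub>F n in sequentially. \<forall>t\<in>{0..T}. L2norm (\<lambda>x. u t x - Sn n (v n t) x) \<le> K * e)"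
    using uniform_error[OF uL weak] by (elim exE conjE) (rule that)
  show ?thesis
  proof (rule tendstoI)
    fix r :: real assume r: "0 < r"
    \<comment> \<open>\<open>K + 1\<close> keeps the quotient defined for \<open>K = 0\<close> and
      makes the final inequality strict; the cap at 1 is demanded by
      \<open>uniform_error\<close>.\<close>
    define e where "e = min 1 (r / (K + 1))"
    have e: "0 < e" "e \<le> 1" using r K by (auto simp: e_def)
    have "K * e \<le> K * (r / (K + 1))" using K by (intro mult_left_mono) (auto simp: e_def)
    also have "\<dots> < r" using K r by (simp add: field_simps)
    finally have Ke: "K * e < r" .
    show "\<forall>\<^sub>F n in sequentially. dist (SUP t\<in>{0..T}. L2norm (\<lambda>x. u t x - Sn n (v n t) x)) 0 < r"
      using lim[rule_format, OF e]
    proof eventually_elim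
      case (elim n)
      let ?L = "\<lambda>t. L2norm (\<lambda>x. u t x - Sn n (v n t) x)"
      have "(SUP t\<in>{0..T}. ?L t) \<le> K * e" by (rule cSUP_least) (use elim T_pos in auto)
      \<comment> \<open>The lower bound 0 for the supremum comes from its member at
        \<open>t = 0\<close>; boundedness above is part of the estimate just used.\<close>
      moreover have "?L 0 \<le> (SUP t\<in>{0..T}. ?L t)"
        by (rule cSUP_upper) (use elim T_pos in \<open>auto intro!: bdd_aboveI2[where M="K * e"]\<close>)
      moreover have "0 \<le> ?L 0" by (rule L2norm_nonneg)
      ultimately show ?case using Ke by (simp add: dist_real_def)
    qed
  qed
qed
end
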